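(* Let $\mathcal{T}$ be a normalised Horn-$\mathcal{ALCHI}$ TBox and $\mathcal{C}$ a stratified set of shape constraints. Then there is a stratified set $\mathcal{C}'$ of shape constraints, computed from $\mathcal{T}$ and $\mathcal{C}$ alone, such that for every set of targets $\mathcal{G}$ and every ABox $\mathcal{A}$ consistent with $\mathcal{T}$: $(\mathcal{T},\mathcal{A})$ validates $(\mathcal{C},\mathcal{G})$ if and only if $\mathcal{A}$ validates $(\mathcal{C}',\mathcal{G})$.
   Context: Concept names $N_C$, role names $N_R$, individuals $N_I$, blank nodes $N_B$, shape names $N_S$ are pairwise disjoint countably infinite sets; roles $\overline{N}_R=\{p,p^-\mid p\in N_R\}$, $(p^-)^-=p$; $\overline{N}_C=N_C\cup\{\top,\bot\}$. An ABox $\mathcal{A}$ is a finite set of atoms $A(a)$, $p(a,b)$ ($a,b\in N_I$). A normalised Horn-$\mathcal{ALCHI}$ TBox is a finite set of inclusions $A_0\sqcap\dots\sqcap A_n\sqsubseteq B$, $A\sqsubseteq\forall r.B$, $A\sqsubseteq\exists r.B$ ($A,A_i,B\in\overline{N}_C$, $r\in\overline{N}_R$) and role inclusions $r\sqsubseteq r'$ ($r,r'\in\overline{N}_R$), with standard semantics; $\mathcal{A}$ is consistent with $\mathcal{T}$ if $(\mathcal{T},\mathcal{A})$ has a model. For consistent $(\mathcal{T},\mathcal{A})$, $\mathit{can}(\mathcal{T},\mathcal{A})$ is its austere canonical model, the unique (up to isomorphism) universal model of $(\mathcal{T},\mathcal{A})$ that is a core (universal: homomorphism into every model; core: every endomorphism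 is a strong injective homomorphism; homomorphisms fix individuals). An ABox $\mathcal{A}$ validates something when its canonical interpretation $\mathcal{I}_\mathcal{A}$ (domain $N_I\cup N_B$, $A^{\mathcal{I}_\mathcal{A}}=\{c\mid A(c)\in\mathcal{A}\}$, $p^{\mathcal{I}_\mathcal{A}}=\{(c,d)\mid p(c,d)\in\mathcal{A}\}$) does. SHACL fragment: shape expressions $\varphi::= c\mid s\mid\neg s\mid A\mid\varphi\lor\varphi\mid\varphi\land\varphi\mid\exists R.\varphi\mid\exists E.\varphi\mid c\land\mathsf{EQ}(E,E')\mid c\land\mathsf{disj}(E,E')$ with $c\in N_I$, $s\in N_S$, $A\in\overline{N}_C$, $R$ a conjunction (finite set) of roles, $E,E'$ regular expressions over $\overline{N}_R$; $(e,e')\in E^\mathcal{I}$ iff some word $r_1\cdots r_n$ of $E$ labels a path $e=e_0,\dots,e_n=e'$ with $(e_{i-1},e_i)\in r_i^\mathcal{I}$. Constraints $s\gets\varphi$ (heads may repeat). Given a shape assignment $S$ (set of atoms $s(e)$): $c^{\mathcal{I},S}=\{c\}$; $s^{\mathcal{I},S}=\{e\mid s(e)\in S\}$; $(\neg s)^{\mathcal{I},S}$ its complement; $A^{\mathcal{I},S}=A^\mathcal{I}$; $\lor,\land$ union, intersection; $(\exists R.\varphi)^{\mathcal{I},S}=\{e\mid\exists e'\forall r\in R:(e,e')\in r^\mathcal{I},e'\in\varphi^{\mathcal{I},S}\}$; $(\exists E.\varphi)^{\mathcal{I},S}=\{e\mid\exists e':(e,e')\in E^\mathcal{I},e'\in\varphi^{\mathcal{I},S}\}$;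 $(c\land\mathsf{EQ}(E,E'))^{\mathcal{I},S}=\{c\}$ if the $E$-successors and $E'$-successors of $c$ coincide, else $\emptyset$; $(c\land\mathsf{disj}(E,E'))^{\mathcal{I},S}=\{c\}$ if they are disjoint, else $\emptyset$. $\mathcal{C}$ is stratified if partitionable into $\mathcal{C}_0,\dots,\mathcal{C}_k$ such that a shape name occurring in a constraint of $\mathcal{C}_i$ is not defined (as a head) in $\mathcal{C}_{i+1}\cup\dots\cup\mathcal{C}_k$, and a shape name $s'$ with $\neg s'$ occurring in a constraint of $\mathcal{C}_i$ is not defined in $\mathcal{C}_i\cup\dots\cup\mathcal{C}_k$. With $T_{\mathcal{I},\mathcal{C}}(S)=S\cup\{s(a)\mid s\gets\varphi\in\mathcal{C},a\in\varphi^{\mathcal{I},S}\}$, $M_0=T_{\mathcal{I},\mathcal{C}_0}\!\uparrow^\omega(\emptyset)$, $M_i=T_{\mathcal{I},\mathcal{C}_i}\!\uparrow^\omega(M_{i-1})$, the perfect assignment is $\mathit{PA}(\mathcal{C},\mathcal{I})=M_k$. Targets: a finite set $\mathcal{G}$ of atoms $s(c)$, $c\in N_I$; $\mathcal{I}$ validates $(\mathcal{C},\mathcal{G})$ iff $\mathcal{G}\subseteq\mathit{PA}(\mathcal{C},\mathcal{I})$; $(\mathcal{T},\mathcal{A})$ validates $(\mathcal{C},\mathcal{G})$ iff $\mathit{can}(\mathcal{T},\mathcal{A})$ does.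
   Formalization: The targets in G are restricted to shape names occurring in C (otherwise the claim fails for auxiliary names of C'), and C is taken to be finite so that C' can be computed from it. *)

theory Defs
  imports Main "HOL-Library.FSet" "HOL-Library.Nat_Bijection"
begin

section \<open>Vocabulary and interpretations\<close>

text \<open>The five pairwise disjoint countably infinite sets of names. Concept names, role names and
  shape names never share a syntactic position, so a copy of \<^typ>\<open>nat\<close> serves for each of them;
  individuals and blank nodes both occur as domain elements and are separated by the constructors
  of \<open>obj\<close>.\<close>

type_synonym concept_name = nat
type_synonym role_name = nat
type_synonym shape_name = nat
type_synonym individual = nat
type_synonym blank_node = nat

datatype obj = Ind individual | Blank blank_node

datatype concept = Top | Bot | Con concept_name

text \<open>Since \<open>(p\<^sup>-)\<^sup>- = p\<close>, the roles are exactly the \<open>p\<close> and the \<open>p\<^sup>-\<close>.\<close>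

datatype role = Fwd role_name | Inv role_name

record interp =
  dom :: "obj set"
  cext :: "concept_name \<Rightarrow> obj set"
  rext :: "role_name \<Rightarrow> (obj \<times> obj) set"

text \<open>Standard names: every individual belongs to every domain and denotes itself.\<close>

definition interpretation_wf :: "interp \<Rightarrow> bool" where
  "interpretation_wf I \<longleftrightarrow>
     range Ind \<subseteq> dom I \<and> (\<forall>A. cext I A \<subseteq> dom I) \<and> (\<forall>p. rext I p \<subseteq> dom I \<times> dom I)"

fun concept_ext :: "interp \<Rightarrow> concept \<Rightarrow> obj set" where
  "concept_ext I Top = dom I"
| "concept_ext I Bot = {}"
| "concept_ext I (Con A) = cext I A"

fun role_ext :: "interp \<Rightarrow> role \<Rightarrow> (obj \<times> obj) set" where
  "role_ext I (Fwd p) = rext I p"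
| "role_ext I (Inv p) = (rext I p)\<inverse>"

section \<open>ABoxes, TBoxes and models\<close>

datatype assertion =
    ConceptAssertion concept_name individual
  | RoleAssertion role_name individual individual

type_synonym abox = "assertion set"

text \<open>\<open>ConjIncl A\<^sub>0 [A\<^sub>1, \<dots>, A\<^sub>n] B\<close> is \<open>A\<^sub>0 \<sqinter> \<dots> \<sqinter> A\<^sub>n \<sqsubseteq> B\<close>; the
  separate first argument makes the conjunction nonempty.\<close>

datatype axiom =
    ConjIncl concept "concept list" concept
  | AllIncl concept role concept
  | ExIncl concept role concept
  | RoleIncl role role

type_synonym tbox = "axiom set"

fun sat_axiom :: "interp \<Rightarrow> axiom \<Rightarrow> bool" where
  "sat_axiom I (ConjIncl A As B) \<longleftrightarrow> (\<Inter>A'\<in>set (A # As). concept_ext I A') \<subseteq> concept_ext I B"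
| "sat_axiom I (AllIncl A r B) \<longleftrightarrow>
     concept_ext I A \<subseteq> {d \<in> dom I. \<forall>e. (d, e) \<in> role_ext I r \<longrightarrow> e \<in> concept_ext I B}"
| "sat_axiom I (ExIncl A r B) \<longleftrightarrow>
     concept_ext I A \<subseteq> {d \<in> dom I. \<exists>e. (d, e) \<in> role_ext I r \<and> e \<in> concept_ext I B}"
| "sat_axiom I (RoleIncl r r') \<longleftrightarrow> role_ext I r \<subseteq> role_ext I r'"

fun sat_assertion :: "interp \<Rightarrow> assertion \<Rightarrow> bool" where
  "sat_assertion I (ConceptAssertion A a) \<longleftrightarrow> Ind a \<in> cext I A"
| "sat_assertion I (RoleAssertion p a b) \<longleftrightarrow> (Ind a, Ind b) \<in> rext I p"

definition is_model :: "tbox \<Rightarrow> abox \<Rightarrow> interp \<Rightarrow> bool" where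
  "is_model T A I \<longleftrightarrow>
     interpretation_wf I \<and> (\<forall>\<alpha>\<in>T. sat_axiom I \<alpha>) \<and> (\<forall>\<alpha>\<in>A. sat_assertion I \<alpha>)"

definition consistent :: "tbox \<Rightarrow> abox \<Rightarrow> bool" where
  "consistent T A \<longleftrightarrow> (\<exists>I. is_model T A I)"

section \<open>The austere canonical model\<close>

definition homomorphism :: "interp \<Rightarrow> interp \<Rightarrow> (obj \<Rightarrow> obj) \<Rightarrow> bool" where
  "homomorphism I J h \<longleftrightarrow>
     h ` dom I \<subseteq> dom J \<and>
     (\<forall>c. h (Ind c) = Ind c) \<and>
     (\<forall>A. \<forall>d\<in>dom I. d \<in> cext I A \<longrightarrow> h d \<in> cext J A) \<and>
     (\<forall>p. \<forall>d\<in>dom I. \<forall>e\<in>dom I. (d, e) \<in> rext I p \<longrightarrow> (h d, h e) \<in> rext J p)"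

definition strong_homomorphism :: "interp \<Rightarrow> interp \<Rightarrow> (obj \<Rightarrow> obj) \<Rightarrow> bool" where
  "strong_homomorphism I J h \<longleftrightarrow>
     homomorphism I J h \<and>
     (\<forall>A. \<forall>d\<in>dom I. h d \<in> cext J A \<longrightarrow> d \<in> cext I A) \<and>
     (\<forall>p. \<forall>d\<in>dom I. \<forall>e\<in>dom I. (h d, h e) \<in> rext J p \<longrightarrow> (d, e) \<in> rext I p)"

definition universal_model :: "tbox \<Rightarrow> abox \<Rightarrow> interp \<Rightarrow> bool" where
  "universal_model T A U \<longleftrightarrow>
     is_model T A U \<and> (\<forall>J. is_model T A J \<longrightarrow> (\<exists>h. homomorphism U J h))"

definition is_core :: "interp \<Rightarrow> bool" where
  "is_core U \<longleftrightarrow>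
     (\<forall>h. homomorphism U U h \<longrightarrow> strong_homomorphism U U h \<and> inj_on h (dom U))"

text \<open>The universal core model is determined up to isomorphism only, hence the choice of one
  representative; validation of shapes does not depend on it.\<close>

definition can :: "tbox \<Rightarrow> abox \<Rightarrow> interp" where
  "can T A = (SOME U. universal_model T A U \<and> is_core U)"

definition abox_interp :: "abox \<Rightarrow> interp" where
  "abox_interp A =
     \<lparr>dom = UNIV,
      cext = (\<lambda>B. {Ind c |c. ConceptAssertion B c \<in> A}),
      rext = (\<lambda>p. {(Ind c, Ind d) |c d. RoleAssertion p c d \<in> A})\<rparr>"

section \<open>Regular path expressions\<close>

datatype rexp = RZero | ROne | RRole role | RAlt rexp rexp | RSeq rexp rexp | RStar rexp

inductive word_of :: "rexp \<Rightarrow> role list \<Rightarrow> bool" where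
  "word_of ROne []"
| "word_of (RRole r) [r]"
| "word_of E w \<Longrightarrow> word_of (RAlt E E') w"
| "word_of E' w \<Longrightarrow> word_of (RAlt E E') w"
| "word_of E v \<Longrightarrow> word_of E' w \<Longrightarrow> word_of (RSeq E E') (v @ w)"
| "word_of (RStar E) []"
| "word_of E v \<Longrightarrow> word_of (RStar E) w \<Longrightarrow> word_of (RStar E) (v @ w)"

fun labels_path :: "interp \<Rightarrow> role list \<Rightarrow> obj \<Rightarrow> obj \<Rightarrow> bool" where
  "labels_path I [] e e' \<longleftrightarrow> e \<in> dom I \<and> e = e'"
| "labels_path I (r # w) e e' \<longleftrightarrow> (\<exists>d. (e, d) \<in> role_ext I r \<and> labels_path I w d e')"

definition rexp_ext :: "interp \<Rightarrow> rexp \<Rightarrow> (obj \<times> obj) set" where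
  "rexp_ext I E = {(e, e'). \<exists>w. word_of E w \<and> labels_path I w e e'}"

section \<open>Shapes\<close>

text \<open>\<open>NomEQ c E E'\<close> and \<open>NomDisj c E E'\<close> are \<open>c \<and> EQ(E, E')\<close> and \<open>c \<and> disj(E, E')\<close>.\<close>

datatype shape =
    Nom individual
  | Name shape_name
  | NegName shape_name
  | Cpt concept
  | Or shape shape
  | And shape shape
  | ExRoles "role fset" shape
  | ExPath rexp shape
  | NomEQ individual rexp rexp
  | NomDisj individual rexp rexp

type_synonym assignment = "(shape_name \<times> obj) set"

primrec shape_ext :: "interp \<Rightarrow> assignment \<Rightarrow> shape \<Rightarrow> obj set" where
  "shape_ext I S (Nom c) = {Ind c}"
| "shape_ext I S (Name s) = {e. (s, e) \<in> S}"
| "shape_ext I S (NegName s) = dom I - {e. (s, e) \<in> S}"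
| "shape_ext I S (Cpt A) = concept_ext I A"
| "shape_ext I S (Or \<phi> \<psi>) = shape_ext I S \<phi> \<union> shape_ext I S \<psi>"
| "shape_ext I S (And \<phi> \<psi>) = shape_ext I S \<phi> \<inter> shape_ext I S \<psi>"
| "shape_ext I S (ExRoles R \<phi>) =
     {e \<in> dom I. \<exists>e'\<in>dom I. (\<forall>r. r |\<in>| R \<longrightarrow> (e, e') \<in> role_ext I r) \<and> e' \<in> shape_ext I S \<phi>}"
| "shape_ext I S (ExPath E \<phi>) =
     {e \<in> dom I. \<exists>e'\<in>dom I. (e, e') \<in> rexp_ext I E \<and> e' \<in> shape_ext I S \<phi>}"
| "shape_ext I S (NomEQ c E E') =
     (if rexp_ext I E `` {Ind c} = rexp_ext I E' `` {Ind c} then {Ind c} else {})"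
| "shape_ext I S (NomDisj c E E') =
     (if rexp_ext I E `` {Ind c} \<inter> rexp_ext I E' `` {Ind c} = {} then {Ind c} else {})"

primrec shape_names :: "shape \<Rightarrow> shape_name set" where
  "shape_names (Nom c) = {}"
| "shape_names (Name s) = {s}"
| "shape_names (NegName s) = {s}"
| "shape_names (Cpt A) = {}"
| "shape_names (Or \<phi> \<psi>) = shape_names \<phi> \<union> shape_names \<psi>"
| "shape_names (And \<phi> \<psi>) = shape_names \<phi> \<union> shape_names \<psi>"
| "shape_names (ExRoles R \<phi>) = shape_names \<phi>"
| "shape_names (ExPath E \<phi>) = shape_names \<phi>"
| "shape_names (NomEQ c E E') = {}"
| "shape_names (NomDisj c E E') = {}"

primrec neg_names :: "shape \<Rightarrow> shape_name set" where
  "neg_names (Nom c) = {}"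
| "neg_names (Name s) = {}"
| "neg_names (NegName s) = {s}"
| "neg_names (Cpt A) = {}"
| "neg_names (Or \<phi> \<psi>) = neg_names \<phi> \<union> neg_names \<psi>"
| "neg_names (And \<phi> \<psi>) = neg_names \<phi> \<union> neg_names \<psi>"
| "neg_names (ExRoles R \<phi>) = neg_names \<phi>"
| "neg_names (ExPath E \<phi>) = neg_names \<phi>"
| "neg_names (NomEQ c E E') = {}"
| "neg_names (NomDisj c E E') = {}"

section \<open>Stratified sets of constraints and validation\<close>

text \<open>The pair \<open>(s, \<phi>)\<close> is the constraint \<open>s \<leftarrow> \<phi>\<close>.\<close>

type_synonym shape_constraint = "shape_name \<times> shape"

definition heads :: "shape_constraint set \<Rightarrow> shape_name set" where
  "heads C = fst ` C"

definition names_of :: "shape_constraint set \<Rightarrow> shape_name set" where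
  "names_of C = (\<Union>(s, \<phi>)\<in>C. insert s (shape_names \<phi>))"

definition neg_names_of :: "shape_constraint set \<Rightarrow> shape_name set" where
  "neg_names_of C = (\<Union>(s, \<phi>)\<in>C. neg_names \<phi>)"

definition stratification :: "shape_constraint set list \<Rightarrow> shape_constraint set \<Rightarrow> bool" where
  "stratification Cs C \<longleftrightarrow>
     Cs \<noteq> [] \<and> \<Union>(set Cs) = C \<and>
     (\<forall>i<length Cs. \<forall>j<length Cs. i \<noteq> j \<longrightarrow> Cs ! i \<inter> Cs ! j = {}) \<and>
     (\<forall>i<length Cs. \<forall>j<length Cs. i < j \<longrightarrow> names_of (Cs ! i) \<inter> heads (Cs ! j) = {}) \<and>
     (\<forall>i<length Cs. \<forall>j<length Cs. i \<le> j \<longrightarrow> neg_names_of (Cs ! i) \<inter> heads (Cs ! j) = {})"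

definition stratified :: "shape_constraint set \<Rightarrow> bool" where
  "stratified C \<longleftrightarrow> (\<exists>Cs. stratification Cs C)"

definition T_op :: "interp \<Rightarrow> shape_constraint set \<Rightarrow> assignment \<Rightarrow> assignment" where
  "T_op I C S = S \<union> {(s, a) |s a \<phi>. (s, \<phi>) \<in> C \<and> a \<in> shape_ext I S \<phi>}"

definition T_omega :: "interp \<Rightarrow> shape_constraint set \<Rightarrow> assignment \<Rightarrow> assignment" where
  "T_omega I C S = (\<Union>n. (T_op I C ^^ n) S)"

definition perfect_along :: "interp \<Rightarrow> shape_constraint set list \<Rightarrow> assignment" where
  "perfect_along I Cs = fold (T_omega I) Cs {}"

text \<open>All stratifications of \<open>C\<close> lead to the same assignment.\<close>

definition PA :: "shape_constraint set \<Rightarrow> interp \<Rightarrow> assignment" where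
  "PA C I = perfect_along I (SOME Cs. stratification Cs C)"

type_synonym target = "shape_name \<times> individual"

definition validates :: "interp \<Rightarrow> shape_constraint set \<Rightarrow> target set \<Rightarrow> bool" where
  "validates I C G \<longleftrightarrow> (\<forall>(s, c)\<in>G. (s, Ind c) \<in> PA C I)"

definition kb_validates :: "tbox \<Rightarrow> abox \<Rightarrow> shape_constraint set \<Rightarrow> target set \<Rightarrow> bool" where
  "kb_validates T A C G \<longleftrightarrow> validates (can T A) C G"

definition abox_validates :: "abox \<Rightarrow> shape_constraint set \<Rightarrow> target set \<Rightarrow> bool" where
  "abox_validates A C G \<longleftrightarrow> validates (abox_interp A) C G"

section \<open>Computability\<close>

text \<open>\<open>recursive n f\<close>: on argument lists of length \<open>n\<close>, the function \<open>f\<close> is a total recursive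
  function. Minimisation is applied to regular functions only, which by Kleene's normal form
  theorem yields exactly the total computable functions.\<close>

inductive recursive :: "nat \<Rightarrow> (nat list \<Rightarrow> nat) \<Rightarrow> bool" where
  zero: "recursive n (\<lambda>xs. 0)"
| succ: "recursive 1 (\<lambda>xs. Suc (xs ! 0))"
| proj: "i < n \<Longrightarrow> recursive n (\<lambda>xs. xs ! i)"
| comp: "recursive m f \<Longrightarrow> (\<And>i. i < m \<Longrightarrow> recursive n (g i)) \<Longrightarrow>
     recursive n (\<lambda>xs. f (map (\<lambda>i. g i xs) [0..<m]))"
| prim_rec: "recursive n f \<Longrightarrow> recursive (Suc (Suc n)) g \<Longrightarrow>
     recursive (Suc n) (\<lambda>xs. rec_nat (f (tl xs)) (\<lambda>k y. g (k # y # tl xs)) (hd xs))"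
| minimise: "recursive (Suc n) f \<Longrightarrow> (\<And>xs. length xs = n \<Longrightarrow> \<exists>k. f (k # xs) = 0) \<Longrightarrow>
     recursive n (\<lambda>xs. LEAST k. f (k # xs) = 0)"

text \<open>Injective codes of the finite syntactic objects. Explicit codes are needed here: the
  encodings of class \<open>countable\<close> are chosen nonconstructively.\<close>

fun code_concept :: "concept \<Rightarrow> nat" where
  "code_concept Top = prod_encode (0, 0)"
| "code_concept Bot = prod_encode (1, 0)"
| "code_concept (Con A) = prod_encode (2, A)"

fun code_role :: "role \<Rightarrow> nat" where
  "code_role (Fwd p) = prod_encode (0, p)"
| "code_role (Inv p) = prod_encode (1, p)"

fun code_axiom :: "axiom \<Rightarrow> nat" where
  "code_axiom (ConjIncl A As B) =
     prod_encode (0, list_encode (code_concept B # code_concept A # map code_concept As))"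
| "code_axiom (AllIncl A r B) =
     prod_encode (1, list_encode [code_concept A, code_role r, code_concept B])"
| "code_axiom (ExIncl A r B) =
     prod_encode (2, list_encode [code_concept A, code_role r, code_concept B])"
| "code_axiom (RoleIncl r r') = prod_encode (3, list_encode [code_role r, code_role r'])"

primrec code_rexp :: "rexp \<Rightarrow> nat" where
  "code_rexp RZero = prod_encode (0, 0)"
| "code_rexp ROne = prod_encode (1, 0)"
| "code_rexp (RRole r) = prod_encode (2, code_role r)"
| "code_rexp (RAlt E E') = prod_encode (3, prod_encode (code_rexp E, code_rexp E'))"
| "code_rexp (RSeq E E') = prod_encode (4, prod_encode (code_rexp E, code_rexp E'))"
| "code_rexp (RStar E) = prod_encode (5, code_rexp E)"

primrec code_shape :: "shape \<Rightarrow> nat" where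
  "code_shape (Nom c) = prod_encode (0, c)"
| "code_shape (Name s) = prod_encode (1, s)"
| "code_shape (NegName s) = prod_encode (2, s)"
| "code_shape (Cpt A) = prod_encode (3, code_concept A)"
| "code_shape (Or \<phi> \<psi>) = prod_encode (4, prod_encode (code_shape \<phi>, code_shape \<psi>))"
| "code_shape (And \<phi> \<psi>) = prod_encode (5, prod_encode (code_shape \<phi>, code_shape \<psi>))"
| "code_shape (ExRoles R \<phi>) =
     prod_encode (6, prod_encode (set_encode (code_role ` fset R), code_shape \<phi>))"
| "code_shape (ExPath E \<phi>) = prod_encode (7, prod_encode (code_rexp E, code_shape \<phi>))"
| "code_shape (NomEQ c E E') = prod_encode (8, list_encode [c, code_rexp E, code_rexp E'])"
| "code_shape (NomDisj c E E') = prod_encode (9, list_encode [c, code_rexp E, code_rexp E'])"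

definition code_tbox :: "tbox \<Rightarrow> nat" where
  "code_tbox T = set_encode (code_axiom ` T)"

definition code_constraints :: "shape_constraint set \<Rightarrow> nat" where
  "code_constraints C = set_encode ((\<lambda>(s, \<phi>). prod_encode (s, code_shape \<phi>)) ` C)"

end

(* Proof idea.  The oblivious chase of an ABox is a forest of trees whose nodes are sequences of
   existential axioms.  Attach finitely many names to its nodes: the derived concepts, the marks that
   select the nodes of the austere canonical model, and the subformulas of the constraints.  Local
   rules relate the names of a node to those of its parent, its children and, at a root, its
   neighbours in the ABox; negation only refers to names of a smaller level.

   Roots are the elements of the ABox, but the other nodes are not.  What a child satisfies depends
   only on which axiom created it and on the names V of its parent, so the rewriting replaces the
   statement "the child k satisfies h" by an auxiliary shape name, evaluated at the root, for each
   pair (k, V).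

   A child is dropped if its set of derived concepts is included in that of a suitable neighbour of
   its parent.  The remaining nodes form a universal model whose only endomorphism is the identity,
   so it is isomorphic to the austere canonical model. *)

theory Submission imports Defs begin

section \<open>Computable functions\<close>

text \<open>The obstacle is stratification. A child is evaluated for an assumed set \<open>V\<close>
  of names of its parent, and \<open>V\<close> has to be checked; absence of a name can only be
  checked by negation, which is forbidden among names of one level. So, for a name of level
  \<open>l\<close>, members of \<open>V\<close> are checked up to level \<open>l\<close>, but
  absence only below \<open>l\<close>. A set that is too small at level \<open>l\<close> does no
  harm: names of that level occur positively, so fewer of them are derived, and the correct set is
  among the guesses. No stratification of the constraints is computed either. Each formula has a
  copy on every level from 4 on, and a negation on level \<open>n + 1\<close> reads level
  \<open>n\<close>. A copy is right as soon as its level has reached the value of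
  \<open>need\<close>, which the number of heads, and hence the code \<open>c\<close>, keeps
  bounded. Levels 0 to 3 hold the chase and the choice of children, where comparing two sets of
  concepts already costs negations. Siblings with equal types and equivalent roles would discard
  each other; the smaller code of the axiom decides between them.\<close>

text \<open>Arguments of the wrong length are ignored, so that a function can be given by any term that
  agrees with a recursive one on lists of length \<open>n\<close>.\<close>

definition computable :: "nat \<Rightarrow> (nat list \<Rightarrow> nat) \<Rightarrow> bool" where
  "computable n f \<longleftrightarrow> (\<exists>g. recursive n g \<and> (\<forall>xs. length xs = n \<longrightarrow> g xs = f xs))"

lemma computable_cong:
  "computable n f \<Longrightarrow> (\<And>xs. length xs = n \<Longrightarrow> f xs = g xs) \<Longrightarrow> computable n g"
  unfolding computable_def by (metis (no_types, lifting))

text \<open>The constructor \<open>recursive.comp\<close> expects an indexed family of recursive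
  functions. The list only supplies functions that agree with recursive ones on lists of length
  \<open>n\<close>, so a representative is chosen for each position.\<close>

lemma computable_compose:
  assumes f: "computable (length gs) f" and gs: "\<And>g. g \<in> set gs \<Longrightarrow> computable n g"
  shows "computable n (\<lambda>xs. f (map (\<lambda>g. g xs) gs))"
proof -
  obtain f' where f': "recursive (length gs) f'" "\<And>xs. length xs = length gs \<Longrightarrow> f' xs = f xs"
    using f unfolding computable_def by blast
  have "\<forall>i. \<exists>g'. i < length gs \<longrightarrow> recursive n g' \<and> (\<forall>xs. length xs = n \<longrightarrow> g' xs = (gs ! i) xs)"
    using gs unfolding computable_def by (metis nth_mem)
  then obtain g' where g': "\<And>i. i < length gs \<Longrightarrow> recursive n (g' i)"
    "\<And>i xs. i < length gs \<Longrightarrow> length xs = n \<Longrightarrow> g' i xs = (gs ! i) xs"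
    by metis
  have "recursive n (\<lambda>xs. f' (map (\<lambda>i. g' i xs) [0..<length gs]))"
    by (rule recursive.comp) (use f' g' in auto)
  moreover have "f' (map (\<lambda>i. g' i xs) [0..<length gs]) = f (map (\<lambda>g. g xs) gs)"
    if "length xs = n" for xs
  proof -
    have "map (\<lambda>i. g' i xs) [0..<length gs] = map (\<lambda>g. g xs) gs"
      by (rule nth_equalityI) (use g' that in auto)
    thus ?thesis using f' by simp
  qed
  ultimately show ?thesis unfolding computable_def by blast
qed

lemma computable_nth: "i < n \<Longrightarrow> computable n (\<lambda>xs. xs ! i)"
  unfolding computable_def using recursive.proj by blast

lemma computable_zero: "computable n (\<lambda>xs. 0)"
  unfolding computable_def using recursive.zero by blast

lemma computable_comp1:
  "computable 1 (\<lambda>xs. h (xs ! 0)) \<Longrightarrow> computable n f \<Longrightarrow> computable n (\<lambda>xs. h (f xs))"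
  using computable_compose[of "[f]" "\<lambda>xs. h (xs ! 0)" n] by simp

lemma computable_comp2:
  "computable 2 (\<lambda>xs. h (xs ! 0) (xs ! 1)) \<Longrightarrow> computable n f \<Longrightarrow> computable n g \<Longrightarrow>
   computable n (\<lambda>xs. h (f xs) (g xs))"
  using computable_compose[of "[f, g]" "\<lambda>xs. h (xs ! 0) (xs ! 1)" n] by (auto simp: numeral_2_eq_2)

lemma computable_comp3:
  "computable 3 (\<lambda>xs. h (xs ! 0) (xs ! 1) (xs ! 2)) \<Longrightarrow> computable n f \<Longrightarrow> computable n g \<Longrightarrow>
   computable n k \<Longrightarrow> computable n (\<lambda>xs. h (f xs) (g xs) (k xs))"
  using computable_compose[of "[f, g, k]" "\<lambda>xs. h (xs ! 0) (xs ! 1) (xs ! 2)" n]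
  by (auto simp: numeral_3_eq_3)

lemma computable_Suc: "computable n f \<Longrightarrow> computable n (\<lambda>xs. Suc (f xs))"
  by (rule computable_comp1[where h = Suc]) (use recursive.succ computable_def in blast)

lemma computable_const: "computable n (\<lambda>xs. k)"
  by (induction k) (auto intro: computable_zero computable_Suc)

text \<open>Under a binder the bound variable becomes the head of the argument list; the outer
  variables are then reached through an iterated \<^const>\<open>drop\<close>.\<close>

lemma computable_drop_nth:
  "a + i < n \<Longrightarrow> computable n (\<lambda>xs. drop a xs ! i)"
  by (rule computable_cong[OF computable_nth[of "a + i"]]) auto

text \<open>One fact for each number of nested binders, because an introduction rule has to match
  the nested \<open>drop\<close> literally. The deepest unions in the rules, those of
  \<open>select_rules_eq\<close>, bind seven variables.\<close>

lemma computable_drops_nth: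
  "a + b + i < n \<Longrightarrow> computable n (\<lambda>xs. drop a (drop b xs) ! i)"
  "a + b + c + i < n \<Longrightarrow> computable n (\<lambda>xs. drop a (drop b (drop c xs)) ! i)"
  "a + b + c + d + i < n \<Longrightarrow> computable n (\<lambda>xs. drop a (drop b (drop c (drop d xs))) ! i)"
  "a + b + c + d + e + i < n \<Longrightarrow> computable n (\<lambda>xs. drop a (drop b (drop c (drop d (drop e xs)))) ! i)"
  "a + b + c + d + e + f + i < n \<Longrightarrow> computable n (\<lambda>xs. drop a (drop b (drop c (drop d (drop e (drop f xs))))) ! i)"
  "a + b + c + d + e + f + g + i < n \<Longrightarrow> computable n (\<lambda>xs. drop a (drop b (drop c (drop d (drop e (drop f (drop g xs)))))) ! i)"
  "a + b + c + d + e + f + g + h + i < n \<Longrightarrow> computable n (\<lambda>xs. drop a (drop b (drop c (drop d (drop e (drop f (drop g (drop h xs))))))) ! i)"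
  "a + b + c + d + e + f + g + h + j + i < n \<Longrightarrow> computable n (\<lambda>xs. drop a (drop b (drop c (drop d (drop e (drop f (drop g (drop h (drop j xs)))))))) ! i)"
  "a + b + c + d + e + f + g + h + j + k + i < n \<Longrightarrow> computable n (\<lambda>xs. drop a (drop b (drop c (drop d (drop e (drop f (drop g (drop h (drop j (drop k xs))))))))) ! i)"
  by (simp_all only: drop_drop) (rule computable_drop_nth, simp)+

lemmas computable_vars = computable_nth computable_drop_nth computable_drops_nth

lemma computable_reindex:
  assumes "computable (length is) f" "\<And>i. i \<in> set is \<Longrightarrow> i < n"
  shows "computable n (\<lambda>ys. f (map (\<lambda>i. ys ! i) is))"
proof -
  have "computable n (\<lambda>xs. f (map (\<lambda>g. g xs) (map (\<lambda>i xs. xs ! i) is)))"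
    by (rule computable_compose) (use assms in \<open>auto intro: computable_nth\<close>)
  thus ?thesis by (simp add: comp_def)
qed

lemma computable_rec:
  assumes b: "computable n b" and s: "computable (Suc (Suc n)) (\<lambda>ys. s (ys ! 0) (ys ! 1) (drop 2 ys))"
    and m: "computable n m"
  shows "computable n (\<lambda>xs. rec_nat (b xs) (\<lambda>k y. s k y xs) (m xs))"
proof -
  obtain b' where b': "recursive n b'" "\<And>xs. length xs = n \<Longrightarrow> b' xs = b xs"
    using b unfolding computable_def by blast
  obtain s' where s': "recursive (Suc (Suc n)) s'"
    "\<And>ys. length ys = Suc (Suc n) \<Longrightarrow> s' ys = s (ys ! 0) (ys ! 1) (drop 2 ys)"
    using s unfolding computable_def by blast
  \<comment> \<open>\<open>prim_rec\<close> recurses on the head of the argument list, so the number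
    of iterations is prepended to the unchanged parameters.\<close>
  let ?R = "\<lambda>xs. rec_nat (b' (tl xs)) (\<lambda>k y. s' (k # y # tl xs)) (hd xs)"
  have R: "computable (Suc n) ?R"
    unfolding computable_def using recursive.prim_rec[OF b'(1) s'(1)] by blast
  let ?gs = "m # map (\<lambda>i xs. xs ! i) [0..<n]"
  have "computable n (\<lambda>xs. ?R (map (\<lambda>g. g xs) ?gs))"
    by (rule computable_compose) (use R m in \<open>auto intro: computable_nth\<close>)
  moreover have "?R (map (\<lambda>g. g xs) ?gs) = rec_nat (b xs) (\<lambda>k y. s k y xs) (m xs)"
    if len: "length xs = n" for xs
  proof -
    have "map (\<lambda>i. xs ! i) [0..<n] = xs" using len by (metis map_nth)
    moreover have "rec_nat (b' xs) (\<lambda>k y. s' (k # y # xs)) j = rec_nat (b xs) (\<lambda>k y. s k y xs) j" for j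
      by (induction j) (use b' s' len in auto)
    ultimately show ?thesis by (simp add: comp_def)
  qed
  ultimately show ?thesis by (rule computable_cong)
qed

section \<open>Arithmetic and bounded sums\<close>

lemma computable_add: "computable n f \<Longrightarrow> computable n g \<Longrightarrow> computable n (\<lambda>xs. f xs + g xs)"
proof -
  assume fg: "computable n f" "computable n g"
  have "rec_nat a (\<lambda>k y. Suc y) b = a + b" for a b :: nat by (induction b) auto
  moreover have "computable n (\<lambda>xs. rec_nat (f xs) (\<lambda>k y. Suc y) (g xs))"
    by (rule computable_rec) (auto intro!: fg computable_Suc computable_nth)
  ultimately show ?thesis by simp
qed

text \<open>The step function of a recursion carries the accumulator in position 1. A term with a
  single bound variable does not mention it, so that position is skipped.\<close>

lemma computable_shift2:
  assumes "computable (Suc n) (\<lambda>ys. F (ys ! 0) (drop 1 ys))"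
  shows "computable (Suc (Suc n)) (\<lambda>ys. F (ys ! 0) (drop 2 ys))"
proof -
  have "computable (Suc (Suc n)) (\<lambda>ys. (\<lambda>ys. F (ys ! 0) (drop 1 ys)) (map (\<lambda>i. ys ! i) (0 # [2..<Suc (Suc n)])))"
    by (rule computable_reindex) (use assms in \<open>auto simp del: upt_Suc\<close>)
  moreover have "map (\<lambda>i. ys ! i) [2..<Suc (Suc n)] = drop 2 ys" if "length ys = Suc (Suc n)" for ys :: "nat list"
    by (rule nth_equalityI) (use that in \<open>auto simp del: upt_Suc\<close>)
  ultimately show ?thesis by (elim computable_cong) (auto simp del: upt_Suc)
qed

lemma computable_sum:
  assumes F: "computable (Suc n) (\<lambda>ys. F (ys ! 0) (drop 1 ys))" and m: "computable n m"
  shows "computable n (\<lambda>xs. \<Sum>k<m xs. F k xs)"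
proof -
  have "rec_nat 0 (\<lambda>k y. y + F k xs) j = (\<Sum>k<j. F k xs)" for xs j by (induction j) auto
  moreover have "computable n (\<lambda>xs. rec_nat 0 (\<lambda>k y. y + F k xs) (m xs))"
    by (rule computable_rec[where s = "\<lambda>k y xs. y + F k xs"])
      (auto intro!: m computable_zero computable_add computable_nth computable_shift2 F)
  ultimately show ?thesis by simp
qed

lemma computable_mult: "computable n f \<Longrightarrow> computable n g \<Longrightarrow> computable n (\<lambda>xs. f xs * g xs)"
proof (erule (1) computable_comp2[where h = "(*)", rotated])
  have "computable 2 (\<lambda>xs. \<Sum>k<xs ! 0. xs ! 1)"
  proof (rule computable_sum)
    show "computable (Suc 2) (\<lambda>ys. drop 1 ys ! 1)"
      by (rule computable_drop_nth) simp
  qed (simp add: computable_nth)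
  thus "computable 2 (\<lambda>xs. xs ! 0 * xs ! 1)" by simp
qed

lemma computable_diff: "computable n f \<Longrightarrow> computable n g \<Longrightarrow> computable n (\<lambda>xs. f xs - g xs)"
proof -
  assume fg: "computable n f" "computable n g"
  have "computable 1 (\<lambda>xs. rec_nat 0 (\<lambda>k y. k) (xs ! 0))"
    by (rule computable_rec[where s = "\<lambda>k y xs. k"]) (auto intro!: computable_zero computable_nth)
  moreover have "rec_nat 0 (\<lambda>k y. k) a = a - 1" for a by (cases a) auto
  ultimately have pred: "computable 1 (\<lambda>xs. xs ! 0 - 1)" by simp
  have "rec_nat a (\<lambda>k y. y - 1) b = a - b" for a b :: nat by (induction b) auto
  moreover have "computable n (\<lambda>xs. rec_nat (f xs) (\<lambda>k y. y - 1) (g xs))"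
    by (rule computable_rec[where s = "\<lambda>k y xs. y - 1"])
      (auto intro!: fg computable_comp1[OF pred] computable_nth simp del: diff_Suc_Suc One_nat_def)
  ultimately show ?thesis by simp
qed

section \<open>Decidable predicates and bounded quantifiers\<close>

definition decidable :: "nat \<Rightarrow> (nat list \<Rightarrow> bool) \<Rightarrow> bool" where
  "decidable n P \<longleftrightarrow> computable n (\<lambda>xs. of_bool (P xs))"

lemma decidable_not: "decidable n P \<Longrightarrow> decidable n (\<lambda>xs. \<not> P xs)"
  unfolding decidable_def
  by (rule computable_cong[OF computable_diff[OF computable_const[of _ 1]]]) auto

lemma decidable_conj: "decidable n P \<Longrightarrow> decidable n Q \<Longrightarrow> decidable n (\<lambda>xs. P xs \<and> Q xs)"
  unfolding decidable_def
  by (rule computable_cong[OF computable_mult]) (auto simp: of_bool_conj)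

lemma decidable_disj: "decidable n P \<Longrightarrow> decidable n Q \<Longrightarrow> decidable n (\<lambda>xs. P xs \<or> Q xs)"
  using decidable_not[OF decidable_conj[OF decidable_not[of n P] decidable_not[of n Q]]] by simp

lemma decidable_imp: "decidable n P \<Longrightarrow> decidable n Q \<Longrightarrow> decidable n (\<lambda>xs. P xs \<longrightarrow> Q xs)"
  unfolding imp_conv_disj by (intro decidable_disj decidable_not)

lemma decidable_le: "computable n f \<Longrightarrow> computable n g \<Longrightarrow> decidable n (\<lambda>xs. f xs \<le> g xs)"
  unfolding decidable_def
  by (rule computable_cong[OF computable_diff[OF computable_const[of _ 1] computable_diff[of n f g]]])
    (auto simp: of_bool_def)

lemma decidable_less: "computable n f \<Longrightarrow> computable n g \<Longrightarrow> decidable n (\<lambda>xs. f xs < g xs)"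
  using decidable_le[OF computable_Suc[of n f], of g] by (simp add: Suc_le_eq)

lemma decidable_eq: "computable n f \<Longrightarrow> computable n g \<Longrightarrow> decidable n (\<lambda>xs. f xs = g xs)"
  using decidable_conj[OF decidable_le[of n f g] decidable_le[of n g f]] by (simp add: eq_iff)

lemma decidable_bex:
  assumes P: "decidable (Suc n) (\<lambda>ys. P (ys ! 0) (drop 1 ys))" and m: "computable n m"
  shows "decidable n (\<lambda>xs. \<exists>k<m xs. P k xs)"
proof -
  have "computable n (\<lambda>xs. \<Sum>k<m xs. of_bool (P k xs))"
    by (rule computable_sum[where F = "\<lambda>k xs. of_bool (P k xs)"]) (use P m decidable_def in auto)
  hence "decidable n (\<lambda>xs. 0 < (\<Sum>k<m xs. of_bool (P k xs) :: nat))"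
    by (intro decidable_less computable_zero)
  moreover have "0 < (\<Sum>k<m xs. of_bool (P k xs) :: nat) \<longleftrightarrow> (\<exists>k<m xs. P k xs)" for xs
    by (auto simp: zero_less_iff_neq_zero)
  ultimately show ?thesis by simp
qed

lemma decidable_ball:
  assumes "decidable (Suc n) (\<lambda>ys. P (ys ! 0) (drop 1 ys))" "computable n m"
  shows "decidable n (\<lambda>xs. \<forall>k<m xs. P k xs)"
  using decidable_not[OF decidable_bex[OF decidable_not[OF assms(1)] assms(2)]] by simp

lemma computable_of_bool: "decidable n P \<Longrightarrow> computable n (\<lambda>xs. of_bool (P xs))"
  by (simp add: decidable_def)

section \<open>Powers, pairing and the projections of pairs\<close>

lemma computable_pow2: "computable n f \<Longrightarrow> computable n (\<lambda>xs. 2 ^ f xs)"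
proof -
  assume f: "computable n f"
  have "rec_nat 1 (\<lambda>k y. y + y) j = (2::nat) ^ j" for j by (induction j) auto
  moreover have "computable n (\<lambda>xs. rec_nat 1 (\<lambda>k y. y + y) (f xs))"
    by (rule computable_rec[where s = "\<lambda>k y xs. y + y"])
      (auto intro!: f computable_add computable_nth computable_const simp del: One_nat_def)
  ultimately show ?thesis by simp
qed

lemma computable_prod_encode:
  "computable n f \<Longrightarrow> computable n g \<Longrightarrow> computable n (\<lambda>xs. prod_encode (f xs, g xs))"
proof -
  assume fg: "computable n f" "computable n g"
  have "(\<Sum>i<Suc m. i) = triangle m" for m by (induction m) auto
  moreover have "computable n (\<lambda>xs. (\<Sum>i<Suc (f xs + g xs). i) + f xs)"
    by (intro computable_add computable_sum computable_Suc fg computable_nth) auto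
  ultimately show ?thesis by (simp add: prod_encode_def del: sum.lessThan_Suc)
qed

lemma prod_encode_mono: "a \<le> a' \<Longrightarrow> b \<le> b' \<Longrightarrow> prod_encode (a, b) \<le> prod_encode (a', b')"
proof -
  assume ab: "a \<le> a'" "b \<le> b'"
  have "mono triangle" by (rule mono_iff_le_Suc[THEN iffD2]) simp
  thus ?thesis using ab by (auto simp: prod_encode_def intro!: add_mono dest: monoD[of triangle "a+b" "a'+b'"])
qed

definition pfst :: "nat \<Rightarrow> nat" where "pfst m = fst (prod_decode m)"
definition psnd :: "nat \<Rightarrow> nat" where "psnd m = snd (prod_decode m)"

lemma pfst_encode [simp]: "pfst (prod_encode (a, b)) = a"
  by (simp add: pfst_def)

lemma psnd_encode [simp]: "psnd (prod_encode (a, b)) = b"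
  by (simp add: psnd_def)

lemma prod_encode_pfst_psnd [simp]: "prod_encode (pfst m, psnd m) = m"
  by (simp add: pfst_def psnd_def)

lemma pfst_le: "pfst m \<le> m" and psnd_le: "psnd m \<le> m"
  using le_prod_encode_1[of "pfst m" "psnd m"] le_prod_encode_2[of "psnd m" "pfst m"] by simp_all

text \<open>A bounded search written as a sum: the indicator vanishes except at the component looked
  for, and a component never exceeds the code of its pair.\<close>

lemma computable_pfst: "computable n f \<Longrightarrow> computable n (\<lambda>xs. pfst (f xs))"
proof (erule computable_comp1[where h = pfst, rotated])
  have eq: "pfst m = (\<Sum>a<Suc m. a * of_bool (\<exists>b<Suc m. m = prod_encode (a, b)))" for m
  proof -
    have "(\<exists>b<Suc m. m = prod_encode (a, b)) \<longleftrightarrow> a = pfst m" for a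
      by (metis pfst_encode prod_encode_pfst_psnd psnd_le less_Suc_eq_le)
    hence "(\<Sum>a<Suc m. a * of_bool (\<exists>b<Suc m. m = prod_encode (a, b))) = (\<Sum>a<Suc m. if a = pfst m then a else 0)"
      by (intro sum.cong) (auto simp: of_bool_def)
    thus ?thesis using pfst_le[of m] by (simp add: sum.delta del: sum.lessThan_Suc)
  qed
  show "computable 1 (\<lambda>xs. pfst (xs ! 0))"
    unfolding eq
    by (intro computable_sum computable_mult computable_of_bool decidable_bex decidable_eq
        computable_prod_encode computable_Suc computable_vars) auto
qed

lemma computable_psnd: "computable n f \<Longrightarrow> computable n (\<lambda>xs. psnd (f xs))"
proof (erule computable_comp1[where h = psnd, rotated])
  have eq: "psnd m = (\<Sum>b<Suc m. b * of_bool (\<exists>a<Suc m. m = prod_encode (a, b)))" for m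
  proof -
    have "(\<exists>a<Suc m. m = prod_encode (a, b)) \<longleftrightarrow> b = psnd m" for b
      by (metis psnd_encode prod_encode_pfst_psnd pfst_le less_Suc_eq_le)
    hence "(\<Sum>b<Suc m. b * of_bool (\<exists>a<Suc m. m = prod_encode (a, b))) = (\<Sum>b<Suc m. if b = psnd m then b else 0)"
      by (intro sum.cong) (auto simp: of_bool_def)
    thus ?thesis using psnd_le[of m] by (simp add: sum.delta del: sum.lessThan_Suc)
  qed
  show "computable 1 (\<lambda>xs. psnd (xs ! 0))"
    unfolding eq
    by (intro computable_sum computable_mult computable_of_bool decidable_bex decidable_eq
        computable_prod_encode computable_Suc computable_vars) auto
qed

section \<open>Finite sets as binary numbers\<close>

lemma mem_set_decode_iff:
  "k \<in> set_decode x \<longleftrightarrow> (\<exists>y<Suc x. \<exists>z<Suc x. x = Suc (2 * y) * 2 ^ k + z \<and> z < 2 ^ k)"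
proof
  assume "k \<in> set_decode x"
  then obtain y where y: "x div 2 ^ k = Suc (2 * y)"
    by (auto simp: set_decode_def elim: oddE)
  have "x = Suc (2 * y) * 2 ^ k + x mod 2 ^ k" by (metis y div_mult_mod_eq)
  moreover have "y < Suc x" using y div_le_dividend[of x "2 ^ k"] by linarith
  ultimately show "\<exists>y<Suc x. \<exists>z<Suc x. x = Suc (2 * y) * 2 ^ k + z \<and> z < 2 ^ k"
    by (metis mod_le_divisor mod_less_divisor mod_less_eq_dividend less_Suc_eq_le zero_less_numeral zero_less_power)
next
  assume "\<exists>y<Suc x. \<exists>z<Suc x. x = Suc (2 * y) * 2 ^ k + z \<and> z < 2 ^ k"
  then obtain y z where "x = Suc (2 * y) * 2 ^ k + z" "z < 2 ^ k" by blast
  hence "x div 2 ^ k = Suc (2 * y)" by (simp only: div_mult_self3) simp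
  thus "k \<in> set_decode x" by (simp add: set_decode_def)
qed

lemma decidable_mem:
  "computable n f \<Longrightarrow> computable n g \<Longrightarrow> decidable n (\<lambda>xs. f xs \<in> set_decode (g xs))"
  unfolding decidable_def
proof (erule (1) computable_comp2[where h = "\<lambda>x y. of_bool (x \<in> set_decode y)", rotated])
  show "computable 2 (\<lambda>xs. of_bool (xs ! 0 \<in> set_decode (xs ! 1)))"
    unfolding mem_set_decode_iff
    by (intro computable_of_bool decidable_bex decidable_conj decidable_eq decidable_less computable_add
        computable_mult computable_pow2 computable_const
        computable_prod_encode computable_Suc computable_vars) auto
qed

lemma less_set_encode: "finite A \<Longrightarrow> x \<in> A \<Longrightarrow> x < set_encode A"
proof -
  assume "finite A" "x \<in> A"
  hence "2 ^ x \<le> set_encode A" unfolding set_encode_def by (intro member_le_sum) auto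
  thus ?thesis using less_exp[of x] by linarith
qed

text \<open>Turns decidable membership below a computable bound into a computable code.\<close>

lemma set_encode_eq_sum:
  assumes "finite A" "A \<subseteq> {..<b}"
  shows "set_encode A = (\<Sum>x<b. 2 ^ x * of_bool (x \<in> A))"
proof -
  have "(\<Sum>x<b. 2 ^ x * of_bool (x \<in> A)) = (\<Sum>x<b. if x \<in> A then 2 ^ x else (0::nat))"
    by (intro sum.cong) auto
  also have "\<dots> = (\<Sum>x\<in>A. 2 ^ x)"
    using assms by (simp add: sum.If_cases Int_absorb1)
  finally show ?thesis by (simp add: set_encode_def)
qed

lemma set_encode_mono_less: "A \<subseteq> {..<b} \<Longrightarrow> set_encode A < 2 ^ b"
proof -
  assume A: "A \<subseteq> {..<b}"
  have "set_encode A \<le> (\<Sum>x<b. 2 ^ x)" unfolding set_encode_def by (rule sum_mono2) (use A in auto)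
  also have "\<dots> < 2 ^ b" by (induction b) auto
  finally show ?thesis .
qed

text \<open>Finiteness is required for argument lists of every length, so that a family indexed by a
  bound variable inherits it without a side condition on lengths.\<close>

definition computable_set :: "nat \<Rightarrow> (nat list \<Rightarrow> nat set) \<Rightarrow> bool" where
  "computable_set n F \<longleftrightarrow> (\<forall>xs. finite (F xs)) \<and> computable n (\<lambda>xs. set_encode (F xs))"

lemma computable_set_encode: "computable_set n F \<Longrightarrow> computable n (\<lambda>xs. set_encode (F xs))"
  by (simp add: computable_set_def)

lemma computable_set_singleton: "computable n f \<Longrightarrow> computable_set n (\<lambda>xs. {f xs})"
  by (simp add: computable_set_def set_encode_def computable_pow2)

lemma computable_set_UN:
  assumes F: "computable_set (Suc n) (\<lambda>ys. F (ys ! 0) (drop 1 ys))" and m: "computable n m"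
  shows "computable_set n (\<lambda>xs. \<Union>k<m xs. F k xs)"
proof -
  have fin: "finite (F k xs)" for k xs
    using F[unfolded computable_set_def, THEN conjunct1, rule_format, of "k # xs"] by simp
  have c: "computable (Suc n) (\<lambda>ys. set_encode (F (ys ! 0) (drop 1 ys)))"
    using F by (simp add: computable_set_def)
  \<comment> \<open>An element is smaller than the code of any finite set that contains it, so this
    sum bounds the whole union.\<close>
  let ?b = "\<lambda>xs. \<Sum>k<m xs. set_encode (F k xs)"
  have b: "computable n ?b" by (rule computable_sum[OF c m])
  have c': "computable (Suc (Suc n)) (\<lambda>ys. set_encode (F (ys ! 0) (drop 1 (drop 1 ys))))"
    using computable_shift2[OF c] by (simp add: numeral_2_eq_2)
  have "computable n (\<lambda>xs. \<Sum>x<?b xs. 2 ^ x * of_bool (\<exists>k<m xs. x \<in> set_decode (set_encode (F k xs))))"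
  proof (rule computable_sum[where F = "\<lambda>x xs. 2 ^ x * of_bool (\<exists>k<m xs. x \<in> set_decode (set_encode (F k xs)))"])
    have m': "computable (Suc n) (\<lambda>ys. m (drop 1 ys))"
    proof -
      have "computable (Suc n) (\<lambda>ys. m (map (\<lambda>i. ys ! i) [1..<Suc n]))"
        by (rule computable_reindex) (use m in \<open>auto simp del: upt_Suc\<close>)
      thus ?thesis
      proof (rule computable_cong)
        fix ys :: "nat list" assume "length ys = Suc n"
        hence "map (\<lambda>i. ys ! i) [1..<Suc n] = drop 1 ys" by (intro nth_equalityI) (auto simp del: upt_Suc)
        thus "m (map (\<lambda>i. ys ! i) [1..<Suc n]) = m (drop 1 ys)" by simp
      qed
    qed
    show "computable (Suc n) (\<lambda>ys. 2 ^ (ys ! 0) * of_bool (\<exists>k<m (drop 1 ys).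
        ys ! 0 \<in> set_decode (set_encode (F k (drop 1 ys)))))"
      by (intro computable_mult computable_pow2 computable_nth computable_of_bool
          decidable_bex[where P = "\<lambda>k ys. ys ! 0 \<in> set_decode (set_encode (F k (drop 1 ys)))"] m' decidable_mem c'
        computable_vars) auto
  qed (rule b)
  moreover have "(\<Sum>x<?b xs. 2 ^ x * of_bool (\<exists>k<m xs. x \<in> set_decode (set_encode (F k xs))))
      = set_encode (\<Union>k<m xs. F k xs)" for xs
  proof -
    have "(\<Union>k<m xs. F k xs) \<subseteq> {..<?b xs}"
    proof clarsimp
      fix k x assume "k < m xs" "x \<in> F k xs"
      have "x < set_encode (F k xs)" using less_set_encode fin \<open>x \<in> F k xs\<close> by blast
      also have "\<dots> \<le> ?b xs" by (rule member_le_sum[of k "{..<m xs}" "\<lambda>k. set_encode (F k xs)"]) (use \<open>k < m xs\<close> in auto)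
      finally show "x < ?b xs" .
    qed
    thus ?thesis using fin by (subst set_encode_eq_sum[of _ "?b xs"]) (auto simp: set_encode_inverse Bex_def)
  qed
  ultimately show ?thesis using fin by (simp add: computable_set_def)
qed

lemma computable_set_Un:
  assumes "computable_set n F" "computable_set n G"
  shows "computable_set n (\<lambda>xs. F xs \<union> G xs)"
proof -
  have drop: "computable_set (Suc n) (\<lambda>ys. H (drop 1 ys))" if "computable_set n H" for H
  proof -
    have "computable (Suc n) (\<lambda>ys. set_encode (H (map (\<lambda>i. ys ! i) [1..<Suc n])))"
      by (rule computable_reindex) (use that computable_set_def in \<open>auto simp del: upt_Suc\<close>)
    moreover have "map (\<lambda>i. ys ! i) [1..<Suc n] = drop 1 ys" if "length ys = Suc n" for ys :: "nat list"
      by (rule nth_equalityI) (use that in \<open>auto simp del: upt_Suc\<close>)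
    ultimately have "computable (Suc n) (\<lambda>ys. set_encode (H (drop 1 ys)))"
      by (elim computable_cong) (auto simp del: upt_Suc)
    thus ?thesis using that by (simp add: computable_set_def)
  qed
  \<comment> \<open>A binary union is a union over an index below 2; two indicator factors express
    the case distinction on the index.\<close>
  have "computable (Suc n) (\<lambda>ys. of_bool (ys ! 0 = 0) * set_encode (F (drop 1 ys))
      + of_bool (ys ! 0 \<noteq> 0) * set_encode (G (drop 1 ys)))"
    by (intro computable_add computable_mult computable_of_bool decidable_eq decidable_not
        computable_set_encode drop assms computable_nth computable_zero) auto
  hence "computable_set (Suc n) (\<lambda>ys. if ys ! 0 = 0 then F (drop 1 ys) else G (drop 1 ys))"
    using drop[OF assms(1)] drop[OF assms(2)] unfolding computable_set_def
    by (auto elim!: computable_cong)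
  from computable_set_UN[where F = "\<lambda>k xs. if k = 0 then F xs else G xs", OF this computable_const[of n 2]]
  show ?thesis by (simp add: lessThan_Suc numeral_2_eq_2 Un_commute)
qed

lemma computable_set_if:
  assumes "decidable n P" "computable_set n F"
  shows "computable_set n (\<lambda>xs. if P xs then F xs else {})"
proof -
  have "computable n (\<lambda>xs. of_bool (P xs) * set_encode (F xs))"
    by (intro computable_mult computable_of_bool computable_set_encode assms)
  thus ?thesis using assms(2) unfolding computable_set_def
    by (auto elim!: computable_cong)
qed

lemma computable_funpow:
  assumes "computable 1 (\<lambda>xs. h (xs ! 0))" "computable n f" "computable n g"
  shows "computable n (\<lambda>xs. (h ^^ f xs) (g xs))"
proof -
  have "rec_nat a (\<lambda>k y. h y) j = (h ^^ j) a" for a j by (induction j) auto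
  moreover have "computable n (\<lambda>xs. rec_nat (g xs) (\<lambda>k y. h y) (f xs))"
    by (rule computable_rec[where s = "\<lambda>k y xs. h y"])
      (auto intro!: assms computable_comp1[of h] computable_nth simp del: One_nat_def)
  ultimately show ?thesis by simp
qed

section \<open>Perfect assignments\<close>

text \<open>Negated names are read off \<open>N\<close>, as in the reduct that defines stable models.\<close>

primrec reduct_ext :: "interp \<Rightarrow> assignment \<Rightarrow> assignment \<Rightarrow> shape \<Rightarrow> obj set" where
  "reduct_ext I N S (Nom c) = {Ind c}"
| "reduct_ext I N S (Name s) = {e. (s, e) \<in> S}"
| "reduct_ext I N S (NegName s) = dom I - {e. (s, e) \<in> N}"
| "reduct_ext I N S (Cpt A) = concept_ext I A"
| "reduct_ext I N S (Or \<phi> \<psi>) = reduct_ext I N S \<phi> \<union> reduct_ext I N S \<psi>"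
| "reduct_ext I N S (And \<phi> \<psi>) = reduct_ext I N S \<phi> \<inter> reduct_ext I N S \<psi>"
| "reduct_ext I N S (ExRoles R \<phi>) =
     {e \<in> dom I. \<exists>e'\<in>dom I. (\<forall>r. r |\<in>| R \<longrightarrow> (e, e') \<in> role_ext I r) \<and> e' \<in> reduct_ext I N S \<phi>}"
| "reduct_ext I N S (ExPath E \<phi>) =
     {e \<in> dom I. \<exists>e'\<in>dom I. (e, e') \<in> rexp_ext I E \<and> e' \<in> reduct_ext I N S \<phi>}"
| "reduct_ext I N S (NomEQ c E E') =
     (if rexp_ext I E `` {Ind c} = rexp_ext I E' `` {Ind c} then {Ind c} else {})"
| "reduct_ext I N S (NomDisj c E E') =
     (if rexp_ext I E `` {Ind c} \<inter> rexp_ext I E' `` {Ind c} = {} then {Ind c} else {})"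

lemma shape_ext_eq_reduct: "shape_ext I S \<phi> = reduct_ext I S S \<phi>"
  by (induction \<phi>) auto

lemma reduct_ext_cong:
  "(\<And>s e. s \<in> neg_names \<phi> \<Longrightarrow> (s, e) \<in> N \<longleftrightarrow> (s, e) \<in> N') \<Longrightarrow>
   (\<And>s e. s \<in> shape_names \<phi> \<Longrightarrow> (s, e) \<in> S \<longleftrightarrow> (s, e) \<in> S') \<Longrightarrow>
   reduct_ext I N S \<phi> = reduct_ext I N' S' \<phi>"
  by (induction \<phi>) auto

lemma neg_names_subset: "neg_names \<phi> \<subseteq> shape_names \<phi>"
  by (induction \<phi>) auto

lemma reduct_ext_mono: "S \<subseteq> S' \<Longrightarrow> reduct_ext I N S \<phi> \<subseteq> reduct_ext I N S' \<phi>"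
  by (induction \<phi>) auto

text \<open>With negation frozen, membership is finitary: an existential needs one witness, and of
  the two stages used by a conjunction the later one serves both parts.\<close>

lemma reduct_ext_Union:
  fixes S :: "nat \<Rightarrow> assignment"
  assumes "mono S" "e \<in> reduct_ext I N (\<Union>n. S n) \<phi>"
  shows "\<exists>n. e \<in> reduct_ext I N (S n) \<phi>"
  using assms(2)
proof (induction \<phi> arbitrary: e)
  case (And \<phi> \<psi>)
  then obtain n m where "e \<in> reduct_ext I N (S n) \<phi>" "e \<in> reduct_ext I N (S m) \<psi>" by (metis Int_iff reduct_ext.simps(6))
  moreover have "S n \<subseteq> S (max n m)" "S m \<subseteq> S (max n m)" using assms(1) by (simp_all add: monoD)
  ultimately have "e \<in> reduct_ext I N (S (max n m)) (And \<phi> \<psi>)"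
    using reduct_ext_mono by (simp, blast)
  thus ?case by blast
next
  case (ExRoles R \<phi>)
  thus ?case by simp blast
next
  case (ExPath E \<phi>)
  thus ?case by simp blast
qed (auto split: if_splits)

section \<open>Iterating the operator of a single stratum\<close>

lemma T_omega_step: "T_op I C ((T_op I C ^^ n) S) \<subseteq> T_omega I C S"
  unfolding T_omega_def by (metis UN_upper UNIV_I funpow.simps(2) o_apply)

lemma T_omega_subset: "S \<subseteq> T_omega I C S"
  unfolding T_omega_def by (metis UN_upper UNIV_I funpow_0)

lemma T_op_heads: "(s, e) \<in> T_op I C S \<Longrightarrow> (s, e) \<in> S \<or> s \<in> heads C"
  by (force simp: T_op_def heads_def)

lemma T_op_funpow_heads: "(s, e) \<in> (T_op I C ^^ n) S \<Longrightarrow> (s, e) \<in> S \<or> s \<in> heads C"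
  by (induction n) (auto dest: T_op_heads)

lemma T_omega_heads: "(s, e) \<in> T_omega I C S \<Longrightarrow> (s, e) \<in> S \<or> s \<in> heads C"
  unfolding T_omega_def by (auto dest: T_op_funpow_heads)

lemma T_op_funpow_subset: "S \<subseteq> (T_op I C ^^ n) S"
  by (induction n) (auto simp: T_op_def)

text \<open>The operator is not monotone, but the names negated in \<open>C\<close> are not heads of
  \<open>C\<close>. Their extension stays fixed during the iteration, which therefore behaves like
  that of the finitary reduct.\<close>

lemma T_omega_closed:
  assumes neg: "neg_names_of C \<inter> heads C = {}" and C: "(s, \<phi>) \<in> C"
    and e: "e \<in> shape_ext I (T_omega I C S) \<phi>"
  shows "(s, e) \<in> T_omega I C S"
proof -
  let ?S = "\<lambda>n. (T_op I C ^^ n) S"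
  have inc: "mono ?S" by (auto simp: mono_iff_le_Suc T_op_def)
  have "e \<in> reduct_ext I (T_omega I C S) (\<Union>n. ?S n) \<phi>"
    using e by (simp add: shape_ext_eq_reduct T_omega_def)
  then obtain n where n: "e \<in> reduct_ext I (T_omega I C S) (?S n) \<phi>"
    using reduct_ext_Union[OF inc] by blast
  have "(s', e') \<in> T_omega I C S \<longleftrightarrow> (s', e') \<in> ?S n" if "s' \<in> neg_names \<phi>" for s' e'
  proof -
    have "s' \<notin> heads C" using that neg C by (auto simp: neg_names_of_def)
    moreover have "?S n \<subseteq> T_omega I C S" unfolding T_omega_def by blast
    ultimately show ?thesis using T_omega_heads T_op_funpow_subset by fastforce
  qed
  hence "reduct_ext I (T_omega I C S) (?S n) \<phi> = shape_ext I (?S n) \<phi>"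
    unfolding shape_ext_eq_reduct by (intro reduct_ext_cong) auto
  hence "(s, e) \<in> T_op I C (?S n)" using n C by (auto simp: T_op_def)
  thus ?thesis using T_omega_step by blast
qed

section \<open>Stages along a stratification\<close>

context
  fixes I :: interp and Cs :: "shape_constraint set list" and C :: "shape_constraint set"
  assumes strat: "stratification Cs C"
begin

definition stage :: "nat \<Rightarrow> assignment" where
  "stage k = fold (T_omega I) (take k Cs) {}"

lemma stage_Suc: "k < length Cs \<Longrightarrow> stage (Suc k) = T_omega I (Cs ! k) (stage k)"
  by (simp add: stage_def take_Suc_conv_app_nth)

lemma stage_mono: "j \<le> k \<Longrightarrow> k \<le> length Cs \<Longrightarrow> stage j \<subseteq> stage k"
proof (induction k)
  case (Suc k)
  show ?case
  proof (cases "j = Suc k")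
    case False
    hence "stage j \<subseteq> stage k" using Suc by simp
    also have "\<dots> \<subseteq> stage (Suc k)" using stage_Suc[of k] T_omega_subset Suc.prems by simp
    finally show ?thesis .
  qed simp
qed simp

lemma stage_agree:
  assumes "j \<le> k" "k \<le> length Cs" "\<And>i. j \<le> i \<Longrightarrow> i < length Cs \<Longrightarrow> s \<notin> heads (Cs ! i)"
  shows "(s, e) \<in> stage k \<longleftrightarrow> (s, e) \<in> stage j"
  using assms(1,2)
proof (induction k)
  case (Suc k)
  show ?case
  proof (cases "j = Suc k")
    case False
    hence "s \<notin> heads (Cs ! k)" using Suc.prems assms(3) by simp
    hence "(s, e) \<in> stage (Suc k) \<longleftrightarrow> (s, e) \<in> stage k"
      using stage_Suc[of k] T_omega_heads T_omega_subset Suc.prems by (metis Suc_le_eq subsetD)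
    thus ?thesis using Suc False by simp
  qed simp
qed simp

text \<open>Names in a body of stratum \<open>i\<close> are not defined later, so the body has the
  same extension at the end as directly after its stratum, where \<open>T_omega_closed\<close>
  applies.\<close>

lemma perfect_along_closed:
  assumes "(s, \<phi>) \<in> C" "e \<in> shape_ext I (perfect_along I Cs) \<phi>"
  shows "(s, e) \<in> perfect_along I Cs"
proof -
  obtain i where i: "i < length Cs" "(s, \<phi>) \<in> Cs ! i"
    using assms(1) strat by (auto simp: stratification_def in_set_conv_nth)
  have X: "perfect_along I Cs = stage (length Cs)" by (simp add: stage_def perfect_along_def)
  have "(s', e') \<in> perfect_along I Cs \<longleftrightarrow> (s', e') \<in> stage (Suc i)" if "s' \<in> shape_names \<phi>" for s' e'
    unfolding X
  proof (rule stage_agree)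
    show "s' \<notin> heads (Cs ! j)" if "Suc i \<le> j" "j < length Cs" for j
    proof -
      have "names_of (Cs ! i) \<inter> heads (Cs ! j) = {}" using strat i that by (auto simp: stratification_def)
      moreover have "s' \<in> names_of (Cs ! i)" using \<open>s' \<in> shape_names \<phi>\<close> i by (auto simp: names_of_def)
      ultimately show ?thesis by blast
    qed
  qed (use i in auto)
  hence "shape_ext I (perfect_along I Cs) \<phi> = shape_ext I (stage (Suc i)) \<phi>"
    unfolding shape_ext_eq_reduct using neg_names_subset by (intro reduct_ext_cong) blast+
  hence "(s, e) \<in> stage (Suc i)"
    using T_omega_closed[of "Cs ! i"] i assms(2) strat by (simp add: stage_Suc stratification_def)
  thus ?thesis using stage_mono[of "Suc i" "length Cs"] i X by auto
qed

text \<open>The induction principle behind every later proof that something is not derived without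
  reason: a rule may be assumed to fire with premises that are both true and in \<open>Q\<close>,
  and its negations may be read off the final assignment.\<close>

lemma perfect_along_least:
  assumes Q: "\<And>s \<phi> e. (s, \<phi>) \<in> C \<Longrightarrow>
    e \<in> reduct_ext I (perfect_along I Cs) (perfect_along I Cs \<inter> Q) \<phi> \<Longrightarrow> (s, e) \<in> Q"
  shows "perfect_along I Cs \<subseteq> Q"
proof -
  have X: "perfect_along I Cs = stage (length Cs)" by (simp add: stage_def perfect_along_def)
  have "stage k \<subseteq> Q" if "k \<le> length Cs" for k
    using that
  proof (induction k)
    case 0 thus ?case by (simp add: stage_def)
  next
    case (Suc k)
    hence k: "k < length Cs" and IH: "stage k \<subseteq> Q" by auto
    let ?S = "\<lambda>n. (T_op I (Cs ! k) ^^ n) (stage k)"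
    have SX: "?S n \<subseteq> perfect_along I Cs" for n
    proof -
      have "?S n \<subseteq> stage (Suc k)" unfolding stage_Suc[OF k] T_omega_def by blast
      thus ?thesis using stage_mono[of "Suc k" "length Cs"] k X by auto
    qed
    have "?S n \<subseteq> Q" for n
    proof (induction n)
      case 0 thus ?case using IH by simp
    next
      case (Suc n)
      have "(s, e) \<in> Q" if C: "(s, \<phi>) \<in> Cs ! k" and e: "e \<in> shape_ext I (?S n) \<phi>" for s \<phi> e
      proof -
        \<comment> \<open>Names negated in stratum \<open>k\<close> are defined strictly before it,
          so they already have their final extension at every point of its iteration.\<close>
        have "(s', e') \<in> ?S n \<longleftrightarrow> (s', e') \<in> perfect_along I Cs" if "s' \<in> neg_names \<phi>" for s' e'
        proof -
          have "s' \<notin> heads (Cs ! j)" if "k \<le> j" "j < length Cs" for j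
          proof -
            have "neg_names_of (Cs ! k) \<inter> heads (Cs ! j) = {}" using strat k that by (auto simp: stratification_def)
            moreover have "s' \<in> neg_names_of (Cs ! k)" using \<open>s' \<in> neg_names \<phi>\<close> C by (auto simp: neg_names_of_def)
            ultimately show ?thesis by blast
          qed
          hence "(s', e') \<in> perfect_along I Cs \<longleftrightarrow> (s', e') \<in> stage k"
            unfolding X by (intro stage_agree) (use k in auto)
          thus ?thesis using SX[of n] T_op_funpow_subset[of "stage k"] by blast
        qed
        hence "e \<in> reduct_ext I (perfect_along I Cs) (?S n) \<phi>"
          using e reduct_ext_cong[of \<phi> "?S n" "perfect_along I Cs" "?S n" "?S n"]
          unfolding shape_ext_eq_reduct by blast
        hence "e \<in> reduct_ext I (perfect_along I Cs) (perfect_along I Cs \<inter> Q) \<phi>"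
          using reduct_ext_mono SX Suc by (metis Int_subset_iff subsetD)
        moreover have "(s, \<phi>) \<in> C" using C k strat by (auto simp: stratification_def)
        ultimately show ?thesis using Q by blast
      qed
      hence "T_op I (Cs ! k) (?S n) \<subseteq> Q" using Suc unfolding T_op_def by blast
      thus ?case by simp
    qed
    thus ?case unfolding stage_Suc[OF k] T_omega_def by blast
  qed
  thus ?thesis using X by simp
qed

end

lemma stratification_SOME: "stratified C \<Longrightarrow> stratification (SOME Cs. stratification Cs C) C"
  unfolding stratified_def by (rule someI_ex)

text \<open>Closedness and leastness say that \<^const>\<open>PA\<close> is a stable model; no stratification is
  mentioned any more.\<close>

lemma PA_closed:
  "stratified C \<Longrightarrow> (s, \<phi>) \<in> C \<Longrightarrow> e \<in> shape_ext I (PA C I) \<phi> \<Longrightarrow> (s, e) \<in> PA C I"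
  unfolding PA_def using perfect_along_closed[OF stratification_SOME] by blast

lemma PA_least:
  "stratified C \<Longrightarrow>
   (\<And>s \<phi> e. (s, \<phi>) \<in> C \<Longrightarrow> e \<in> reduct_ext I (PA C I) (PA C I \<inter> Q) \<phi> \<Longrightarrow> (s, e) \<in> Q) \<Longrightarrow>
   PA C I \<subseteq> Q"
  unfolding PA_def using perfect_along_least[OF stratification_SOME] by blast

text \<open>Stratum \<open>i\<close> consists of the constraints whose head has level
  \<open>i\<close>.\<close>

lemma stratified_by_levels:
  assumes lv: "\<And>s \<phi>. (s, \<phi>) \<in> C \<Longrightarrow> lv s \<le> B"
    "\<And>s \<phi> s'. (s, \<phi>) \<in> C \<Longrightarrow> s' \<in> shape_names \<phi> \<Longrightarrow> lv s' \<le> lv s"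
    "\<And>s \<phi> s'. (s, \<phi>) \<in> C \<Longrightarrow> s' \<in> neg_names \<phi> \<Longrightarrow> lv s' < (lv s :: nat)"
  shows "stratified C"
proof -
  let ?Cs = "map (\<lambda>i. {(s, \<phi>). (s, \<phi>) \<in> C \<and> lv s = i}) [0..<Suc B]"
  have nth: "?Cs ! i = {(s, \<phi>). (s, \<phi>) \<in> C \<and> lv s = i}" if "i < length ?Cs" for i
    using that by (simp del: upt_Suc)
  have "stratification ?Cs C"
    unfolding stratification_def
  proof (intro conjI allI impI)
    show "\<Union> (set ?Cs) = C" using lv(1) by (fastforce simp: less_Suc_eq_le simp del: upt_Suc)
    fix i j assume ij: "i < length ?Cs" "j < length ?Cs"
    show "?Cs ! i \<inter> ?Cs ! j = {}" if "i \<noteq> j" using that by (auto simp only: nth[OF ij(1)] nth[OF ij(2)])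
    show "names_of (?Cs ! i) \<inter> heads (?Cs ! j) = {}" if "i < j"
      unfolding nth[OF ij(1)] nth[OF ij(2)] names_of_def heads_def using that lv(2) by fastforce
    show "neg_names_of (?Cs ! i) \<inter> heads (?Cs ! j) = {}" if "i \<le> j"
      unfolding nth[OF ij(1)] nth[OF ij(2)] neg_names_of_def heads_def using that lv(3) by fastforce
  qed simp
  thus ?thesis unfolding stratified_def by blast
qed

subsection \<open>Invariance under isomorphism\<close>

primrec noms :: "shape \<Rightarrow> individual set" where
  "noms (Nom c) = {c}"
| "noms (Name s) = {}"
| "noms (NegName s) = {}"
| "noms (Cpt A) = {}"
| "noms (Or \<phi> \<psi>) = noms \<phi> \<union> noms \<psi>"
| "noms (And \<phi> \<psi>) = noms \<phi> \<union> noms \<psi>"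
| "noms (ExRoles R \<phi>) = noms \<phi>"
| "noms (ExPath E \<phi>) = noms \<phi>"
| "noms (NomEQ c E E') = {c}"
| "noms (NomDisj c E E') = {c}"

lemma role_ext_dom: "interpretation_wf K \<Longrightarrow> (d, e) \<in> role_ext K r \<Longrightarrow> d \<in> dom K \<and> e \<in> dom K"
  by (cases r) (force simp: interpretation_wf_def)+

lemma labels_path_dom: "interpretation_wf K \<Longrightarrow> labels_path K w d e \<Longrightarrow> d \<in> dom K \<and> e \<in> dom K"
  by (induction w arbitrary: d) (auto dest: role_ext_dom)

lemma rexp_ext_dom: "interpretation_wf K \<Longrightarrow> (d, e) \<in> rexp_ext K E \<Longrightarrow> d \<in> dom K \<and> e \<in> dom K"
  by (auto simp: rexp_ext_def dest: labels_path_dom)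

text \<open>Individuals may be moved; only those that a shape mentions have to be fixed later on.
  This admits the exchange of a blank node with an individual that occurs nowhere, on which
  \<open>sat_Blank\<close> rests.\<close>

locale interp_iso =
  fixes I J :: interp and g :: "obj \<Rightarrow> obj"
  assumes wfI: "interpretation_wf I" and wfJ: "interpretation_wf J"
    and bij: "bij_betw g (dom I) (dom J)"
    and cext: "\<And>A d. d \<in> dom I \<Longrightarrow> g d \<in> cext J A \<longleftrightarrow> d \<in> cext I A"
    and rext: "\<And>p d e. d \<in> dom I \<Longrightarrow> e \<in> dom I \<Longrightarrow> (g d, g e) \<in> rext J p \<longleftrightarrow> (d, e) \<in> rext I p"
begin

lemma g_dom [simp]: "d \<in> dom I \<Longrightarrow> g d \<in> dom J"
  using bij by (auto simp: bij_betw_def)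

lemma g_eq [simp]: "d \<in> dom I \<Longrightarrow> e \<in> dom I \<Longrightarrow> g d = g e \<longleftrightarrow> d = e"
  using bij by (auto simp: bij_betw_def inj_on_def)

lemma g_surj: "e \<in> dom J \<Longrightarrow> \<exists>d\<in>dom I. e = g d"
  using bij by (auto simp: bij_betw_def)

lemma role_ext_g [simp]:
  "d \<in> dom I \<Longrightarrow> e \<in> dom I \<Longrightarrow> (g d, g e) \<in> role_ext J r \<longleftrightarrow> (d, e) \<in> role_ext I r"
  by (cases r) (auto simp: rext)

lemma concept_ext_g [simp]: "d \<in> dom I \<Longrightarrow> g d \<in> concept_ext J A \<longleftrightarrow> d \<in> concept_ext I A"
  by (cases A) (auto simp: cext)

lemma labels_path_g:
  "d \<in> dom I \<Longrightarrow> e \<in> dom I \<Longrightarrow> labels_path J w (g d) (g e) \<longleftrightarrow> labels_path I w d e"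
proof (induction w arbitrary: d)
  case (Cons r w)
  show ?case
  proof
    assume "labels_path J (r # w) (g d) (g e)"
    then obtain d' where d': "(g d, d') \<in> role_ext J r" "labels_path J w d' (g e)" by auto
    then obtain d'' where "d'' \<in> dom I" "d' = g d''" using role_ext_dom[OF wfJ] g_surj by blast
    thus "labels_path I (r # w) d e" using d' Cons by auto
  next
    assume "labels_path I (r # w) d e"
    then obtain d' where d': "(d, d') \<in> role_ext I r" "labels_path I w d' e" by auto
    hence "d' \<in> dom I" using role_ext_dom[OF wfI] by blast
    thus "labels_path J (r # w) (g d) (g e)"
      using d' Cons role_ext_g[of d d' r] by (auto intro!: exI[of _ "g d'"])
  qed
qed auto

lemma rexp_ext_g [simp]:
  "d \<in> dom I \<Longrightarrow> e \<in> dom I \<Longrightarrow> (g d, g e) \<in> rexp_ext J E \<longleftrightarrow> (d, e) \<in> rexp_ext I E"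
  by (simp add: rexp_ext_def labels_path_g)

lemma rexp_ext_image: "d \<in> dom I \<Longrightarrow> rexp_ext J E `` {g d} = g ` (rexp_ext I E `` {d})"
proof (intro set_eqI iffI)
  fix x assume d: "d \<in> dom I" "x \<in> rexp_ext J E `` {g d}"
  then obtain y where "y \<in> dom I" "x = g y" using g_surj rexp_ext_dom[OF wfJ] by blast
  thus "x \<in> g ` (rexp_ext I E `` {d})" using d by auto
next
  fix x assume d: "d \<in> dom I" "x \<in> g ` (rexp_ext I E `` {d})"
  thus "x \<in> rexp_ext J E `` {g d}" using rexp_ext_dom[OF wfI] by auto
qed

lemma Ind_dom [simp]: "Ind c \<in> dom I"
  using wfI by (auto simp: interpretation_wf_def)

lemma rexp_ext_successors: "rexp_ext I E `` {d} \<subseteq> dom I"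
  using rexp_ext_dom[OF wfI] by blast

lemma shape_ext_g:
  assumes "\<And>s d. d \<in> dom I \<Longrightarrow> (s, g d) \<in> S' \<longleftrightarrow> (s, d) \<in> S"
    and "\<And>c. c \<in> noms \<phi> \<Longrightarrow> g (Ind c) = Ind c" and "d \<in> dom I"
  shows "g d \<in> shape_ext J S' \<phi> \<longleftrightarrow> d \<in> shape_ext I S \<phi>"
  using assms(2,3)
proof (induction \<phi> arbitrary: d)
  case (Nom c) thus ?case using g_eq[of d "Ind c"] by simp
next
  case (ExRoles R \<phi>)
  show ?case
  proof
    assume "g d \<in> shape_ext J S' (ExRoles R \<phi>)"
    then obtain e where e: "e \<in> dom J" "\<forall>r. r |\<in>| R \<longrightarrow> (g d, e) \<in> role_ext J r" "e \<in> shape_ext J S' \<phi>" by auto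
    then obtain e' where "e' \<in> dom I" "e = g e'" using g_surj by blast
    thus "d \<in> shape_ext I S (ExRoles R \<phi>)" using e ExRoles by auto
  next
    assume "d \<in> shape_ext I S (ExRoles R \<phi>)"
    then obtain e where e: "e \<in> dom I" "\<forall>r. r |\<in>| R \<longrightarrow> (d, e) \<in> role_ext I r" "e \<in> shape_ext I S \<phi>" by auto
    thus "g d \<in> shape_ext J S' (ExRoles R \<phi>)" using ExRoles by (auto intro!: bexI[of _ "g e"])
  qed
next
  case (ExPath R \<phi>)
  show ?case
  proof
    assume "g d \<in> shape_ext J S' (ExPath R \<phi>)"
    then obtain e where e: "e \<in> dom J" "(g d, e) \<in> rexp_ext J R" "e \<in> shape_ext J S' \<phi>" by auto
    then obtain e' where "e' \<in> dom I" "e = g e'" using g_surj by blast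
    thus "d \<in> shape_ext I S (ExPath R \<phi>)" using e ExPath by auto
  next
    assume "d \<in> shape_ext I S (ExPath R \<phi>)"
    then obtain e where e: "e \<in> dom I" "(d, e) \<in> rexp_ext I R" "e \<in> shape_ext I S \<phi>" by auto
    thus "g d \<in> shape_ext J S' (ExPath R \<phi>)" using ExPath by (auto intro!: bexI[of _ "g e"])
  qed
next
  case (NomEQ c E E')
  have c: "g (Ind c) = Ind c" using NomEQ by simp
  have "rexp_ext J F `` {Ind c} = g ` (rexp_ext I F `` {Ind c})" for F
    using rexp_ext_image[of "Ind c" F] c by simp
  moreover have "inj_on g (dom I)" using bij by (simp add: bij_betw_def)
  ultimately have "rexp_ext J E `` {Ind c} = rexp_ext J E' `` {Ind c} \<longleftrightarrow>
      rexp_ext I E `` {Ind c} = rexp_ext I E' `` {Ind c}"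
    by (simp add: inj_on_image_eq_iff rexp_ext_successors)
  moreover have "g d = Ind c \<longleftrightarrow> d = Ind c" using g_eq[of d "Ind c"] c NomEQ by simp
  ultimately show ?case by simp
next
  case (NomDisj c E E')
  have c: "g (Ind c) = Ind c" using NomDisj by simp
  have i: "rexp_ext J F `` {Ind c} = g ` (rexp_ext I F `` {Ind c})" for F
    using rexp_ext_image[of "Ind c" F] c by simp
  have "g ` (rexp_ext I E `` {Ind c}) \<inter> g ` (rexp_ext I E' `` {Ind c})
      = g ` (rexp_ext I E `` {Ind c} \<inter> rexp_ext I E' `` {Ind c})"
    using bij by (intro inj_on_image_Int[symmetric, of g "dom I"] rexp_ext_successors) (simp add: bij_betw_def)
  hence "rexp_ext J E `` {Ind c} \<inter> rexp_ext J E' `` {Ind c} = {} \<longleftrightarrow>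
      rexp_ext I E `` {Ind c} \<inter> rexp_ext I E' `` {Ind c} = {}"
    by (simp add: i)
  moreover have "g d = Ind c \<longleftrightarrow> d = Ind c" using g_eq[of d "Ind c"] c NomDisj by simp
  ultimately show ?case by simp
qed (use assms(1) in auto)

lemma T_op_g:
  assumes S: "\<And>s d. d \<in> dom I \<Longrightarrow> (s, g d) \<in> S' \<longleftrightarrow> (s, d) \<in> S"
    and C: "\<And>s \<phi> c. (s, \<phi>) \<in> C \<Longrightarrow> c \<in> noms \<phi> \<Longrightarrow> g (Ind c) = Ind c" and "d \<in> dom I"
  shows "(s, g d) \<in> T_op J C S' \<longleftrightarrow> (s, d) \<in> T_op I C S"
  using shape_ext_g[OF S C] S assms(3) unfolding T_op_def by (auto; blast)

lemma T_omega_g: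
  assumes S: "\<And>s d. d \<in> dom I \<Longrightarrow> (s, g d) \<in> S' \<longleftrightarrow> (s, d) \<in> S"
    and C: "\<And>s \<phi> c. (s, \<phi>) \<in> C \<Longrightarrow> c \<in> noms \<phi> \<Longrightarrow> g (Ind c) = Ind c" and "d \<in> dom I"
  shows "(s, g d) \<in> T_omega J C S' \<longleftrightarrow> (s, d) \<in> T_omega I C S"
proof -
  have "\<forall>s. \<forall>d\<in>dom I. (s, g d) \<in> (T_op J C ^^ n) S' \<longleftrightarrow> (s, d) \<in> (T_op I C ^^ n) S" for n
  proof (induction n)
    case (Suc n)
    thus ?case using T_op_g[of "(T_op J C ^^ n) S'" "(T_op I C ^^ n) S" C] C by simp
  qed (use S in simp)
  thus ?thesis using assms(3) unfolding T_omega_def by simp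
qed

lemma PA_g:
  assumes "stratified C" and C: "\<And>s \<phi> c. (s, \<phi>) \<in> C \<Longrightarrow> c \<in> noms \<phi> \<Longrightarrow> g (Ind c) = Ind c" and "d \<in> dom I"
  shows "(s, g d) \<in> PA C J \<longleftrightarrow> (s, d) \<in> PA C I"
proof -
  have *: "\<forall>s. \<forall>d\<in>dom I. (s, g d) \<in> fold (T_omega J) Cs S' \<longleftrightarrow> (s, d) \<in> fold (T_omega I) Cs S"
    if "\<And>s d. d \<in> dom I \<Longrightarrow> (s, g d) \<in> S' \<longleftrightarrow> (s, d) \<in> S" "\<Union> (set Cs) \<subseteq> C" for Cs S S'
    using that
  proof (induction Cs arbitrary: S S')
    case (Cons D Cs)
    have "(s, g d) \<in> T_omega J D S' \<longleftrightarrow> (s, d) \<in> T_omega I D S" if "d \<in> dom I" for s d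
      by (rule T_omega_g) (use Cons.prems C that in auto)
    thus ?case using Cons by simp
  qed simp
  \<comment> \<open>The chosen stratification depends on \<open>C\<close> alone, so both
    interpretations are evaluated along the same list of strata.\<close>
  have "\<Union> (set (SOME Cs. stratification Cs C)) = C"
    using stratification_SOME[OF assms(1)] by (simp add: stratification_def)
  thus ?thesis unfolding PA_def perfect_along_def using *[of "{}" "{}"] assms(3) by simp
qed

end

section \<open>Eliminating virtual trees\<close>

text \<open>A name \<open>h\<close> of a local program carries its level in its first component, so that negation can
  be confined to smaller levels without any reference to a stratification.\<close>

abbreviation lev :: "nat \<Rightarrow> nat" where "lev \<equiv> pfst"

text \<open>The level remains in the first component and only the body is wrapped: a literal about
  another node has the level of the name it speaks of.\<close>

definition kid_name :: "nat \<Rightarrow> nat \<Rightarrow> nat" where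
  "kid_name k t = prod_encode (lev t, prod_encode (0, prod_encode (k, psnd t)))"
definition parent_name :: "nat \<Rightarrow> nat" where
  "parent_name t = prod_encode (lev t, prod_encode (1, psnd t))"
definition neighbour_name :: "nat \<Rightarrow> nat \<Rightarrow> nat" where
  "neighbour_name R t = prod_encode (lev t, prod_encode (2, prod_encode (R, psnd t)))"
definition true_name :: nat where "true_name = prod_encode (0, prod_encode (3, 0))"
definition root_name :: nat where "root_name = prod_encode (0, prod_encode (4, 0))"
definition is_kid_name :: "nat \<Rightarrow> nat" where "is_kid_name k = prod_encode (0, prod_encode (5, k))"
definition concept_name :: "nat \<Rightarrow> nat" where "concept_name A = prod_encode (0, prod_encode (6, A))"
definition nominal_name :: "nat \<Rightarrow> nat" where "nominal_name a = prod_encode (0, prod_encode (7, a))"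

lemma lev_names [simp]:
  "lev (kid_name k t) = lev t" "lev (parent_name t) = lev t" "lev (neighbour_name R t) = lev t"
  "lev true_name = 0" "lev root_name = 0" "lev (is_kid_name k) = 0"
  "lev (concept_name A) = 0" "lev (nominal_name A) = 0"
  by (simp_all add: kid_name_def parent_name_def neighbour_name_def true_name_def root_name_def
      is_kid_name_def concept_name_def nominal_name_def)

definition code_roles :: "role fset \<Rightarrow> nat" where
  "code_roles Q = set_encode (code_role ` fset Q)"

text \<open>The successor keeps \<open>0\<close> free for the root.\<close>

definition kid_ctx :: "nat \<Rightarrow> nat \<Rightarrow> nat" where "kid_ctx k V = Suc (prod_encode (k, V))"

lemma kid_ctx_eq [simp]: "kid_ctx k V = kid_ctx k' V' \<longleftrightarrow> k = k' \<and> V = V'" "kid_ctx k V \<noteq> 0" "0 \<noteq> kid_ctx k V"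
  by (simp_all add: kid_ctx_def prod_encode_eq)

text \<open>A context is \<open>0\<close> at a root and \<open>kid_ctx k V\<close> at a virtual \<open>k\<close>-th child whose parent
  satisfies exactly the names in \<open>V\<close>.  The shape name \<open>at_name off \<kappa> h\<close> says that a node in
  context \<open>\<kappa>\<close> satisfies \<open>h\<close>; it is evaluated at the root of the virtual tree.
  \<open>upto_name off \<kappa> l V m\<close> says that, as far as names below \<open>m\<close> are concerned, the node satisfies
  those of \<open>V\<close> up to level \<open>l\<close> and no others of level less than \<open>l\<close>.\<close>

definition at_name :: "nat \<Rightarrow> nat \<Rightarrow> nat \<Rightarrow> nat" where
  "at_name off \<kappa> h = off + prod_encode (lev h, prod_encode (0, prod_encode (\<kappa>, h)))"
definition upto_name :: "nat \<Rightarrow> nat \<Rightarrow> nat \<Rightarrow> nat \<Rightarrow> nat \<Rightarrow> nat" where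
  "upto_name off \<kappa> l V m = off + prod_encode (l, prod_encode (1, prod_encode (\<kappa>, prod_encode (V, m))))"

lemma name_eqs [simp]:
  "at_name off \<kappa> h = at_name off \<kappa>' h' \<longleftrightarrow> \<kappa> = \<kappa>' \<and> h = h'"
  "upto_name off \<kappa> l V m = upto_name off \<kappa>' l' V' m' \<longleftrightarrow> \<kappa> = \<kappa>' \<and> l = l' \<and> V = V' \<and> m = m'"
  "at_name off \<kappa> h \<noteq> upto_name off \<kappa>' l V m" "upto_name off \<kappa>' l V m \<noteq> at_name off \<kappa> h"
  by (auto simp: at_name_def upto_name_def prod_encode_eq)

lemma name_ge [simp]: "\<not> at_name off \<kappa> h < off" "\<not> upto_name off \<kappa> l V m < off"
  by (simp_all add: at_name_def upto_name_def)

definition ctx_bound :: "nat \<Rightarrow> nat" where "ctx_bound M = Suc (Suc (prod_encode (M, 2 ^ M)))"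

text \<open>The rule \<open>kid\<close> guesses the set \<open>V\<close> of names of the parent,
  which is a finite disjunction over constraints with one head. The \<open>upto\<close> rules
  confirm the guess name by name: members of level at most \<open>l\<close> positively, non-members
  of level below \<open>l\<close> by negation. Everything else is skipped, since absence on level
  \<open>l\<close> itself cannot be tested within a stratified set, and names above \<open>l\<close>
  have no influence on a name of level \<open>l\<close>. The information that flows down to a child
  is entirely contained in its context, which is why \<open>parent\<close> has no condition beyond
  membership in \<open>V\<close>.\<close>

inductive_set tree_rules ::
  "nat \<Rightarrow> nat \<Rightarrow> (nat \<times> nat \<times> nat \<times> nat) set \<Rightarrow> (nat \<times> nat \<times> nat) set \<Rightarrow> (nat \<times> nat) set \<Rightarrow>
   shape_constraint set"
  for off M Pos Neg Out where
    pos: "(h, a, b, c) \<in> Pos \<Longrightarrow> \<kappa> < ctx_bound M \<Longrightarrow>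
      (at_name off \<kappa> h, And (Name (at_name off \<kappa> a)) (And (Name (at_name off \<kappa> b)) (Name (at_name off \<kappa> c))))
        \<in> tree_rules off M Pos Neg Out"
  | neg: "(h, a, b) \<in> Neg \<Longrightarrow> \<kappa> < ctx_bound M \<Longrightarrow>
      (at_name off \<kappa> h, And (Name (at_name off \<kappa> a)) (NegName (at_name off \<kappa> b)))
        \<in> tree_rules off M Pos Neg Out"
  | kid: "\<kappa> < ctx_bound M \<Longrightarrow> k < M \<Longrightarrow> t < M \<Longrightarrow> V < 2 ^ M \<Longrightarrow>
      (at_name off \<kappa> (kid_name k t),
       And (Name (at_name off (kid_ctx k V) t)) (Name (upto_name off \<kappa> (lev t) V M)))
        \<in> tree_rules off M Pos Neg Out"
  | upto_0: "\<kappa> < ctx_bound M \<Longrightarrow> l < M \<Longrightarrow> V < 2 ^ M \<Longrightarrow>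
      (upto_name off \<kappa> l V 0, Cpt Top) \<in> tree_rules off M Pos Neg Out"
  | upto_pos: "\<kappa> < ctx_bound M \<Longrightarrow> l < M \<Longrightarrow> V < 2 ^ M \<Longrightarrow> m < M \<Longrightarrow> m \<in> set_decode V \<Longrightarrow> lev m \<le> l \<Longrightarrow>
      (upto_name off \<kappa> l V (Suc m), And (Name (upto_name off \<kappa> l V m)) (Name (at_name off \<kappa> m)))
        \<in> tree_rules off M Pos Neg Out"
  | upto_neg: "\<kappa> < ctx_bound M \<Longrightarrow> l < M \<Longrightarrow> V < 2 ^ M \<Longrightarrow> m < M \<Longrightarrow> m \<notin> set_decode V \<Longrightarrow> lev m < l \<Longrightarrow>
      (upto_name off \<kappa> l V (Suc m), And (Name (upto_name off \<kappa> l V m)) (NegName (at_name off \<kappa> m)))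
        \<in> tree_rules off M Pos Neg Out"
  | upto_skip: "\<kappa> < ctx_bound M \<Longrightarrow> l < M \<Longrightarrow> V < 2 ^ M \<Longrightarrow> m < M \<Longrightarrow>
      \<not> (m \<in> set_decode V \<and> lev m \<le> l) \<Longrightarrow> \<not> (m \<notin> set_decode V \<and> lev m < l) \<Longrightarrow>
      (upto_name off \<kappa> l V (Suc m), Name (upto_name off \<kappa> l V m)) \<in> tree_rules off M Pos Neg Out"
  | parent: "k < M \<Longrightarrow> V < 2 ^ M \<Longrightarrow> t < M \<Longrightarrow> t \<in> set_decode V \<Longrightarrow>
      (at_name off (kid_ctx k V) (parent_name t), Cpt Top) \<in> tree_rules off M Pos Neg Out"
  | true: "\<kappa> < ctx_bound M \<Longrightarrow> (at_name off \<kappa> true_name, Cpt Top) \<in> tree_rules off M Pos Neg Out"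
  | is_kid: "k < M \<Longrightarrow> V < 2 ^ M \<Longrightarrow>
      (at_name off (kid_ctx k V) (is_kid_name k), Cpt Top) \<in> tree_rules off M Pos Neg Out"
  | root: "(at_name off 0 root_name, Cpt Top) \<in> tree_rules off M Pos Neg Out"
  | neighbour: "code_roles Q < M \<Longrightarrow> t < M \<Longrightarrow>
      (at_name off 0 (neighbour_name (code_roles Q) t), ExRoles Q (Name (at_name off 0 t)))
        \<in> tree_rules off M Pos Neg Out"
  | concept: "A < M \<Longrightarrow> (at_name off 0 (concept_name A), Cpt (Con A)) \<in> tree_rules off M Pos Neg Out"
  | nominal: "a < M \<Longrightarrow> (at_name off 0 (nominal_name a), Nom a) \<in> tree_rules off M Pos Neg Out"
  | out: "(s, h) \<in> Out \<Longrightarrow> (s, Name (at_name off 0 h)) \<in> tree_rules off M Pos Neg Out"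

lemma interpretation_wf_abox [simp]: "interpretation_wf (abox_interp A)"
  by (simp add: interpretation_wf_def abox_interp_def)

lemma dom_abox [simp]: "dom (abox_interp A) = UNIV"
  by (simp add: abox_interp_def)

lemma set_decode_less: "V < 2 ^ M \<Longrightarrow> v \<in> set_decode V \<Longrightarrow> v < M"
proof (rule ccontr)
  assume V: "V < 2 ^ M" "v \<in> set_decode V" "\<not> v < M"
  have "(2::nat) ^ M \<le> 2 ^ v" using V(3) by simp
  hence "V < 2 ^ v" using V(1) by linarith
  hence "V div 2 ^ v = 0" by simp
  thus False using V(2) by (simp add: set_decode_def)
qed

section \<open>Local programs and the names satisfied in a virtual tree\<close>

locale local_program =
  fixes off M :: nat and Pos :: "(nat \<times> nat \<times> nat \<times> nat) set" and Neg :: "(nat \<times> nat \<times> nat) set"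
    and Out :: "(nat \<times> nat) set"
  assumes Pos: "(h, a, b, c) \<in> Pos \<Longrightarrow>
      h < M \<and> a < M \<and> b < M \<and> c < M \<and> lev a \<le> lev h \<and> lev b \<le> lev h \<and> lev c \<le> lev h"
    and Neg: "(h, a, b) \<in> Neg \<Longrightarrow> h < M \<and> a < M \<and> b < M \<and> lev a \<le> lev h \<and> lev b < lev h"
    and Out: "(s, h) \<in> Out \<Longrightarrow> s < off \<and> h < M"
begin

abbreviation rules :: "shape_constraint set" where "rules \<equiv> tree_rules off M Pos Neg Out"
abbreviation at :: "nat \<Rightarrow> nat \<Rightarrow> nat" where "at \<equiv> at_name off"
abbreviation upto :: "nat \<Rightarrow> nat \<Rightarrow> nat \<Rightarrow> nat \<Rightarrow> nat" where "upto \<equiv> upto_name off"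

text \<open>Output names come after all others: \<open>lev h\<close> is at most \<open>h\<close>,
  which is below \<open>M\<close> for every name of the program.\<close>

definition name_lev :: "nat \<Rightarrow> nat" where
  "name_lev s = (if s < off then M else lev (s - off))"

lemma name_lev_simps [simp]:
  "name_lev (at \<kappa> h) = lev h" "name_lev (upto \<kappa> l V m) = l" "s < off \<Longrightarrow> name_lev s = M"
  by (auto simp: name_lev_def at_name_def upto_name_def)

lemma stratified_rules: "stratified rules"
proof (rule stratified_by_levels[of rules name_lev M])
  have l: "h < M \<Longrightarrow> lev h \<le> M" for h using pfst_le[of h] by linarith
  fix s \<phi> assume r: "(s, \<phi>) \<in> rules"
  show "name_lev s \<le> M" using r by cases (auto dest!: Pos Neg Out intro: l)
  show "name_lev s' \<le> name_lev s" if "s' \<in> shape_names \<phi>" for s'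
    using r that by cases (auto dest!: Pos Neg Out intro: l)
  show "name_lev s' < name_lev s" if "s' \<in> neg_names \<phi>" for s'
    using r that by cases (auto dest!: Neg)
qed

context
  fixes A :: abox
begin

abbreviation \<I> :: interp where "\<I> \<equiv> abox_interp A"
abbreviation \<X> :: assignment where "\<X> \<equiv> PA rules \<I>"

text \<open>Paths list the last step first. The constraints derive names for arbitrary contexts,
  including contexts that no node has; here each context carries the set that its parent really
  satisfies.\<close>

fun sat :: "obj \<Rightarrow> nat list \<Rightarrow> nat set" where
  "sat x [] = {h. h < M \<and> (at 0 h, x) \<in> \<X>}"
| "sat x (k # p) = {h. h < M \<and> (at (kid_ctx k (set_encode (sat x p))) h, x) \<in> \<X>}"

fun ctx :: "obj \<Rightarrow> nat list \<Rightarrow> nat" where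
  "ctx x [] = 0"
| "ctx x (k # p) = kid_ctx k (set_encode (sat x p))"

lemma sat_iff: "h \<in> sat x p \<longleftrightarrow> h < M \<and> (at (ctx x p) h, x) \<in> \<X>"
  by (cases p) auto

lemma sat_subset: "sat x p \<subseteq> {..<M}"
  by (auto simp: sat_iff)

lemma finite_sat [simp]: "finite (sat x p)"
  using sat_subset finite_subset by blast

lemma set_encode_sat: "set_encode (sat x p) < 2 ^ M"
  by (rule set_encode_mono_less[OF sat_subset])

lemma kid_ctx_less: "k < M \<Longrightarrow> V < 2 ^ M \<Longrightarrow> kid_ctx k V < ctx_bound M"
  using prod_encode_mono[of k M V "2 ^ M"] by (simp add: kid_ctx_def ctx_bound_def)

lemma ctx_less: "set p \<subseteq> {..<M} \<Longrightarrow> ctx x p < ctx_bound M"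
proof (cases p)
  case Nil thus ?thesis by (simp add: ctx_bound_def)
qed (simp add: kid_ctx_less set_encode_sat)

lemma closed: "(s, \<phi>) \<in> rules \<Longrightarrow> x \<in> shape_ext \<I> \<X> \<phi> \<Longrightarrow> (s, x) \<in> \<X>"
  by (rule PA_closed[OF stratified_rules])

lemma sat_pos:
  "set p \<subseteq> {..<M} \<Longrightarrow> (h, a, b, c) \<in> Pos \<Longrightarrow> a \<in> sat x p \<Longrightarrow> b \<in> sat x p \<Longrightarrow> c \<in> sat x p \<Longrightarrow> h \<in> sat x p"
  using closed[OF tree_rules.pos[OF _ ctx_less]] Pos by (simp add: sat_iff)

lemma sat_neg:
  "set p \<subseteq> {..<M} \<Longrightarrow> (h, a, b) \<in> Neg \<Longrightarrow> a \<in> sat x p \<Longrightarrow> b \<notin> sat x p \<Longrightarrow> h \<in> sat x p"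
  using closed[OF tree_rules.neg[OF _ ctx_less]] Neg by (simp add: sat_iff)

text \<open>For the true set of names all comparisons succeed on every level, because its members
  hold and its non-members fail. So the correct guess is always available to the rule
  \<open>kid\<close>.\<close>

lemma upto_sat:
  assumes p: "set p \<subseteq> {..<M}" and l: "l < M"
  shows "m \<le> M \<Longrightarrow> (upto (ctx x p) l (set_encode (sat x p)) m, x) \<in> \<X>"
proof (induction m)
  case 0
  thus ?case using closed[OF tree_rules.upto_0[OF ctx_less[OF p] l set_encode_sat]] by simp
next
  case (Suc m)
  hence IH: "(upto (ctx x p) l (set_encode (sat x p)) m, x) \<in> \<X>" and m: "m < M" by auto
  note b = ctx_less[OF p] l set_encode_sat m
  have d: "set_decode (set_encode (sat x p)) = sat x p" by (simp add: set_encode_inverse)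
  consider "m \<in> sat x p" "lev m \<le> l" | "m \<notin> sat x p" "lev m < l"
    | "\<not> (m \<in> sat x p \<and> lev m \<le> l)" "\<not> (m \<notin> sat x p \<and> lev m < l)" by blast
  thus ?case
  proof cases
    case 1
    thus ?thesis using closed[OF tree_rules.upto_pos[OF b]] IH d by (simp add: sat_iff)
  next
    case 2
    thus ?thesis using closed[OF tree_rules.upto_neg[OF b]] IH d m by (simp add: sat_iff)
  next
    case 3
    thus ?thesis using closed[OF tree_rules.upto_skip[OF b]] IH d by simp
  qed
qed

lemma sat_kid:
  assumes "set p \<subseteq> {..<M}" "k < M" "t \<in> sat x (k # p)" "kid_name k t < M"
  shows "kid_name k t \<in> sat x p"
proof -
  have t: "t < M" using assms(3) by simp
  hence "lev t < M" using pfst_le[of t] by linarith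
  thus ?thesis
    using closed[OF tree_rules.kid[OF ctx_less[OF assms(1), of x] assms(2) t set_encode_sat[of x p]], of x]
      upto_sat[OF assms(1), of "lev t" M] assms(3,4) by (simp add: sat_iff)
qed

lemma sat_parent:
  assumes "k < M" "t \<in> sat x p" "parent_name t < M"
  shows "parent_name t \<in> sat x (k # p)"
  using closed[OF tree_rules.parent[OF assms(1) set_encode_sat, of t x p]] assms(2,3)
    sat_subset[of x p] by (auto simp: set_encode_inverse)

lemma sat_true: "set p \<subseteq> {..<M} \<Longrightarrow> true_name < M \<Longrightarrow> true_name \<in> sat x p"
  using closed[OF tree_rules.true[OF ctx_less]] by (simp add: sat_iff)

lemma sat_is_kid: "k < M \<Longrightarrow> is_kid_name k < M \<Longrightarrow> is_kid_name k \<in> sat x (k # p)"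
  using closed[OF tree_rules.is_kid[OF _ set_encode_sat]] by simp

lemma sat_root: "root_name < M \<Longrightarrow> root_name \<in> sat x []"
  using closed[OF tree_rules.root] by simp

lemma sat_neighbour:
  assumes "\<And>r. r |\<in>| Q \<Longrightarrow> (x, y) \<in> role_ext \<I> r" "t \<in> sat y []" "code_roles Q < M"
    "neighbour_name (code_roles Q) t < M"
  shows "neighbour_name (code_roles Q) t \<in> sat x []"
  using closed[OF tree_rules.neighbour[OF assms(3), of t], of x] assms by auto

lemma sat_concept: "B < M \<Longrightarrow> concept_name B < M \<Longrightarrow> x \<in> cext \<I> B \<Longrightarrow> concept_name B \<in> sat x []"
  using closed[OF tree_rules.concept] by simp

lemma sat_nominal: "a < M \<Longrightarrow> nominal_name a < M \<Longrightarrow> nominal_name a \<in> sat (Ind a) []"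
  using closed[OF tree_rules.nominal] by simp

text \<open>Whether a virtual child satisfies a name of level \<open>l\<close> depends on the names of level at most
  \<open>l\<close> of its parent only.\<close>

lemma at_kid_local:
  assumes "lev h = l" "\<And>v. lev v \<le> l \<Longrightarrow> v \<in> set_decode V \<longleftrightarrow> v \<in> set_decode V'"
    "k < M" "V < 2 ^ M" "V' < 2 ^ M" "(at (kid_ctx k V) h, x) \<in> \<X>"
  shows "(at (kid_ctx k V') h, x) \<in> \<X>"
  using assms
proof (induction l arbitrary: h V V' k x rule: less_induct)
  case (less l)
  let ?agree = "\<lambda>V V'. \<forall>v. lev v \<le> l \<longrightarrow> (v \<in> set_decode V \<longleftrightarrow> v \<in> set_decode V')"
  \<comment> \<open>This inner induction by leastness treats level \<open>l\<close> only. Premises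
    of smaller level, among them all negated ones, are settled by the outer induction on
    levels.\<close>
  let ?Q = "{(s, x).
    (\<forall>k V h V'. s = at (kid_ctx k V) h \<longrightarrow> lev h = l \<longrightarrow> k < M \<longrightarrow> V < 2 ^ M \<longrightarrow> V' < 2 ^ M \<longrightarrow> ?agree V V' \<longrightarrow>
        (at (kid_ctx k V') h, x) \<in> \<X>) \<and>
    (\<forall>k V U m V'. s = upto (kid_ctx k V) l U m \<longrightarrow> k < M \<longrightarrow> V < 2 ^ M \<longrightarrow> V' < 2 ^ M \<longrightarrow> ?agree V V' \<longrightarrow>
        (upto (kid_ctx k V') l U m, x) \<in> \<X>)}"
  have IH: "(at (kid_ctx k V) h, x) \<in> \<X> \<longleftrightarrow> (at (kid_ctx k V') h, x) \<in> \<X>"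
    if "lev h < l" "?agree V V'" "k < M" "V < 2 ^ M" "V' < 2 ^ M" for h V V' k x
    using less.IH[OF that(1) refl, of V V' k x] less.IH[OF that(1) refl, of V' V k x] that by auto
  have "\<X> \<subseteq> ?Q"
  proof (rule PA_least[OF stratified_rules])
    fix s \<phi> x assume r: "(s, \<phi>) \<in> rules" and x: "x \<in> reduct_ext \<I> \<X> (\<X> \<inter> ?Q) \<phi>"
    have premise: "(at (kid_ctx k V') a, x) \<in> \<X>"
      if "(at (kid_ctx k V) a, x) \<in> \<X> \<inter> ?Q" "lev a \<le> l" "?agree V V'" "k < M" "V < 2 ^ M" "V' < 2 ^ M" for a k V V'
    proof (cases "lev a = l")
      case True thus ?thesis using that by auto
    next
      case False thus ?thesis using that IH[of a V V' k x] by auto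
    qed
    have 1: "(at (kid_ctx k V') h, x) \<in> \<X>"
      if s: "s = at (kid_ctx k V) h" "lev h = l" and k: "k < M" and V: "V < 2 ^ M" "V' < 2 ^ M"
        and agree: "?agree V V'" for k V h V'
      using r
    proof cases
      case (pos h' a b c \<kappa>)
      have "(at (kid_ctx k V') e, x) \<in> \<X>" if "e \<in> {a, b, c}" for e
        by (rule premise[OF _ _ agree k V]) (use that pos x s Pos[OF pos(3)] in auto)
      thus ?thesis using closed[OF tree_rules.pos[OF pos(3) kid_ctx_less[OF k V(2)]], of x] pos s by auto
    next
      case (neg h' a b \<kappa>)
      have "(at (kid_ctx k V') a, x) \<in> \<X>"
        by (rule premise[OF _ _ agree k V]) (use neg x s Neg[OF neg(3)] in auto)
      moreover have "(at (kid_ctx k V') b, x) \<notin> \<X>"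
        using IH[OF _ agree k V, of b x] neg x s Neg[OF neg(3)] by auto
      ultimately show ?thesis using closed[OF tree_rules.neg[OF neg(3) kid_ctx_less[OF k V(2)]], of x] neg s by auto
    next
      \<comment> \<open>The premise about the grandchild lives in context
        \<open>kid_ctx j U\<close>, which does not mention \<open>V\<close>; only the comparison
        with \<open>U\<close> has to be moved from \<open>V\<close> to \<open>V'\<close>.\<close>
      case (kid \<kappa> j t U)
      have "(upto (kid_ctx k V') l U M, x) \<in> \<X>" using kid x s agree k V by auto
      thus ?thesis using closed[OF tree_rules.kid[OF kid_ctx_less[OF k V(2)] kid(4-6)], of x] kid s x by auto
    next
      case (parent k' V'' t)
      hence "t \<in> set_decode V'" using s agree by auto
      thus ?thesis using closed[OF tree_rules.parent[OF k V(2)], of t x] parent s by auto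
    next
      case (true \<kappa>)
      thus ?thesis using closed[OF tree_rules.true[OF kid_ctx_less[OF k V(2)]], of x] s by auto
    next
      case (is_kid k' V'')
      thus ?thesis using closed[OF tree_rules.is_kid[OF k V(2)], of x] s by auto
    next
      case (out h') thus ?thesis using s Out by fastforce
    qed (use s in auto)
    have 2: "(upto (kid_ctx k V') l U m, x) \<in> \<X>"
      if s: "s = upto (kid_ctx k V) l U m" and k: "k < M" and V: "V < 2 ^ M" "V' < 2 ^ M"
        and agree: "?agree V V'" for k V U m V'
      using r
    proof cases
      case upto_0
      thus ?thesis using closed[OF tree_rules.upto_0[OF kid_ctx_less[OF k V(2)]], of l U x] s by auto
    next
      case (upto_pos \<kappa> l' U' m')
      have u: "(upto (kid_ctx k V') l U m', x) \<in> \<X>" using upto_pos x s agree k V by auto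
      have "(at (kid_ctx k V') m', x) \<in> \<X>" by (rule premise[OF _ _ agree k V]) (use upto_pos x s in auto)
      thus ?thesis using u closed[OF tree_rules.upto_pos[OF kid_ctx_less[OF k V(2)]], of l U m' x] upto_pos s by auto
    next
      case (upto_neg \<kappa> l' U' m')
      have u: "(upto (kid_ctx k V') l U m', x) \<in> \<X>" using upto_neg x s agree k V by auto
      have "(at (kid_ctx k V') m', x) \<notin> \<X>" using IH[OF _ agree k V, of m' x] upto_neg x s by auto
      thus ?thesis using u closed[OF tree_rules.upto_neg[OF kid_ctx_less[OF k V(2)]], of l U m' x] upto_neg s by auto
    next
      case (upto_skip \<kappa> l' U' m')
      have u: "(upto (kid_ctx k V') l U m', x) \<in> \<X>" using upto_skip x s agree k V by auto
      thus ?thesis using u closed[OF tree_rules.upto_skip[OF kid_ctx_less[OF k V(2)]], of l U m' x] upto_skip s by auto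
    next
      case (out h') thus ?thesis using s Out by fastforce
    qed (use s in auto)
    show "(s, x) \<in> ?Q" using 1 2 by blast
  qed
  thus ?case using less.prems by blast
qed

text \<open>In a proof by this rule, negated names may be read off the final \<^const>\<open>sat\<close>.\<close>

lemma sat_induct:
  assumes h0: "h0 \<in> sat x0 p0" "set p0 \<subseteq> {..<M}"
    and pos: "\<And>x p h a b c. set p \<subseteq> {..<M} \<Longrightarrow> (h, a, b, c) \<in> Pos \<Longrightarrow>
      a \<in> sat x p \<Longrightarrow> b \<in> sat x p \<Longrightarrow> c \<in> sat x p \<Longrightarrow> P x p a \<Longrightarrow> P x p b \<Longrightarrow> P x p c \<Longrightarrow> P x p h"
    and neg: "\<And>x p h a b. set p \<subseteq> {..<M} \<Longrightarrow> (h, a, b) \<in> Neg \<Longrightarrow>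
      a \<in> sat x p \<Longrightarrow> P x p a \<Longrightarrow> b \<notin> sat x p \<Longrightarrow> P x p h"
    and kid: "\<And>x p k t. set p \<subseteq> {..<M} \<Longrightarrow> k < M \<Longrightarrow> kid_name k t < M \<Longrightarrow>
      t \<in> sat x (k # p) \<Longrightarrow> P x (k # p) t \<Longrightarrow> P x p (kid_name k t)"
    and parent: "\<And>x p k t. set p \<subseteq> {..<M} \<Longrightarrow> k < M \<Longrightarrow> parent_name t < M \<Longrightarrow>
      t \<in> sat x p \<Longrightarrow> P x p t \<Longrightarrow> P x (k # p) (parent_name t)"
    and true: "\<And>x p. set p \<subseteq> {..<M} \<Longrightarrow> P x p true_name"
    and is_kid: "\<And>x p k. set p \<subseteq> {..<M} \<Longrightarrow> k < M \<Longrightarrow> P x (k # p) (is_kid_name k)"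
    and root: "\<And>x. P x [] root_name"
    and neighbour: "\<And>x y Q t. code_roles Q < M \<Longrightarrow> (\<And>r. r |\<in>| Q \<Longrightarrow> (x, y) \<in> role_ext \<I> r) \<Longrightarrow>
      t \<in> sat y [] \<Longrightarrow> P y [] t \<Longrightarrow> P x [] (neighbour_name (code_roles Q) t)"
    and concept: "\<And>x B. B < M \<Longrightarrow> x \<in> cext \<I> B \<Longrightarrow> P x [] (concept_name B)"
    and nominal: "\<And>a. a < M \<Longrightarrow> P (Ind a) [] (nominal_name a)"
  shows "P x0 p0 h0"
proof -
  \<comment> \<open>A guess that has passed the comparison on level \<open>l\<close>: what it
    contains up to \<open>l\<close> is true and has property \<open>P\<close>, and below
    \<open>l\<close> nothing is missing.\<close>
  define exact where "exact V x q l \<longleftrightarrow>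
      (\<forall>v. v \<in> set_decode V \<longrightarrow> lev v \<le> l \<longrightarrow> v \<in> sat x q \<and> P x q v) \<and>
      (\<forall>v. lev v < l \<longrightarrow> (v \<in> set_decode V \<longleftrightarrow> v \<in> sat x q))" for V x q l
  \<comment> \<open>The context may stem from a wrong guess, but from one under which a name of
    level \<open>l\<close> is derived only if it holds in the true context.\<close>
  define compat where "compat \<kappa> x p l \<longleftrightarrow> set p \<subseteq> {..<M} \<and> ((\<kappa> = 0 \<and> p = []) \<or>
    (\<exists>k q V. \<kappa> = kid_ctx k V \<and> p = k # q \<and> k < M \<and> V < 2 ^ M \<and> exact V x q l))" for \<kappa> x p l
  define Q where "Q = {(s, x).
    (\<forall>\<kappa> h p. s = at \<kappa> h \<longrightarrow> h < M \<longrightarrow> compat \<kappa> x p (lev h) \<longrightarrow> h \<in> sat x p \<and> P x p h) \<and>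
    (\<forall>\<kappa> l V m p v. s = upto \<kappa> l V m \<longrightarrow> compat \<kappa> x p l \<longrightarrow> v < m \<longrightarrow>
       (v \<in> set_decode V \<longrightarrow> lev v \<le> l \<longrightarrow> v \<in> sat x p \<and> P x p v) \<and>
              (lev v < l \<longrightarrow> (v \<in> set_decode V \<longleftrightarrow> v \<in> sat x p)))}"
  have QI: "(s, x) \<in> Q"
    if "\<And>\<kappa> h p. s = at \<kappa> h \<Longrightarrow> h < M \<Longrightarrow> compat \<kappa> x p (lev h) \<Longrightarrow> h \<in> sat x p \<and> P x p h"
      "\<And>\<kappa> l V m p v. s = upto \<kappa> l V m \<Longrightarrow> compat \<kappa> x p l \<Longrightarrow> v < m \<Longrightarrow>
       (v \<in> set_decode V \<longrightarrow> lev v \<le> l \<longrightarrow> v \<in> sat x p \<and> P x p v) \<and>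
              (lev v < l \<longrightarrow> (v \<in> set_decode V \<longleftrightarrow> v \<in> sat x p))" for s x
    using that unfolding Q_def by blast
  have Q_at: "h \<in> sat x p \<and> P x p h" if "(at \<kappa> h, x) \<in> Q" "h < M" "compat \<kappa> x p (lev h)" for \<kappa> h x p
    using that unfolding Q_def by blast
  have Q_upto: "(v \<in> set_decode V \<longrightarrow> lev v \<le> l \<longrightarrow> v \<in> sat x p \<and> P x p v) \<and>
              (lev v < l \<longrightarrow> (v \<in> set_decode V \<longleftrightarrow> v \<in> sat x p))"
    if "(upto \<kappa> l V m, x) \<in> Q" "compat \<kappa> x p l" "v < m" for \<kappa> l V m x p v
    using that unfolding Q_def by blast
  have exact_mono: "exact V x q l'" if "exact V x q l" "l' \<le> l" for V x q l l'
    using that unfolding exact_def by (meson le_trans less_le_trans)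
  have compat_mono: "compat \<kappa> x p l'" if "compat \<kappa> x p l" "l' \<le> l" for \<kappa> x p l l'
    using that exact_mono unfolding compat_def by blast
  have compat_path: "set p \<subseteq> {..<M}" if "compat \<kappa> x p l" for \<kappa> x p l
    using that unfolding compat_def by blast
  have compat_kidD: "\<exists>q. p = k # q \<and> k < M \<and> exact V x q l \<and> set q \<subseteq> {..<M}"
    if "compat (kid_ctx k V) x p l" for k V x p l
    using that unfolding compat_def by auto
  have compat_0D: "p = []" if "compat 0 x p l" for x p l
    using that unfolding compat_def by auto
  \<comment> \<open>A failing name of smaller level really fails: below \<open>l\<close> the guess
    agrees with the true set, so \<open>at_kid_local\<close> carries a derivation from the true
    context over to the guessed one.\<close>
  have compat_neg: "b \<notin> sat x p" if c: "compat \<kappa> x p l" and l: "lev b < l" and b: "(at \<kappa> b, x) \<notin> \<X>" for \<kappa> x p l b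
  proof (cases p)
    case Nil
    thus ?thesis using c b by (auto simp: compat_def)
  next
    case (Cons k q)
    then obtain V where V: "\<kappa> = kid_ctx k V" "k < M" "V < 2 ^ M" "exact V x q l"
      using c by (auto simp: compat_def)
    have "(at (ctx x p) b, x) \<notin> \<X>"
    proof
      assume "(at (ctx x p) b, x) \<in> \<X>"
      hence "(at (kid_ctx k V) b, x) \<in> \<X>"
        unfolding Cons ctx.simps
        by (rule at_kid_local[OF refl _ V(2) set_encode_sat V(3), rotated])
           (use V(4) l in \<open>auto simp: set_encode_inverse exact_def\<close>)
      thus False using b V(1) by simp
    qed
    thus ?thesis by (simp add: sat_iff)
  qed
  have "\<X> \<subseteq> Q"
  proof (rule PA_least[OF stratified_rules])
    fix s \<phi> x assume r: "(s, \<phi>) \<in> rules" and x: "x \<in> reduct_ext \<I> \<X> (\<X> \<inter> Q) \<phi>"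
    have at: "a \<in> sat x p \<and> P x p a"
      if "compat \<kappa> x p l" "(at \<kappa> a, x) \<in> Q" "a < M" "lev a \<le> l" for a \<kappa> p l
      by (rule Q_at[OF that(2,3) compat_mono[OF that(1,4)]])
    show "(s, x) \<in> Q"
    proof (rule QI)
      fix \<kappa> h p assume s: "s = at \<kappa> h" "h < M" and c: "compat \<kappa> x p (lev h)"
      note path = compat_path[OF c]
      from r show "h \<in> sat x p \<and> P x p h"
      proof cases
        case (pos h' a b e \<kappa>')
        hence e: "\<kappa>' = \<kappa>" "h' = h" using s by auto
        have y: "y \<in> sat x p \<and> P x p y" if "y \<in> {a, b, e}" for y
          by (rule at[OF c]) (use pos(2) that x e Pos[OF pos(3)] in auto)
        show ?thesis
          using assms(3)[OF path pos(3), of x] sat_pos[OF path pos(3), of x] y[of a] y[of b] y[of e]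
          unfolding e by simp
      next
        case (neg h' a b \<kappa>')
        hence e: "\<kappa>' = \<kappa>" "h' = h" using s by auto
        have "a \<in> sat x p \<and> P x p a"
          by (rule at[OF c]) (use neg(2) x e Neg[OF neg(3)] in auto)
        moreover have "b \<notin> sat x p"
          by (rule compat_neg[OF c]) (use neg(2) x e Neg[OF neg(3)] in auto)
        ultimately show ?thesis using assms(4)[OF path neg(3), of x] sat_neg[OF path neg(3), of x] unfolding e by simp
      next
        case (kid \<kappa>' j t U)
        hence e: "\<kappa>' = \<kappa>" "h = kid_name j t" using s by auto
        have u: "(upto \<kappa> (lev h) U M, x) \<in> Q" "(at (kid_ctx j U) t, x) \<in> Q" using kid(2) x e by auto
        \<comment> \<open>The comparison has run through all names below \<open>M\<close>, and
          neither \<open>U\<close> nor the names satisfied at \<open>p\<close> contain larger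
          ones.\<close>
        have "exact U x p (lev h)"
          unfolding exact_def
          using Q_upto[OF u(1) c] set_decode_less[OF kid(6)] sat_subset[of x p] by blast
        hence "compat (kid_ctx j U) x (j # p) (lev t)"
          using kid(4,6) path e by (simp add: compat_def)
        hence "t \<in> sat x (j # p) \<and> P x (j # p) t" by (rule Q_at[OF u(2) kid(5)])
        thus ?thesis using assms(5)[OF path kid(4), of t x] sat_kid[OF path kid(4), of t x] s(2) unfolding e by simp
      next
        case (parent k V t)
        hence e: "\<kappa> = kid_ctx k V" "h = parent_name t" using s by auto
        then obtain q where q: "p = k # q" "exact V x q (lev h)" "set q \<subseteq> {..<M}"
          using compat_kidD c by blast
        hence "t \<in> sat x q \<and> P x q t" using parent(6) e by (simp add: exact_def)
        thus ?thesis using assms(6)[OF q(3) parent(3), of t x] sat_parent[OF parent(3), of t x] s(2) unfolding e q by simp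
      next
        case true thus ?thesis using assms(7)[OF path, of x] sat_true[OF path, of x] s by simp
      next
        case (is_kid k V)
        then obtain q where "p = k # q" "set q \<subseteq> {..<M}" using compat_kidD[of k V x p "lev h"] c s by auto
        thus ?thesis using assms(8)[of q k x] sat_is_kid[of k x q] is_kid s by simp
      next
        case root
        hence "p = []" using compat_0D[of x p "lev h"] c s by simp
        thus ?thesis using assms(9)[of x] sat_root[of x] root s by simp
      next
        case (neighbour Q' t)
        hence e: "\<kappa> = 0" "h = neighbour_name (code_roles Q') t" using s by auto
        hence p: "p = []" using compat_0D c by blast
        obtain y where y: "\<And>r. r |\<in>| Q' \<Longrightarrow> (x, y) \<in> role_ext \<I> r" "(at 0 t, y) \<in> Q"
          using x neighbour(2) by auto
        have "t \<in> sat y [] \<and> P y [] t" by (rule Q_at[OF y(2) neighbour(4)]) (simp add: compat_def)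
        thus ?thesis using assms(10)[OF neighbour(3) y(1)] sat_neighbour[OF y(1) _ neighbour(3)] s(2)
          unfolding e p by simp
      next
        case (concept B)
        hence "x \<in> cext \<I> B" "p = []" using x compat_0D[of x p "lev h"] c s by simp_all
        thus ?thesis using assms(11)[of B x] sat_concept[of B x] s concept by simp
      next
        case (nominal a)
        hence "x = Ind a" "p = []" using x compat_0D[of x p "lev h"] c s by simp_all
        thus ?thesis using assms(12)[of a] sat_nominal[of a] s nominal by simp
      next
        case (out h') thus ?thesis using s Out by fastforce
      qed (use s in auto)
    next
      fix \<kappa> l V m p v assume s: "s = upto \<kappa> l V m" and c: "compat \<kappa> x p l" and v: "v < m"
      from r show "(v \<in> set_decode V \<longrightarrow> lev v \<le> l \<longrightarrow> v \<in> sat x p \<and> P x p v) \<and>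
              (lev v < l \<longrightarrow> (v \<in> set_decode V \<longleftrightarrow> v \<in> sat x p))"
      proof cases
        case (upto_pos \<kappa>' l' U m')
        hence e: "\<kappa>' = \<kappa>" "l' = l" "U = V" "m = Suc m'" using s by auto
        have u: "(upto \<kappa> l V m', x) \<in> Q" "(at \<kappa> m', x) \<in> Q" using upto_pos(2) x e by auto
        have "m' \<in> sat x p \<and> P x p m'" by (rule at[OF c]) (use upto_pos u e in auto)
        thus ?thesis using Q_upto[OF u(1) c, of v] v upto_pos(7) e less_Suc_eq by auto
      next
        case (upto_neg \<kappa>' l' U m')
        hence e: "\<kappa>' = \<kappa>" "l' = l" "U = V" "m = Suc m'" using s by auto
        have u: "(upto \<kappa> l V m', x) \<in> Q" using upto_neg(2) x e by auto
        have "m' \<notin> sat x p" by (rule compat_neg[OF c]) (use upto_neg x e in auto)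
        thus ?thesis using Q_upto[OF u c, of v] v upto_neg(7) e less_Suc_eq by auto
      next
        case (upto_skip \<kappa>' l' U m')
        hence e: "\<kappa>' = \<kappa>" "l' = l" "U = V" "m = Suc m'" using s by auto
        have u: "(upto \<kappa> l V m', x) \<in> Q" using upto_skip(2) x e by auto
        thus ?thesis using Q_upto[OF u c, of v] v upto_skip(7,8) e less_Suc_eq by auto
      next
        case (out h') thus ?thesis using s Out by fastforce
      qed (use s v in auto)
    qed
  qed
  \<comment> \<open>The true context of a child is compatible only once \<open>P\<close> is known
    for all names of its parent, hence the induction on the path.\<close>
  moreover have "P x p h" if sub: "\<X> \<subseteq> Q" and "h \<in> sat x p" "set p \<subseteq> {..<M}" for x p h
    using that(2,3)
  proof (induction p arbitrary: h)
    case Nil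
    hence "(at 0 h, x) \<in> Q" "h < M" using sub by auto
    thus ?case using Q_at[of 0 h x "[]"] by (simp add: compat_def)
  next
    case (Cons k q)
    have "compat (ctx x (k # q)) x (k # q) (lev h)"
      using Cons set_encode_sat by (simp add: compat_def exact_def set_encode_inverse)
    moreover have "(at (ctx x (k # q)) h, x) \<in> Q" "h < M" using Cons.prems sub by auto
    ultimately show ?case using Q_at by blast
  qed
  ultimately show ?thesis using h0 by blast
qed

lemma PA_rules_out: "s < off \<Longrightarrow> (s, x) \<in> \<X> \<longleftrightarrow> (\<exists>h. (s, h) \<in> Out \<and> h \<in> sat x [])"
proof
  assume "s < off" "(s, x) \<in> \<X>"
  moreover have "\<X> \<subseteq> {(s, x). s < off \<longrightarrow> (\<exists>h. (s, h) \<in> Out \<and> (at 0 h, x) \<in> \<X>)}"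
  proof (rule PA_least[OF stratified_rules], clarify)
    fix s \<phi> x assume "(s, \<phi>) \<in> rules" "s < off"
      "x \<in> reduct_ext \<I> \<X> (\<X> \<inter> {(s, x). s < off \<longrightarrow> (\<exists>h. (s, h) \<in> Out \<and> (at 0 h, x) \<in> \<X>)}) \<phi>"
    thus "\<exists>h. (s, h) \<in> Out \<and> (at 0 h, x) \<in> \<X>" by cases auto
  qed
  ultimately show "\<exists>h. (s, h) \<in> Out \<and> h \<in> sat x []" using Out by fastforce
next
  assume "s < off" "\<exists>h. (s, h) \<in> Out \<and> h \<in> sat x []"
  thus "(s, x) \<in> \<X>" using closed[OF tree_rules.out] by auto
qed

lemma noms_rules: "(s, \<phi>) \<in> rules \<Longrightarrow> c \<in> noms \<phi> \<Longrightarrow> c < M"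
  by (erule tree_rules.cases) auto

text \<open>Exchanging the blank node with an individual outside the ABox is an automorphism of the
  canonical interpretation, and no rule mentions that individual because it is at least
  \<open>M\<close>.\<close>

lemma sat_Blank:
  assumes "M \<le> c" "\<And>B. ConceptAssertion B c \<notin> A" "\<And>q d. RoleAssertion q c d \<notin> A" "\<And>q d. RoleAssertion q d c \<notin> A"
  shows "sat (Blank b) p = sat (Ind c) p"
proof -
  let ?g = "\<lambda>d. if d = Blank b then Ind c else if d = Ind c then Blank b else d"
  interpret interp_iso \<I> \<I> ?g
  proof
    show "bij_betw ?g (dom \<I>) (dom \<I>)"
      by (rule bij_betw_byWitness[where f' = ?g]) auto
  qed (use assms in \<open>auto simp: abox_interp_def interpretation_wf_def\<close>)
  have "(s, Ind c) \<in> \<X> \<longleftrightarrow> (s, Blank b) \<in> \<X>" for s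
    using PA_g[OF stratified_rules, of "Blank b" s] noms_rules assms(1) by fastforce
  thus ?thesis by (induction p) auto
qed

end

end

section \<open>The rewriting\<close>

definition ex_code :: "nat \<Rightarrow> nat \<Rightarrow> nat \<Rightarrow> nat" where
  "ex_code a r b = prod_encode (2, list_encode [a, r, b])"
definition all_code :: "nat \<Rightarrow> nat \<Rightarrow> nat \<Rightarrow> nat" where
  "all_code a r b = prod_encode (1, list_encode [a, r, b])"
definition role_incl_code :: "nat \<Rightarrow> nat \<Rightarrow> nat" where
  "role_incl_code r s = prod_encode (3, list_encode [r, s])"

definition inv_code :: "nat \<Rightarrow> nat" where
  "inv_code r = prod_encode (1 - pfst r, psnd r)"

text \<open>Reachability along role inclusions is expressed as membership in all closed sets, so
  that bounded quantifiers suffice. An inclusion also relates the inverse roles, which accounts for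
  the second implication. The bounds on \<open>u\<close> and \<open>v\<close> are harmless, as both
  are smaller than the code of their inclusion.\<close>

definition role_closed :: "nat \<Rightarrow> nat \<Rightarrow> bool" where
  "role_closed t X \<longleftrightarrow> (\<forall>u<Suc t. \<forall>v<Suc t. role_incl_code u v \<in> set_decode t \<longrightarrow>
     (u \<in> set_decode X \<longrightarrow> v \<in> set_decode X) \<and>
     (inv_code u \<in> set_decode X \<longrightarrow> inv_code v \<in> set_decode X))"

text \<open>The bound on \<open>X\<close> exceeds the code of the set of all roles above \<open>r\<close>.\<close>

definition role_le :: "nat \<Rightarrow> nat \<Rightarrow> nat \<Rightarrow> bool" where
  "role_le t r s \<longleftrightarrow> (\<forall>X<2 ^ Suc (prod_encode (1, t) + r).
     role_closed t X \<longrightarrow> r \<in> set_decode X \<longrightarrow> s \<in> set_decode X)"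

text \<open>Every node of the virtual forest has a child for each \<open>A \<sqsubseteq> \<exists>r.B\<close> of the TBox, and \<open>Ex\<close> marks
  those nodes that the oblivious chase creates.  \<open>CN x\<close>: the concept with code \<open>x\<close> is derived;
  \<open>LS l\<close>: all concepts on the list with code \<open>l\<close> are.  For sets \<open>X\<close> of concept codes, \<open>Has X\<close>
  and \<open>Lacks X\<close> compare the type of the node with \<open>X\<close>, and \<open>Sub i X\<close> says that the type of the
  \<open>i\<close>-th child is contained in \<open>X\<close>.  \<open>Dom i\<close>: the \<open>i\<close>-th child is redundant in the austere model;
  \<open>Act\<close>: the node belongs to that model.  \<open>FM f\<close> is a formula, \<open>Dia R f\<close> is \<open>\<exists>R.f\<close>, and \<open>Glo f\<close>
  says that \<open>f\<close> holds somewhere, which is what \<open>\<exists>R.f\<close> means for the empty \<open>R\<close>.\<close>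

datatype name_body =
    Kid nat name_body | Par name_body | Nbr nat name_body
  | Tru | Root | IsKid nat | CA nat | IND nat
  | Ex | CN nat | LS nat
  | NSub nat nat | Sub nat nat | Lacks nat | Has nat | Dom nat | Cand nat | Act
  | FM nat | Dia nat nat | Bel nat | Glo nat

text \<open>The tags 0 to 7 are those of \<open>kid_name\<close> up to \<open>nominal_name\<close>,
  so these literals are understood by \<open>tree_rules\<close> without translation.\<close>

primrec code_body :: "name_body \<Rightarrow> nat" where
  "code_body (Kid k b) = prod_encode (0, prod_encode (k, code_body b))"
| "code_body (Par b) = prod_encode (1, code_body b)"
| "code_body (Nbr R b) = prod_encode (2, prod_encode (R, code_body b))"
| "code_body Tru = prod_encode (3, 0)"
| "code_body Root = prod_encode (4, 0)"
| "code_body (IsKid k) = prod_encode (5, k)"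
| "code_body (CA A) = prod_encode (6, A)"
| "code_body (IND a) = prod_encode (7, a)"
| "code_body Ex = prod_encode (8, 0)"
| "code_body (CN x) = prod_encode (9, x)"
| "code_body (LS l) = prod_encode (10, l)"
| "code_body (NSub i X) = prod_encode (11, prod_encode (i, X))"
| "code_body (Sub i X) = prod_encode (12, prod_encode (i, X))"
| "code_body (Lacks X) = prod_encode (13, X)"
| "code_body (Has X) = prod_encode (14, X)"
| "code_body (Dom i) = prod_encode (15, i)"
| "code_body (Cand i) = prod_encode (16, i)"
| "code_body Act = prod_encode (17, 0)"
| "code_body (FM f) = prod_encode (18, f)"
| "code_body (Dia R f) = prod_encode (19, prod_encode (R, f))"
| "code_body (Bel f) = prod_encode (20, f)"
| "code_body (Glo f) = prod_encode (21, f)"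

type_synonym nm = "nat \<times> name_body"

definition code_name :: "nm \<Rightarrow> nat" where
  "code_name n = prod_encode (fst n, code_body (snd n))"

lemma code_body_eq [simp]: "code_body b = code_body b' \<longleftrightarrow> b = b'"
proof (induction b arbitrary: b')
qed (case_tac b'; simp add: prod_encode_eq)+

lemma code_name_eq [simp]: "code_name n = code_name n' \<longleftrightarrow> n = n'"
  by (auto simp: code_name_def prod_encode_eq prod_eq_iff)

section \<open>Formula codes and the rules of the local program\<close>

definition sh_code :: "nat \<Rightarrow> nat" where "sh_code x = prod_encode (0, x)"
definition path_code :: "nat \<Rightarrow> nat \<Rightarrow> nat \<Rightarrow> nat" where
  "path_code d e f = prod_encode (1, prod_encode (d, prod_encode (e, f)))"
definition not_code :: "nat \<Rightarrow> nat" where "not_code f = prod_encode (2, f)"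

lemma code_eqs [simp]:
  "ex_code a r b = ex_code a' r' b' \<longleftrightarrow> a = a' \<and> r = r' \<and> b = b'"
  "all_code a r b = all_code a' r' b' \<longleftrightarrow> a = a' \<and> r = r' \<and> b = b'"
  "role_incl_code r b = role_incl_code r' b' \<longleftrightarrow> r = r' \<and> b = b'"
  "sh_code x = sh_code x' \<longleftrightarrow> x = x'" "not_code x = not_code x' \<longleftrightarrow> x = x'"
  "path_code a r b = path_code a' r' b' \<longleftrightarrow> a = a' \<and> r = r' \<and> b = b'"
  "sh_code x \<noteq> path_code a r b" "path_code a r b \<noteq> sh_code x" "sh_code x \<noteq> not_code f" "not_code f \<noteq> sh_code x"
  "not_code f \<noteq> path_code a r b" "path_code a r b \<noteq> not_code f"
  by (auto simp: ex_code_def all_code_def role_incl_code_def sh_code_def path_code_def not_code_def prod_encode_eq)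

text \<open>Saturation of the chase, entirely on level 0 and without negation. All rules have three
  premises; a rule with fewer repeats one. The number \<open>2 ^ u\<close> is the code of the
  singleton role set with element \<open>u\<close>. Concepts travel up from a child by
  \<open>all_up\<close> even if that child is dropped later, since the chase has to be finished
  before children are compared.\<close>

inductive_set concept_rules :: "nat \<Rightarrow> nat \<Rightarrow> (nm \<times> nm \<times> nm \<times> nm) set"
  for t W where
    top: "((0, CN (prod_encode (0, 0))), (0, Ex), (0, Ex), (0, Ex))
      \<in> concept_rules t W"
  | conj_nil: "((0, LS 0), (0, Ex), (0, Ex), (0, Ex))
      \<in> concept_rules t W"
  | conj_cons: "x < W \<Longrightarrow> l < W \<Longrightarrow>
     ((0, LS (Suc (prod_encode (x, l)))), (0, CN x), (0, LS l), (0, LS l))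
      \<in> concept_rules t W"
  | conj: "y < W \<Longrightarrow> l < W \<Longrightarrow> prod_encode (0, Suc (prod_encode (y, l))) \<in> set_decode t \<Longrightarrow>
     ((0, CN y), (0, LS l), (0, LS l), (0, LS l))
      \<in> concept_rules t W"
  | ex_root: "((0, Ex), (0, Root), (0, Root), (0, Root))
      \<in> concept_rules t W"
  | ex_kid: "a < W \<Longrightarrow> r < W \<Longrightarrow> b < W \<Longrightarrow> ex_code a r b \<in> set_decode t \<Longrightarrow>
     ((0, Ex), (0, IsKid (ex_code a r b)), (0, Par (CN a)), (0, Par (CN a)))
      \<in> concept_rules t W"
  | kid_filler: "a < W \<Longrightarrow> r < W \<Longrightarrow> b < W \<Longrightarrow> ex_code a r b \<in> set_decode t \<Longrightarrow>
     ((0, CN b), (0, IsKid (ex_code a r b)), (0, Ex), (0, Ex))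
      \<in> concept_rules t W"
  | all_down: "a < W \<Longrightarrow> r < W \<Longrightarrow> b < W \<Longrightarrow> x < W \<Longrightarrow> s < W \<Longrightarrow> y < W \<Longrightarrow> ex_code a r b \<in> set_decode t \<Longrightarrow> all_code x s y \<in> set_decode t \<Longrightarrow> role_le t r s \<Longrightarrow>
     ((0, CN y), (0, IsKid (ex_code a r b)), (0, Ex), (0, Par (CN x)))
      \<in> concept_rules t W"
  | all_up: "a < W \<Longrightarrow> r < W \<Longrightarrow> b < W \<Longrightarrow> x < W \<Longrightarrow> s < W \<Longrightarrow> y < W \<Longrightarrow> ex_code a r b \<in> set_decode t \<Longrightarrow> all_code x s y \<in> set_decode t \<Longrightarrow> role_le t r (inv_code s) \<Longrightarrow>
     ((0, CN y), (0, Kid (ex_code a r b) (CN x)), (0, Kid (ex_code a r b) (CN x)), (0, Kid (ex_code a r b) (CN x)))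
      \<in> concept_rules t W"
  | all_nbr: "u < W \<Longrightarrow> x < W \<Longrightarrow> s < W \<Longrightarrow> y < W \<Longrightarrow> all_code x s y \<in> set_decode t \<Longrightarrow> role_le t u (inv_code s) \<Longrightarrow>
     ((0, CN y), (0, Nbr (2 ^ u) (CN x)), (0, Nbr (2 ^ u) (CN x)), (0, Nbr (2 ^ u) (CN x)))
      \<in> concept_rules t W"
  | assertion: "A < W \<Longrightarrow>
     ((0, CN (prod_encode (2, A))), (0, CA A), (0, CA A), (0, CA A))
      \<in> concept_rules t W"

text \<open>Two nodes cannot compare their types directly; the rules guess a set \<open>X\<close>
  that contains the type of the child and is contained in that of its rival. Containment is a
  negated existential, which yields the levels: \<open>NSub\<close> on 0, \<open>Sub\<close> and
  \<open>Lacks\<close> on 1, \<open>Has\<close> and \<open>Dom\<close> on 2, \<open>Act\<close> on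
  3. \<open>Has\<close> also demands \<open>Ex\<close>, as otherwise a node outside the chase could
  dominate through the empty set. A sibling dominates only with a smaller code, a properly smaller
  role or a properly larger type, so that no two siblings eliminate each other. In
  \<open>dom_strict\<close> the bound on \<open>X\<close> confines the surplus concept to the codes
  that are compared at all.\<close>

inductive_set select_rules :: "nat \<Rightarrow> nat \<Rightarrow> (nm \<times> nm \<times> nm \<times> nm) set"
  for t W where
    not_sub: "i < W \<Longrightarrow> X < W \<Longrightarrow> x < W \<Longrightarrow> x \<le> t \<Longrightarrow> x \<notin> set_decode X \<Longrightarrow>
     ((0, NSub i X), (0, Kid i (CN x)), (0, Kid i (CN x)), (0, Kid i (CN x)))
      \<in> select_rules t W"
  | dom_nbr: "a < W \<Longrightarrow> r < W \<Longrightarrow> b < W \<Longrightarrow> u < W \<Longrightarrow> X < W \<Longrightarrow> ex_code a r b \<in> set_decode t \<Longrightarrow> role_le t u r \<Longrightarrow>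
     ((2, Dom (ex_code a r b)), (2, Nbr (2 ^ u) (Has X)), (1, Sub (ex_code a r b) X), (1, Sub (ex_code a r b) X))
      \<in> select_rules t W"
  | dom_parent: "a < W \<Longrightarrow> r < W \<Longrightarrow> b < W \<Longrightarrow> a' < W \<Longrightarrow> r' < W \<Longrightarrow> b' < W \<Longrightarrow> X < W \<Longrightarrow> ex_code a r b \<in> set_decode t \<Longrightarrow> ex_code a' r' b' \<in> set_decode t \<Longrightarrow> role_le t (inv_code r') r \<Longrightarrow>
     ((2, Dom (ex_code a r b)), (0, IsKid (ex_code a' r' b')), (2, Par (Has X)), (1, Sub (ex_code a r b) X))
      \<in> select_rules t W"
  | dom_sibling: "a < W \<Longrightarrow> r < W \<Longrightarrow> b < W \<Longrightarrow> a' < W \<Longrightarrow> r' < W \<Longrightarrow> b' < W \<Longrightarrow> X < W \<Longrightarrow> ex_code a r b \<in> set_decode t \<Longrightarrow> ex_code a' r' b' \<in> set_decode t \<Longrightarrow> role_le t r' r \<Longrightarrow> ex_code a' r' b' < ex_code a r b \<or> \<not> role_le t r r' \<Longrightarrow>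
     ((2, Dom (ex_code a r b)), (2, Kid (ex_code a' r' b') (Has X)), (1, Sub (ex_code a r b) X), (1, Sub (ex_code a r b) X))
      \<in> select_rules t W"
  | dom_strict: "a < W \<Longrightarrow> r < W \<Longrightarrow> b < W \<Longrightarrow> a' < W \<Longrightarrow> r' < W \<Longrightarrow> b' < W \<Longrightarrow> X < W \<Longrightarrow> ex_code a r b \<in> set_decode t \<Longrightarrow> ex_code a' r' b' \<in> set_decode t \<Longrightarrow> role_le t r' r \<Longrightarrow> X < 2 ^ Suc t \<Longrightarrow>
     ((2, Dom (ex_code a r b)), (2, Kid (ex_code a' r' b') (Has X)), (1, Sub (ex_code a r b) X), (1, Kid (ex_code a r b) (Lacks X)))
      \<in> select_rules t W"
  | cand: "i < W \<Longrightarrow>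
     ((3, Cand i), (0, IsKid i), (0, Ex), (3, Par Act))
      \<in> select_rules t W"
  | act_root: "((3, Act), (0, Root), (0, Root), (0, Root))
      \<in> select_rules t W"

inductive_set select_neg_rules :: "nat \<Rightarrow> (nm \<times> nm \<times> nm) set"
  for W where
    sub: "i < W \<Longrightarrow> X < W \<Longrightarrow>
     ((1, Sub i X), (0, Tru), (0, NSub i X))
      \<in> select_neg_rules W"
  | lacks: "x < W \<Longrightarrow> X < W \<Longrightarrow> x \<in> set_decode X \<Longrightarrow>
     ((1, Lacks X), (0, Tru), (0, CN x))
      \<in> select_neg_rules W"
  | has: "X < W \<Longrightarrow>
     ((2, Has X), (0, Ex), (1, Lacks X))
      \<in> select_neg_rules W"
  | act: "i < W \<Longrightarrow>
     ((3, Act), (3, Cand i), (2, Par (Dom i)))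
      \<in> select_neg_rules W"

text \<open>The level \<open>n\<close> is a parameter: every formula has a copy on each level,
  positive subformulas stay on the level, and only \<open>formula_neg_rules\<close> steps down.
  Hence the program is stratified whatever the constraints are. In a path formula, direction 1 means
  the converse, for which a sequence is traversed in reverse order. Equality of successors says
  twice that no successor along one expression fails to be reached from the nominal along the other.
  Between roots a conjunction of roles is witnessed by one set \<open>Q\<close> of ABox roles;
  towards a child or the parent the single role of the connecting axiom must lie below all of
  them.\<close>

inductive_set formula_rules :: "nat \<Rightarrow> nat \<Rightarrow> nat \<Rightarrow> (nm \<times> nm \<times> nm \<times> nm) set"
  for t c W where
    nom: "n < W \<Longrightarrow> a < W \<Longrightarrow> 4 \<le> n \<Longrightarrow>
     ((n, FM (sh_code (prod_encode (0, a)))), (0, IND a), (0, IND a), (0, IND a))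
      \<in> formula_rules t c W"
  | name: "n < W \<Longrightarrow> s < W \<Longrightarrow> f < W \<Longrightarrow> 4 \<le> n \<Longrightarrow> prod_encode (s, f) \<in> set_decode c \<Longrightarrow>
     ((n, FM (sh_code (prod_encode (1, s)))), (n, FM (sh_code f)), (n, FM (sh_code f)), (n, FM (sh_code f)))
      \<in> formula_rules t c W"
  | cpt: "n < W \<Longrightarrow> x < W \<Longrightarrow> 4 \<le> n \<Longrightarrow>
     ((n, FM (sh_code (prod_encode (3, x)))), (0, CN x), (0, CN x), (0, CN x))
      \<in> formula_rules t c W"
  | or1: "n < W \<Longrightarrow> f < W \<Longrightarrow> g < W \<Longrightarrow> 4 \<le> n \<Longrightarrow>
     ((n, FM (sh_code (prod_encode (4, prod_encode (f, g))))), (n, FM (sh_code f)), (n, FM (sh_code f)), (n, FM (sh_code f)))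
      \<in> formula_rules t c W"
  | or2: "n < W \<Longrightarrow> f < W \<Longrightarrow> g < W \<Longrightarrow> 4 \<le> n \<Longrightarrow>
     ((n, FM (sh_code (prod_encode (4, prod_encode (f, g))))), (n, FM (sh_code g)), (n, FM (sh_code g)), (n, FM (sh_code g)))
      \<in> formula_rules t c W"
  | conj_shape: "n < W \<Longrightarrow> f < W \<Longrightarrow> g < W \<Longrightarrow> 4 \<le> n \<Longrightarrow>
     ((n, FM (sh_code (prod_encode (5, prod_encode (f, g))))), (n, FM (sh_code f)), (n, FM (sh_code g)), (n, FM (sh_code g)))
      \<in> formula_rules t c W"
  | ex_roles: "n < W \<Longrightarrow> R < W \<Longrightarrow> f < W \<Longrightarrow> 4 \<le> n \<Longrightarrow>
     ((n, FM (sh_code (prod_encode (6, prod_encode (R, f))))), (n, Dia R (sh_code f)), (n, Dia R (sh_code f)), (n, Dia R (sh_code f)))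
      \<in> formula_rules t c W"
  | ex_path: "n < W \<Longrightarrow> e < W \<Longrightarrow> f < W \<Longrightarrow> 4 \<le> n \<Longrightarrow>
     ((n, FM (sh_code (prod_encode (7, prod_encode (e, f))))), (n, FM (path_code 0 e (sh_code f))), (n, FM (path_code 0 e (sh_code f))), (n, FM (path_code 0 e (sh_code f))))
      \<in> formula_rules t c W"
  | eq: "n < W \<Longrightarrow> a < W \<Longrightarrow> e < W \<Longrightarrow> e' < W \<Longrightarrow> 4 \<le> n \<Longrightarrow>
     ((n, FM (sh_code (prod_encode (8, list_encode [a, e, e'])))), (n, FM (sh_code (prod_encode (0, a)))), (n, FM (not_code (path_code 0 e (not_code (path_code 1 e' (sh_code (prod_encode (0, a)))))))), (n, FM (not_code (path_code 0 e' (not_code (path_code 1 e (sh_code (prod_encode (0, a)))))))))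
      \<in> formula_rules t c W"
  | disj: "n < W \<Longrightarrow> a < W \<Longrightarrow> e < W \<Longrightarrow> e' < W \<Longrightarrow> 4 \<le> n \<Longrightarrow>
     ((n, FM (sh_code (prod_encode (9, list_encode [a, e, e'])))), (n, FM (sh_code (prod_encode (0, a)))), (n, FM (not_code (path_code 0 e (path_code 1 e' (sh_code (prod_encode (0, a))))))), (n, FM (not_code (path_code 0 e (path_code 1 e' (sh_code (prod_encode (0, a))))))))
      \<in> formula_rules t c W"
  | path_one: "n < W \<Longrightarrow> d < W \<Longrightarrow> f < W \<Longrightarrow> 4 \<le> n \<Longrightarrow>
     ((n, FM (path_code d (prod_encode (1, 0)) f)), (n, FM f), (n, FM f), (n, FM f))
      \<in> formula_rules t c W"
  | path_role: "n < W \<Longrightarrow> r < W \<Longrightarrow> f < W \<Longrightarrow> 4 \<le> n \<Longrightarrow>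
     ((n, FM (path_code 0 (prod_encode (2, r)) f)), (n, Dia (2 ^ r) f), (n, Dia (2 ^ r) f), (n, Dia (2 ^ r) f))
      \<in> formula_rules t c W"
  | path_back: "n < W \<Longrightarrow> r < W \<Longrightarrow> f < W \<Longrightarrow> 4 \<le> n \<Longrightarrow>
     ((n, FM (path_code 1 (prod_encode (2, r)) f)), (n, Dia (2 ^ inv_code r) f), (n, Dia (2 ^ inv_code r) f), (n, Dia (2 ^ inv_code r) f))
      \<in> formula_rules t c W"
  | path_alt1: "n < W \<Longrightarrow> d < W \<Longrightarrow> e < W \<Longrightarrow> e' < W \<Longrightarrow> f < W \<Longrightarrow> 4 \<le> n \<Longrightarrow>
     ((n, FM (path_code d (prod_encode (3, prod_encode (e, e'))) f)), (n, FM (path_code d e f)), (n, FM (path_code d e f)), (n, FM (path_code d e f)))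
      \<in> formula_rules t c W"
  | path_alt2: "n < W \<Longrightarrow> d < W \<Longrightarrow> e < W \<Longrightarrow> e' < W \<Longrightarrow> f < W \<Longrightarrow> 4 \<le> n \<Longrightarrow>
     ((n, FM (path_code d (prod_encode (3, prod_encode (e, e'))) f)), (n, FM (path_code d e' f)), (n, FM (path_code d e' f)), (n, FM (path_code d e' f)))
      \<in> formula_rules t c W"
  | path_seq: "n < W \<Longrightarrow> e < W \<Longrightarrow> e' < W \<Longrightarrow> f < W \<Longrightarrow> 4 \<le> n \<Longrightarrow>
     ((n, FM (path_code 0 (prod_encode (4, prod_encode (e, e'))) f)), (n, FM (path_code 0 e (path_code 0 e' f))), (n, FM (path_code 0 e (path_code 0 e' f))), (n, FM (path_code 0 e (path_code 0 e' f))))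
      \<in> formula_rules t c W"
  | path_seq_back: "n < W \<Longrightarrow> e < W \<Longrightarrow> e' < W \<Longrightarrow> f < W \<Longrightarrow> 4 \<le> n \<Longrightarrow>
     ((n, FM (path_code 1 (prod_encode (4, prod_encode (e, e'))) f)), (n, FM (path_code 1 e' (path_code 1 e f))), (n, FM (path_code 1 e' (path_code 1 e f))), (n, FM (path_code 1 e' (path_code 1 e f))))
      \<in> formula_rules t c W"
  | path_star0: "n < W \<Longrightarrow> d < W \<Longrightarrow> e < W \<Longrightarrow> f < W \<Longrightarrow> 4 \<le> n \<Longrightarrow>
     ((n, FM (path_code d (prod_encode (5, e)) f)), (n, FM f), (n, FM f), (n, FM f))
      \<in> formula_rules t c W"
  | path_star: "n < W \<Longrightarrow> d < W \<Longrightarrow> e < W \<Longrightarrow> f < W \<Longrightarrow> 4 \<le> n \<Longrightarrow>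
     ((n, FM (path_code d (prod_encode (5, e)) f)), (n, FM (path_code d e (path_code d (prod_encode (5, e)) f))), (n, FM (path_code d e (path_code d (prod_encode (5, e)) f))), (n, FM (path_code d e (path_code d (prod_encode (5, e)) f))))
      \<in> formula_rules t c W"
  | dia_nbr: "n < W \<Longrightarrow> R < W \<Longrightarrow> Q < W \<Longrightarrow> f < W \<Longrightarrow> 4 \<le> n \<Longrightarrow> \<forall>r<R. r \<in> set_decode R \<longrightarrow> (\<exists>u<Q. u \<in> set_decode Q \<and> role_le t u r) \<Longrightarrow>
     ((n, Dia R f), (n, Nbr Q (FM f)), (n, Nbr Q (FM f)), (n, Nbr Q (FM f)))
      \<in> formula_rules t c W"
  | dia_kid: "n < W \<Longrightarrow> R < W \<Longrightarrow> a < W \<Longrightarrow> r < W \<Longrightarrow> b < W \<Longrightarrow> f < W \<Longrightarrow> 4 \<le> n \<Longrightarrow> ex_code a r b \<in> set_decode t \<Longrightarrow> \<forall>s<R. s \<in> set_decode R \<longrightarrow> role_le t r s \<Longrightarrow>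
     ((n, Dia R f), (n, Kid (ex_code a r b) (FM f)), (3, Kid (ex_code a r b) Act), (3, Kid (ex_code a r b) Act))
      \<in> formula_rules t c W"
  | dia_parent: "n < W \<Longrightarrow> R < W \<Longrightarrow> a < W \<Longrightarrow> r < W \<Longrightarrow> b < W \<Longrightarrow> f < W \<Longrightarrow> 4 \<le> n \<Longrightarrow> ex_code a r b \<in> set_decode t \<Longrightarrow> \<forall>s<R. s \<in> set_decode R \<longrightarrow> role_le t (inv_code r) s \<Longrightarrow>
     ((n, Dia R f), (0, IsKid (ex_code a r b)), (n, Par (FM f)), (n, Par (FM f)))
      \<in> formula_rules t c W"
  | dia_all: "n < W \<Longrightarrow> f < W \<Longrightarrow> 4 \<le> n \<Longrightarrow>
     ((n, Dia 0 f), (n, Glo f), (n, Glo f), (n, Glo f))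
      \<in> formula_rules t c W"
  | below: "n < W \<Longrightarrow> f < W \<Longrightarrow> 4 \<le> n \<Longrightarrow>
     ((n, Bel f), (n, FM f), (3, Act), (3, Act))
      \<in> formula_rules t c W"
  | below_kid: "n < W \<Longrightarrow> i < W \<Longrightarrow> f < W \<Longrightarrow> 4 \<le> n \<Longrightarrow>
     ((n, Bel f), (n, Kid i (Bel f)), (n, Kid i (Bel f)), (n, Kid i (Bel f)))
      \<in> formula_rules t c W"
  | global: "n < W \<Longrightarrow> f < W \<Longrightarrow> 4 \<le> n \<Longrightarrow>
     ((n, Glo f), (n, Nbr 0 (Bel f)), (n, Nbr 0 (Bel f)), (n, Nbr 0 (Bel f)))
      \<in> formula_rules t c W"
  | global_kid: "n < W \<Longrightarrow> f < W \<Longrightarrow> 4 \<le> n \<Longrightarrow>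
     ((n, Glo f), (n, Par (Glo f)), (n, Par (Glo f)), (n, Par (Glo f)))
      \<in> formula_rules t c W"

inductive_set formula_neg_rules :: "nat \<Rightarrow> (nm \<times> nm \<times> nm) set"
  for W where
    neg_name: "n < W \<Longrightarrow> s < W \<Longrightarrow> 4 \<le> n \<Longrightarrow>
     ((Suc n, FM (sh_code (prod_encode (2, s)))), (0, Tru), (n, FM (sh_code (prod_encode (1, s)))))
      \<in> formula_neg_rules W"
  | neg: "n < W \<Longrightarrow> f < W \<Longrightarrow> 4 \<le> n \<Longrightarrow>
     ((Suc n, FM (not_code f)), (0, Tru), (n, FM f))
      \<in> formula_neg_rules W"


definition code_pos :: "nm \<times> nm \<times> nm \<times> nm \<Rightarrow> nat" where
  "code_pos = (\<lambda>(h, a, b, c). prod_encode (code_name h, prod_encode (code_name a,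
     prod_encode (code_name b, code_name c))))"
definition code_neg :: "nm \<times> nm \<times> nm \<Rightarrow> nat" where
  "code_neg = (\<lambda>(h, a, b). prod_encode (code_name h, prod_encode (code_name a, code_name b)))"

subsection \<open>Computability of the rules\<close>

lemma mem_if_empty: "x \<in> (if P then A else {}) \<longleftrightarrow> P \<and> x \<in> A"
  by simp

lemma disj_eqI: "P = P' \<Longrightarrow> Q = Q' \<Longrightarrow> (P \<or> Q) = (P' \<or> Q')"
  by simp

lemmas mem_union_simps = Un_iff UN_iff mem_if_empty singleton_iff lessThan_iff

text \<open>The inductive set as a finite union of bounded unions of singletons, the form on which
  the closure properties of computable sets operate.\<close>

lemma concept_rules_eq:
  "concept_rules t W =
    ({((0, CN (prod_encode (0, 0))), (0, Ex), (0, Ex), (0, Ex))}) \<union>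
    (({((0, LS 0), (0, Ex), (0, Ex), (0, Ex))}) \<union>
    ((\<Union>x<W. \<Union>l<W. {((0, LS (Suc (prod_encode (x, l)))), (0, CN x), (0, LS l), (0, LS l))}) \<union>
    ((\<Union>y<W. \<Union>l<W. if prod_encode (0, Suc (prod_encode (y, l))) \<in> set_decode t then {((0, CN y), (0, LS l), (0, LS l), (0, LS l))} else {}) \<union>
    (({((0, Ex), (0, Root), (0, Root), (0, Root))}) \<union>
    ((\<Union>a<W. \<Union>r<W. \<Union>b<W. if ex_code a r b \<in> set_decode t then {((0, Ex), (0, IsKid (ex_code a r b)), (0, Par (CN a)), (0, Par (CN a)))} else {}) \<union>
    ((\<Union>a<W. \<Union>r<W. \<Union>b<W. if ex_code a r b \<in> set_decode t then {((0, CN b), (0, IsKid (ex_code a r b)), (0, Ex), (0, Ex))} else {}) \<union>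
    ((\<Union>a<W. \<Union>r<W. \<Union>b<W. \<Union>x<W. \<Union>s<W. \<Union>y<W. if ex_code a r b \<in> set_decode t \<and> all_code x s y \<in> set_decode t \<and> role_le t r s then {((0, CN y), (0, IsKid (ex_code a r b)), (0, Ex), (0, Par (CN x)))} else {}) \<union>
    ((\<Union>a<W. \<Union>r<W. \<Union>b<W. \<Union>x<W. \<Union>s<W. \<Union>y<W. if ex_code a r b \<in> set_decode t \<and> all_code x s y \<in> set_decode t \<and> role_le t r (inv_code s) then {((0, CN y), (0, Kid (ex_code a r b) (CN x)), (0, Kid (ex_code a r b) (CN x)), (0, Kid (ex_code a r b) (CN x)))} else {}) \<union>
    ((\<Union>u<W. \<Union>x<W. \<Union>s<W. \<Union>y<W. if all_code x s y \<in> set_decode t \<and> role_le t u (inv_code s) then {((0, CN y), (0, Nbr (2 ^ u) (CN x)), (0, Nbr (2 ^ u) (CN x)), (0, Nbr (2 ^ u) (CN x)))} else {}) \<union>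
    ((\<Union>A<W. {((0, CN (prod_encode (2, A))), (0, CA A), (0, CA A), (0, CA A))})))))))))))"
  by (rule set_eqI, simp only: split_paired_all, subst concept_rules.simps, unfold mem_union_simps, intro disj_eqI) (auto, (blast+)?)

lemma select_rules_eq:
  "select_rules t W =
    (\<Union>i<W. \<Union>X<W. \<Union>x<W. if x \<le> t \<and> x \<notin> set_decode X then {((0, NSub i X), (0, Kid i (CN x)), (0, Kid i (CN x)), (0, Kid i (CN x)))} else {}) \<union>
    ((\<Union>a<W. \<Union>r<W. \<Union>b<W. \<Union>u<W. \<Union>X<W. if ex_code a r b \<in> set_decode t \<and> role_le t u r then {((2, Dom (ex_code a r b)), (2, Nbr (2 ^ u) (Has X)), (1, Sub (ex_code a r b) X), (1, Sub (ex_code a r b) X))} else {}) \<union>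
    ((\<Union>a<W. \<Union>r<W. \<Union>b<W. \<Union>a'<W. \<Union>r'<W. \<Union>b'<W. \<Union>X<W. if ex_code a r b \<in> set_decode t \<and> ex_code a' r' b' \<in> set_decode t \<and> role_le t (inv_code r') r then {((2, Dom (ex_code a r b)), (0, IsKid (ex_code a' r' b')), (2, Par (Has X)), (1, Sub (ex_code a r b) X))} else {}) \<union>
    ((\<Union>a<W. \<Union>r<W. \<Union>b<W. \<Union>a'<W. \<Union>r'<W. \<Union>b'<W. \<Union>X<W. if ex_code a r b \<in> set_decode t \<and> ex_code a' r' b' \<in> set_decode t \<and> role_le t r' r \<and> (ex_code a' r' b' < ex_code a r b \<or> \<not> role_le t r r') then {((2, Dom (ex_code a r b)), (2, Kid (ex_code a' r' b') (Has X)), (1, Sub (ex_code a r b) X), (1, Sub (ex_code a r b) X))} else {}) \<union>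
    ((\<Union>a<W. \<Union>r<W. \<Union>b<W. \<Union>a'<W. \<Union>r'<W. \<Union>b'<W. \<Union>X<W. if ex_code a r b \<in> set_decode t \<and> ex_code a' r' b' \<in> set_decode t \<and> role_le t r' r \<and> X < 2 ^ Suc t then {((2, Dom (ex_code a r b)), (2, Kid (ex_code a' r' b') (Has X)), (1, Sub (ex_code a r b) X), (1, Kid (ex_code a r b) (Lacks X)))} else {}) \<union>
    ((\<Union>i<W. {((3, Cand i), (0, IsKid i), (0, Ex), (3, Par Act))}) \<union>
    (({((3, Act), (0, Root), (0, Root), (0, Root))})))))))"
  by (rule set_eqI, simp only: split_paired_all, subst select_rules.simps, unfold mem_union_simps, intro disj_eqI) (auto, (blast+)?)

lemma select_neg_rules_eq:
  "select_neg_rules W =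
    (\<Union>i<W. \<Union>X<W. {((1, Sub i X), (0, Tru), (0, NSub i X))}) \<union>
    ((\<Union>x<W. \<Union>X<W. if x \<in> set_decode X then {((1, Lacks X), (0, Tru), (0, CN x))} else {}) \<union>
    ((\<Union>X<W. {((2, Has X), (0, Ex), (1, Lacks X))}) \<union>
    ((\<Union>i<W. {((3, Act), (3, Cand i), (2, Par (Dom i)))}))))"
  by (rule set_eqI, simp only: split_paired_all, subst select_neg_rules.simps, unfold mem_union_simps, intro disj_eqI) (auto, (blast+)?)

lemma formula_rules_eq:
  "formula_rules t c W =
    (\<Union>n<W. \<Union>a<W. if 4 \<le> n then {((n, FM (sh_code (prod_encode (0, a)))), (0, IND a), (0, IND a), (0, IND a))} else {}) \<union>
    ((\<Union>n<W. \<Union>s<W. \<Union>f<W. if 4 \<le> n \<and> prod_encode (s, f) \<in> set_decode c then {((n, FM (sh_code (prod_encode (1, s)))), (n, FM (sh_code f)), (n, FM (sh_code f)), (n, FM (sh_code f)))} else {}) \<union>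
    ((\<Union>n<W. \<Union>x<W. if 4 \<le> n then {((n, FM (sh_code (prod_encode (3, x)))), (0, CN x), (0, CN x), (0, CN x))} else {}) \<union>
    ((\<Union>n<W. \<Union>f<W. \<Union>g<W. if 4 \<le> n then {((n, FM (sh_code (prod_encode (4, prod_encode (f, g))))), (n, FM (sh_code f)), (n, FM (sh_code f)), (n, FM (sh_code f)))} else {}) \<union>
    ((\<Union>n<W. \<Union>f<W. \<Union>g<W. if 4 \<le> n then {((n, FM (sh_code (prod_encode (4, prod_encode (f, g))))), (n, FM (sh_code g)), (n, FM (sh_code g)), (n, FM (sh_code g)))} else {}) \<union>
    ((\<Union>n<W. \<Union>f<W. \<Union>g<W. if 4 \<le> n then {((n, FM (sh_code (prod_encode (5, prod_encode (f, g))))), (n, FM (sh_code f)), (n, FM (sh_code g)), (n, FM (sh_code g)))} else {}) \<union>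
    ((\<Union>n<W. \<Union>R<W. \<Union>f<W. if 4 \<le> n then {((n, FM (sh_code (prod_encode (6, prod_encode (R, f))))), (n, Dia R (sh_code f)), (n, Dia R (sh_code f)), (n, Dia R (sh_code f)))} else {}) \<union>
    ((\<Union>n<W. \<Union>e<W. \<Union>f<W. if 4 \<le> n then {((n, FM (sh_code (prod_encode (7, prod_encode (e, f))))), (n, FM (path_code 0 e (sh_code f))), (n, FM (path_code 0 e (sh_code f))), (n, FM (path_code 0 e (sh_code f))))} else {}) \<union>
    ((\<Union>n<W. \<Union>a<W. \<Union>e<W. \<Union>e'<W. if 4 \<le> n then {((n, FM (sh_code (prod_encode (8, list_encode [a, e, e'])))), (n, FM (sh_code (prod_encode (0, a)))), (n, FM (not_code (path_code 0 e (not_code (path_code 1 e' (sh_code (prod_encode (0, a)))))))), (n, FM (not_code (path_code 0 e' (not_code (path_code 1 e (sh_code (prod_encode (0, a)))))))))} else {}) \<union>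
    ((\<Union>n<W. \<Union>a<W. \<Union>e<W. \<Union>e'<W. if 4 \<le> n then {((n, FM (sh_code (prod_encode (9, list_encode [a, e, e'])))), (n, FM (sh_code (prod_encode (0, a)))), (n, FM (not_code (path_code 0 e (path_code 1 e' (sh_code (prod_encode (0, a))))))), (n, FM (not_code (path_code 0 e (path_code 1 e' (sh_code (prod_encode (0, a))))))))} else {}) \<union>
    ((\<Union>n<W. \<Union>d<W. \<Union>f<W. if 4 \<le> n then {((n, FM (path_code d (prod_encode (1, 0)) f)), (n, FM f), (n, FM f), (n, FM f))} else {}) \<union>
    ((\<Union>n<W. \<Union>r<W. \<Union>f<W. if 4 \<le> n then {((n, FM (path_code 0 (prod_encode (2, r)) f)), (n, Dia (2 ^ r) f), (n, Dia (2 ^ r) f), (n, Dia (2 ^ r) f))} else {}) \<union>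
    ((\<Union>n<W. \<Union>r<W. \<Union>f<W. if 4 \<le> n then {((n, FM (path_code 1 (prod_encode (2, r)) f)), (n, Dia (2 ^ inv_code r) f), (n, Dia (2 ^ inv_code r) f), (n, Dia (2 ^ inv_code r) f))} else {}) \<union>
    ((\<Union>n<W. \<Union>d<W. \<Union>e<W. \<Union>e'<W. \<Union>f<W. if 4 \<le> n then {((n, FM (path_code d (prod_encode (3, prod_encode (e, e'))) f)), (n, FM (path_code d e f)), (n, FM (path_code d e f)), (n, FM (path_code d e f)))} else {}) \<union>
    ((\<Union>n<W. \<Union>d<W. \<Union>e<W. \<Union>e'<W. \<Union>f<W. if 4 \<le> n then {((n, FM (path_code d (prod_encode (3, prod_encode (e, e'))) f)), (n, FM (path_code d e' f)), (n, FM (path_code d e' f)), (n, FM (path_code d e' f)))} else {}) \<union>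
    ((\<Union>n<W. \<Union>e<W. \<Union>e'<W. \<Union>f<W. if 4 \<le> n then {((n, FM (path_code 0 (prod_encode (4, prod_encode (e, e'))) f)), (n, FM (path_code 0 e (path_code 0 e' f))), (n, FM (path_code 0 e (path_code 0 e' f))), (n, FM (path_code 0 e (path_code 0 e' f))))} else {}) \<union>
    ((\<Union>n<W. \<Union>e<W. \<Union>e'<W. \<Union>f<W. if 4 \<le> n then {((n, FM (path_code 1 (prod_encode (4, prod_encode (e, e'))) f)), (n, FM (path_code 1 e' (path_code 1 e f))), (n, FM (path_code 1 e' (path_code 1 e f))), (n, FM (path_code 1 e' (path_code 1 e f))))} else {}) \<union>
    ((\<Union>n<W. \<Union>d<W. \<Union>e<W. \<Union>f<W. if 4 \<le> n then {((n, FM (path_code d (prod_encode (5, e)) f)), (n, FM f), (n, FM f), (n, FM f))} else {}) \<union>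
    ((\<Union>n<W. \<Union>d<W. \<Union>e<W. \<Union>f<W. if 4 \<le> n then {((n, FM (path_code d (prod_encode (5, e)) f)), (n, FM (path_code d e (path_code d (prod_encode (5, e)) f))), (n, FM (path_code d e (path_code d (prod_encode (5, e)) f))), (n, FM (path_code d e (path_code d (prod_encode (5, e)) f))))} else {}) \<union>
    ((\<Union>n<W. \<Union>R<W. \<Union>Q<W. \<Union>f<W. if 4 \<le> n \<and> (\<forall>r<R. r \<in> set_decode R \<longrightarrow> (\<exists>u<Q. u \<in> set_decode Q \<and> role_le t u r)) then {((n, Dia R f), (n, Nbr Q (FM f)), (n, Nbr Q (FM f)), (n, Nbr Q (FM f)))} else {}) \<union>
    ((\<Union>n<W. \<Union>R<W. \<Union>a<W. \<Union>r<W. \<Union>b<W. \<Union>f<W. if 4 \<le> n \<and> ex_code a r b \<in> set_decode t \<and> (\<forall>s<R. s \<in> set_decode R \<longrightarrow> role_le t r s) then {((n, Dia R f), (n, Kid (ex_code a r b) (FM f)), (3, Kid (ex_code a r b) Act), (3, Kid (ex_code a r b) Act))} else {}) \<union>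
    ((\<Union>n<W. \<Union>R<W. \<Union>a<W. \<Union>r<W. \<Union>b<W. \<Union>f<W. if 4 \<le> n \<and> ex_code a r b \<in> set_decode t \<and> (\<forall>s<R. s \<in> set_decode R \<longrightarrow> role_le t (inv_code r) s) then {((n, Dia R f), (0, IsKid (ex_code a r b)), (n, Par (FM f)), (n, Par (FM f)))} else {}) \<union>
    ((\<Union>n<W. \<Union>f<W. if 4 \<le> n then {((n, Dia 0 f), (n, Glo f), (n, Glo f), (n, Glo f))} else {}) \<union>
    ((\<Union>n<W. \<Union>f<W. if 4 \<le> n then {((n, Bel f), (n, FM f), (3, Act), (3, Act))} else {}) \<union>
    ((\<Union>n<W. \<Union>i<W. \<Union>f<W. if 4 \<le> n then {((n, Bel f), (n, Kid i (Bel f)), (n, Kid i (Bel f)), (n, Kid i (Bel f)))} else {}) \<union>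
    ((\<Union>n<W. \<Union>f<W. if 4 \<le> n then {((n, Glo f), (n, Nbr 0 (Bel f)), (n, Nbr 0 (Bel f)), (n, Nbr 0 (Bel f)))} else {}) \<union>
    ((\<Union>n<W. \<Union>f<W. if 4 \<le> n then {((n, Glo f), (n, Par (Glo f)), (n, Par (Glo f)), (n, Par (Glo f)))} else {})))))))))))))))))))))))))))"
  by (rule set_eqI, simp only: split_paired_all, subst formula_rules.simps, unfold mem_union_simps, intro disj_eqI) (auto, (blast+)?)

lemma formula_neg_rules_eq:
  "formula_neg_rules W =
    (\<Union>n<W. \<Union>s<W. if 4 \<le> n then {((Suc n, FM (sh_code (prod_encode (2, s)))), (0, Tru), (n, FM (sh_code (prod_encode (1, s)))))} else {}) \<union>
    ((\<Union>n<W. \<Union>f<W. if 4 \<le> n then {((Suc n, FM (not_code f)), (0, Tru), (n, FM f))} else {}))"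
  by (rule set_eqI, simp only: split_paired_all, subst formula_neg_rules.simps, unfold mem_union_simps, intro disj_eqI) (auto, (blast+)?)


lemma computable_list_encode:
  "computable n (\<lambda>xs. list_encode [])"
  "computable n f \<Longrightarrow> computable n (\<lambda>xs. list_encode (g xs)) \<Longrightarrow> computable n (\<lambda>xs. list_encode (f xs # g xs))"
  by (auto intro: computable_zero computable_Suc computable_prod_encode)

lemma computable_codes:
  assumes "computable n f" "computable n g" "computable n h"
  shows "computable n (\<lambda>xs. ex_code (f xs) (g xs) (h xs))" "computable n (\<lambda>xs. all_code (f xs) (g xs) (h xs))"
    "computable n (\<lambda>xs. path_code (f xs) (g xs) (h xs))"
  unfolding ex_code_def all_code_def path_code_def
  by (intro computable_prod_encode computable_list_encode computable_const assms)+

lemma computable_codes1: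
  assumes "computable n f"
  shows "computable n (\<lambda>xs. sh_code (f xs))" "computable n (\<lambda>xs. not_code (f xs))" "computable n (\<lambda>xs. inv_code (f xs))"
  unfolding sh_code_def not_code_def inv_code_def
  by (intro computable_prod_encode computable_const computable_diff computable_pfst computable_psnd assms)+

lemma decidable_role_le:
  assumes "computable n f" "computable n g" "computable n h"
  shows "decidable n (\<lambda>xs. role_le (f xs) (g xs) (h xs))"
  unfolding decidable_def
proof (rule computable_comp3[where h = "\<lambda>t r s. of_bool (role_le t r s)", OF _ assms])
  have rc: "decidable 2 (\<lambda>xs. role_closed (xs ! 0) (xs ! 1))"
    unfolding role_closed_def role_incl_code_def
    by (intro decidable_ball decidable_imp decidable_conj decidable_mem computable_prod_encode computable_list_encode
        computable_codes1 computable_const computable_Suc computable_vars) auto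
  have rc': "decidable n (\<lambda>xs. role_closed (f xs) (g xs))" if "computable n f" "computable n g" for n f g
    using computable_comp2[where h = "\<lambda>t X. of_bool (role_closed t X)", OF rc[unfolded decidable_def] that]
    by (simp add: decidable_def)
  show "computable 3 (\<lambda>xs. of_bool (role_le (xs ! 0) (xs ! 1) (xs ! 2)))"
    unfolding role_le_def
    by (intro rc' computable_of_bool decidable_ball decidable_imp decidable_conj decidable_mem computable_prod_encode
        computable_add computable_pow2 computable_const computable_Suc computable_vars) auto
qed

lemmas computable_intros =
  computable_set_Un computable_set_UN computable_set_if computable_set_singleton
  decidable_conj decidable_disj decidable_imp decidable_not decidable_le decidable_less decidable_eq
  decidable_mem decidable_role_le decidable_ball decidable_bex
  computable_codes computable_codes1 computable_list_encode computable_prod_encode computable_Suc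
  computable_pow2 computable_pfst computable_psnd computable_const computable_vars

lemma if_image: "f ` (if P then A else {}) = (if P then f ` A else {})"
  by simp

lemmas code_defs = code_pos_def code_neg_def code_name_def image_Un image_UN if_image image_insert image_empty
  case_prod_conv fst_conv snd_conv code_body.simps

lemma computable_concept_rules:
  "computable_set 3 (\<lambda>xs. code_pos ` concept_rules (xs ! 0) (xs ! 2))"
  unfolding concept_rules_eq code_defs by (intro computable_intros) simp_all

lemma computable_select_rules:
  "computable_set 3 (\<lambda>xs. code_pos ` select_rules (xs ! 0) (xs ! 2))"
  unfolding select_rules_eq code_defs by (intro computable_intros) simp_all

lemma computable_select_neg_rules:
  "computable_set 3 (\<lambda>xs. code_neg ` select_neg_rules (xs ! 2))"
  unfolding select_neg_rules_eq code_defs by (intro computable_intros) simp_all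

lemma computable_formula_rules:
  "computable_set 3 (\<lambda>xs. code_pos ` formula_rules (xs ! 0) (xs ! 1) (xs ! 2))"
  unfolding formula_rules_eq code_defs by (intro computable_intros) simp_all

lemma computable_formula_neg_rules:
  "computable_set 3 (\<lambda>xs. code_neg ` formula_neg_rules (xs ! 2))"
  unfolding formula_neg_rules_eq code_defs by (intro computable_intros) simp_all

text \<open>\<^const>\<open>tree_rules\<close> on the level of codes, the programs being given by codes as well.\<close>

inductive_set tree_codes :: "nat \<Rightarrow> nat \<Rightarrow> nat \<Rightarrow> nat \<Rightarrow> nat \<Rightarrow> nat set" for off M P N O' where
    pos: "\<kappa> < ctx_bound M \<Longrightarrow> q < P \<Longrightarrow> q \<in> set_decode P \<Longrightarrow>
     prod_encode (at_name off \<kappa> (pfst q), prod_encode (5, prod_encode (prod_encode (1, at_name off \<kappa> (pfst (psnd q))), prod_encode (5, prod_encode (prod_encode (1, at_name off \<kappa> (pfst (psnd (psnd q)))), prod_encode (1, at_name off \<kappa> (psnd (psnd (psnd q)))))))))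
      \<in> tree_codes off M P N O'"
  | neg: "\<kappa> < ctx_bound M \<Longrightarrow> q < N \<Longrightarrow> q \<in> set_decode N \<Longrightarrow>
     prod_encode (at_name off \<kappa> (pfst q), prod_encode (5, prod_encode (prod_encode (1, at_name off \<kappa> (pfst (psnd q))), prod_encode (2, at_name off \<kappa> (psnd (psnd q))))))
      \<in> tree_codes off M P N O'"
  | kid: "\<kappa> < ctx_bound M \<Longrightarrow> k < M \<Longrightarrow> t < M \<Longrightarrow> V < 2 ^ M \<Longrightarrow>
     prod_encode (at_name off \<kappa> (kid_name k t), prod_encode (5, prod_encode (prod_encode (1, at_name off (kid_ctx k V) t), prod_encode (1, upto_name off \<kappa> (lev t) V M))))
      \<in> tree_codes off M P N O'"
  | upto_0: "\<kappa> < ctx_bound M \<Longrightarrow> l < M \<Longrightarrow> V < 2 ^ M \<Longrightarrow>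
     prod_encode (upto_name off \<kappa> l V 0, prod_encode (3, prod_encode (0, 0)))
      \<in> tree_codes off M P N O'"
  | upto_pos: "\<kappa> < ctx_bound M \<Longrightarrow> l < M \<Longrightarrow> V < 2 ^ M \<Longrightarrow> m < M \<Longrightarrow> m \<in> set_decode V \<Longrightarrow> lev m \<le> l \<Longrightarrow>
     prod_encode (upto_name off \<kappa> l V (Suc m), prod_encode (5, prod_encode (prod_encode (1, upto_name off \<kappa> l V m), prod_encode (1, at_name off \<kappa> m))))
      \<in> tree_codes off M P N O'"
  | upto_neg: "\<kappa> < ctx_bound M \<Longrightarrow> l < M \<Longrightarrow> V < 2 ^ M \<Longrightarrow> m < M \<Longrightarrow> m \<notin> set_decode V \<Longrightarrow> lev m < l \<Longrightarrow>
     prod_encode (upto_name off \<kappa> l V (Suc m), prod_encode (5, prod_encode (prod_encode (1, upto_name off \<kappa> l V m), prod_encode (2, at_name off \<kappa> m))))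
      \<in> tree_codes off M P N O'"
  | upto_skip: "\<kappa> < ctx_bound M \<Longrightarrow> l < M \<Longrightarrow> V < 2 ^ M \<Longrightarrow> m < M \<Longrightarrow> \<not> (m \<in> set_decode V \<and> lev m \<le> l) \<Longrightarrow> \<not> (m \<notin> set_decode V \<and> lev m < l) \<Longrightarrow>
     prod_encode (upto_name off \<kappa> l V (Suc m), prod_encode (1, upto_name off \<kappa> l V m))
      \<in> tree_codes off M P N O'"
  | parent: "k < M \<Longrightarrow> V < 2 ^ M \<Longrightarrow> t < M \<Longrightarrow> t \<in> set_decode V \<Longrightarrow>
     prod_encode (at_name off (kid_ctx k V) (parent_name t), prod_encode (3, prod_encode (0, 0)))
      \<in> tree_codes off M P N O'"
  | true: "\<kappa> < ctx_bound M \<Longrightarrow>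
     prod_encode (at_name off \<kappa> true_name, prod_encode (3, prod_encode (0, 0)))
      \<in> tree_codes off M P N O'"
  | is_kid: "k < M \<Longrightarrow> V < 2 ^ M \<Longrightarrow>
     prod_encode (at_name off (kid_ctx k V) (is_kid_name k), prod_encode (3, prod_encode (0, 0)))
      \<in> tree_codes off M P N O'"
  | root: "prod_encode (at_name off 0 root_name, prod_encode (3, prod_encode (0, 0)))
      \<in> tree_codes off M P N O'"
  | neighbour: "R < M \<Longrightarrow> t < M \<Longrightarrow> \<forall>x<R. x \<in> set_decode R \<longrightarrow> (\<exists>p<R. x = prod_encode (0, p) \<or> x = prod_encode (1, p)) \<Longrightarrow>
     prod_encode (at_name off 0 (neighbour_name R t), prod_encode (6, prod_encode (R, prod_encode (1, at_name off 0 t))))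
      \<in> tree_codes off M P N O'"
  | concept: "A < M \<Longrightarrow>
     prod_encode (at_name off 0 (concept_name A), prod_encode (3, prod_encode (2, A)))
      \<in> tree_codes off M P N O'"
  | nominal: "a < M \<Longrightarrow>
     prod_encode (at_name off 0 (nominal_name a), prod_encode (0, a))
      \<in> tree_codes off M P N O'"
  | out: "q < O' \<Longrightarrow> q \<in> set_decode O' \<Longrightarrow>
     prod_encode (pfst q, prod_encode (1, at_name off 0 (psnd q)))
      \<in> tree_codes off M P N O'"

lemma tree_codes_eq:
  "tree_codes off M P N O' =
    (\<Union>\<kappa><ctx_bound M. \<Union>q<P. if q \<in> set_decode P then {prod_encode (at_name off \<kappa> (pfst q), prod_encode (5, prod_encode (prod_encode (1, at_name off \<kappa> (pfst (psnd q))), prod_encode (5, prod_encode (prod_encode (1, at_name off \<kappa> (pfst (psnd (psnd q)))), prod_encode (1, at_name off \<kappa> (psnd (psnd (psnd q)))))))))} else {}) \<union>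
    ((\<Union>\<kappa><ctx_bound M. \<Union>q<N. if q \<in> set_decode N then {prod_encode (at_name off \<kappa> (pfst q), prod_encode (5, prod_encode (prod_encode (1, at_name off \<kappa> (pfst (psnd q))), prod_encode (2, at_name off \<kappa> (psnd (psnd q))))))} else {}) \<union>
    ((\<Union>\<kappa><ctx_bound M. \<Union>k<M. \<Union>t<M. \<Union>V<2 ^ M. {prod_encode (at_name off \<kappa> (kid_name k t), prod_encode (5, prod_encode (prod_encode (1, at_name off (kid_ctx k V) t), prod_encode (1, upto_name off \<kappa> (lev t) V M))))}) \<union>
    ((\<Union>\<kappa><ctx_bound M. \<Union>l<M. \<Union>V<2 ^ M. {prod_encode (upto_name off \<kappa> l V 0, prod_encode (3, prod_encode (0, 0)))}) \<union>
    ((\<Union>\<kappa><ctx_bound M. \<Union>l<M. \<Union>V<2 ^ M. \<Union>m<M. if m \<in> set_decode V \<and> lev m \<le> l then {prod_encode (upto_name off \<kappa> l V (Suc m), prod_encode (5, prod_encode (prod_encode (1, upto_name off \<kappa> l V m), prod_encode (1, at_name off \<kappa> m))))} else {}) \<union>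
    ((\<Union>\<kappa><ctx_bound M. \<Union>l<M. \<Union>V<2 ^ M. \<Union>m<M. if m \<notin> set_decode V \<and> lev m < l then {prod_encode (upto_name off \<kappa> l V (Suc m), prod_encode (5, prod_encode (prod_encode (1, upto_name off \<kappa> l V m), prod_encode (2, at_name off \<kappa> m))))} else {}) \<union>
    ((\<Union>\<kappa><ctx_bound M. \<Union>l<M. \<Union>V<2 ^ M. \<Union>m<M. if \<not> (m \<in> set_decode V \<and> lev m \<le> l) \<and> \<not> (m \<notin> set_decode V \<and> lev m < l) then {prod_encode (upto_name off \<kappa> l V (Suc m), prod_encode (1, upto_name off \<kappa> l V m))} else {}) \<union>
    ((\<Union>k<M. \<Union>V<2 ^ M. \<Union>t<M. if t \<in> set_decode V then {prod_encode (at_name off (kid_ctx k V) (parent_name t), prod_encode (3, prod_encode (0, 0)))} else {}) \<union>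
    ((\<Union>\<kappa><ctx_bound M. {prod_encode (at_name off \<kappa> true_name, prod_encode (3, prod_encode (0, 0)))}) \<union>
    ((\<Union>k<M. \<Union>V<2 ^ M. {prod_encode (at_name off (kid_ctx k V) (is_kid_name k), prod_encode (3, prod_encode (0, 0)))}) \<union>
    (({prod_encode (at_name off 0 root_name, prod_encode (3, prod_encode (0, 0)))}) \<union>
    ((\<Union>R<M. \<Union>t<M. if (\<forall>x<R. x \<in> set_decode R \<longrightarrow> (\<exists>p<R. x = prod_encode (0, p) \<or> x = prod_encode (1, p))) then {prod_encode (at_name off 0 (neighbour_name R t), prod_encode (6, prod_encode (R, prod_encode (1, at_name off 0 t))))} else {}) \<union>
    ((\<Union>A<M. {prod_encode (at_name off 0 (concept_name A), prod_encode (3, prod_encode (2, A)))}) \<union>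
    ((\<Union>a<M. {prod_encode (at_name off 0 (nominal_name a), prod_encode (0, a))}) \<union>
    ((\<Union>q<O'. if q \<in> set_decode O' then {prod_encode (pfst q, prod_encode (1, at_name off 0 (psnd q)))} else {})))))))))))))))"
  by (rule set_eqI, subst tree_codes.simps, unfold mem_union_simps, intro disj_eqI) (auto, (blast+)?)

lemma computable_names:
  assumes "computable n off" "computable n f" "computable n g" "computable n h" "computable n k"
  shows "computable n (\<lambda>xs. kid_name (f xs) (g xs))" "computable n (\<lambda>xs. neighbour_name (f xs) (g xs))"
    "computable n (\<lambda>xs. kid_ctx (f xs) (g xs))" "computable n (\<lambda>xs. at_name (off xs) (f xs) (g xs))"
    "computable n (\<lambda>xs. upto_name (off xs) (f xs) (g xs) (h xs) (k xs))"
  unfolding kid_name_def neighbour_name_def kid_ctx_def at_name_def upto_name_def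
  by (intro computable_intros computable_add assms)+

lemma computable_names1:
  assumes "computable n f"
  shows "computable n (\<lambda>xs. parent_name (f xs))" "computable n (\<lambda>xs. is_kid_name (f xs))"
    "computable n (\<lambda>xs. concept_name (f xs))" "computable n (\<lambda>xs. nominal_name (f xs))"
    "computable n (\<lambda>xs. ctx_bound (f xs))"
  unfolding parent_name_def is_kid_name_def concept_name_def nominal_name_def ctx_bound_def
  by (intro computable_intros assms)+

lemma computable_tree_codes:
  "computable_set 5 (\<lambda>xs. tree_codes (xs ! 0) (xs ! 1) (xs ! 2) (xs ! 3) (xs ! 4))"
  unfolding tree_codes_eq
  by (intro computable_names[where off = "\<lambda>_. 0" and h = "\<lambda>_. 0" and k = "\<lambda>_. 0"]
    computable_names(4)[where h = "\<lambda>_. 0" and k = "\<lambda>_. 0"] computable_names(5)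
    computable_names1 computable_intros) simp_all

definition pos_of :: "nat \<Rightarrow> (nat \<times> nat \<times> nat \<times> nat) set" where
  "pos_of P = {(h, a, b, c). prod_encode (h, prod_encode (a, prod_encode (b, c))) \<in> set_decode P}"
definition neg_of :: "nat \<Rightarrow> (nat \<times> nat \<times> nat) set" where
  "neg_of N = {(h, a, b). prod_encode (h, prod_encode (a, b)) \<in> set_decode N}"
definition out_of :: "nat \<Rightarrow> (nat \<times> nat) set" where
  "out_of Q = {(s, h). prod_encode (s, h) \<in> set_decode Q}"

lemma member_less: "x \<in> set_decode n \<Longrightarrow> x < n"
  using less_set_encode[of "set_decode n" x] by simp

lemma code_role_eq [simp]: "code_role r = code_role s \<longleftrightarrow> r = s"
  by (cases r; cases s) (auto simp: prod_encode_eq)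

text \<open>Not every number codes a set of roles. The test is arithmetical, and its bound suffices
  because a role name is at most the code of its role, which lies below the code of the set.\<close>

lemma code_roles_valid:
  "(\<forall>x<R. x \<in> set_decode R \<longrightarrow> (\<exists>p<R. x = prod_encode (0, p) \<or> x = prod_encode (1, p))) \<longleftrightarrow>
   (\<exists>Q. R = code_roles Q)"
proof
  assume *: "\<forall>x<R. x \<in> set_decode R \<longrightarrow> (\<exists>p<R. x = prod_encode (0, p) \<or> x = prod_encode (1, p))"
  have r: "\<exists>r. x = code_role r" if "x \<in> set_decode R" for x
    using * that member_less[OF that] by (metis code_role.simps)
  define Q where "Q = (inv_into UNIV code_role) |`| Abs_fset (set_decode R)"
  have inv: "code_role (inv_into UNIV code_role x) = x" if "x \<in> set_decode R" for x
    using r[OF that] by (auto simp: f_inv_into_f)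
  have "fset (Abs_fset (set_decode R)) = set_decode R" by (simp add: Abs_fset_inverse)
  hence "code_role ` fset Q = (\<lambda>x. x) ` set_decode R"
    unfolding Q_def fimage.rep_eq image_image using inv by (intro image_cong) auto
  hence "R = code_roles Q" by (simp add: code_roles_def)
  thus "\<exists>Q. R = code_roles Q" ..
next
  assume "\<exists>Q. R = code_roles Q"
  then obtain Q where Q: "R = code_roles Q" by blast
  have d: "set_decode R = code_role ` fset Q" by (simp add: Q code_roles_def set_encode_inverse)
  show "\<forall>x<R. x \<in> set_decode R \<longrightarrow> (\<exists>p<R. x = prod_encode (0, p) \<or> x = prod_encode (1, p))"
  proof (intro allI impI)
    fix x assume x: "x < R" "x \<in> set_decode R"
    then obtain r where r: "x = code_role r" using d by auto
    show "\<exists>p<R. x = prod_encode (0, p) \<or> x = prod_encode (1, p)"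
    proof (cases r)
      case (Fwd p)
      thus ?thesis using r x(1) le_prod_encode_2[of p 0] by (intro exI[of _ p]) auto
    next
      case (Inv p)
      thus ?thesis using r x(1) le_prod_encode_2[of p 1] by (intro exI[of _ p]) auto
    qed
  qed
qed

text \<open>This carries computability over from sets of numbers to the constraints
  themselves.\<close>

lemma code_tree_rules:
  "(\<lambda>(s, \<phi>). prod_encode (s, code_shape \<phi>)) ` tree_rules off M (pos_of P) (neg_of N) (out_of Q) =
   tree_codes off M P N Q" (is "?f ` ?R = ?T")
proof (intro set_eqI iffI)
  fix y assume "y \<in> ?f ` ?R"
  then obtain s \<phi> where r: "(s, \<phi>) \<in> ?R" and y: "y = prod_encode (s, code_shape \<phi>)" by auto
  from r show "y \<in> ?T"
  proof cases
    case (pos h a b c \<kappa>)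
    have q: "prod_encode (h, prod_encode (a, prod_encode (b, c))) \<in> set_decode P"
      using pos(3) by (simp add: pos_of_def)
    show ?thesis using tree_codes.pos[OF pos(4) member_less[OF q] q] by (simp add: y pos(1,2))
  next
    case (neg h a b \<kappa>)
    have q: "prod_encode (h, prod_encode (a, b)) \<in> set_decode N"
      using neg(3) by (simp add: neg_of_def)
    show ?thesis using tree_codes.neg[OF neg(4) member_less[OF q] q] by (simp add: y neg(1,2))
  next
    case (neighbour R t)
    thus ?thesis using tree_codes.neighbour[of "code_roles R" M t off P N Q] y code_roles_valid[of "code_roles R"]
      by (auto simp: code_roles_def)
  next
    case (out h)
    have q: "prod_encode (s, h) \<in> set_decode Q" using out(2) by (simp add: out_of_def)
    show ?thesis using tree_codes.out[OF member_less[OF q] q] by (simp add: y out(1))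
  qed (simp_all only: y code_shape.simps code_concept.simps, (rule tree_codes.intros; assumption)+)
next
  fix y assume "y \<in> ?T"
  thus "y \<in> ?f ` ?R"
  proof cases
    case (pos \<kappa> q)
    have "(pfst q, pfst (psnd q), pfst (psnd (psnd q)), psnd (psnd (psnd q))) \<in> pos_of P"
      using pos by (simp add: pos_of_def)
    from tree_rules.pos[OF this pos(2)] show ?thesis by (rule rev_image_eqI) (use pos in simp)
  next
    case (neg \<kappa> q)
    have "(pfst q, pfst (psnd q), psnd (psnd q)) \<in> neg_of N"
      using neg by (simp add: neg_of_def)
    from tree_rules.neg[OF this neg(2)] show ?thesis by (rule rev_image_eqI) (use neg in simp)
  next
    case (kid \<kappa> k t V)
    from tree_rules.kid[OF this(2-)] show ?thesis by (rule rev_image_eqI) (use kid in simp)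
  next
    case (upto_0 \<kappa> l V)
    from tree_rules.upto_0[OF this(2-)] show ?thesis by (rule rev_image_eqI) (use upto_0 in simp)
  next
    case (upto_pos \<kappa> l V m)
    from tree_rules.upto_pos[OF this(2-)] show ?thesis by (rule rev_image_eqI) (use upto_pos in simp)
  next
    case (upto_neg \<kappa> l V m)
    from tree_rules.upto_neg[OF this(2-)] show ?thesis by (rule rev_image_eqI) (use upto_neg in simp)
  next
    case (upto_skip \<kappa> l V m)
    from tree_rules.upto_skip[OF this(2-)] show ?thesis by (rule rev_image_eqI) (use upto_skip in simp)
  next
    case (parent k V t)
    from tree_rules.parent[OF this(2-)] show ?thesis by (rule rev_image_eqI) (use parent in simp)
  next
    case (true \<kappa>)
    from tree_rules.true[OF this(2-)] show ?thesis by (rule rev_image_eqI) (use true in simp)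
  next
    case (is_kid k V)
    from tree_rules.is_kid[OF this(2-)] show ?thesis by (rule rev_image_eqI) (use is_kid in simp)
  next
    case root
    from tree_rules.root show ?thesis by (rule rev_image_eqI) (use root in simp)
  next
    case (neighbour R t)
    then obtain S where S: "R = code_roles S" using code_roles_valid by blast
    from tree_rules.neighbour[OF neighbour(2,3)[unfolded S]] show ?thesis
      by (rule rev_image_eqI) (use neighbour S in \<open>simp add: code_roles_def\<close>)
  next
    case (concept A)
    from tree_rules.concept[OF this(2-)] show ?thesis by (rule rev_image_eqI) (use concept in simp)
  next
    case (nominal a)
    from tree_rules.nominal[OF this(2-)] show ?thesis by (rule rev_image_eqI) (use nominal in simp)
  next
    case (out q)
    have "(pfst q, psnd q) \<in> out_of Q" using out by (simp add: out_of_def)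
    from tree_rules.out[OF this] show ?thesis by (rule rev_image_eqI) (use out in simp)
  qed
qed

subsection \<open>Bounds\<close>

text \<open>Bounds every term built from numbers up to \<open>y\<close> with at most
  \<open>i\<close> nested pairings. For positive \<open>y\<close> a successor costs no more than one
  pairing.\<close>

definition grow :: "nat \<Rightarrow> nat \<Rightarrow> nat" where "grow i y = ((\<lambda>z. prod_encode (z, z)) ^^ i) y"

lemma grow_Suc: "grow (Suc i) y = prod_encode (grow i y, grow i y)"
  by (simp add: grow_def)

lemma grow_mono: "i \<le> j \<Longrightarrow> grow i y \<le> grow j y"
proof (rule lift_Suc_mono_le[of "\<lambda>i. grow i y"])
  show "grow i y \<le> grow (Suc i) y" for i unfolding grow_Suc by (rule le_prod_encode_1)
qed

lemma grow_ge: "y \<le> grow i y"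
  using grow_mono[of 0 i y] by (simp add: grow_def)

lemma grow_pair: "a \<le> grow i y \<Longrightarrow> b \<le> grow i y \<Longrightarrow> prod_encode (a, b) \<le> grow (Suc i) y"
  unfolding grow_Suc by (rule prod_encode_mono)

lemma grow_Suc_le: "a \<le> grow i y \<Longrightarrow> 0 < y \<Longrightarrow> Suc a \<le> grow (Suc i) y"
proof -
  assume a: "a \<le> grow i y" "0 < y"
  have y: "0 < grow i y" using grow_ge[of y i] a(2) by linarith
  have "n \<le> triangle n" for n by (induction n) auto
  from this[of "grow i y + grow i y"]
  have "Suc (grow i y) \<le> grow (Suc i) y" using y by (simp add: grow_Suc prod_encode_def)
  thus ?thesis using a(1) by linarith
qed

text \<open>Covers the leaves of all names in the rules: parameters below \<open>W\<close>, tags and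
  levels up to 30, and the singleton codes \<open>2 ^ x\<close> and \<open>2 ^ inv_code x\<close> of
  roles, where inverting a role gives at most \<open>prod_encode (1, W)\<close>. In
  \<open>name_bound\<close> the number 60 exceeds the nesting of pairings and successors in any such
  name.\<close>

definition name_base :: "nat \<Rightarrow> nat" where
  "name_base W = 2 ^ Suc (prod_encode (1, W)) + W + 30"
definition name_bound :: "nat \<Rightarrow> nat" where
  "name_bound W = Suc (grow 60 (name_base W))"
text \<open>The power of two exceeds the codes of the role sets in question and of the sets of
  concept codes up to \<open>t\<close>. A formula nests at most \<open>c + 10\<close> deep and each
  layer costs at most three pairings, which \<open>8 * c + 60\<close> leaves room for.\<close>

definition param_bound :: "nat \<Rightarrow> nat \<Rightarrow> nat" where
  "param_bound t c = Suc (grow (8 * c + 60) (2 ^ Suc (Suc (prod_encode (1, t + c) + t + c)) + 30))"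

lemma small_pair:
  "0 < i \<Longrightarrow> a \<le> grow (i - 1) y \<Longrightarrow> b \<le> grow (i - 1) y \<Longrightarrow> prod_encode (a, b) \<le> grow i y"
  using grow_pair[of a "i - 1" y b] by simp

lemma small_Suc: "0 < i \<Longrightarrow> a \<le> grow (i - 1) (name_base W) \<Longrightarrow> Suc a \<le> grow i (name_base W)"
  using grow_Suc_le[of a "i - 1" "name_base W"] by (simp add: name_base_def)

lemma inv_code_le: "r \<le> W \<Longrightarrow> inv_code r \<le> prod_encode (1, W)"
  unfolding inv_code_def by (rule prod_encode_mono) (use psnd_le[of r] in auto)

lemma small_leaf:
  "x < W \<Longrightarrow> x \<le> grow i (name_base W)"
  "x \<le> 30 \<Longrightarrow> x \<le> grow i (name_base W)"
  "x < W \<Longrightarrow> 2 ^ x \<le> grow i (name_base W)"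
  "x < W \<Longrightarrow> 2 ^ inv_code x \<le> grow i (name_base W)"
proof -
  have g: "name_base W \<le> grow i (name_base W)" by (rule grow_ge)
  show "x < W \<Longrightarrow> x \<le> grow i (name_base W)" "x \<le> 30 \<Longrightarrow> x \<le> grow i (name_base W)"
    using g by (auto simp: name_base_def)
  show "2 ^ x \<le> grow i (name_base W)" if "x < W"
  proof -
    have "x \<le> Suc (prod_encode (1, W))" using that le_prod_encode_2[of W 1] by linarith
    hence "(2::nat) ^ x \<le> 2 ^ Suc (prod_encode (1, W))" by (intro power_increasing) auto
    thus ?thesis using g unfolding name_base_def by linarith
  qed
  show "2 ^ inv_code x \<le> grow i (name_base W)" if "x < W"
  proof -
    have "inv_code x \<le> Suc (prod_encode (1, W))" using inv_code_le[of x W] that by linarith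
    hence "(2::nat) ^ inv_code x \<le> 2 ^ Suc (prod_encode (1, W))" by (intro power_increasing) auto
    thus ?thesis using g unfolding name_base_def by linarith
  qed
qed

lemma code_pair_less: "code_name (l, b) < name_bound W \<longleftrightarrow> prod_encode (l, code_body b) \<le> grow 60 (name_base W)"
  by (simp add: code_name_def name_bound_def less_Suc_eq_le)

lemmas small_defs = code_pair_less code_body.simps ex_code_def all_code_def sh_code_def path_code_def
  not_code_def list_encode.simps

text \<open>Together with its four companions this provides the side conditions of
  \<open>local_program\<close>. Each pairing or successor uses up one iteration of
  \<open>grow\<close>, until a leaf is reached.\<close>

lemma concept_rules_small:
  "(h, a, b, c) \<in> concept_rules t W \<Longrightarrow> code_name h < name_bound W \<and> code_name a < name_bound W \<and>
     code_name b < name_bound W \<and> code_name c < name_bound W \<and>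
     fst a \<le> fst h \<and> fst b \<le> fst h \<and> fst c \<le> fst h"
  by (cases h; cases a; cases b; cases c; simp only:; erule concept_rules.cases)
    (simp_all only: small_defs fst_conv order_refl simp_thms,
     (intro conjI small_pair small_Suc; (rule small_leaf; simp; fail | simp))+)

lemma select_rules_small:
  "(h, a, b, c) \<in> select_rules t W \<Longrightarrow> code_name h < name_bound W \<and> code_name a < name_bound W \<and>
     code_name b < name_bound W \<and> code_name c < name_bound W \<and>
     fst a \<le> fst h \<and> fst b \<le> fst h \<and> fst c \<le> fst h"
  by (cases h; cases a; cases b; cases c; simp only:; erule select_rules.cases)
    (simp_all only: small_defs fst_conv order_refl simp_thms,
     (intro conjI small_pair small_Suc; (rule small_leaf; simp; fail | simp))+)

lemma formula_rules_small:
  "(h, a, b, d) \<in> formula_rules t c W \<Longrightarrow> code_name h < name_bound W \<and> code_name a < name_bound W \<and>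
     code_name b < name_bound W \<and> code_name d < name_bound W \<and>
     fst a \<le> fst h \<and> fst b \<le> fst h \<and> fst d \<le> fst h"
  by (cases h; cases a; cases b; cases d; simp only:; erule formula_rules.cases)
    (simp_all only: small_defs fst_conv order_refl simp_thms,
     (intro conjI small_pair small_Suc; (rule small_leaf; simp; fail | simp))+)

lemma select_neg_rules_small:
  "(h, a, b) \<in> select_neg_rules W \<Longrightarrow> code_name h < name_bound W \<and> code_name a < name_bound W \<and>
     code_name b < name_bound W \<and> fst a \<le> fst h \<and> fst b < fst h"
  by (cases h; cases a; cases b; simp only:; erule select_neg_rules.cases)
    (simp_all only: small_defs fst_conv order_refl simp_thms,
     (intro conjI small_pair small_Suc; (rule small_leaf; simp; fail | simp))+)

lemma formula_neg_rules_small: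
  "(h, a, b) \<in> formula_neg_rules W \<Longrightarrow> code_name h < name_bound W \<and> code_name a < name_bound W \<and>
     code_name b < name_bound W \<and> fst a \<le> fst h \<and> fst b < fst h"
  by (cases h; cases a; cases b; simp only:; erule formula_neg_rules.cases)
    (simp_all only: small_defs fst_conv order_refl simp_thms,
     (intro conjI small_pair small_Suc; (rule small_leaf; simp; fail | simp))+)

subsection \<open>The rewriting function\<close>

definition pos_rules :: "nat \<Rightarrow> nat \<Rightarrow> nat \<Rightarrow> (nm \<times> nm \<times> nm \<times> nm) set" where
  "pos_rules t c W = concept_rules t W \<union> (select_rules t W \<union> formula_rules t c W)"
definition neg_rules :: "nat \<Rightarrow> (nm \<times> nm \<times> nm) set" where
  "neg_rules W = select_neg_rules W \<union> formula_neg_rules W"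

definition pos_code :: "nat \<Rightarrow> nat \<Rightarrow> nat \<Rightarrow> nat" where
  "pos_code t c W = set_encode (code_pos ` pos_rules t c W)"
definition neg_code :: "nat \<Rightarrow> nat" where
  "neg_code W = set_encode (code_neg ` neg_rules W)"

text \<open>At level \<open>c + 10\<close> the alternation of negations has become stationary.\<close>

definition out_name :: "nat \<Rightarrow> nat \<Rightarrow> nm" where
  "out_name c s = (c + 10, FM (sh_code (prod_encode (1, s))))"
definition out_code :: "nat \<Rightarrow> nat" where
  "out_code c = set_encode (\<Union>s<c. {prod_encode (s, code_name (out_name c s))})"

text \<open>Every shape name of the constraints is smaller than their code \<open>c\<close>, so
  \<open>c\<close> serves as the offset that separates these names from the auxiliary ones.\<close>

definition rewriting_code :: "nat \<Rightarrow> nat \<Rightarrow> nat" where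
  "rewriting_code t c = set_encode (tree_codes c (name_bound (param_bound t c))
     (pos_code t c (param_bound t c)) (neg_code (param_bound t c)) (out_code c))"

lemma computable_grow: "computable n f \<Longrightarrow> computable n g \<Longrightarrow> computable n (\<lambda>xs. grow (f xs) (g xs))"
  unfolding grow_def by (intro computable_funpow[where h = "\<lambda>z. prod_encode (z, z)"] computable_intros) auto

lemma computable_param_bound:
  "computable n f \<Longrightarrow> computable n g \<Longrightarrow> computable n (\<lambda>xs. param_bound (f xs) (g xs))"
  unfolding param_bound_def by (intro computable_grow computable_add computable_mult computable_intros)

lemma computable_name_bound: "computable n f \<Longrightarrow> computable n (\<lambda>xs. name_bound (f xs))"
  unfolding name_bound_def name_base_def by (intro computable_grow computable_add computable_mult computable_intros)

lemma computable_out_code: "computable 2 (\<lambda>xs. out_code (xs ! 1))"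
proof -
  have "computable_set 2 (\<lambda>xs. \<Union>s<xs ! 1. {prod_encode (s, code_name (out_name (xs ! 1) s))})"
    unfolding out_name_def code_name_def fst_conv snd_conv code_body.simps
    by (intro computable_intros computable_add) simp_all
  thus ?thesis unfolding out_code_def by (rule computable_set_encode)
qed

lemma computable_rules_code:
  "computable 2 (\<lambda>xs. pos_code (xs ! 0) (xs ! 1) (param_bound (xs ! 0) (xs ! 1)))"
  "computable 2 (\<lambda>xs. neg_code (param_bound (xs ! 0) (xs ! 1)))"
proof -
  have W: "computable 2 (\<lambda>xs. param_bound (xs ! 0) (xs ! 1))"
    by (intro computable_param_bound computable_nth) simp_all
  have "computable_set 3 (\<lambda>xs. code_pos ` pos_rules (xs ! 0) (xs ! 1) (xs ! 2))"
    unfolding pos_rules_def image_Un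
    by (intro computable_set_Un computable_concept_rules computable_select_rules computable_formula_rules)
  from computable_set_encode[OF this]
  have "computable 3 (\<lambda>xs. pos_code (xs ! 0) (xs ! 1) (xs ! 2))" unfolding pos_code_def .
  from computable_comp3[where h = pos_code, OF this computable_nth computable_nth W, of 0 1]
  show "computable 2 (\<lambda>xs. pos_code (xs ! 0) (xs ! 1) (param_bound (xs ! 0) (xs ! 1)))" by simp
  have "computable_set 3 (\<lambda>xs. code_neg ` neg_rules (xs ! 2))"
    unfolding neg_rules_def image_Un
    by (intro computable_set_Un computable_select_neg_rules computable_formula_neg_rules)
  from computable_set_encode[OF this]
  have "computable 3 (\<lambda>xs. neg_code (xs ! 2))" unfolding neg_code_def .
  from computable_comp3[where h = "\<lambda>_ _. neg_code", OF this computable_nth computable_nth W, of 0 1]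
  show "computable 2 (\<lambda>xs. neg_code (param_bound (xs ! 0) (xs ! 1)))" by simp
qed

lemma computable_rewriting_code: "computable 2 (\<lambda>xs. rewriting_code (xs ! 0) (xs ! 1))"
proof -
  have W: "computable 2 (\<lambda>xs. param_bound (xs ! 0) (xs ! 1))"
    by (intro computable_param_bound computable_nth) simp_all
  let ?gs = "[\<lambda>xs. xs ! 1, \<lambda>xs. name_bound (param_bound (xs ! 0) (xs ! 1)),
    \<lambda>xs. pos_code (xs ! 0) (xs ! 1) (param_bound (xs ! 0) (xs ! 1)),
    \<lambda>xs. neg_code (param_bound (xs ! 0) (xs ! 1)), \<lambda>xs. out_code (xs ! 1)] :: (nat list \<Rightarrow> nat) list"
  have len: "length ?gs = 5" by simp
  have "computable (length ?gs) (\<lambda>xs. set_encode (tree_codes (xs ! 0) (xs ! 1) (xs ! 2) (xs ! 3) (xs ! 4)))"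
    unfolding len by (rule computable_set_encode[OF computable_tree_codes])
  moreover have "computable 2 g" if "g \<in> set ?gs" for g
    using that computable_rules_code computable_out_code computable_name_bound[OF W] computable_nth[of 1 2] by auto
  ultimately have "computable 2 (\<lambda>xs. (\<lambda>xs. set_encode (tree_codes (xs ! 0) (xs ! 1) (xs ! 2) (xs ! 3) (xs ! 4)))
      (map (\<lambda>g. g xs) ?gs))"
    by (rule computable_compose)
  thus ?thesis by (simp add: rewriting_code_def numeral_2_eq_2 numeral_3_eq_3 numeral_eq_Suc)
qed

subsection \<open>Injectivity of the codes\<close>

lemma code_concept_eq [simp]: "code_concept A = code_concept B \<longleftrightarrow> A = B"
  by (cases A; cases B) (auto simp: prod_encode_eq)

lemma code_rexp_eq [simp]: "code_rexp E = code_rexp F \<longleftrightarrow> E = F"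
proof (induction E arbitrary: F)
qed (case_tac F; simp add: prod_encode_eq)+

lemma code_roles_eq [simp]: "code_roles Q = code_roles R \<longleftrightarrow> Q = R"
proof -
  have "inj code_role" by (simp add: inj_def)
  thus ?thesis by (simp add: code_roles_def set_encode_eq inj_image_eq_iff fset_inject)
qed

lemma code_shape_ExRoles: "code_shape (ExRoles R \<phi>) = prod_encode (6, prod_encode (code_roles R, code_shape \<phi>))"
  by (simp add: code_roles_def)

lemma code_shape_eq [simp]: "code_shape \<phi> = code_shape \<psi> \<longleftrightarrow> \<phi> = \<psi>"
proof (induction \<phi> arbitrary: \<psi>)
qed (case_tac \<psi>; simp add: prod_encode_eq list_encode_eq flip: code_roles_def)+

lemma code_axiom_eq [simp]: "code_axiom \<alpha> = code_axiom \<beta> \<longleftrightarrow> \<alpha> = \<beta>"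
proof -
  have "inj code_concept" by (simp add: inj_def)
  hence "map code_concept As = map code_concept Bs \<longleftrightarrow> As = Bs" for As Bs by (rule inj_map_eq_map)
  thus ?thesis by (cases \<alpha>; cases \<beta>) (auto simp: prod_encode_eq list_encode_eq)
qed

lemma mem_code_tbox: "finite T \<Longrightarrow> x \<in> set_decode (code_tbox T) \<longleftrightarrow> (\<exists>\<alpha>\<in>T. x = code_axiom \<alpha>)"
  by (auto simp: code_tbox_def set_encode_inverse)

lemma mem_code_constraints:
  "finite C \<Longrightarrow> prod_encode (s, x) \<in> set_decode (code_constraints C) \<longleftrightarrow> (\<exists>\<phi>. (s, \<phi>) \<in> C \<and> x = code_shape \<phi>)"
  by (force simp: code_constraints_def set_encode_inverse prod_encode_eq)

subsection \<open>Satisfied names\<close>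

text \<open>The literals \<open>Kid\<close>, \<open>Par\<close>, \<open>Nbr\<close> and the facts are evaluated, given the other names.\<close>

fun lit :: "interp \<Rightarrow> nat \<Rightarrow> (obj \<Rightarrow> nat list \<Rightarrow> nm \<Rightarrow> bool) \<Rightarrow> obj \<Rightarrow> nat list \<Rightarrow> nm \<Rightarrow> bool" where
  "lit I M S x p (l, Kid k b) \<longleftrightarrow> S x (k # p) (l, b)"
| "lit I M S x p (l, Par b) \<longleftrightarrow> (\<exists>k q. p = k # q \<and> S x q (l, b))"
| "lit I M S x p (l, Nbr R b) \<longleftrightarrow> p = [] \<and> (\<exists>Q y. R = code_roles Q \<and> R < M \<and>
     (\<forall>r. r |\<in>| Q \<longrightarrow> (x, y) \<in> role_ext I r) \<and> S y [] (l, b))"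
| "lit I M S x p (l, Tru) \<longleftrightarrow> l = 0"
| "lit I M S x p (l, Root) \<longleftrightarrow> l = 0 \<and> p = []"
| "lit I M S x p (l, IsKid k) \<longleftrightarrow> l = 0 \<and> (\<exists>q. p = k # q)"
| "lit I M S x p (l, CA A) \<longleftrightarrow> l = 0 \<and> p = [] \<and> A < M \<and> x \<in> cext I A"
| "lit I M S x p (l, IND a) \<longleftrightarrow> l = 0 \<and> p = [] \<and> a < M \<and> x = Ind a"
| "lit I M S x p n \<longleftrightarrow> S x p n"

text \<open>The names that rules of the program derive. All others have a meaning fixed by the
  tree.\<close>

fun basic :: "nm \<Rightarrow> bool" where
  "basic (l, Kid k b) = False"
| "basic (l, Par b) = False"
| "basic (l, Nbr R b) = False"
| "basic (l, Tru) = False"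
| "basic (l, Root) = False"
| "basic (l, IsKid k) = False"
| "basic (l, CA A) = False"
| "basic (l, IND a) = False"
| "basic n = True"

lemma lit_basic: "basic n \<Longrightarrow> lit I M S x p n \<longleftrightarrow> S x p n"
  by (cases n rule: basic.cases) auto

lemma code_name_combinators:
  "code_name (l, Kid k b) = kid_name k (code_name (l, b))"
  "code_name (l, Par b) = parent_name (code_name (l, b))"
  "code_name (l, Nbr R b) = neighbour_name R (code_name (l, b))"
  "code_name (0, Tru) = true_name" "code_name (0, Root) = root_name"
  "code_name (0, IsKid k) = is_kid_name k" "code_name (0, CA A) = concept_name A"
  "code_name (0, IND a) = nominal_name a"
  by (simp_all add: code_name_def kid_name_def parent_name_def neighbour_name_def true_name_def root_name_def
      is_kid_name_def concept_name_def nominal_name_def)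

text \<open>A code made by a combinator belongs to a structured name with the same combinator, so
  the rules for trees never produce a basic name.\<close>

lemma combinator_names:
  "kid_name k t = code_name n \<longleftrightarrow> (\<exists>l b. n = (l, Kid k b) \<and> t = code_name (l, b))"
  "parent_name t = code_name n \<longleftrightarrow> (\<exists>l b. n = (l, Par b) \<and> t = code_name (l, b))"
  "neighbour_name R t = code_name n \<longleftrightarrow> (\<exists>l b. n = (l, Nbr R b) \<and> t = code_name (l, b))"
  "true_name = code_name n \<longleftrightarrow> n = (0, Tru)" "root_name = code_name n \<longleftrightarrow> n = (0, Root)"
  "is_kid_name k = code_name n \<longleftrightarrow> n = (0, IsKid k)" "concept_name A = code_name n \<longleftrightarrow> n = (0, CA A)"
  "nominal_name a = code_name n \<longleftrightarrow> n = (0, IND a)"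
proof -
  have t: "t = prod_encode (lev t, psnd t)" by simp
  show "kid_name k t = code_name n \<longleftrightarrow> (\<exists>l b. n = (l, Kid k b) \<and> t = code_name (l, b))"
    by (cases n, subst (2) t, cases "snd n") (auto simp: code_name_def kid_name_def prod_encode_eq simp del: prod_encode_pfst_psnd)
  show "parent_name t = code_name n \<longleftrightarrow> (\<exists>l b. n = (l, Par b) \<and> t = code_name (l, b))"
    by (cases n, subst (2) t, cases "snd n") (auto simp: code_name_def parent_name_def prod_encode_eq simp del: prod_encode_pfst_psnd)
  show "neighbour_name R t = code_name n \<longleftrightarrow> (\<exists>l b. n = (l, Nbr R b) \<and> t = code_name (l, b))"
    by (cases n, subst (2) t, cases "snd n") (auto simp: code_name_def neighbour_name_def prod_encode_eq simp del: prod_encode_pfst_psnd)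
qed (simp_all flip: code_name_combinators add: eq_commute)

lemma rule_heads_basic:
  "(h, a, b, d) \<in> pos_rules t c W \<Longrightarrow> basic h" "(h, a, b) \<in> neg_rules W \<Longrightarrow> basic h"
proof -
  show "(h, a, b, d) \<in> pos_rules t c W \<Longrightarrow> basic h"
    by (cases h; cases a; cases b; cases d)
       (auto simp: pos_rules_def elim: concept_rules.cases select_rules.cases formula_rules.cases)
  show "(h, a, b) \<in> neg_rules W \<Longrightarrow> basic h"
    by (cases h; cases a; cases b) (auto simp: neg_rules_def elim: select_neg_rules.cases formula_neg_rules.cases)
qed

lemma pos_rules_small:
  "(h, a, b, d) \<in> pos_rules t c W \<Longrightarrow> code_name h < name_bound W \<and> code_name a < name_bound W \<and>
     code_name b < name_bound W \<and> code_name d < name_bound W \<and> fst a \<le> fst h \<and> fst b \<le> fst h \<and> fst d \<le> fst h"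
  unfolding pos_rules_def using concept_rules_small select_rules_small formula_rules_small by blast

lemma neg_rules_small:
  "(h, a, b) \<in> neg_rules W \<Longrightarrow> code_name h < name_bound W \<and> code_name a < name_bound W \<and>
     code_name b < name_bound W \<and> fst a \<le> fst h \<and> fst b < fst h"
  unfolding neg_rules_def using select_neg_rules_small formula_neg_rules_small by blast

lemma lev_code_name [simp]: "lev (code_name n) = fst n"
  by (simp add: code_name_def)

lemma less_param_bound: "x \<le> 2 ^ Suc (Suc (prod_encode (1, t + c) + t + c)) + 30 \<Longrightarrow> x < param_bound t c"
  unfolding param_bound_def using grow_ge by (meson le_trans less_Suc_eq_le)

lemma finite_pos_rules: "finite (code_pos ` pos_rules t c W)"
  using computable_concept_rules computable_select_rules computable_formula_rules
  unfolding computable_set_def pos_rules_def image_Un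
  by (metis (no_types, lifting) finite_UnI nth_Cons_0 nth_Cons_Suc numeral_2_eq_2 One_nat_def)

lemma finite_neg_rules: "finite (code_neg ` neg_rules W)"
  using computable_select_neg_rules computable_formula_neg_rules
  unfolding computable_set_def neg_rules_def image_Un
  by (metis (no_types, lifting) finite_UnI nth_Cons_0 nth_Cons_Suc numeral_2_eq_2)

lemma mem_pos_of_code:
  "(h, a, b, d) \<in> pos_of (pos_code t c W) \<longleftrightarrow> (\<exists>h' a' b' d'. (h', a', b', d') \<in> pos_rules t c W \<and>
     h = code_name h' \<and> a = code_name a' \<and> b = code_name b' \<and> d = code_name d')"
proof -
  have "(h, a, b, d) \<in> pos_of (pos_code t c W) \<longleftrightarrow>
      prod_encode (h, prod_encode (a, prod_encode (b, d))) \<in> code_pos ` pos_rules t c W"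
    by (simp add: pos_of_def pos_code_def set_encode_inverse finite_pos_rules)
  also have "\<dots> \<longleftrightarrow> (\<exists>h' a' b' d'. (h', a', b', d') \<in> pos_rules t c W \<and>
     prod_encode (h, prod_encode (a, prod_encode (b, d))) = code_pos (h', a', b', d'))"
    unfolding image_iff Bex_def by (metis prod_cases4)
  finally show ?thesis by (simp add: code_pos_def prod_encode_eq)
qed

lemma mem_neg_of_code:
  "(h, a, b) \<in> neg_of (neg_code W) \<longleftrightarrow> (\<exists>h' a' b'. (h', a', b') \<in> neg_rules W \<and>
     h = code_name h' \<and> a = code_name a' \<and> b = code_name b')"
proof -
  have "(h, a, b) \<in> neg_of (neg_code W) \<longleftrightarrow>
      prod_encode (h, prod_encode (a, b)) \<in> code_neg ` neg_rules W"
    by (simp add: neg_of_def neg_code_def set_encode_inverse finite_neg_rules)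
  also have "\<dots> \<longleftrightarrow> (\<exists>h' a' b'. (h', a', b') \<in> neg_rules W \<and>
     prod_encode (h, prod_encode (a, b)) = code_neg (h', a', b'))"
    unfolding image_iff Bex_def by (metis prod_cases3)
  finally show ?thesis by (simp add: code_neg_def prod_encode_eq)
qed

lemma mem_out_of_code: "(s, h) \<in> out_of (out_code c) \<longleftrightarrow> s < c \<and> h = code_name (out_name c s)"
  unfolding out_of_def out_code_def by (auto simp: set_encode_inverse prod_encode_eq)

section \<open>The rewriting of a fixed TBox and set of constraints\<close>

locale rewriting =
  fixes T :: tbox and C :: "shape_constraint set"
  assumes finite_T: "finite T" and finite_C: "finite C"
begin

definition t :: nat where "t = code_tbox T"
definition c :: nat where "c = code_constraints C"
definition W :: nat where "W = param_bound t c"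
definition M :: nat where "M = name_bound W"

lemma W_bounds: "t < W" "c < W" "c + 10 < W" "30 < W"
  "x \<le> 2 ^ Suc (Suc (prod_encode (1, t + c) + t + c)) \<Longrightarrow> x < W"
proof -
  have "t + c \<le> Suc (Suc (prod_encode (1, t + c) + t + c))" by simp
  also have "\<dots> < 2 ^ Suc (Suc (prod_encode (1, t + c) + t + c))" by (rule less_exp)
  finally show "t < W" "c < W" "c + 10 < W" "30 < W"
    "x \<le> 2 ^ Suc (Suc (prod_encode (1, t + c) + t + c)) \<Longrightarrow> x < W"
    unfolding W_def by (auto intro!: less_param_bound)
qed

lemma W_le_M: "W \<le> M"
  using small_leaf(1)[of "W - 1" W 60] W_bounds by (simp add: M_def name_bound_def)

lemma out_name_small: "s < c \<Longrightarrow> code_name (out_name c s) < M"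
proof -
  assume s: "s < c"
  hence "s < W" using W_bounds by simp
  thus ?thesis unfolding out_name_def M_def small_defs
    by (intro small_pair small_Suc) (insert W_bounds(3), (rule small_leaf(1), assumption | rule small_leaf(2), simp | simp)+)
qed

sublocale local_program c M "pos_of (pos_code t c W)" "neg_of (neg_code W)" "out_of (out_code c)"
proof
qed (auto simp: mem_pos_of_code mem_neg_of_code mem_out_of_code M_def[symmetric] intro: out_name_small
    dest!: pos_rules_small neg_rules_small)

lemma code_constraints_rules: "code_constraints rules = rewriting_code t c"
  unfolding code_constraints_def code_tree_rules rewriting_code_def M_def W_def ..

lemma finite_rules: "finite rules"
proof (rule finite_imageD)
  have "finite (tree_codes c M (pos_code t c W) (neg_code W) (out_code c))"
    using computable_tree_codes[unfolded computable_set_def, THEN conjunct1, rule_format,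
      of "[c, M, pos_code t c W, neg_code W, out_code c]"] by (simp add: numeral_eq_Suc)
  thus "finite ((\<lambda>(s, \<phi>). prod_encode (s, code_shape \<phi>)) ` rules)" by (simp only: code_tree_rules)
qed (auto simp: inj_on_def prod_encode_eq)

context
  fixes A :: abox
begin

definition th :: "obj \<Rightarrow> nat list \<Rightarrow> nm set" where
  "th x p = {n. code_name n \<in> sat A x p}"

abbreviation holds :: "obj \<Rightarrow> nat list \<Rightarrow> nm \<Rightarrow> bool" where "holds x p n \<equiv> n \<in> th x p"

abbreviation lits :: "(obj \<Rightarrow> nat list \<Rightarrow> nm \<Rightarrow> bool) \<Rightarrow> obj \<Rightarrow> nat list \<Rightarrow> nm \<Rightarrow> bool" where
  "lits \<equiv> lit (abox_interp A) M"

definition valid :: "nat list \<Rightarrow> bool" where "valid p \<longleftrightarrow> set p \<subseteq> {..<M}"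

lemma valid_simps [simp]: "valid []" "valid (k # p) \<longleftrightarrow> k < M \<and> valid p"
  by (auto simp: valid_def)

text \<open>\<open>sat_induct\<close> for structured names. Literals are evaluated by
  \<open>lit\<close> instead of having a case of their own, so that an induction only has to treat
  the rules of the program, and the property only matters for basic names.\<close>

lemma th_induct:
  assumes n0: "n0 \<in> th x0 p0" "basic n0" and valid: "valid p0"
    and pos: "\<And>x p h a b d. valid p \<Longrightarrow> (h, a, b, d) \<in> pos_rules t c W \<Longrightarrow>
      lits (\<lambda>x p n. n \<in> th x p \<and> (basic n \<longrightarrow> P x p n)) x p a \<Longrightarrow>
      lits (\<lambda>x p n. n \<in> th x p \<and> (basic n \<longrightarrow> P x p n)) x p b \<Longrightarrow>
      lits (\<lambda>x p n. n \<in> th x p \<and> (basic n \<longrightarrow> P x p n)) x p d \<Longrightarrow> P x p h"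
    and neg: "\<And>x p h a b. valid p \<Longrightarrow> (h, a, b) \<in> neg_rules W \<Longrightarrow>
      lits (\<lambda>x p n. n \<in> th x p \<and> (basic n \<longrightarrow> P x p n)) x p a \<Longrightarrow> b \<notin> th x p \<Longrightarrow> P x p h"
  shows "P x0 p0 n0"
proof -
  let ?S = "\<lambda>x p n. n \<in> th x p \<and> (basic n \<longrightarrow> P x p n)"
  let ?P = "\<lambda>x p h. \<forall>n. h = code_name n \<longrightarrow> (basic n \<longrightarrow> P x p n) \<and> (\<not> basic n \<longrightarrow> lits ?S x p n)"
  have lits: "lits ?S x p n" if "code_name n \<in> sat A x p" "?P x p (code_name n)" for x p n
    using that by (cases "basic n") (auto simp: lit_basic th_def)
  have "?P x0 p0 (code_name n0)"
  proof (rule sat_induct[where A = A and P = ?P])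
    show "code_name n0 \<in> sat A x0 p0" using n0 by (simp add: th_def)
    show "set p0 \<subseteq> {..<M}" using valid by (simp add: valid_def)
  next
    fix x p h a b d
    assume *: "set p \<subseteq> {..<M}" "(h, a, b, d) \<in> pos_of (pos_code t c W)" "a \<in> sat A x p" "b \<in> sat A x p" "d \<in> sat A x p"
      "?P x p a" "?P x p b" "?P x p d"
    then obtain h' a' b' d' where r: "(h', a', b', d') \<in> pos_rules t c W"
      "h = code_name h'" "a = code_name a'" "b = code_name b'" "d = code_name d'" by (auto simp: mem_pos_of_code)
    have "P x p h'"
      by (rule pos[OF _ r(1) lits[OF *(3,6)[unfolded r(3)]] lits[OF *(4,7)[unfolded r(4)]]
            lits[OF *(5,8)[unfolded r(5)]]]) (simp add: valid_def *(1))
    thus "?P x p h" using r rule_heads_basic by simp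
  next
    fix x p h a b
    assume *: "set p \<subseteq> {..<M}" "(h, a, b) \<in> neg_of (neg_code W)" "a \<in> sat A x p" "?P x p a" "b \<notin> sat A x p"
    then obtain h' a' b' where r: "(h', a', b') \<in> neg_rules W"
      "h = code_name h'" "a = code_name a'" "b = code_name b'" by (auto simp: mem_neg_of_code)
    have "P x p h'"
      by (rule neg[OF _ r(1) lits[OF *(3,4)[unfolded r(3)]]]) (use *(1,5) r(4) in \<open>simp_all add: valid_def th_def\<close>)
    thus "?P x p h" using r rule_heads_basic by simp
  next
    fix x y Q t
    assume *: "code_roles Q < M" "\<And>r. r |\<in>| Q \<Longrightarrow> (x, y) \<in> role_ext (abox_interp A) r" "t \<in> sat A y []" "?P y [] t"
    show "?P x [] (neighbour_name (code_roles Q) t)"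
    proof (intro allI impI conjI)
      fix n assume "neighbour_name (code_roles Q) t = code_name n"
      then obtain l b where n: "n = (l, Nbr (code_roles Q) b)" "t = code_name (l, b)" by (auto simp: combinator_names)
      show "lits ?S x [] n" unfolding n(1) lit.simps
        by (intro conjI refl exI[of _ Q] exI[of _ y]) (use * n in \<open>auto simp: th_def\<close>)
      show "P x [] n" if "basic n" using that n by simp
    qed
  qed (auto simp: combinator_names th_def)
  thus ?thesis using n0 by simp
qed

text \<open>A literal can only come from the rules for trees, because the heads of the program are
  basic; conversely these rules derive every true literal whose code is below
  \<open>M\<close>.\<close>

lemma th_lit:
  assumes n: "code_name n < M" and p: "valid p" and k: "\<And>k b. snd n = Kid k b \<Longrightarrow> k < M"
  shows "n \<in> th x p \<longleftrightarrow> lits holds x p n"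
proof (cases "basic n")
  case True
  thus ?thesis by (simp add: lit_basic)
next
  case False
  let ?P = "\<lambda>x p h. \<forall>n. h = code_name n \<longrightarrow> \<not> basic n \<longrightarrow> lits holds x p n"
  have p': "set p \<subseteq> {..<M}" using p by (simp add: valid_def)
  have "lits holds x p n" if "n \<in> th x p"
  proof -
    have "?P x p (code_name n)"
    proof (rule sat_induct[where A = A and P = ?P])
      show "code_name n \<in> sat A x p" using that by (simp add: th_def)
    next
      fix x y Q t
      assume "code_roles Q < M" "\<And>r. r |\<in>| Q \<Longrightarrow> (x, y) \<in> role_ext (abox_interp A) r" "t \<in> sat A y []"
      thus "?P x [] (neighbour_name (code_roles Q) t)"
        by (auto simp: combinator_names th_def intro!: exI[of _ y])
    qed (use p' rule_heads_basic in \<open>auto simp: combinator_names th_def mem_pos_of_code mem_neg_of_code\<close>)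
    thus ?thesis using False by simp
  qed
  moreover have "n \<in> th x p" if l: "lits holds x p n"
  proof (cases n rule: basic.cases)
    case (1 l k b)
    thus ?thesis using l n k[of k b] sat_kid[OF p', of k "code_name (l, b)" A x]
      by (simp add: th_def code_name_combinators)
  next
    case (2 l b)
    then obtain k q where "p = k # q" "(l, b) \<in> th x q" using l by auto
    thus ?thesis using 2 n p sat_parent[of k "code_name (l, b)" A x q] by (simp add: th_def code_name_combinators)
  next
    case (3 l R b)
    then obtain Q y where "p = []" "R = code_roles Q" "R < M" "\<forall>r. r |\<in>| Q \<longrightarrow> (x, y) \<in> role_ext (abox_interp A) r"
      "(l, b) \<in> th y []" using l by auto
    thus ?thesis using 3 n sat_neighbour[of Q x y A "code_name (l, b)"] by (simp add: th_def code_name_combinators)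
  qed (use False n l sat_true[OF p'] sat_root sat_is_kid sat_concept sat_nominal p in
      \<open>auto simp: th_def code_name_combinators\<close>)
  ultimately show ?thesis by blast
qed

lemma kid_less: "code_name (l, Kid k b) < M \<Longrightarrow> k < M"
proof -
  assume "code_name (l, Kid k b) < M"
  moreover have "k \<le> code_name (l, Kid k b)"
    unfolding code_name_def by simp (meson le_prod_encode_1 le_prod_encode_2 le_trans)
  ultimately show ?thesis by simp
qed

lemma th_lit': "code_name n < M \<Longrightarrow> valid p \<Longrightarrow> n \<in> th x p \<longleftrightarrow> lits holds x p n"
  using th_lit[of n p x] kid_less by (cases n) auto

lemma th_pos:
  assumes "valid p" "(h, a, b, d) \<in> pos_rules t c W" "lits holds x p a" "lits holds x p b" "lits holds x p d"
  shows "h \<in> th x p"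
proof -
  have "(code_name h, code_name a, code_name b, code_name d) \<in> pos_of (pos_code t c W)"
    using assms(2) mem_pos_of_code by blast
  from sat_pos[OF _ this, of p A x] show ?thesis
    using assms pos_rules_small[OF assms(2)] th_lit'[of a p x] th_lit'[of b p x] th_lit'[of d p x]
    by (simp add: valid_def th_def M_def)
qed

lemma th_neg:
  assumes "valid p" "(h, a, b) \<in> neg_rules W" "lits holds x p a" "\<not> lits holds x p b"
  shows "h \<in> th x p"
proof -
  have "(code_name h, code_name a, code_name b) \<in> neg_of (neg_code W)"
    using assms(2) mem_neg_of_code by blast
  from sat_neg[OF _ this, of p A x] show ?thesis
    using assms neg_rules_small[OF assms(2)] th_lit'[of a p x] th_lit'[of b p x]
    by (simp add: valid_def th_def M_def)
qed

text \<open>Inversion is obtained from induction by taking the inversion statement itself as the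
  property: each rule application provides its own instance.\<close>

lemma th_cases:
  assumes "n \<in> th x p" "basic n" "valid p"
  shows "(\<exists>a b d. (n, a, b, d) \<in> pos_rules t c W \<and> lits holds x p a \<and> lits holds x p b \<and> lits holds x p d) \<or>
    (\<exists>a b. (n, a, b) \<in> neg_rules W \<and> lits holds x p a \<and> \<not> lits holds x p b)"
proof -
  have mono: "lits holds x p n" if "lits (\<lambda>x p n. n \<in> th x p \<and> Q x p n) x p n" for Q x p n
    using that by (cases n rule: basic.cases) auto
  define R where "R x p n \<longleftrightarrow>
      (\<exists>a b d. (n, a, b, d) \<in> pos_rules t c W \<and> lits holds x p a \<and> lits holds x p b \<and> lits holds x p d) \<or>
      (\<exists>a b. (n, a, b) \<in> neg_rules W \<and> lits holds x p a \<and> \<not> lits holds x p b)" for x p n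
  note mono = mono[of "\<lambda>x p n. basic n \<longrightarrow> R x p n"]
  have "R x p n"
  proof (rule th_induct[OF assms, where P = R], goal_cases)
    case (1 x p h a b d)
    thus ?case using mono unfolding R_def[of x p h] by blast
  next
    case (2 x p h a b)
    have "\<not> lits holds x p b" using 2 th_lit'[of b p x] neg_rules_small[of h a b W] unfolding M_def[symmetric] by blast
    thus ?case using 2 mono unfolding R_def[of x p h] by blast
  qed
  thus ?thesis unfolding R_def .
qed

lemma PA_rules_iff: "s < c \<Longrightarrow> (s, x) \<in> PA rules (abox_interp A) \<longleftrightarrow> out_name c s \<in> th x []"
  by (auto simp: PA_rules_out mem_out_of_code th_def)

lemma th_Blank:
  assumes "M \<le> a" "\<And>B. ConceptAssertion B a \<notin> A" "\<And>q d. RoleAssertion q a d \<notin> A" "\<And>q d. RoleAssertion q d a \<notin> A"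
  shows "th (Blank b) p = th (Ind a) p"
  by (simp add: th_def sat_Blank[OF assms])

end

end

section \<open>The austere canonical model\<close>

fun inv_role :: "role \<Rightarrow> role" where
  "inv_role (Fwd p) = Inv p"
| "inv_role (Inv p) = Fwd p"

lemma inv_role_inv [simp]: "inv_role (inv_role r) = r"
  by (cases r) auto

lemma role_ext_inv [simp]: "(d, e) \<in> role_ext I (inv_role r) \<longleftrightarrow> (e, d) \<in> role_ext I r"
  by (cases r) auto

lemma concept_ext_dom: "interpretation_wf K \<Longrightarrow> concept_ext K B \<subseteq> dom K"
  by (cases B) (auto simp: interpretation_wf_def)

lemma inv_code_role [simp]: "inv_code (code_role r) = code_role (inv_role r)"
  by (cases r) (auto simp: inv_code_def)

definition role_step :: "tbox \<Rightarrow> role \<Rightarrow> role \<Rightarrow> bool" where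
  "role_step T r s \<longleftrightarrow> RoleIncl r s \<in> T \<or> RoleIncl (inv_role r) (inv_role s) \<in> T"

abbreviation sub_role :: "tbox \<Rightarrow> role \<Rightarrow> role \<Rightarrow> bool" where "sub_role T \<equiv> (role_step T)\<^sup>*\<^sup>*"

lemma sub_role_inv: "sub_role T r s \<Longrightarrow> sub_role T (inv_role r) (inv_role s)"
proof (induction rule: rtranclp_induct)
  case (step s u)
  have "role_step T (inv_role s) (inv_role u)" using step(2) by (auto simp: role_step_def)
  thus ?case using step(3) by simp
qed simp

lemma sub_role_inv_iff: "sub_role T (inv_role r) s \<longleftrightarrow> sub_role T r (inv_role s)"
  using sub_role_inv[of T "inv_role r" s] sub_role_inv[of T r "inv_role s"] by auto

lemma sub_role_model: "sub_role T r s \<Longrightarrow> is_model T A J \<Longrightarrow> (d, e) \<in> role_ext J r \<Longrightarrow> (d, e) \<in> role_ext J s"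
proof (induction arbitrary: d e rule: rtranclp_induct)
  case (step s u)
  have de: "(d, e) \<in> role_ext J s" using step by blast
  from step(2) show ?case unfolding role_step_def
  proof
    assume "RoleIncl s u \<in> T"
    hence "sat_axiom J (RoleIncl s u)" using step(4) unfolding is_model_def by blast
    thus ?thesis using de by auto
  next
    assume "RoleIncl (inv_role s) (inv_role u) \<in> T"
    hence "sat_axiom J (RoleIncl (inv_role s) (inv_role u))" using step(4) unfolding is_model_def by blast
    hence "role_ext J (inv_role s) \<subseteq> role_ext J (inv_role u)" by simp
    thus ?thesis using de by (metis role_ext_inv subsetD)
  qed
qed simp

lemma code_components:
  "a < ex_code a r b" "r < ex_code a r b" "b < ex_code a r b"
  "a < all_code a r b" "r < all_code a r b" "b < all_code a r b"
  "r < role_incl_code r b" "b < role_incl_code r b"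
proof -
  have 1: "x < prod_encode (y, Suc z)" if "x \<le> z" for x y z
    using that le_prod_encode_2[of "Suc z" y] by linarith
  have 2: "x \<le> prod_encode (x, z)" "z \<le> y \<Longrightarrow> z \<le> prod_encode (x, y)" "z \<le> y \<Longrightarrow> z \<le> Suc y" for x y z
    using le_prod_encode_1[of x z] le_prod_encode_2[of y x] by auto
  show "a < ex_code a r b" "r < ex_code a r b" "b < ex_code a r b"
    "a < all_code a r b" "r < all_code a r b" "b < all_code a r b"
    "r < role_incl_code r b" "b < role_incl_code r b"
    unfolding ex_code_def all_code_def role_incl_code_def list_encode.simps by (intro 1 2)+
qed

declare code_axiom.simps(2-4) [simp del]

section \<open>Decoding axioms and the role hierarchy\<close>

context rewriting
begin

lemma mem_t: "x \<in> set_decode t \<longleftrightarrow> (\<exists>\<alpha>\<in>T. x = code_axiom \<alpha>)"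
  by (simp add: t_def mem_code_tbox finite_T)

lemma code_axiom_codes:
  "code_axiom (ExIncl a r b) = ex_code (code_concept a) (code_role r) (code_concept b)"
  "code_axiom (AllIncl a r b) = all_code (code_concept a) (code_role r) (code_concept b)"
  "code_axiom (RoleIncl r s) = role_incl_code (code_role r) (code_role s)"
  by (simp_all add: ex_code_def all_code_def role_incl_code_def code_axiom.simps)

lemma mem_t_codes:
  "ex_code a r b \<in> set_decode t \<longleftrightarrow> (\<exists>a' r' b'. a = code_concept a' \<and> r = code_role r' \<and> b = code_concept b' \<and> ExIncl a' r' b' \<in> T)"
  "all_code a r b \<in> set_decode t \<longleftrightarrow> (\<exists>a' r' b'. a = code_concept a' \<and> r = code_role r' \<and> b = code_concept b' \<and> AllIncl a' r' b' \<in> T)"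
  "role_incl_code r b \<in> set_decode t \<longleftrightarrow> (\<exists>r' b'. r = code_role r' \<and> b = code_role b' \<and> RoleIncl r' b' \<in> T)"
proof -
  have ex: "ex_code a r b = code_axiom \<alpha> \<longleftrightarrow> (\<exists>a' r' b'. a = code_concept a' \<and> r = code_role r' \<and> b = code_concept b' \<and> \<alpha> = ExIncl a' r' b')" for \<alpha>
    by (cases \<alpha>) (auto simp: ex_code_def prod_encode_eq list_encode_eq code_axiom.simps)
  have all: "all_code a r b = code_axiom \<alpha> \<longleftrightarrow> (\<exists>a' r' b'. a = code_concept a' \<and> r = code_role r' \<and> b = code_concept b' \<and> \<alpha> = AllIncl a' r' b')" for \<alpha>
    by (cases \<alpha>) (auto simp: all_code_def prod_encode_eq list_encode_eq code_axiom.simps)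
  have role: "role_incl_code r b = code_axiom \<alpha> \<longleftrightarrow> (\<exists>r' b'. r = code_role r' \<and> b = code_role b' \<and> \<alpha> = RoleIncl r' b')" for \<alpha>
    by (cases \<alpha>) (auto simp: role_incl_code_def prod_encode_eq list_encode_eq code_axiom.simps)
  show "ex_code a r b \<in> set_decode t \<longleftrightarrow> (\<exists>a' r' b'. a = code_concept a' \<and> r = code_role r' \<and> b = code_concept b' \<and> ExIncl a' r' b' \<in> T)"
    unfolding mem_t ex by blast
  show "all_code a r b \<in> set_decode t \<longleftrightarrow> (\<exists>a' r' b'. a = code_concept a' \<and> r = code_role r' \<and> b = code_concept b' \<and> AllIncl a' r' b' \<in> T)"
    unfolding mem_t all by blast
  show "role_incl_code r b \<in> set_decode t \<longleftrightarrow> (\<exists>r' b'. r = code_role r' \<and> b = code_role b' \<and> RoleIncl r' b' \<in> T)"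
    unfolding mem_t role by blast
qed

lemma code_axiom_mem: "\<alpha> \<in> T \<Longrightarrow> code_axiom \<alpha> \<in> set_decode t"
  using mem_t by blast

lemma less_t: "\<alpha> \<in> T \<Longrightarrow> code_axiom \<alpha> < t"
  using mem_t member_less by blast

lemma ExIncl_less: "ExIncl a r b \<in> T \<Longrightarrow> code_concept a < t \<and> code_role r < t \<and> code_concept b < t"
  using less_t[of "ExIncl a r b"] code_components unfolding code_axiom_codes by (meson less_trans)

lemma AllIncl_less: "AllIncl a r b \<in> T \<Longrightarrow> code_concept a < t \<and> code_role r < t \<and> code_concept b < t"
  using less_t[of "AllIncl a r b"] code_components unfolding code_axiom_codes by (meson less_trans)

lemma RoleIncl_less: "RoleIncl r s \<in> T \<Longrightarrow> code_role r < t \<and> code_role s < t"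
  using less_t[of "RoleIncl r s"] code_components unfolding code_axiom_codes by (meson less_trans)

lemma role_step_le:
  assumes "role_step T r s"
  shows "code_role r \<le> prod_encode (1, t)" "code_role s \<le> prod_encode (1, t)"
proof -
  have 1: "code_role u \<le> prod_encode (1, t)" if "code_role u < t \<or> code_role (inv_role u) < t" for u
    using that
  proof
    assume "code_role u < t"
    thus ?thesis using le_prod_encode_2[of t 1] by linarith
  next
    assume "code_role (inv_role u) < t"
    thus ?thesis using inv_code_le[of "code_role (inv_role u)" t] by simp
  qed
  show "code_role r \<le> prod_encode (1, t)" "code_role s \<le> prod_encode (1, t)"
    using assms RoleIncl_less 1 unfolding role_step_def by blast+
qed

text \<open>A role on which no inclusion acts is related to itself only. Therefore roles that occur
  in the ABox alone need no bound.\<close>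

lemma sub_role_source: "sub_role T r s \<Longrightarrow> r = s \<or> code_role r \<le> prod_encode (1, t)"
  by (induction rule: converse_rtranclp_induct) (auto dest: role_step_le)

lemma sub_role_target: "sub_role T r s \<Longrightarrow> r = s \<or> code_role s \<le> prod_encode (1, t)"
  by (induction rule: rtranclp_induct) (auto dest: role_step_le)

text \<open>The roles above \<open>r\<close> form a closed set, and by
  \<open>sub_role_target\<close> its code respects the bound in \<open>role_le\<close>; this
  instance gives one direction. The other follows a chain of inclusions inside an arbitrary closed
  set.\<close>

lemma role_le_iff: "role_le t (code_role r) y \<longleftrightarrow> (\<exists>s. y = code_role s \<and> sub_role T r s)"
proof
  assume le: "role_le t (code_role r) y"
  let ?Y = "code_role ` {s. sub_role T r s}"
  have Y: "?Y \<subseteq> {..<Suc (prod_encode (1, t) + code_role r)}"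
    using sub_role_target by fastforce
  hence d: "set_decode (set_encode ?Y) = ?Y" by (meson finite_lessThan finite_subset set_encode_inverse)
  have "role_closed t (set_encode ?Y)"
    unfolding role_closed_def d mem_t_codes
  proof (intro allI impI conjI)
    fix u v assume "\<exists>r' b'. u = code_role r' \<and> v = code_role b' \<and> RoleIncl r' b' \<in> T"
    then obtain u' v' where uv: "u = code_role u'" "v = code_role v'" "RoleIncl u' v' \<in> T" by blast
    have "role_step T u' v'" "role_step T (inv_role u') (inv_role v')" using uv(3) by (auto simp: role_step_def)
    thus "u \<in> ?Y \<Longrightarrow> v \<in> ?Y" "inv_code u \<in> ?Y \<Longrightarrow> inv_code v \<in> ?Y"
      by (auto simp: uv(1,2) intro: rtranclp.rtrancl_into_rtrancl)
  qed
  moreover have "code_role r \<in> set_decode (set_encode ?Y)" unfolding d by auto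
  ultimately have "y \<in> set_decode (set_encode ?Y)" using le set_encode_mono_less[OF Y] unfolding role_le_def by blast
  hence "y \<in> ?Y" unfolding d .
  thus "\<exists>s. y = code_role s \<and> sub_role T r s" by auto
next
  assume "\<exists>s. y = code_role s \<and> sub_role T r s"
  then obtain s where s: "y = code_role s" "sub_role T r s" by blast
  have "code_role s \<in> set_decode X" if X: "role_closed t X" "code_role r \<in> set_decode X" for X
    using s(2)
  proof (induction rule: rtranclp_induct)
    case (step u v)
    have *: "(u \<in> set_decode X \<longrightarrow> v \<in> set_decode X) \<and> (inv_code u \<in> set_decode X \<longrightarrow> inv_code v \<in> set_decode X)"
      if "role_incl_code u v \<in> set_decode t" for u v
    proof -
      have "u < Suc t" "v < Suc t" using member_less[OF that] code_components(7)[of u v] code_components(8)[of v u] by linarith+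
      thus ?thesis using that X(1) unfolding role_closed_def by blast
    qed
    from step(2) show ?case unfolding role_step_def
    proof
      assume "RoleIncl u v \<in> T"
      thus ?case using *[OF code_axiom_mem[of "RoleIncl u v", unfolded code_axiom_codes]] step(3) by blast
    next
      assume "RoleIncl (inv_role u) (inv_role v) \<in> T"
      hence "inv_code (code_role (inv_role u)) \<in> set_decode X \<longrightarrow> inv_code (code_role (inv_role v)) \<in> set_decode X"
        using *[OF code_axiom_mem[of "RoleIncl (inv_role u) (inv_role v)", unfolded code_axiom_codes]] by blast
      thus ?case using step(3) by simp
    qed
  qed (rule X(2))
  thus "role_le t (code_role r) y" using s(1) by (simp add: role_le_def)
qed

lemma role_le_code [simp]: "role_le t (code_role r) (code_role s) \<longleftrightarrow> sub_role T r s"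
  by (auto simp: role_le_iff)

lemma prod_1_t_less_W: "prod_encode (1, t) < W"
proof -
  have "prod_encode (1, t) \<le> prod_encode (1, t + c)" by (rule prod_encode_mono) auto
  also have "\<dots> \<le> Suc (Suc (prod_encode (1, t + c) + t + c))" by simp
  also have "\<dots> \<le> 2 ^ Suc (Suc (prod_encode (1, t + c) + t + c))" by (rule less_imp_le, rule less_exp)
  finally show ?thesis by (intro W_bounds(5)) linarith
qed

definition kid_of :: "axiom \<Rightarrow> nat" where "kid_of \<alpha> = code_axiom \<alpha>"

definition good_path :: "nat list \<Rightarrow> bool" where
  "good_path p \<longleftrightarrow> (\<forall>k\<in>set p. \<exists>a r b. ExIncl a r b \<in> T \<and> k = code_axiom (ExIncl a r b))"

lemma good_path_simps [simp]:
  "good_path []"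
  "good_path (k # p) \<longleftrightarrow> (\<exists>a r b. ExIncl a r b \<in> T \<and> k = code_axiom (ExIncl a r b)) \<and> good_path p"
  by (auto simp: good_path_def)

lemma axiom_less_W: "\<alpha> \<in> T \<Longrightarrow> code_axiom \<alpha> < W"
  using less_t W_bounds(1) by (meson less_trans)

lemma valid_good_path: "good_path p \<Longrightarrow> valid p"
  unfolding good_path_def valid_def using axiom_less_W W_le_M by fastforce

section \<open>Closure of the derived concepts under the TBox\<close>

context
  fixes A :: abox
begin

abbreviation ex :: "obj \<Rightarrow> nat list \<Rightarrow> bool" where "ex x p \<equiv> (0, Ex) \<in> th A x p"
abbreviation has :: "obj \<Rightarrow> nat list \<Rightarrow> concept \<Rightarrow> bool" where "has x p B \<equiv> (0, CN (code_concept B)) \<in> th A x p"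
abbreviation act :: "obj \<Rightarrow> nat list \<Rightarrow> bool" where "act x p \<equiv> (3, Act) \<in> th A x p"

lemma concept_rule:
  "valid p \<Longrightarrow> (h, a, b, d) \<in> concept_rules t W \<Longrightarrow> lits A (holds A) x p a \<Longrightarrow> lits A (holds A) x p b \<Longrightarrow>
   lits A (holds A) x p d \<Longrightarrow> h \<in> th A x p"
  using th_pos[of p h a b d A x] unfolding pos_rules_def by blast

lemma ex_root [simp]: "ex x []"
  by (rule concept_rule[OF _ concept_rules.ex_root]) auto

lemma has_Top: "valid p \<Longrightarrow> ex x p \<Longrightarrow> has x p Top"
  using concept_rule[OF _ concept_rules.top, of p x] by simp

lemma ex_kid:
  assumes "valid p" "ExIncl a r b \<in> T" "has x p a"
  shows "ex x (code_axiom (ExIncl a r b) # p)"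
  unfolding code_axiom_codes
  by (rule concept_rule[OF _ concept_rules.ex_kid[of "code_concept a" W "code_role r" "code_concept b"]])
     (use assms ExIncl_less[OF assms(2)] W_bounds(1) axiom_less_W[OF assms(2)] W_le_M in
      \<open>auto simp: mem_t_codes code_axiom_mem simp flip: code_axiom_codes\<close>)

lemma kid_filler:
  assumes "valid p" "ExIncl a r b \<in> T" "ex x (code_axiom (ExIncl a r b) # p)"
  shows "has x (code_axiom (ExIncl a r b) # p) b"
  using assms(3) unfolding code_axiom_codes
  by (intro concept_rule[OF _ concept_rules.kid_filler[of "code_concept a" W "code_role r" "code_concept b"]])
     (use assms ExIncl_less[OF assms(2)] W_bounds(1) axiom_less_W[OF assms(2)] W_le_M in
      \<open>auto simp: mem_t_codes code_axiom_mem simp flip: code_axiom_codes\<close>)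

lemma all_down:
  assumes "valid p" "ExIncl a r b \<in> T" "AllIncl e s g \<in> T" "sub_role T r s"
    "ex x (code_axiom (ExIncl a r b) # p)" "has x p e"
  shows "has x (code_axiom (ExIncl a r b) # p) g"
  using assms(5) unfolding code_axiom_codes
  by (intro concept_rule[OF _ concept_rules.all_down[of "code_concept a" W "code_role r" "code_concept b"
        "code_concept e" "code_role s" "code_concept g"]])
     (use assms ExIncl_less[OF assms(2)] AllIncl_less[OF assms(3)] W_bounds(1) axiom_less_W[OF assms(2)] W_le_M in
      \<open>auto simp: mem_t_codes code_axiom_mem simp flip: code_axiom_codes\<close>)

lemma all_up:
  assumes "valid p" "ExIncl a r b \<in> T" "AllIncl e s g \<in> T" "sub_role T r (inv_role s)"
    "has x (code_axiom (ExIncl a r b) # p) e"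
  shows "has x p g"
  using assms(5) unfolding code_axiom_codes
  by (intro concept_rule[OF _ concept_rules.all_up[of "code_concept a" W "code_role r" "code_concept b"
        "code_concept e" "code_role s" "code_concept g"]])
     (use assms ExIncl_less[OF assms(2)] AllIncl_less[OF assms(3)] W_bounds(1) in
      \<open>auto simp: mem_t_codes\<close>)

lemma code_roles_single: "code_roles {|r|} = 2 ^ code_role r"
  by (simp add: code_roles_def)

lemma pow_less_M: "x < W \<Longrightarrow> 2 ^ x < M"
  using small_leaf(3)[of x W 60] by (simp add: M_def name_bound_def)

lemma all_nbr:
  assumes "AllIncl e s g \<in> T" "sub_role T u s" "has y [] e" "(y, x) \<in> role_ext (abox_interp A) u"
  shows "has x [] g"
proof -
  have s: "sub_role T (inv_role u) (inv_role s)" using assms(2) by (rule sub_role_inv)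
  have "code_role (inv_role s) \<le> prod_encode (1, t)"
    using inv_code_le[of "code_role s" t] AllIncl_less[OF assms(1)] by simp
  \<comment> \<open>The role \<open>u\<close> comes from the ABox and may be arbitrarily large in
    general, but it lies below a role of the TBox and hence is that role or occurs in an inclusion,
    up to inversion.\<close>
  hence u: "code_role (inv_role u) < W" using sub_role_source[OF s] prod_1_t_less_W by auto
  show ?thesis
  proof (rule concept_rule[OF _ concept_rules.all_nbr[OF u]])
    show "all_code (code_concept e) (code_role s) (code_concept g) \<in> set_decode t"
      using assms(1) by (auto simp: mem_t_codes)
    show "role_le t (code_role (inv_role u)) (inv_code (code_role s))" using s by simp
    show "lits A (holds A) x [] (0, Nbr (2 ^ code_role (inv_role u)) (CN (code_concept e)))"
      "lits A (holds A) x [] (0, Nbr (2 ^ code_role (inv_role u)) (CN (code_concept e)))"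
      "lits A (holds A) x [] (0, Nbr (2 ^ code_role (inv_role u)) (CN (code_concept e)))"
      using assms(3,4) pow_less_M[OF u] by (auto simp flip: code_roles_single)
  qed (use AllIncl_less[OF assms(1)] W_bounds(1) in auto)
qed

lemma assertion_has: "ConceptAssertion B a \<in> A \<Longrightarrow> B < W \<Longrightarrow> has (Ind a) [] (Con B)"
  using concept_rule[OF _ concept_rules.assertion, of "[]" B "Ind a"] W_le_M
  by (auto simp: abox_interp_def)

lemma LS_holds:
  assumes "valid p" "ex x p" "list_encode (map code_concept Bs) \<le> t" "\<forall>B\<in>set Bs. has x p B"
  shows "(0, LS (list_encode (map code_concept Bs))) \<in> th A x p"
  using assms(3,4)
proof (induction Bs)
  case Nil
  thus ?case using concept_rule[OF assms(1) concept_rules.conj_nil, of x] assms(2) by simp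
next
  case (Cons B Bs)
  let ?l = "list_encode (map code_concept Bs)"
  have "Suc (prod_encode (code_concept B, ?l)) \<le> t" using Cons.prems(1) by simp
  hence le: "code_concept B < t" "?l < t"
    using le_prod_encode_1[of "code_concept B" ?l] le_prod_encode_2[of ?l "code_concept B"] by linarith+
  thus ?case using concept_rule[OF assms(1) concept_rules.conj_cons, of "code_concept B" ?l x] Cons W_bounds(1) by simp
qed

lemma conj_has:
  assumes "valid p" "ConjIncl B0 Bs B \<in> T" "ex x p" "\<forall>B\<in>set (B0 # Bs). has x p B"
  shows "has x p B"
proof -
  let ?l = "list_encode (map code_concept (B0 # Bs))"
  have m: "prod_encode (0, Suc (prod_encode (code_concept B, ?l))) \<in> set_decode t"
    using assms(2) unfolding mem_t by (intro bexI[of _ "ConjIncl B0 Bs B"]) simp_all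
  have "Suc (prod_encode (code_concept B, ?l)) \<le> t"
    using member_less[OF m] le_prod_encode_2[of "Suc (prod_encode (code_concept B, ?l))" 0] by linarith
  hence le: "code_concept B < t" "?l < t"
    using le_prod_encode_1[of "code_concept B" ?l] le_prod_encode_2[of ?l "code_concept B"] by linarith+
  have "(0, LS ?l) \<in> th A x p" using LS_holds[OF assms(1,3) _ assms(4)] le by simp
  thus ?thesis using concept_rule[OF assms(1) concept_rules.conj[OF _ _ m], of x] le W_bounds(1) by simp
qed

subsection \<open>Soundness of the derived concepts\<close>

context
  fixes J :: interp
  assumes J: "is_model T A J"
begin

text \<open>The homomorphism from the chase into \<open>J\<close>, extended along the path by chosen
  witnesses. By injectivity of the codes at most one axiom competes in the choice. A blank root
  occurs in no assertion, so some fixed individual can represent it.\<close>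

primrec hm :: "obj \<Rightarrow> nat list \<Rightarrow> obj" where
  "hm x [] = (case x of Ind a \<Rightarrow> Ind a | Blank _ \<Rightarrow> Ind 0)"
| "hm x (k # p) = (SOME e. \<forall>a r b. k = code_axiom (ExIncl a r b) \<longrightarrow> ExIncl a r b \<in> T \<longrightarrow>
     hm x p \<in> concept_ext J a \<longrightarrow> (hm x p, e) \<in> role_ext J r \<and> e \<in> concept_ext J b)"

primrec exists_in :: "obj \<Rightarrow> nat list \<Rightarrow> bool" where
  "exists_in x [] \<longleftrightarrow> True"
| "exists_in x (k # p) \<longleftrightarrow> exists_in x p \<and>
     (\<exists>a r b. k = code_axiom (ExIncl a r b) \<and> ExIncl a r b \<in> T \<and> hm x p \<in> concept_ext J a)"

lemma sat_J: "\<alpha> \<in> T \<Longrightarrow> sat_axiom J \<alpha>"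
  using J by (simp add: is_model_def)

lemma hm_kid:
  assumes "ExIncl a r b \<in> T" "hm x p \<in> concept_ext J a"
  shows "(hm x p, hm x (code_axiom (ExIncl a r b) # p)) \<in> role_ext J r"
    "hm x (code_axiom (ExIncl a r b) # p) \<in> concept_ext J b"
proof -
  obtain e where "(hm x p, e) \<in> role_ext J r" "e \<in> concept_ext J b"
    using sat_J[OF assms(1)] assms(2) by auto
  hence "\<exists>e. \<forall>a' r' b'. code_axiom (ExIncl a r b) = code_axiom (ExIncl a' r' b') \<longrightarrow> ExIncl a' r' b' \<in> T \<longrightarrow>
     hm x p \<in> concept_ext J a' \<longrightarrow> (hm x p, e) \<in> role_ext J r' \<and> e \<in> concept_ext J b'"
    unfolding code_axiom_eq by blast
  from someI_ex[OF this] show "(hm x p, hm x (code_axiom (ExIncl a r b) # p)) \<in> role_ext J r"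
    "hm x (code_axiom (ExIncl a r b) # p) \<in> concept_ext J b"
    using assms unfolding hm.simps by blast+
qed

lemma hm_dom: "exists_in x p \<Longrightarrow> hm x p \<in> dom J"
proof (cases p)
  case Nil
  thus ?thesis using J by (auto simp: is_model_def interpretation_wf_def split: obj.split)
next
  case (Cons k q)
  assume "exists_in x p"
  thus ?thesis using Cons hm_kid(2) concept_ext_dom J by (fastforce simp del: hm.simps simp: is_model_def)
qed

text \<open>The induction principle speaks of all names at once, so those outside the chase receive
  the trivial invariant. Conditions on numbers are restricted to actual codes.\<close>

primrec in_J :: "obj \<Rightarrow> nat list \<Rightarrow> name_body \<Rightarrow> bool" where
  "in_J x p Ex \<longleftrightarrow> exists_in x p"
| "in_J x p (CN n) \<longleftrightarrow> exists_in x p \<and> (\<forall>B. n = code_concept B \<longrightarrow> hm x p \<in> concept_ext J B)"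
| "in_J x p (LS n) \<longleftrightarrow> exists_in x p \<and>
     (\<forall>Bs. n = list_encode (map code_concept Bs) \<longrightarrow> (\<forall>B\<in>set Bs. hm x p \<in> concept_ext J B))"
| "in_J x p (Kid k b) \<longleftrightarrow> True" | "in_J x p (Par b) \<longleftrightarrow> True" | "in_J x p (Nbr R b) \<longleftrightarrow> True"
| "in_J x p Tru \<longleftrightarrow> True" | "in_J x p Root \<longleftrightarrow> True" | "in_J x p (IsKid k) \<longleftrightarrow> True"
| "in_J x p (CA B) \<longleftrightarrow> True" | "in_J x p (IND a) \<longleftrightarrow> True" | "in_J x p (NSub i X) \<longleftrightarrow> True"
| "in_J x p (Sub i X) \<longleftrightarrow> True" | "in_J x p (Lacks X) \<longleftrightarrow> True" | "in_J x p (Has X) \<longleftrightarrow> True"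
| "in_J x p (Dom i) \<longleftrightarrow> True" | "in_J x p (Cand i) \<longleftrightarrow> True" | "in_J x p Act \<longleftrightarrow> True"
| "in_J x p (FM f) \<longleftrightarrow> True" | "in_J x p (Dia R f) \<longleftrightarrow> True" | "in_J x p (Bel f) \<longleftrightarrow> True" | "in_J x p (Glo f) \<longleftrightarrow> True"

lemma concept_rule_in_J:
  assumes r: "((hl, hb), (al, ab), (bl, bb), (dl, db)) \<in> concept_rules t W"
    and lit: "lits A (\<lambda>x p n. n \<in> th A x p \<and> (basic n \<longrightarrow> in_J x p (snd n))) x p (al, ab)"
      "lits A (\<lambda>x p n. n \<in> th A x p \<and> (basic n \<longrightarrow> in_J x p (snd n))) x p (bl, bb)"
      "lits A (\<lambda>x p n. n \<in> th A x p \<and> (basic n \<longrightarrow> in_J x p (snd n))) x p (dl, db)"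
  shows "in_J x p hb"
  using r
proof cases
  case top
  have *: "B = Top" if "prod_encode (0, 0) = code_concept B" for B
    using that by (cases B) (auto simp: prod_encode_eq)
  have e: "exists_in x p" using lit(1) top by simp
  have "in_J x p (CN (prod_encode (0, 0)))"
    unfolding in_J.simps using e hm_dom[OF e] by (auto dest!: *)
  thus ?thesis using top by blast
next
  case conj_nil
  have *: "Bs = []" if "0 = list_encode (map code_concept Bs)" for Bs
    using that by (cases Bs) auto
  have "exists_in x p" using lit(1) conj_nil by simp
  hence "in_J x p (LS 0)" unfolding in_J.simps by (auto dest!: *[OF sym])
  thus ?thesis using conj_nil by blast
next
  case (conj_cons y l)
  have "\<exists>B Bs'. Bs = B # Bs' \<and> y = code_concept B \<and> l = list_encode (map code_concept Bs')"
    if "Suc (prod_encode (y, l)) = list_encode (map code_concept Bs)" for Bs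
    using that by (cases Bs) (auto simp: prod_encode_eq)
  moreover have "exists_in x p" "\<And>B. y = code_concept B \<Longrightarrow> hm x p \<in> concept_ext J B"
    "\<And>Bs. l = list_encode (map code_concept Bs) \<Longrightarrow> \<forall>B\<in>set Bs. hm x p \<in> concept_ext J B"
    using lit(1,2) conj_cons by simp_all
  ultimately have "in_J x p (LS (Suc (prod_encode (y, l))))" unfolding in_J.simps by fastforce
  thus ?thesis using conj_cons by blast
next
  case (conj y l)
  then obtain \<alpha> where \<alpha>: "\<alpha> \<in> T" "prod_encode (0, Suc (prod_encode (y, l))) = code_axiom \<alpha>"
    unfolding mem_t by blast
  then obtain B0 Bs B where b: "\<alpha> = ConjIncl B0 Bs B" "y = code_concept B" "l = list_encode (map code_concept (B0 # Bs))"
    by (cases \<alpha>) (auto simp: prod_encode_eq code_axiom.simps)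
  have "in_J x p (LS l)" using lit(1) conj by (simp del: in_J.simps)
  hence "exists_in x p \<and> (\<forall>B\<in>set (B0 # Bs). hm x p \<in> concept_ext J B)"
    unfolding in_J.simps using b(3) by blast
  moreover have "hm x p \<in> concept_ext J B" if "\<forall>B\<in>set (B0 # Bs). hm x p \<in> concept_ext J B"
    using sat_J[OF \<alpha>(1)] that b(1) by auto
  ultimately show ?thesis using conj b(2) by simp
next
  case ex_root
  thus ?thesis using lit by simp
next
  case (ex_kid a r b)
  then obtain a' r' b' where m: "ExIncl a' r' b' \<in> T" "a = code_concept a'" "r = code_role r'" "b = code_concept b'"
    by (auto simp: mem_t_codes)
  obtain q where q: "p = ex_code a r b # q" using lit(1) ex_kid by auto
  have "in_J x q (CN a)" using lit(2) ex_kid q by (simp del: in_J.simps)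
  hence "exists_in x q" "hm x q \<in> concept_ext J a'" unfolding in_J.simps m(2) by blast+
  hence "exists_in x p" unfolding q exists_in.simps m(2-4) using m(1) code_axiom_codes(1) by metis
  thus ?thesis using ex_kid by simp
next
  case (kid_filler a r b)
  then obtain a' r' b' where m: "ExIncl a' r' b' \<in> T" "a = code_concept a'" "r = code_role r'" "b = code_concept b'"
    by (auto simp: mem_t_codes)
  obtain q where "p = ex_code a r b # q" using lit(1) kid_filler by auto
  hence q: "p = code_axiom (ExIncl a' r' b') # q" by (simp add: m code_axiom_codes)
  have e: "exists_in x p" using lit(2) kid_filler by simp
  hence "hm x q \<in> concept_ext J a'" using q by auto
  hence "hm x p \<in> concept_ext J b'" using hm_kid(2)[OF m(1)] q by blast
  hence "in_J x p (CN b)" unfolding in_J.simps using e m(4) by simp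
  thus ?thesis using kid_filler by simp
next
  case (all_down a r b y s z)
  then obtain a' r' b' y' s' z' where m: "ExIncl a' r' b' \<in> T" "a = code_concept a'" "r = code_role r'" "b = code_concept b'"
    "AllIncl y' s' z' \<in> T" "y = code_concept y'" "s = code_role s'" "z = code_concept z'" by (auto simp: mem_t_codes)
  obtain q where "p = ex_code a r b # q" using lit(1) all_down by auto
  hence q: "p = code_axiom (ExIncl a' r' b') # q" by (simp add: m code_axiom_codes)
  have e: "exists_in x p" using lit(2) all_down by simp
  have "in_J x q (CN y)" using lit(3) all_down q by (simp del: in_J.simps)
  hence y: "hm x q \<in> concept_ext J y'" unfolding in_J.simps m(6) by blast
  have "hm x q \<in> concept_ext J a'" using e q by auto
  from hm_kid(1)[OF m(1) this] have "(hm x q, hm x p) \<in> role_ext J s'"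
    using sub_role_model[OF _ J, of r' s'] all_down m q by simp
  hence "hm x p \<in> concept_ext J z'" using sat_J[OF m(5)] y by auto
  hence "in_J x p (CN z)" unfolding in_J.simps using e m(8) by simp
  thus ?thesis using all_down by simp
next
  case (all_up a r b y s z)
  then obtain a' r' b' y' s' z' where m: "ExIncl a' r' b' \<in> T" "a = code_concept a'" "r = code_role r'" "b = code_concept b'"
    "AllIncl y' s' z' \<in> T" "y = code_concept y'" "s = code_role s'" "z = code_concept z'" by (auto simp: mem_t_codes)
  let ?q = "code_axiom (ExIncl a' r' b') # p"
  have "in_J x ?q (CN y)" using lit(1) all_up m by (simp add: code_axiom_codes del: in_J.simps)
  hence q: "exists_in x ?q" "hm x ?q \<in> concept_ext J y'" unfolding in_J.simps m(6) by blast+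
  hence a: "hm x p \<in> concept_ext J a'" "exists_in x p" by auto
  have "sub_role T r' (inv_role s')" using all_up m by simp
  hence "(hm x p, hm x ?q) \<in> role_ext J (inv_role s')"
    using sub_role_model[OF _ J] hm_kid(1)[OF m(1) a(1)] by blast
  hence "hm x p \<in> concept_ext J z'" using sat_J[OF m(5)] q(2) by auto
  hence "in_J x p (CN z)" unfolding in_J.simps using a m(8) by simp
  thus ?thesis using all_up by simp
next
  case (all_nbr u y s z)
  then obtain y' s' z' where m:
    "AllIncl y' s' z' \<in> T" "y = code_concept y'" "s = code_role s'" "z = code_concept z'" by (auto simp: mem_t_codes)
  obtain Q v where "p = []" "2 ^ u = code_roles Q" "\<forall>r. r |\<in>| Q \<longrightarrow> (x, v) \<in> role_ext (abox_interp A) r"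
    "in_J v [] (CN y)"
    using lit(1) all_nbr by (auto simp del: in_J.simps)
  hence Q: "p = []" "2 ^ u = code_roles Q" "\<forall>r. r |\<in>| Q \<longrightarrow> (x, v) \<in> role_ext (abox_interp A) r"
    "hm v [] \<in> concept_ext J y'" unfolding in_J.simps m(2) by blast+
  \<comment> \<open>The literal only provides some role set with code \<open>2 ^ u\<close>; decoding
    shows that it is a singleton, and thus that \<open>u\<close> is the code of a role.\<close>
  have "set_decode (2 ^ u) = code_role ` fset Q" unfolding Q(2) by (simp add: code_roles_def set_encode_inverse)
  moreover have "set_decode (2 ^ u) = {u}" using set_encode_inverse[of "{u}"] by simp
  ultimately obtain u' where u': "u = code_role u'" "u' |\<in>| Q" by auto
  have xv: "(x, v) \<in> role_ext (abox_interp A) u'" using Q(3) u'(2) by blast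
  \<comment> \<open>Roles of the canonical interpretation come from assertions. Hence both ends are
    individuals, which \<open>hm\<close> leaves fixed, and \<open>J\<close> satisfies the
    assertion.\<close>
  obtain a b where ab: "x = Ind a" "v = Ind b" "(Ind a, Ind b) \<in> role_ext J u'"
  proof (cases u')
    case (Fwd P)
    thus ?thesis using xv J that by (fastforce simp: abox_interp_def is_model_def)
  next
    case (Inv P)
    thus ?thesis using xv J that by (fastforce simp: abox_interp_def is_model_def)
  qed
  have "sub_role T u' (inv_role s')" using all_nbr m u' by simp
  hence "(Ind a, Ind b) \<in> role_ext J (inv_role s')" using sub_role_model[OF _ J ab(3)] by blast
  hence "Ind a \<in> concept_ext J z'" using sat_J[OF m(1)] Q(4) ab by auto
  hence "in_J x p (CN z)" unfolding in_J.simps using Q(1) ab(1) m(4) by simp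
  thus ?thesis using all_nbr by simp
next
  case (assertion B)
  obtain a where a: "p = []" "x = Ind a" "ConceptAssertion B a \<in> A"
    using lit(1) assertion by (auto simp: abox_interp_def)
  have "Ind a \<in> cext J B" using J a by (fastforce simp: is_model_def)
  moreover have "B' = Con B" if "prod_encode (2, B) = code_concept B'" for B'
    using that by (cases B') (auto simp: prod_encode_eq)
  ultimately have "in_J x p (CN (prod_encode (2, B)))" unfolding in_J.simps using a by fastforce
  thus ?thesis using assertion by simp
qed

lemma in_J: "n \<in> th A x p \<Longrightarrow> basic n \<Longrightarrow> valid p \<Longrightarrow> in_J x p (snd n)"
proof (rule th_induct[where A = A and P = "\<lambda>x p n. in_J x p (snd n)"], goal_cases)
  case (4 x p h a b d)
  show ?case
  proof (cases "(h, a, b, d) \<in> concept_rules t W")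
    case True
    thus ?thesis using concept_rule_in_J[of "fst h" "snd h" "fst a" "snd a" "fst b" "snd b" "fst d" "snd d" x p] 4 by simp
  next
    case False
    hence "(h, a, b, d) \<in> select_rules t W \<union> formula_rules t c W" using 4 by (simp add: pos_rules_def)
    thus ?thesis
      by (cases h; cases a; cases b; cases d) (auto elim: select_rules.cases formula_rules.cases)
  qed
next
  case (5 x p h a b)
  thus ?case
    by (cases h; cases a; cases b) (auto simp: neg_rules_def elim: select_neg_rules.cases formula_neg_rules.cases)
qed

lemma has_sound: "has x p B \<Longrightarrow> valid p \<Longrightarrow> exists_in x p \<and> hm x p \<in> concept_ext J B"
  using in_J[of "(0, CN (code_concept B))" x p] by simp

lemma ex_sound: "ex x p \<Longrightarrow> valid p \<Longrightarrow> exists_in x p"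
  using in_J[of "(0, Ex)" x p] by simp

end

end

end

subsection \<open>Selection of the children that are kept\<close>

lemma select_rule_heads:
  "((0, NSub i X), a, b, d) \<in> pos_rules t c W \<Longrightarrow> \<exists>n. n < W \<and> n \<le> t \<and> n \<notin> set_decode X \<and> a = (0, Kid i (CN n))"
  "((0, NSub i X), a, b) \<notin> neg_rules W"
  "((1, Sub i X), a, b, d) \<notin> pos_rules t c W"
  "((1, Sub i X), a, b) \<in> neg_rules W \<Longrightarrow> b = (0, NSub i X)"
  "((1, Lacks X), a, b, d) \<notin> pos_rules t c W"
  "((1, Lacks X), a, b) \<in> neg_rules W \<Longrightarrow> \<exists>n. n \<in> set_decode X \<and> b = (0, CN n)"
  "((2, Has X), a, b, d) \<notin> pos_rules t c W"
  "((2, Has X), a, b) \<in> neg_rules W \<Longrightarrow> X < W \<and> a = (0, Ex) \<and> b = (1, Lacks X)"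
  "((3, Cand i), a, b, d) \<in> pos_rules t c W \<Longrightarrow> a = (0, IsKid i) \<and> b = (0, Ex) \<and> d = (3, Par Act)"
  "((3, Cand i), a, b) \<notin> neg_rules W"
  "((3, Act), a, b, d) \<in> pos_rules t c W \<Longrightarrow> a = (0, Root)"
  "((3, Act), a, b) \<in> neg_rules W \<Longrightarrow> \<exists>i. a = (3, Cand i) \<and> b = (2, Par (Dom i))"
  "((0, Ex), a, b, d) \<in> pos_rules t c W \<Longrightarrow>
     a = (0, Root) \<or> (\<exists>e r g. ex_code e r g \<in> set_decode t \<and> a = (0, IsKid (ex_code e r g)) \<and> b = (0, Par (CN e)))"
  "((0, Ex), a, b) \<notin> neg_rules W"
  "((2, Dom i), a, b) \<notin> neg_rules W"
  by (cases a; cases b; cases d;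
      auto simp: pos_rules_def neg_rules_def elim: concept_rules.cases select_rules.cases formula_rules.cases
        select_neg_rules.cases formula_neg_rules.cases; fail)+

lemma Dom_rule_heads:
  assumes "((2, Dom i), a, b, d) \<in> pos_rules t c W"
  shows "\<exists>e r g X. i = ex_code e r g \<and> X < W \<and>
    ((\<exists>u. role_le t u r \<and> a = (2, Nbr (2 ^ u) (Has X)) \<and> b = (1, Sub i X)) \<or>
     (\<exists>e' r' g'. ex_code e' r' g' \<in> set_decode t \<and> role_le t (inv_code r') r \<and>
        a = (0, IsKid (ex_code e' r' g')) \<and> b = (2, Par (Has X)) \<and> d = (1, Sub i X)) \<or>
     (\<exists>e' r' g'. ex_code e' r' g' \<in> set_decode t \<and> role_le t r' r \<and>
        a = (2, Kid (ex_code e' r' g') (Has X)) \<and> b = (1, Sub i X) \<and>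
        (ex_code e' r' g' < i \<or> \<not> role_le t r r' \<or> X < 2 ^ Suc t \<and> d = (1, Kid i (Lacks X)))))"
proof -
  obtain a1 a2 b1 b2 d1 d2 where abd: "a = (a1, a2)" "b = (b1, b2)" "d = (d1, d2)"
    by (cases a; cases b; cases d) blast
  have "((2, Dom i), (a1, a2), (b1, b2), (d1, d2)) \<in> select_rules t W"
    using assms unfolding pos_rules_def abd by (auto elim: concept_rules.cases formula_rules.cases)
  thus ?thesis
  proof cases
    case (dom_nbr e r g u X)
    thus ?thesis unfolding abd by (intro exI[of _ e] exI[of _ r] exI[of _ g] exI[of _ X]) auto
  next
    case (dom_parent e r g e' r' g' X)
    thus ?thesis unfolding abd by (intro exI[of _ e] exI[of _ r] exI[of _ g] exI[of _ X]) auto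
  next
    case (dom_sibling e r g e' r' g' X)
    thus ?thesis unfolding abd by (intro exI[of _ e] exI[of _ r] exI[of _ g] exI[of _ X]) auto
  next
    case (dom_strict e r g e' r' g' X)
    thus ?thesis unfolding abd by (intro exI[of _ e] exI[of _ r] exI[of _ g] exI[of _ X]) auto
  qed
qed

locale kb = rewriting +
  fixes A :: abox
  assumes finite_A: "finite A" and consistent: "consistent T A"
begin

text \<open>The type of a node, cut down to codes up to \<open>t\<close>. All concepts of the TBox
  survive the cut, and the code of the set stays below \<open>2 ^ Suc t\<close> for every ABox, so
  that it is among the sets \<open>X\<close> of the rules.\<close>

abbreviation concepts_at :: "obj \<Rightarrow> nat list \<Rightarrow> nat set" where
  "concepts_at x p \<equiv> {n. n \<le> t \<and> (0, CN n) \<in> th A x p}"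

lemma two_pow_t_less_W: "2 ^ Suc t < W"
proof -
  have "Suc t \<le> Suc (Suc (prod_encode (1, t + c) + t + c))" by simp
  hence "(2::nat) ^ Suc t \<le> 2 ^ Suc (Suc (prod_encode (1, t + c) + t + c))" by (intro power_increasing) auto
  thus ?thesis by (intro W_bounds(5)) linarith
qed

lemma concepts_at_code:
  "set_encode (concepts_at x p) < W" "set_encode (concepts_at x p) < 2 ^ Suc t"
  "set_decode (set_encode (concepts_at x p)) = concepts_at x p"
proof -
  have "concepts_at x p \<subseteq> {..<Suc t}" by auto
  from set_encode_mono_less[OF this] show "set_encode (concepts_at x p) < 2 ^ Suc t" .
  thus "set_encode (concepts_at x p) < W" using two_pow_t_less_W by linarith
  have "finite (concepts_at x p)" by (rule finite_subset[of _ "{..t}"]) auto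
  thus "set_decode (set_encode (concepts_at x p)) = concepts_at x p" by (rule set_encode_inverse)
qed

lemma pos_cases:
  assumes "n \<in> th A x p" "valid p" "basic n" "\<And>a b. (n, a, b) \<notin> neg_rules W"
  obtains a b d where "(n, a, b, d) \<in> pos_rules t c W" "lits A (holds A) x p a" "lits A (holds A) x p b"
    "lits A (holds A) x p d"
  using th_cases[OF assms(1,3,2)] assms(4) by blast

lemma neg_cases:
  assumes "n \<in> th A x p" "valid p" "basic n" "\<And>a b d. (n, a, b, d) \<notin> pos_rules t c W"
  obtains a b where "(n, a, b) \<in> neg_rules W" "lits A (holds A) x p a" "\<not> lits A (holds A) x p b"
  using th_cases[OF assms(1,3,2)] assms(4) by blast

lemma select_rule:
  "valid p \<Longrightarrow> (h, a, b, d) \<in> select_rules t W \<Longrightarrow> lits A (holds A) x p a \<Longrightarrow> lits A (holds A) x p b \<Longrightarrow>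
   lits A (holds A) x p d \<Longrightarrow> h \<in> th A x p"
  using th_pos[of p h a b d A x] unfolding pos_rules_def by blast

lemma select_neg_rule:
  "valid p \<Longrightarrow> (h, a, b) \<in> select_neg_rules W \<Longrightarrow> lits A (holds A) x p a \<Longrightarrow> \<not> lits A (holds A) x p b \<Longrightarrow>
   h \<in> th A x p"
  using th_neg[of p h a b A x] unfolding neg_rules_def by blast

section \<open>Meaning of the names that select children\<close>

lemma NSub_iff:
  assumes "valid p" "i < W" "X < W"
  shows "(0, NSub i X) \<in> th A x p \<longleftrightarrow> \<not> concepts_at x (i # p) \<subseteq> set_decode X"
proof
  assume "(0, NSub i X) \<in> th A x p"
  then obtain a b d where "((0, NSub i X), a, b, d) \<in> pos_rules t c W" "lits A (holds A) x p a"
    by (rule pos_cases) (use assms select_rule_heads in auto)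
  thus "\<not> concepts_at x (i # p) \<subseteq> set_decode X" using select_rule_heads(1) by fastforce
next
  assume "\<not> concepts_at x (i # p) \<subseteq> set_decode X"
  then obtain n where n: "n \<le> t" "(0, CN n) \<in> th A x (i # p)" "n \<notin> set_decode X" by blast
  show "(0, NSub i X) \<in> th A x p"
    by (rule select_rule[OF assms(1) select_rules.not_sub[OF assms(2,3) _ n(1,3)]]) (use n W_bounds(1) in auto)
qed

lemma Sub_iff:
  assumes "valid p" "i < W" "X < W"
  shows "(1, Sub i X) \<in> th A x p \<longleftrightarrow> concepts_at x (i # p) \<subseteq> set_decode X"
proof
  assume "(1, Sub i X) \<in> th A x p"
  then obtain a b where "((1, Sub i X), a, b) \<in> neg_rules W" "\<not> lits A (holds A) x p b"
    by (rule neg_cases) (use assms select_rule_heads in auto)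
  hence "(0, NSub i X) \<notin> th A x p" using select_rule_heads(4) by fastforce
  thus "concepts_at x (i # p) \<subseteq> set_decode X" using NSub_iff[OF assms] by simp
next
  assume "concepts_at x (i # p) \<subseteq> set_decode X"
  hence "(0, NSub i X) \<notin> th A x p" using NSub_iff[OF assms] by simp
  thus "(1, Sub i X) \<in> th A x p"
    by (intro select_neg_rule[OF assms(1) select_neg_rules.sub[OF assms(2,3)]]) auto
qed

lemma Lacks_iff:
  assumes "valid p" "X < W"
  shows "(1, Lacks X) \<in> th A x p \<longleftrightarrow> (\<exists>n\<in>set_decode X. (0, CN n) \<notin> th A x p)"
proof
  assume "(1, Lacks X) \<in> th A x p"
  then obtain a b where "((1, Lacks X), a, b) \<in> neg_rules W" "\<not> lits A (holds A) x p b"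
    by (rule neg_cases) (use assms select_rule_heads in auto)
  thus "\<exists>n\<in>set_decode X. (0, CN n) \<notin> th A x p" using select_rule_heads(6) by fastforce
next
  assume "\<exists>n\<in>set_decode X. (0, CN n) \<notin> th A x p"
  then obtain n where n: "n \<in> set_decode X" "(0, CN n) \<notin> th A x p" by blast
  have "n < W" using member_less[OF n(1)] assms(2) by linarith
  thus "(1, Lacks X) \<in> th A x p"
    by (intro select_neg_rule[OF assms(1) select_neg_rules.lacks[OF _ assms(2) n(1)]]) (use n in auto)
qed

lemma HasD:
  assumes "valid p" "(2, Has X) \<in> th A x p"
  shows "X < W \<and> ex A x p \<and> (\<forall>n\<in>set_decode X. (0, CN n) \<in> th A x p)"
proof -
  obtain a b where "((2, Has X), a, b) \<in> neg_rules W" "lits A (holds A) x p a" "\<not> lits A (holds A) x p b"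
    by (rule neg_cases[OF assms(2,1)]) (use assms select_rule_heads in auto)
  moreover from this have "X < W" "a = (0, Ex)" "b = (1, Lacks X)" using select_rule_heads(8) by blast+
  ultimately show ?thesis using Lacks_iff[OF assms(1)] by auto
qed

lemma HasI:
  assumes "valid p" "X < W" "ex A x p" "\<And>n. n \<in> set_decode X \<Longrightarrow> (0, CN n) \<in> th A x p"
  shows "(2, Has X) \<in> th A x p"
  by (rule select_neg_rule[OF assms(1) select_neg_rules.has[OF assms(2)]]) (use assms Lacks_iff in auto)

lemma act_root [simp]: "act A x []"
  by (rule select_rule[OF _ select_rules.act_root]) auto

lemma act_kid_iff:
  assumes "valid (i # p)" "i < W"
  shows "act A x (i # p) \<longleftrightarrow> ex A x (i # p) \<and> act A x p \<and> (2, Dom i) \<notin> th A x p"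
proof
  assume "act A x (i # p)"
  then consider a b d where "((3, Act), a, b, d) \<in> pos_rules t c W" "lits A (holds A) x (i # p) a"
    | a b where "((3, Act), a, b) \<in> neg_rules W" "lits A (holds A) x (i # p) a" "\<not> lits A (holds A) x (i # p) b"
    using th_cases[of "(3, Act)" A x "i # p"] assms(1) by auto
  thus "ex A x (i # p) \<and> act A x p \<and> (2, Dom i) \<notin> th A x p"
  proof cases
    case 1
    thus ?thesis using select_rule_heads(11)[OF 1(1)] by auto
  next
    case 2
    obtain j where j: "a = (3, Cand j)" "b = (2, Par (Dom j))" using select_rule_heads(12)[OF 2(1)] by blast
    have "(3, Cand j) \<in> th A x (i # p)" using 2(2) j by simp
    then obtain a' b' d' where r: "((3, Cand j), a', b', d') \<in> pos_rules t c W" "lits A (holds A) x (i # p) a'"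
      "lits A (holds A) x (i # p) b'" "lits A (holds A) x (i # p) d'"
      by (rule pos_cases) (use assms select_rule_heads in auto)
    have "a' = (0, IsKid j)" "b' = (0, Ex)" "d' = (3, Par Act)" using select_rule_heads(9)[OF r(1)] by auto
    thus ?thesis using r 2(3) j by auto
  qed
next
  assume *: "ex A x (i # p) \<and> act A x p \<and> (2, Dom i) \<notin> th A x p"
  have "(3, Cand i) \<in> th A x (i # p)"
    by (rule select_rule[OF assms(1) select_rules.cand[OF assms(2)]]) (use * in auto)
  thus "act A x (i # p)"
    by (intro select_neg_rule[OF assms(1) select_neg_rules.act[OF assms(2)]]) (use * in auto)
qed

lemma ex_good: "ex A x (i # p) \<Longrightarrow> valid (i # p) \<Longrightarrow> \<exists>e r g. ExIncl e r g \<in> T \<and> i = code_axiom (ExIncl e r g)"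
proof (erule pos_cases)
  fix a b d assume "((0, Ex), a, b, d) \<in> pos_rules t c W" "lits A (holds A) x (i # p) a"
  thus "\<exists>e r g. ExIncl e r g \<in> T \<and> i = code_axiom (ExIncl e r g)"
    using select_rule_heads(13)[of a b d t c W] by (fastforce simp: mem_t_codes code_axiom_codes)
qed (use select_rule_heads in auto)

lemma act_good: "act A x p \<Longrightarrow> valid p \<Longrightarrow> good_path p"
proof (induction p)
  case (Cons i p)
  have "ex A x (i # p)"
  proof -
    consider a b d where "((3, Act), a, b, d) \<in> pos_rules t c W" "lits A (holds A) x (i # p) a"
      | a b where "((3, Act), a, b) \<in> neg_rules W" "lits A (holds A) x (i # p) a"
      using th_cases[of "(3, Act)" A x "i # p"] Cons.prems by auto
    thus ?thesis
    proof cases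
      case 1
      thus ?thesis using select_rule_heads(11)[OF 1(1)] by auto
    next
      case 2
      obtain j where j: "a = (3, Cand j)" using select_rule_heads(12)[OF 2(1)] by blast
      have "(3, Cand j) \<in> th A x (i # p)" using 2(2) j by simp
      then obtain a' b' d' where r: "((3, Cand j), a', b', d') \<in> pos_rules t c W" "lits A (holds A) x (i # p) b'"
        by (rule pos_cases) (use Cons.prems select_rule_heads in auto)
      thus ?thesis using select_rule_heads(9)[OF r(1)] by auto
    qed
  qed
  then obtain e r g where i: "ExIncl e r g \<in> T" "i = code_axiom (ExIncl e r g)"
    using ex_good Cons.prems by blast
  hence "i < W" using axiom_less_W by simp
  hence "act A x p" using act_kid_iff[OF Cons.prems(2)] Cons.prems(1) by blast
  thus ?case using Cons i by auto
qed simp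

text \<open>The guessed set \<open>X\<close> lies between the two types and so can be eliminated.
  The introduction lemmas below go back by inserting one of the types for it.\<close>

lemma DomD:
  assumes "(2, Dom i) \<in> th A x p" "good_path p" "ExIncl e r g \<in> T" "i = code_axiom (ExIncl e r g)"
  shows "(p = [] \<and> (\<exists>y u. (x, y) \<in> role_ext (abox_interp A) u \<and> sub_role T u r \<and> concepts_at x (i # p) \<subseteq> concepts_at y [])) \<or>
    (\<exists>e' r' g' q. p = code_axiom (ExIncl e' r' g') # q \<and> ExIncl e' r' g' \<in> T \<and> sub_role T (inv_role r') r \<and>
      concepts_at x (i # p) \<subseteq> concepts_at x q) \<or>
    (\<exists>e' r' g' k. k = code_axiom (ExIncl e' r' g') \<and> ExIncl e' r' g' \<in> T \<and> sub_role T r' r \<and> ex A x (k # p) \<and>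
      concepts_at x (i # p) \<subseteq> concepts_at x (k # p) \<and>
      (k < i \<or> \<not> sub_role T r r' \<or> \<not> concepts_at x (k # p) \<subseteq> concepts_at x (i # p)))"
proof -
  have valid: "valid p" using assms(2) by (rule valid_good_path)
  obtain a b d where rule: "((2, Dom i), a, b, d) \<in> pos_rules t c W" and
    l: "lits A (holds A) x p a" "lits A (holds A) x p b" "lits A (holds A) x p d"
    by (rule pos_cases[OF assms(1) valid]) (use select_rule_heads in auto)
  obtain e0 r0 g0 X where i: "i = ex_code e0 r0 g0" "X < W" and
    cs: "(\<exists>u. role_le t u r0 \<and> a = (2, Nbr (2 ^ u) (Has X)) \<and> b = (1, Sub i X)) \<or>
     (\<exists>e' r' g'. ex_code e' r' g' \<in> set_decode t \<and> role_le t (inv_code r') r0 \<and>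
        a = (0, IsKid (ex_code e' r' g')) \<and> b = (2, Par (Has X)) \<and> d = (1, Sub i X)) \<or>
     (\<exists>e' r' g'. ex_code e' r' g' \<in> set_decode t \<and> role_le t r' r0 \<and>
        a = (2, Kid (ex_code e' r' g') (Has X)) \<and> b = (1, Sub i X) \<and>
        (ex_code e' r' g' < i \<or> \<not> role_le t r0 r' \<or> X < 2 ^ Suc t \<and> d = (1, Kid i (Lacks X))))"
    using Dom_rule_heads[OF rule] by blast
  have iW: "i < W" using axiom_less_W[OF assms(3)] assms(4) by simp
  have r0: "r0 = code_role r" using i assms(4) by (simp add: code_axiom_codes)
  have sub: "concepts_at x (i # p) \<subseteq> set_decode X" if "(1, Sub i X) \<in> th A x p"
    using that Sub_iff[OF valid iW i(2)] by simp
  have vi: "valid (i # p)" using valid iW W_le_M by simp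
  from cs consider
      (nbr) u where "role_le t u r0" "a = (2, Nbr (2 ^ u) (Has X))" "b = (1, Sub i X)"
    | (parent) e' r' g' where "ex_code e' r' g' \<in> set_decode t" "role_le t (inv_code r') r0"
        "a = (0, IsKid (ex_code e' r' g'))" "b = (2, Par (Has X))" "d = (1, Sub i X)"
    | (sibling) e' r' g' where "ex_code e' r' g' \<in> set_decode t" "role_le t r' r0"
        "a = (2, Kid (ex_code e' r' g') (Has X))" "b = (1, Sub i X)"
        "ex_code e' r' g' < i \<or> \<not> role_le t r0 r' \<or> X < 2 ^ Suc t \<and> d = (1, Kid i (Lacks X))"
    by blast
  thus ?thesis
  proof cases
    case u: nbr
    obtain Q y where Q: "p = []" "2 ^ u = code_roles Q" "\<forall>r. r |\<in>| Q \<longrightarrow> (x, y) \<in> role_ext (abox_interp A) r"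
      "(2, Has X) \<in> th A y []" using l(1) u(2) by auto
    have "set_decode (2 ^ u) = code_role ` fset Q" unfolding Q(2) by (simp add: code_roles_def set_encode_inverse)
    moreover have "set_decode (2 ^ u) = {u}" using set_encode_inverse[of "{u}"] by simp
    ultimately obtain u' where u': "u = code_role u'" "u' |\<in>| Q" by auto
    have "sub_role T u' r" using u(1) by (simp add: r0 u'(1))
    moreover have "concepts_at x (i # p) \<subseteq> concepts_at y []"
      using sub l(2) u(3) HasD[OF _ Q(4)] by auto
    ultimately show ?thesis using Q(1,3) u'(2) by blast
  next
    case u: parent
    then obtain e'' r'' g'' where m: "ExIncl e'' r'' g'' \<in> T" "e' = code_concept e''" "r' = code_role r''" "g' = code_concept g''"
      by (auto simp: mem_t_codes)
    obtain q where q: "p = code_axiom (ExIncl e'' r'' g'') # q" "(2, Has X) \<in> th A x q"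
      using l(1,2) u(3,4) by (auto simp: m code_axiom_codes)
    have "sub_role T (inv_role r'') r" using u(2) by (simp add: r0 m)
    moreover have "concepts_at x (i # p) \<subseteq> concepts_at x q"
      using sub l(3) u(5) HasD[OF _ q(2)] valid q(1) by auto
    ultimately show ?thesis using q(1) m(1) by blast
  next
    case u: sibling
    note strict = u(5)
    from u(1) obtain e'' r'' g'' where m: "ExIncl e'' r'' g'' \<in> T" "e' = code_concept e''" "r' = code_role r''" "g' = code_concept g''"
      by (auto simp: mem_t_codes)
    let ?k = "code_axiom (ExIncl e'' r'' g'')"
    have k: "ex_code e' r' g' = ?k" by (simp add: m code_axiom_codes)
    have vk: "valid (?k # p)" using valid axiom_less_W[OF m(1)] W_le_M by simp
    have "(2, Has X) \<in> th A x (?k # p)" using l(1) u(3) k by simp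
    note has = HasD[OF vk this]
    have ss: "concepts_at x (i # p) \<subseteq> concepts_at x (?k # p)" using sub l(2) u(4) has by auto
    have "?k < i \<or> \<not> sub_role T r r'' \<or> \<not> concepts_at x (?k # p) \<subseteq> concepts_at x (i # p)"
    proof -
      consider "?k < i" | "\<not> sub_role T r r''" | "X < 2 ^ Suc t" "d = (1, Kid i (Lacks X))"
        using strict unfolding k unfolding r0 m(3) role_le_code by blast
      thus ?thesis
      proof cases
        case 3
        hence "(1, Lacks X) \<in> th A x (i # p)" using l(3) by simp
        then obtain n where n: "n \<in> set_decode X" "(0, CN n) \<notin> th A x (i # p)" using Lacks_iff[OF vi i(2)] by blast
        \<comment> \<open>By the bound on \<open>X\<close> the concept that the child lacks belongs
          to the range in which types are compared.\<close>
        have "n \<le> t" using set_decode_less[OF 3(1) n(1)] by simp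
        thus ?thesis using n has by blast
      qed auto
    qed
    moreover have "sub_role T r'' r" using u(2) by (simp add: r0 m)
    ultimately show ?thesis using m(1) ss has by blast
  qed
qed

lemma Dom_nbrI:
  assumes "ExIncl e r g \<in> T" "(x, y) \<in> role_ext (abox_interp A) u" "sub_role T u r"
    "concepts_at x [code_axiom (ExIncl e r g)] \<subseteq> concepts_at y []"
  shows "(2, Dom (code_axiom (ExIncl e r g))) \<in> th A x []"
proof -
  let ?i = "code_axiom (ExIncl e r g)" and ?X = "set_encode (concepts_at x [code_axiom (ExIncl e r g)])"
  have i: "?i < W" using axiom_less_W[OF assms(1)] .
  note l = ExIncl_less[OF assms(1)] W_bounds(1)
  have u: "code_role u < W" using sub_role_source[OF assms(3)] prod_1_t_less_W l by auto
  have "(2, Has ?X) \<in> th A y []" by (rule HasI) (use concepts_at_code assms(4) in auto)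
  hence n: "lits A (holds A) x [] (2, Nbr (2 ^ code_role u) (Has ?X))"
    using assms(2) pow_less_M[OF u] by (auto simp flip: code_roles_single)
  have "(1, Sub ?i ?X) \<in> th A x []" using Sub_iff[of "[]" ?i ?X] i concepts_at_code by simp
  thus ?thesis unfolding code_axiom_codes
    using select_rule[OF _ select_rules.dom_nbr[OF _ _ _ u concepts_at_code(1)], of "[]" "code_concept e" "code_role r" "code_concept g" x x "[code_axiom (ExIncl e r g)]"]
      n l assms(1,3) by (auto simp: mem_t_codes code_axiom_codes)
qed

lemma Dom_parentI:
  assumes "ExIncl e r g \<in> T" "ExIncl e' r' g' \<in> T" "good_path q" "ex A x q" "sub_role T (inv_role r') r"
    "p = code_axiom (ExIncl e' r' g') # q"
    "concepts_at x (code_axiom (ExIncl e r g) # p) \<subseteq> concepts_at x q"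
  shows "(2, Dom (code_axiom (ExIncl e r g))) \<in> th A x p"
proof -
  let ?i = "code_axiom (ExIncl e r g)" and ?X = "set_encode (concepts_at x (code_axiom (ExIncl e r g) # p))"
  have i: "?i < W" using axiom_less_W[OF assms(1)] .
  note l = ExIncl_less[OF assms(1)] ExIncl_less[OF assms(2)] W_bounds(1)
  have v: "valid p" using assms(2,3,6) by (intro valid_good_path) auto
  have n: "(2, Has ?X) \<in> th A x q" by (rule HasI) (use concepts_at_code assms valid_good_path in auto)
  have "(1, Sub ?i ?X) \<in> th A x p" using Sub_iff[OF v i] concepts_at_code by simp
  thus ?thesis unfolding code_axiom_codes
    using select_rule[OF v select_rules.dom_parent[OF _ _ _ _ _ _ concepts_at_code(1)], of "code_concept e" "code_role r" "code_concept g"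
      "code_concept e'" "code_role r'" "code_concept g'" x x "code_axiom (ExIncl e r g) # p"]
      n l assms(1,2,5,6) by (auto simp: mem_t_codes code_axiom_codes)
qed

lemma Dom_siblingI:
  assumes "ExIncl e r g \<in> T" "ExIncl e' r' g' \<in> T" "good_path p" "sub_role T r' r"
    "i = code_axiom (ExIncl e r g)" "k = code_axiom (ExIncl e' r' g')" "ex A x (k # p)"
    "concepts_at x (i # p) \<subseteq> concepts_at x (k # p)"
    "k < i \<or> \<not> sub_role T r r' \<or> \<not> concepts_at x (k # p) \<subseteq> concepts_at x (i # p)"
  shows "(2, Dom i) \<in> th A x p"
proof -
  have i: "i < W" "k < W" using axiom_less_W assms(1,2,5,6) by auto
  note l = ExIncl_less[OF assms(1)] ExIncl_less[OF assms(2)] W_bounds(1)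
  have v: "valid p" "valid (k # p)" "valid (i # p)" using valid_good_path[OF assms(3)] i W_le_M by auto
  have ik: "i = ex_code (code_concept e) (code_role r) (code_concept g)"
    "k = ex_code (code_concept e') (code_role r') (code_concept g')" using assms(5,6) by (simp_all add: code_axiom_codes)
  have m: "i \<in> set_decode t" "k \<in> set_decode t" using assms(1,2,5,6) code_axiom_mem by auto
  show ?thesis
  proof (cases "k < i \<or> \<not> sub_role T r r'")
    case True
    let ?X = "set_encode (concepts_at x (i # p))"
    have n: "(2, Has ?X) \<in> th A x (k # p)" by (rule HasI) (use concepts_at_code assms v in auto)
    have s: "(1, Sub i ?X) \<in> th A x p" using Sub_iff[OF v(1) i(1)] concepts_at_code by simp
    show ?thesis unfolding ik(1)
      by (rule select_rule[OF v(1) select_rules.dom_sibling[of "code_concept e" W "code_role r" "code_concept g"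
        "code_concept e'" "code_role r'" "code_concept g'" ?X]])
        (use n s l m concepts_at_code True assms(4) in \<open>simp_all flip: ik\<close>)
  next
    case False
    hence st: "\<not> concepts_at x (k # p) \<subseteq> concepts_at x (i # p)" using assms(9) by blast
    \<comment> \<open>Here \<open>X\<close> has to be the larger type, that of \<open>k\<close>: its
      surplus is what \<open>Lacks\<close> finds missing at \<open>i\<close>.\<close>
    let ?X = "set_encode (concepts_at x (k # p))"
    have n: "(2, Has ?X) \<in> th A x (k # p)" by (rule HasI) (use concepts_at_code assms v in auto)
    have s: "(1, Sub i ?X) \<in> th A x p" using Sub_iff[OF v(1) i(1)] concepts_at_code assms(8) by simp
    have lk: "(1, Lacks ?X) \<in> th A x (i # p)" using Lacks_iff[OF v(3)] concepts_at_code st by auto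
    show ?thesis unfolding ik(1)
      by (rule select_rule[OF v(1) select_rules.dom_strict[of "code_concept e" W "code_role r" "code_concept g"
        "code_concept e'" "code_role r'" "code_concept g'" ?X]])
        (use n s lk l m concepts_at_code assms(4) in \<open>simp_all flip: ik\<close>)
  qed
qed

subsection \<open>The model\<close>

definition node :: "individual \<Rightarrow> nat list \<Rightarrow> bool" where
  "node a p \<longleftrightarrow> good_path p \<and> act A (Ind a) p"

definition el :: "individual \<Rightarrow> nat list \<Rightarrow> obj" where
  "el a p = (if p = [] then Ind a else Blank (prod_encode (a, list_encode p)))"

lemma el_eq [simp]: "el a p = el b q \<longleftrightarrow> a = b \<and> p = q"
  by (auto simp: el_def prod_encode_eq list_encode_eq)

lemma el_Nil [simp]: "el a [] = Ind a" "el a p = Ind b \<longleftrightarrow> a = b \<and> p = []"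
  by (auto simp: el_def)

definition rel :: "individual \<Rightarrow> nat list \<Rightarrow> individual \<Rightarrow> nat list \<Rightarrow> role \<Rightarrow> bool" where
  "rel a p b q r \<longleftrightarrow>
     (p = [] \<and> q = [] \<and> (\<exists>u. (Ind a, Ind b) \<in> role_ext (abox_interp A) u \<and> sub_role T u r)) \<or>
     (a = b \<and> (\<exists>e s g. ExIncl e s g \<in> T \<and> q = code_axiom (ExIncl e s g) # p \<and> sub_role T s r)) \<or>
     (a = b \<and> (\<exists>e s g. ExIncl e s g \<in> T \<and> p = code_axiom (ExIncl e s g) # q \<and> sub_role T (inv_role s) r))"

text \<open>The ABox may use concept names beyond \<open>W\<close>, for which no rule derives
  \<open>CN\<close>; the first disjunct adds them. They do not interact with the TBox.\<close>

definition U :: interp where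
  "U = \<lparr>dom = {el a p |a p. node a p},
    cext = (\<lambda>B. {el a p |a p. node a p \<and> (p = [] \<and> ConceptAssertion B a \<in> A \<or> has A (Ind a) p (Con B))}),
    rext = (\<lambda>P. {(el a p, el b q) |a p b q. node a p \<and> node b q \<and> rel a p b q (Fwd P)})\<rparr>"

lemma node_Nil [simp]: "node a []"
  by (simp add: node_def)

lemma node_valid: "node a p \<Longrightarrow> valid p"
  using valid_good_path node_def by blast

lemma node_kid: "node a (k # p) \<Longrightarrow> node a p \<and> ex A (Ind a) (k # p) \<and> (2, Dom k) \<notin> th A (Ind a) p"
  using act_kid_iff[of k p "Ind a"] valid_good_path[of "k # p"] axiom_less_W unfolding node_def by fastforce

lemma node_ex: "node a p \<Longrightarrow> ex A (Ind a) p"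
  by (cases p) (auto dest: node_kid)

lemma rel_mono: "rel a p b q r \<Longrightarrow> sub_role T r s \<Longrightarrow> rel a p b q s"
  unfolding rel_def by (elim disjE conjE exE) (blast intro: rtranclp_trans)+

lemma rel_inv: "rel a p b q (inv_role r) \<longleftrightarrow> rel b q a p r"
proof -
  have 1: "rel b q a p (inv_role r)" if "rel a p b q r" for a p b q r
    using that unfolding rel_def
  proof (elim disjE conjE exE)
    fix u assume *: "p = []" "q = []" "(Ind a, Ind b) \<in> role_ext (abox_interp A) u" "sub_role T u r"
    hence "(Ind b, Ind a) \<in> role_ext (abox_interp A) (inv_role u)" by simp
    thus "(q = [] \<and> p = [] \<and> (\<exists>u. (Ind b, Ind a) \<in> role_ext (abox_interp A) u \<and> sub_role T u (inv_role r))) \<or>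
     (b = a \<and> (\<exists>e s g. ExIncl e s g \<in> T \<and> p = code_axiom (ExIncl e s g) # q \<and> sub_role T s (inv_role r))) \<or>
     (b = a \<and> (\<exists>e s g. ExIncl e s g \<in> T \<and> q = code_axiom (ExIncl e s g) # p \<and> sub_role T (inv_role s) (inv_role r)))"
      using * sub_role_inv by blast
  next
    fix e s g assume *: "a = b" "ExIncl e s g \<in> T" "q = code_axiom (ExIncl e s g) # p" "sub_role T s r"
    thus "(q = [] \<and> p = [] \<and> (\<exists>u. (Ind b, Ind a) \<in> role_ext (abox_interp A) u \<and> sub_role T u (inv_role r))) \<or>
     (b = a \<and> (\<exists>e s g. ExIncl e s g \<in> T \<and> p = code_axiom (ExIncl e s g) # q \<and> sub_role T s (inv_role r))) \<or>
     (b = a \<and> (\<exists>e s g. ExIncl e s g \<in> T \<and> q = code_axiom (ExIncl e s g) # p \<and> sub_role T (inv_role s) (inv_role r)))"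
      using sub_role_inv by blast
  next
    fix e s g assume *: "a = b" "ExIncl e s g \<in> T" "p = code_axiom (ExIncl e s g) # q" "sub_role T (inv_role s) r"
    hence "sub_role T s (inv_role r)" by (simp add: sub_role_inv_iff)
    thus "(q = [] \<and> p = [] \<and> (\<exists>u. (Ind b, Ind a) \<in> role_ext (abox_interp A) u \<and> sub_role T u (inv_role r))) \<or>
     (b = a \<and> (\<exists>e s g. ExIncl e s g \<in> T \<and> p = code_axiom (ExIncl e s g) # q \<and> sub_role T s (inv_role r))) \<or>
     (b = a \<and> (\<exists>e s g. ExIncl e s g \<in> T \<and> q = code_axiom (ExIncl e s g) # p \<and> sub_role T (inv_role s) (inv_role r)))"
      using * by blast
  qed
  show ?thesis using 1[of a p b q "inv_role r"] 1[of b q a p r] by auto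
qed

lemma dom_U: "d \<in> dom U \<longleftrightarrow> (\<exists>a p. node a p \<and> d = el a p)"
  by (auto simp: U_def)

lemma el_dom [simp]: "el a p \<in> dom U \<longleftrightarrow> node a p"
  by (auto simp: U_def)

lemma role_ext_U: "(d, e) \<in> role_ext U r \<longleftrightarrow> (\<exists>a p b q. node a p \<and> node b q \<and> d = el a p \<and> e = el b q \<and> rel a p b q r)"
proof (cases r)
  case (Fwd P)
  thus ?thesis by (auto simp: U_def)
next
  case (Inv P)
  hence r: "r = inv_role (Fwd P)" by simp
  show ?thesis unfolding r rel_inv by (auto simp: U_def)
qed

lemma role_ext_U_el [simp]:
  "(el a p, el b q) \<in> role_ext U r \<longleftrightarrow> node a p \<and> node b q \<and> rel a p b q r"
  by (auto simp: role_ext_U)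

lemma J_ex: "\<exists>J. is_model T A J"
  using consistent by (simp add: consistent_def)

lemma not_has_Bot: "valid p \<Longrightarrow> \<not> has A x p Bot"
proof
  assume *: "valid p" "has A x p Bot"
  obtain J where "is_model T A J" using J_ex ..
  from has_sound[OF this *(2,1)] show False by simp
qed

lemma concept_ext_U [simp]:
  assumes "code_concept B < W"
  shows "el a p \<in> concept_ext U B \<longleftrightarrow> node a p \<and> has A (Ind a) p B"
proof (cases B)
  case Top
  thus ?thesis using has_Top node_valid node_ex by auto
next
  case Bot
  thus ?thesis using not_has_Bot node_valid by auto
next
  case (Con C)
  have "C < W" using assms le_prod_encode_2[of C 2] unfolding Con by simp
  thus ?thesis using Con assertion_has by (auto simp: U_def)
qed

lemma interpretation_wf_U: "interpretation_wf U"
  unfolding interpretation_wf_def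
proof (intro conjI allI)
  show "range Ind \<subseteq> dom U" using el_dom[of _ "[]"] by auto
qed (auto simp: U_def)

lemma rel_has:
  assumes r: "rel a p b q r" and n: "node a p" "node b q" and all: "AllIncl e r g \<in> T" "has A (Ind a) p e"
  shows "has A (Ind b) q g"
proof -
  note v = node_valid[OF n(1)] node_valid[OF n(2)]
  from r consider u where "p = []" "q = []" "(Ind a, Ind b) \<in> role_ext (abox_interp A) u" "sub_role T u r"
    | e' s g' where "a = b" "ExIncl e' s g' \<in> T" "q = code_axiom (ExIncl e' s g') # p" "sub_role T s r"
    | e' s g' where "a = b" "ExIncl e' s g' \<in> T" "p = code_axiom (ExIncl e' s g') # q" "sub_role T (inv_role s) r"
    unfolding rel_def by blast
  thus ?thesis
  proof cases
    case 1
    thus ?thesis using all_nbr[OF all(1) 1(4)] all(2) by simp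
  next
    case 2
    thus ?thesis using all_down[OF v(1) 2(2) all(1) 2(4)] all(2) node_ex[OF n(2)] by simp
  next
    case 3
    hence "sub_role T s (inv_role r)" by (simp add: sub_role_inv_iff)
    thus ?thesis using all_up[OF v(2) 3(2) all(1)] all(2) 3 by simp
  qed
qed

text \<open>A redundant child is represented by the parent's parent, by a neighbour in the ABox, or by a
  sibling; siblings only get larger in the order of \<^const>\<open>Dom\<close>, so that this process ends.\<close>

lemma witness:
  assumes n: "node a p"
  shows "ExIncl e r g \<in> T \<Longrightarrow> i = code_axiom (ExIncl e r g) \<Longrightarrow> ex A (Ind a) (i # p) \<Longrightarrow>
    \<exists>b q. node b q \<and> rel a p b q r \<and> concepts_at (Ind a) (i # p) \<subseteq> concepts_at (Ind b) q"
proof (induction "(card T + Suc t - (card {\<alpha> \<in> T. \<exists>e' r' g'. \<alpha> = ExIncl e' r' g' \<and> sub_role T r r'} +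
      card (concepts_at (Ind a) (i # p)))) * W + i" arbitrary: e r g i rule: less_induct)
  case less
  \<comment> \<open>The measure is lexicographic. A dominating sibling has a smaller role, so
    \<open>up\<close> does not shrink, and a larger type, so \<open>w\<close> does not decrease;
    where \<open>w\<close> stays the same, the code of the axiom drops. Codes are below
    \<open>W\<close>, hence the factor \<open>W\<close>.\<close>
  define up where "up r = {\<alpha> \<in> T. \<exists>e' r' g'. \<alpha> = ExIncl e' r' g' \<and> sub_role T r r'}" for r
  define w where "w r i = card (up r) + card (concepts_at (Ind a) (i # p))" for r i
  have fin: "finite (up r)" "finite (concepts_at x q)" for r x q
    using finite_T by (auto simp: up_def intro: finite_subset[of _ "{..t}"])
  have bound: "w r i \<le> card T + Suc t" for r i
  proof -
    have "card (up r) \<le> card T" by (rule card_mono[OF finite_T]) (auto simp: up_def)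
    moreover have "card (concepts_at (Ind a) (i # p)) \<le> card {..t}" by (rule card_mono) auto
    ultimately show ?thesis by (simp add: w_def)
  qed
  have good: "good_path p" using n by (simp add: node_def)
  show ?case
  proof (cases "node a (i # p)")
    case True
    moreover have "rel a p a (i # p) r" using less.prems by (auto simp: rel_def)
    ultimately show ?thesis by blast
  next
    case False
    have v: "valid (i # p)" using valid_good_path[of "i # p"] good less.prems by auto
    have "(2, Dom i) \<in> th A (Ind a) p"
      using False act_kid_iff[OF v] axiom_less_W less.prems n unfolding node_def by auto
    from DomD[OF this good less.prems(1,2)] consider
        (nbr) y u where "p = []" "(Ind a, y) \<in> role_ext (abox_interp A) u" "sub_role T u r"
          "concepts_at (Ind a) (i # p) \<subseteq> concepts_at y []"
      | (parent) e' r' g' q where "p = code_axiom (ExIncl e' r' g') # q" "ExIncl e' r' g' \<in> T"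
          "sub_role T (inv_role r') r" "concepts_at (Ind a) (i # p) \<subseteq> concepts_at (Ind a) q"
      | (sibling) e' r' g' k where "k = code_axiom (ExIncl e' r' g')" "ExIncl e' r' g' \<in> T" "sub_role T r' r"
          "ex A (Ind a) (k # p)" "concepts_at (Ind a) (i # p) \<subseteq> concepts_at (Ind a) (k # p)"
          "k < i \<or> \<not> sub_role T r r' \<or> \<not> concepts_at (Ind a) (k # p) \<subseteq> concepts_at (Ind a) (i # p)"
      by blast
    thus ?thesis
    proof cases
      case *: nbr
      then obtain b where "y = Ind b" by (cases u) (auto simp: abox_interp_def)
      thus ?thesis using * by (intro exI[of _ b] exI[of _ "[]"]) (auto simp: rel_def)
    next
      case *: parent
      moreover have "node a q" using node_kid n * by blast
      ultimately show ?thesis by (intro exI[of _ a] exI[of _ q]) (auto simp: rel_def)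
    next
      case k: sibling
      note s = k(6)
      have up: "up r \<subseteq> up r'" using k(3) unfolding up_def by (auto intro: rtranclp_trans)
      have w: "w r i \<le> w r' k" unfolding w_def by (intro add_mono card_mono fin up k(5))
      have "(card T + Suc t - w r' k) * W + k < (card T + Suc t - w r i) * W + i"
      proof (cases "k < i")
        case True
        have "card T + Suc t - w r' k \<le> card T + Suc t - w r i" using w by simp
        hence "(card T + Suc t - w r' k) * W \<le> (card T + Suc t - w r i) * W" by (rule mult_le_mono1)
        thus ?thesis using True by linarith
      next
        case False
        have "w r i < w r' k"
        proof (cases "sub_role T r r'")
          case True
          hence "concepts_at (Ind a) (i # p) \<subset> concepts_at (Ind a) (k # p)" using s False k(5) by blast
          hence "card (concepts_at (Ind a) (i # p)) < card (concepts_at (Ind a) (k # p))" by (intro psubset_card_mono fin)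
          moreover have "card (up r) \<le> card (up r')" by (intro card_mono fin up)
          ultimately show ?thesis by (simp add: w_def)
        next
          case False
          \<comment> \<open>The axiom of the sibling itself separates the two sets: its role is
            above \<open>r'\<close> trivially, but not above \<open>r\<close>.\<close>
          hence "ExIncl e' r' g' \<in> up r' - up r" using k(2) by (auto simp: up_def)
          hence "up r \<subset> up r'" using up by blast
          hence "card (up r) < card (up r')" by (intro psubset_card_mono fin)
          moreover have "card (concepts_at (Ind a) (i # p)) \<le> card (concepts_at (Ind a) (k # p))" by (intro card_mono fin k(5))
          ultimately show ?thesis by (simp add: w_def)
        qed
        hence "Suc (card T + Suc t - w r' k) \<le> card T + Suc t - w r i" using bound[of r' k] by linarith
        hence "Suc (card T + Suc t - w r' k) * W \<le> (card T + Suc t - w r i) * W" by (rule mult_le_mono1)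
        moreover have "k < W" using axiom_less_W k(1,2) by simp
        ultimately show ?thesis by simp
      qed
      from less.hyps[OF this[unfolded w_def up_def] k(2,1,4)] obtain b q where
        "node b q" "rel a p b q r'" "concepts_at (Ind a) (k # p) \<subseteq> concepts_at (Ind b) q" by blast
      thus ?thesis using rel_mono[OF _ k(3)] k(5) by blast
    qed
  qed
qed

text \<open>Types are sets of numbers, whereas homomorphisms preserve concepts; this closes the gap
  in \<open>U_rigid\<close>.\<close>

lemma CN_code: "(0, CN n) \<in> th A x p \<Longrightarrow> valid p \<Longrightarrow> \<exists>B. n = code_concept B"
proof (erule pos_cases)
  fix a b d assume r: "((0, CN n), a, b, d) \<in> pos_rules t c W"
  obtain a1 a2 b1 b2 d1 d2 where abd: "a = (a1, a2)" "b = (b1, b2)" "d = (d1, d2)"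
    by (cases a; cases b; cases d) blast
  have "((0, CN n), (a1, a2), (b1, b2), (d1, d2)) \<in> concept_rules t W"
    using r unfolding pos_rules_def abd by (auto elim: select_rules.cases formula_rules.cases)
  thus "\<exists>B. n = code_concept B"
  proof cases
    case top
    thus ?thesis by (intro exI[of _ Top]) simp
  next
    case (conj l)
    then obtain \<alpha> where "prod_encode (0, Suc (prod_encode (n, l))) = code_axiom \<alpha>" unfolding mem_t by blast
    thus ?thesis by (cases \<alpha>) (auto simp: prod_encode_eq code_axiom.simps)
  next
    case (assertion B)
    thus ?thesis by (intro exI[of _ "Con B"]) simp
  qed (auto simp: mem_t_codes)
next
  fix a b show "((0, CN n), a, b) \<notin> neg_rules W"
    by (cases a; cases b) (auto simp: neg_rules_def elim: select_neg_rules.cases formula_neg_rules.cases)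
qed auto

lemma concept_less_W: "code_concept e < t \<Longrightarrow> code_concept e < W"
  using W_bounds(1) by simp

lemma U_model: "is_model T A U"
  unfolding is_model_def
proof (intro conjI ballI interpretation_wf_U)
  fix \<alpha> assume \<alpha>: "\<alpha> \<in> A"
  show "sat_assertion U \<alpha>"
  proof (cases \<alpha>)
    case (ConceptAssertion B a)
    have "el a [] \<in> cext U B" using \<alpha> unfolding ConceptAssertion U_def interp.simps using node_Nil by blast
    thus ?thesis by (simp add: ConceptAssertion)
  next
    case (RoleAssertion P a b)
    have "(Ind a, Ind b) \<in> role_ext (abox_interp A) (Fwd P)" using \<alpha> RoleAssertion by (simp add: abox_interp_def)
    hence "\<exists>u. (Ind a, Ind b) \<in> role_ext (abox_interp A) u \<and> sub_role T u (Fwd P)" by blast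
    hence "rel a [] b [] (Fwd P)" unfolding rel_def by blast
    hence "(el a [], el b []) \<in> role_ext U (Fwd P)" unfolding role_ext_U_el by simp
    thus ?thesis by (simp add: RoleAssertion)
  qed
next
  fix \<alpha> assume \<alpha>: "\<alpha> \<in> T"
  have W: "code_concept B < W" if "code_concept B < t" for B using that concept_less_W by simp
  show "sat_axiom U \<alpha>"
  proof (cases \<alpha>)
    case (ConjIncl B0 Bs B)
    have less: "code_concept B' < W" if "B' \<in> set (B # B0 # Bs)" for B'
    proof -
      have "x \<le> list_encode xs" if "x \<in> set xs" for x xs
        using that
      proof (induction xs)
        case (Cons y ys)
        thus ?case using le_prod_encode_1[of y "list_encode ys"] le_prod_encode_2[of "list_encode ys" y] by auto
      qed simp
      hence "code_concept B' \<le> list_encode (map code_concept (B # B0 # Bs))"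
        using that by (metis imageI list.set_map)
      also have "\<dots> \<le> code_axiom \<alpha>" unfolding ConjIncl
        using le_prod_encode_2[of "list_encode (map code_concept (B # B0 # Bs))" 0] by simp
      finally show ?thesis using axiom_less_W[OF \<alpha>] by simp
    qed
    show ?thesis unfolding ConjIncl sat_axiom.simps
    proof
      fix d assume d: "d \<in> (\<Inter>B'\<in>set (B0 # Bs). concept_ext U B')"
      hence "d \<in> concept_ext U B0" by simp
      hence "d \<in> dom U" using concept_ext_dom[OF interpretation_wf_U] by blast
      then obtain a p where ap: "d = el a p" "node a p" by (auto simp: dom_U)
      have "\<forall>B'\<in>set (B0 # Bs). has A (Ind a) p B'" using d ap less by fastforce
      hence "has A (Ind a) p B" using conj_has[OF node_valid[OF ap(2)]] \<alpha> ConjIncl node_ex[OF ap(2)] by blast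
      thus "d \<in> concept_ext U B" using ap less by simp
    qed
  next
    case (AllIncl e r g)
    note l = AllIncl_less[OF \<alpha>[unfolded AllIncl]]
    show ?thesis unfolding AllIncl sat_axiom.simps
    proof
      fix d assume d: "d \<in> concept_ext U e"
      hence "d \<in> dom U" using concept_ext_dom[OF interpretation_wf_U] by blast
      then obtain a p where ap: "d = el a p" "node a p" by (auto simp: dom_U)
      have h: "has A (Ind a) p e" using d ap W l by simp
      have "y \<in> concept_ext U g" if dy: "(d, y) \<in> role_ext U r" for y
      proof -
        obtain b q where "y = el b q" "node b q" "rel a p b q r" using dy ap(1) by (auto simp: role_ext_U)
        thus ?thesis using rel_has[OF _ ap(2) _ \<alpha>[unfolded AllIncl] h] W l by simp
      qed
      thus "d \<in> {d \<in> dom U. \<forall>e. (d, e) \<in> role_ext U r \<longrightarrow> e \<in> concept_ext U g}" using \<open>d \<in> dom U\<close> by blast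
    qed
  next
    case (ExIncl e r g)
    note T = \<alpha>[unfolded ExIncl]
    note l = ExIncl_less[OF T]
    show ?thesis unfolding ExIncl sat_axiom.simps
    proof
      fix d assume d: "d \<in> concept_ext U e"
      hence "d \<in> dom U" using concept_ext_dom[OF interpretation_wf_U] by blast
      then obtain a p where ap: "d = el a p" "node a p" by (auto simp: dom_U)
      note v = node_valid[OF ap(2)]
      have "has A (Ind a) p e" using d ap W l by simp
      hence x: "ex A (Ind a) (code_axiom (ExIncl e r g) # p)" by (rule ex_kid[OF v T])
      obtain b q where b: "node b q" "rel a p b q r"
        "concepts_at (Ind a) (code_axiom (ExIncl e r g) # p) \<subseteq> concepts_at (Ind b) q"
        using witness[OF ap(2) T refl x] by blast
      have "code_concept g \<in> concepts_at (Ind a) (code_axiom (ExIncl e r g) # p)"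
        using kid_filler[OF v T x] l by simp
      hence "has A (Ind b) q g" using b(3) by blast
      hence "(d, el b q) \<in> role_ext U r \<and> el b q \<in> concept_ext U g" using b ap W l by simp
      thus "d \<in> {d \<in> dom U. \<exists>y. (d, y) \<in> role_ext U r \<and> y \<in> concept_ext U g}" using \<open>d \<in> dom U\<close> by blast
    qed
  next
    case (RoleIncl r s)
    have "role_step T r s" using \<alpha> RoleIncl by (simp add: role_step_def)
    hence "sub_role T r s" by blast
    thus ?thesis unfolding RoleIncl sat_axiom.simps using rel_mono by (fastforce simp: role_ext_U)
  qed
qed

text \<open>The map \<open>hm\<close> of the whole chase, restricted to the kept nodes. Each clause
  of \<open>rel\<close> holds in every model: ABox edges by the assertions, tree edges by the choice
  of witnesses, and larger roles by the inclusions.\<close>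

lemma U_universal: "universal_model T A U"
  unfolding universal_model_def
proof (intro conjI allI impI U_model)
  fix J assume J: "is_model T A J"
  define h where "h d = (THE y. \<exists>a p. d = el a p \<and> y = hm J (Ind a) p)" for d
  have h: "h (el a p) = hm J (Ind a) p" for a p
    unfolding h_def by (rule the_equality) auto
  have ex: "exists_in J (Ind a) p" if "node a p" for a p
    using ex_sound[OF J node_ex node_valid] that by blast
  have "homomorphism U J h"
    unfolding homomorphism_def
  proof (intro conjI allI ballI impI)
    show "h ` dom U \<subseteq> dom J" using hm_dom[OF J] ex h by (auto simp: dom_U)
    show "h (Ind a) = Ind a" for a using h[of a "[]"] by (simp add: hm.simps[OF J])
    fix B d assume "d \<in> dom U" "d \<in> cext U B"
    then obtain a p where d: "d = el a p" "node a p" "p = [] \<and> ConceptAssertion B a \<in> A \<or> has A (Ind a) p (Con B)"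
      by (auto simp: U_def)
    from d(3) show "h d \<in> cext J B"
    proof
      assume "p = [] \<and> ConceptAssertion B a \<in> A"
      hence "sat_assertion J (ConceptAssertion B a)" "h d = Ind a"
        using J d(1) h[of a "[]"] by (auto simp: is_model_def hm.simps[OF J])
      thus ?thesis by simp
    next
      assume "has A (Ind a) p (Con B)"
      thus ?thesis using has_sound[OF J _ node_valid[OF d(2)], where x = "Ind a" and B = "Con B"] d(1) h by simp
    qed
  next
    fix P d y assume "d \<in> dom U" "y \<in> dom U" "(d, y) \<in> rext U P"
    then obtain a p b q where d: "d = el a p" "y = el b q" "node a p" "node b q" "rel a p b q (Fwd P)"
      by (auto simp: U_def)
    have kid: "(hm J (Ind a) q, hm J (Ind a) (code_axiom (ExIncl e s g) # q)) \<in> role_ext J s"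
      if "ExIncl e s g \<in> T" "node a (code_axiom (ExIncl e s g) # q)" for a e s g q
    proof -
      have "hm J (Ind a) q \<in> concept_ext J e" using ex[OF that(2)] by (auto simp: exists_in.simps[OF J])
      thus ?thesis by (rule hm_kid(1)[OF J that(1)])
    qed
    have "(hm J (Ind a) p, hm J (Ind b) q) \<in> role_ext J (Fwd P)"
      using d(5) unfolding rel_def
    proof (elim disjE conjE exE)
      fix u assume *: "p = []" "q = []" "(Ind a, Ind b) \<in> role_ext (abox_interp A) u" "sub_role T u (Fwd P)"
      have "(Ind a, Ind b) \<in> role_ext J u"
        using *(3) J by (cases u) (fastforce simp: abox_interp_def is_model_def)+
      thus ?thesis using sub_role_model[OF *(4) J] *(1,2) by (simp add: hm.simps(1)[OF J])
    next
      fix e s g assume *: "a = b" "ExIncl e s g \<in> T" "q = code_axiom (ExIncl e s g) # p" "sub_role T s (Fwd P)"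
      show ?thesis using sub_role_model[OF *(4) J kid[OF *(2)]] *(1,3) d(4) by simp
    next
      fix e s g assume *: "a = b" "ExIncl e s g \<in> T" "p = code_axiom (ExIncl e s g) # q" "sub_role T (inv_role s) (Fwd P)"
      show ?thesis using sub_role_model[OF *(4) J, of "hm J (Ind a) p" "hm J (Ind a) q"] kid[OF *(2), of a q] *(1,3) d(3)
        by simp
    qed
    thus "(h d, h y) \<in> rext J P" using d h by simp
  qed
  thus "\<exists>h. homomorphism U J h" by blast
qed

section \<open>Rigidity and the isomorphism with the canonical model\<close>

lemma homomorphism_role: "homomorphism K J h \<Longrightarrow> d \<in> dom K \<Longrightarrow> e \<in> dom K \<Longrightarrow> (d, e) \<in> role_ext K r \<Longrightarrow> (h d, h e) \<in> role_ext J r"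
  by (cases r) (auto simp: homomorphism_def)

lemma homomorphism_concept: "homomorphism K J h \<Longrightarrow> d \<in> dom K \<Longrightarrow> d \<in> concept_ext K B \<Longrightarrow> h d \<in> concept_ext J B"
  by (cases B) (auto simp: homomorphism_def)

text \<open>By induction the parent is fixed, so a child moves to a neighbour of its parent along
  the same role, with at least the same type. If that neighbour were a root reached by an ABox edge
  or the parent's parent, the child would have been dropped. If it is a sibling, then, as neither of
  the two is dropped, roles and types are equivalent and neither code is smaller, so the sibling is
  the child itself.\<close>

lemma U_rigid: "homomorphism U U h \<Longrightarrow> node a p \<Longrightarrow> h (el a p) = el a p"
proof (induction p)
  case Nil
  thus ?case by (simp add: homomorphism_def)
next
  case (Cons i p)
  have np: "node a p" "ex A (Ind a) (i # p)" "(2, Dom i) \<notin> th A (Ind a) p" using node_kid Cons.prems(2) by blast+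
  have IH: "h (el a p) = el a p" using Cons np by blast
  have good: "good_path p" using np(1) by (simp add: node_def)
  obtain e r g where i: "ExIncl e r g \<in> T" "i = code_axiom (ExIncl e r g)"
    using Cons.prems(2) by (auto simp: node_def)
  have "rel a p a (i # p) r" using i by (auto simp: rel_def)
  hence "(el a p, el a (i # p)) \<in> role_ext U r" using np(1) Cons.prems(2) by simp
  from homomorphism_role[OF Cons.prems(1) _ _ this] have hr: "(el a p, h (el a (i # p))) \<in> role_ext U r"
    using IH np(1) Cons.prems(2) by simp
  then obtain b q where y: "h (el a (i # p)) = el b q" "node b q" "rel a p b q r" by (auto simp: role_ext_U)
  have sub: "concepts_at (Ind a) (i # p) \<subseteq> concepts_at (Ind b) q"
  proof
    fix n assume n: "n \<in> concepts_at (Ind a) (i # p)"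
    have "\<exists>B. n = code_concept B"
      by (rule CN_code[of _ "Ind a" "i # p"]) (use n node_valid[OF Cons.prems(2)] in auto)
    then obtain B where B: "n = code_concept B" by blast
    have W: "code_concept B < W" using n B W_bounds(1) by auto
    have "el a (i # p) \<in> concept_ext U B" using n B W Cons.prems(2) by simp
    hence "h (el a (i # p)) \<in> concept_ext U B"
      by (rule homomorphism_concept[OF Cons.prems(1), rotated]) (use Cons.prems(2) in simp)
    hence "el b q \<in> concept_ext U B" unfolding y(1) .
    thus "n \<in> concepts_at (Ind b) q" using n B W by simp
  qed
  from y(3) show ?case unfolding rel_def
  proof (elim disjE conjE exE)
    fix u assume *: "p = []" "q = []" "(Ind a, Ind b) \<in> role_ext (abox_interp A) u" "sub_role T u r"
    hence "(2, Dom i) \<in> th A (Ind a) p" using Dom_nbrI[OF i(1) *(3,4)] sub i(2) by simp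
    thus ?case using np(3) by blast
  next
    fix e' r' g' assume *: "a = b" "ExIncl e' r' g' \<in> T" "p = code_axiom (ExIncl e' r' g') # q" "sub_role T (inv_role r') r"
    have "(2, Dom i) \<in> th A (Ind a) p"
      using Dom_parentI[OF i(1) *(2) _ _ *(4,3)] sub i(2) good *(1,3) node_ex[OF y(2)] by simp
    thus ?case using np(3) by blast
  next
    fix e' r' g' assume *: "a = b" "ExIncl e' r' g' \<in> T" "q = code_axiom (ExIncl e' r' g') # p" "sub_role T r' r"
    let ?k = "code_axiom (ExIncl e' r' g')"
    have nk: "node a (?k # p)" using y(2) * by simp
    have kx: "ex A (Ind a) (?k # p)" "(2, Dom ?k) \<notin> th A (Ind a) p" using node_kid[OF nk] by blast+
    have s: "concepts_at (Ind a) (i # p) \<subseteq> concepts_at (Ind a) (?k # p)" using sub * by simp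
    have 1: "\<not> (?k < i \<or> \<not> sub_role T r r' \<or> \<not> concepts_at (Ind a) (?k # p) \<subseteq> concepts_at (Ind a) (i # p))"
      using Dom_siblingI[OF i(1) *(2) good *(4) i(2) refl kx(1) s] np(3) by blast
    hence "\<not> i < ?k" using Dom_siblingI[OF *(2) i(1) good _ refl i(2) np(2)] kx(2) by blast
    hence "i = ?k" using 1 by simp
    thus ?case using y(1) * by simp
  qed
qed

lemma U_core: "is_core U"
  unfolding is_core_def
proof (intro allI impI)
  fix h assume h: "homomorphism U U h"
  have id: "h d = d" if "d \<in> dom U" for d using U_rigid[OF h] that by (auto simp: dom_U)
  thus "strong_homomorphism U U h \<and> inj_on h (dom U)"
    using h by (auto simp: strong_homomorphism_def inj_on_def)
qed

lemma homomorphism_comp: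
  "homomorphism K J g \<Longrightarrow> homomorphism J L h \<Longrightarrow> homomorphism K L (h \<circ> g)"
  unfolding homomorphism_def by (auto simp: image_subset_iff)

text \<open>Since the identity is the only endomorphism of \<^const>\<open>U\<close>, every universal core is
  isomorphic to it.\<close>

lemma can_iso: "\<exists>g. interp_iso U (can T A) g \<and> (\<forall>a. g (Ind a) = Ind a)"
proof -
  have K: "universal_model T A (can T A)" "is_core (can T A)"
    \<comment> \<open>\<open>U\<close> itself shows that a universal core exists, so the choice in
      \<open>can\<close> is justified.\<close>
    using someI[of "\<lambda>U. universal_model T A U \<and> is_core U" U] U_universal U_core unfolding can_def by blast+
  let ?K = "can T A"
  have models: "is_model T A U" "is_model T A ?K" using U_model K(1) by (auto simp: universal_model_def)
  obtain g where g: "homomorphism U ?K g" using U_universal models(2) unfolding universal_model_def by blast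
  obtain h where h: "homomorphism ?K U h" using K(1) models(1) unfolding universal_model_def by blast
  have hg: "h (g d) = d" if "d \<in> dom U" for d
    using U_rigid[OF homomorphism_comp[OF g h]] that by (auto simp: dom_U)
  have gh: "strong_homomorphism ?K ?K (g \<circ> h)" "inj_on (g \<circ> h) (dom ?K)"
    using K(2) homomorphism_comp[OF h g] unfolding is_core_def by blast+
  have dom: "\<And>d. d \<in> dom U \<Longrightarrow> g d \<in> dom ?K" "\<And>e. e \<in> dom ?K \<Longrightarrow> h e \<in> dom U"
    using g h by (auto simp: homomorphism_def)
  \<comment> \<open>Being a core makes \<open>g \<circ> h\<close> injective. It takes equal values
    at \<open>e\<close> and at \<open>g (h e)\<close>, because \<open>h \<circ> g\<close> is the
    identity on \<open>U\<close>.\<close>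
  have surj: "g (h e) = e" if e: "e \<in> dom ?K" for e
  proof -
    have "(g \<circ> h) (g (h e)) = (g \<circ> h) e" using hg dom e by simp
    thus ?thesis using gh(2) dom e unfolding inj_on_def by blast
  qed
  have "interp_iso U ?K g"
  proof
    show "interpretation_wf U" "interpretation_wf ?K" using models by (auto simp: is_model_def)
    show "bij_betw g (dom U) (dom ?K)"
      by (rule bij_betw_byWitness[where f' = h]) (use hg surj dom node_Nil in auto)
    show "g d \<in> cext ?K B \<longleftrightarrow> d \<in> cext U B" if "d \<in> dom U" for B d
      using homomorphism_concept[OF g that, of "Con B"] homomorphism_concept[OF h dom(1)[OF that], of "Con B"]
      by (auto simp: hg[OF that])
    show "(g d, g e) \<in> rext ?K P \<longleftrightarrow> (d, e) \<in> rext U P" if "d \<in> dom U" "e \<in> dom U" for P d e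
      using homomorphism_role[OF g that, of "Fwd P"]
        homomorphism_role[OF h dom(1)[OF that(1)] dom(1)[OF that(2)], of "Fwd P"]
      by (auto simp: hg[OF that(1)] hg[OF that(2)])
  qed
  moreover have "g (Ind a) = Ind a" for a using g by (simp add: homomorphism_def)
  ultimately show ?thesis by blast
qed

end

section \<open>Correctness of the formulas\<close>

text \<open>\<open>PT False E f\<close> is \<open>\<exists>E.f\<close>, and \<open>PT True E f\<close> is \<open>\<exists>E\<^sup>-.f\<close> for the converse of \<open>E\<close>.\<close>

datatype fm = Sh shape | PT bool rexp fm | NT fm

primrec code_fm :: "fm \<Rightarrow> nat" where
  "code_fm (Sh \<phi>) = sh_code (code_shape \<phi>)"
| "code_fm (PT d E f) = path_code (if d then 1 else 0) (code_rexp E) (code_fm f)"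
| "code_fm (NT f) = not_code (code_fm f)"

lemma code_fm_inv:
  "sh_code x = code_fm f \<longleftrightarrow> (\<exists>\<phi>. f = Sh \<phi> \<and> x = code_shape \<phi>)"
  "path_code d e x = code_fm f \<longleftrightarrow> (\<exists>b E g. f = PT b E g \<and> d = (if b then 1 else 0) \<and> e = code_rexp E \<and> x = code_fm g)"
  "not_code x = code_fm f \<longleftrightarrow> (\<exists>g. f = NT g \<and> x = code_fm g)"
  by (cases f; auto)+

lemma code_fm_eq [simp]: "code_fm f = code_fm g \<longleftrightarrow> f = g"
proof (induction f arbitrary: g)
qed (case_tac g; auto)+

lemma code_shape_inv:
  "prod_encode (0, x) = code_shape \<phi> \<longleftrightarrow> \<phi> = Nom x"
  "prod_encode (Suc 0, x) = code_shape \<phi> \<longleftrightarrow> \<phi> = Name x"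
  "prod_encode (2, x) = code_shape \<phi> \<longleftrightarrow> \<phi> = NegName x"
  "prod_encode (3, x) = code_shape \<phi> \<longleftrightarrow> (\<exists>B. \<phi> = Cpt B \<and> x = code_concept B)"
  "prod_encode (4, prod_encode (x, y)) = code_shape \<phi> \<longleftrightarrow> (\<exists>\<psi> \<chi>. \<phi> = Or \<psi> \<chi> \<and> x = code_shape \<psi> \<and> y = code_shape \<chi>)"
  "prod_encode (5, prod_encode (x, y)) = code_shape \<phi> \<longleftrightarrow> (\<exists>\<psi> \<chi>. \<phi> = And \<psi> \<chi> \<and> x = code_shape \<psi> \<and> y = code_shape \<chi>)"
  "prod_encode (6, prod_encode (x, y)) = code_shape \<phi> \<longleftrightarrow> (\<exists>R \<chi>. \<phi> = ExRoles R \<chi> \<and> x = code_roles R \<and> y = code_shape \<chi>)"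
  "prod_encode (7, prod_encode (x, y)) = code_shape \<phi> \<longleftrightarrow> (\<exists>E \<chi>. \<phi> = ExPath E \<chi> \<and> x = code_rexp E \<and> y = code_shape \<chi>)"
  "prod_encode (8, list_encode [a, x, y]) = code_shape \<phi> \<longleftrightarrow> (\<exists>E E'. \<phi> = NomEQ a E E' \<and> x = code_rexp E \<and> y = code_rexp E')"
  "prod_encode (9, list_encode [a, x, y]) = code_shape \<phi> \<longleftrightarrow> (\<exists>E E'. \<phi> = NomDisj a E E' \<and> x = code_rexp E \<and> y = code_rexp E')"
  by (cases \<phi>; auto simp: prod_encode_eq list_encode_eq code_roles_def)+

lemma code_rexp_inv:
  "prod_encode (Suc 0, 0) = code_rexp E \<longleftrightarrow> E = ROne"
  "prod_encode (2, x) = code_rexp E \<longleftrightarrow> (\<exists>r. E = RRole r \<and> x = code_role r)"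
  "prod_encode (3, prod_encode (x, y)) = code_rexp E \<longleftrightarrow> (\<exists>F G. E = RAlt F G \<and> x = code_rexp F \<and> y = code_rexp G)"
  "prod_encode (4, prod_encode (x, y)) = code_rexp E \<longleftrightarrow> (\<exists>F G. E = RSeq F G \<and> x = code_rexp F \<and> y = code_rexp G)"
  "prod_encode (5, x) = code_rexp E \<longleftrightarrow> (\<exists>F. E = RStar F \<and> x = code_rexp F)"
  by (cases E; auto simp: prod_encode_eq)+

section \<open>Paths and regular expressions\<close>

lemma labels_path_append:
  "labels_path K (v @ w) d e \<longleftrightarrow> (\<exists>m. labels_path K v d m \<and> labels_path K w m e)" if "interpretation_wf K"
proof (induction v arbitrary: d)
  case Nil
  have "d \<in> dom K" if "labels_path K w d e"
    using that
  proof (cases w)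
    case (Cons r w')
    thus ?thesis using that \<open>interpretation_wf K\<close> by (cases r) (auto simp: interpretation_wf_def)
  qed auto
  thus ?case by auto
qed auto

lemma rexp_ext_eqs:
  assumes "interpretation_wf K"
  shows "(d, e) \<in> rexp_ext K ROne \<longleftrightarrow> d \<in> dom K \<and> d = e"
    "(d, e) \<in> rexp_ext K (RRole r) \<longleftrightarrow> (d, e) \<in> role_ext K r"
    "(d, e) \<in> rexp_ext K F \<Longrightarrow> (d, e) \<in> rexp_ext K (RAlt F G)"
    "(d, e) \<in> rexp_ext K G \<Longrightarrow> (d, e) \<in> rexp_ext K (RAlt F G)"
    "(d, m) \<in> rexp_ext K F \<Longrightarrow> (m, e) \<in> rexp_ext K G \<Longrightarrow> (d, e) \<in> rexp_ext K (RSeq F G)"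
    "d \<in> dom K \<Longrightarrow> (d, d) \<in> rexp_ext K (RStar F)"
    "(d, m) \<in> rexp_ext K F \<Longrightarrow> (m, e) \<in> rexp_ext K (RStar F) \<Longrightarrow> (d, e) \<in> rexp_ext K (RStar F)"
    "(d, m) \<in> rexp_ext K (RStar F) \<Longrightarrow> (m, e) \<in> rexp_ext K F \<Longrightarrow> (d, e) \<in> rexp_ext K (RStar F)"
proof -
  show "(d, e) \<in> rexp_ext K ROne \<longleftrightarrow> d \<in> dom K \<and> d = e"
    by (auto simp: rexp_ext_def intro: word_of.intros elim: word_of.cases)
  have "e \<in> dom K" if "(d, e) \<in> role_ext K r"
    using that assms by (cases r) (auto simp: interpretation_wf_def)
  thus "(d, e) \<in> rexp_ext K (RRole r) \<longleftrightarrow> (d, e) \<in> role_ext K r"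
    by (auto simp: rexp_ext_def elim!: word_of.cases[of "RRole r"] intro!: exI[of _ "[r]"] word_of.intros)
  show "(d, e) \<in> rexp_ext K F \<Longrightarrow> (d, e) \<in> rexp_ext K (RAlt F G)"
    "(d, e) \<in> rexp_ext K G \<Longrightarrow> (d, e) \<in> rexp_ext K (RAlt F G)"
    "d \<in> dom K \<Longrightarrow> (d, d) \<in> rexp_ext K (RStar F)"
    by (fastforce simp: rexp_ext_def intro: word_of.intros)+
  show "(d, m) \<in> rexp_ext K F \<Longrightarrow> (m, e) \<in> rexp_ext K G \<Longrightarrow> (d, e) \<in> rexp_ext K (RSeq F G)"
    "(d, m) \<in> rexp_ext K F \<Longrightarrow> (m, e) \<in> rexp_ext K (RStar F) \<Longrightarrow> (d, e) \<in> rexp_ext K (RStar F)"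
    unfolding rexp_ext_def using labels_path_append[OF assms] word_of.intros(5,7) by blast+
  \<comment> \<open>\<open>word_of\<close> unfolds a star at its beginning; for converse paths it
    has to be unfolded at its end.\<close>
  have star: "word_of (RStar F) (v @ w)" if "word_of (RStar F) v" "word_of F w" for v w
    using that
  proof (induction "RStar F" v rule: word_of.induct)
    case 6
    thus ?case using word_of.intros(7)[of F w "[]"] word_of.intros(6)[of F] by simp
  next
    case (7 u v)
    thus ?case using word_of.intros(7)[of F u "v @ w"] by simp
  qed
  show "(d, m) \<in> rexp_ext K (RStar F) \<Longrightarrow> (m, e) \<in> rexp_ext K F \<Longrightarrow> (d, e) \<in> rexp_ext K (RStar F)"
    using labels_path_append[OF assms] star by (fastforce simp: rexp_ext_def)
qed

text \<open>The level from which on the copy of a shape is correct, if names are correct from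
  \<open>st\<close> on. Level 4 is the first one for formulas; the disjointness shape is translated
  with one negation and the equality shape with two nested ones, hence 5 and 6.\<close>

primrec need_shape :: "(shape_name \<Rightarrow> nat) \<Rightarrow> shape \<Rightarrow> nat" where
  "need_shape st (Nom a) = 4"
| "need_shape st (Name s) = st s"
| "need_shape st (NegName s) = Suc (st s)"
| "need_shape st (Cpt B) = 4"
| "need_shape st (Or \<phi> \<psi>) = max (need_shape st \<phi>) (need_shape st \<psi>)"
| "need_shape st (And \<phi> \<psi>) = max (need_shape st \<phi>) (need_shape st \<psi>)"
| "need_shape st (ExRoles R \<phi>) = need_shape st \<phi>"
| "need_shape st (ExPath E \<phi>) = need_shape st \<phi>"
| "need_shape st (NomEQ a E E') = 6"
| "need_shape st (NomDisj a E E') = 5"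

primrec need :: "(shape_name \<Rightarrow> nat) \<Rightarrow> fm \<Rightarrow> nat" where
  "need st (Sh \<phi>) = need_shape st \<phi>"
| "need st (PT d E f) = need st f"
| "need st (NT f) = Suc (need st f)"

section \<open>Nesting and size of formulas\<close>

primrec height :: "rexp \<Rightarrow> nat" where
  "height RZero = 1" | "height ROne = 1" | "height (RRole r) = 1"
| "height (RAlt E F) = Suc (max (height E) (height F))"
| "height (RSeq E F) = Suc (max (height E) (height F))"
| "height (RStar E) = Suc (height E)"

primrec depth :: "fm \<Rightarrow> nat" where
  "depth (Sh \<phi>) = 0" | "depth (PT d E f) = Suc (depth f)" | "depth (NT f) = Suc (depth f)"

lemma height_pos: "0 < height E"
  by (cases E) auto

lemma less_prod_encode: "x \<le> y \<Longrightarrow> 0 < k \<Longrightarrow> x < prod_encode (k, y)"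
proof -
  assume "x \<le> y" "0 < k"
  have "triangle y \<ge> y" for y by (induction y) auto
  hence "y \<le> triangle (k + y)" by (meson le_add2 le_trans)
  thus ?thesis using \<open>x \<le> y\<close> \<open>0 < k\<close> by (simp add: prod_encode_def)
qed

lemma height_le: "height E \<le> Suc (code_rexp E)"
proof (induction E)
  case (RAlt E F)
  hence "max (height E) (height F) \<le> Suc (prod_encode (code_rexp E, code_rexp F))"
    using le_prod_encode_1[of "code_rexp E" "code_rexp F"] le_prod_encode_2[of "code_rexp F" "code_rexp E"] by simp
  moreover have "prod_encode (code_rexp E, code_rexp F) < prod_encode (3, prod_encode (code_rexp E, code_rexp F))"
    by (rule less_prod_encode) simp_all
  ultimately show ?case by simp
next
  case (RSeq E F)
  hence "max (height E) (height F) \<le> Suc (prod_encode (code_rexp E, code_rexp F))"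
    using le_prod_encode_1[of "code_rexp E" "code_rexp F"] le_prod_encode_2[of "code_rexp F" "code_rexp E"] by simp
  moreover have "prod_encode (code_rexp E, code_rexp F) < prod_encode (4, prod_encode (code_rexp E, code_rexp F))"
    by (rule less_prod_encode) simp_all
  ultimately show ?case by simp
next
  case (RStar E)
  moreover have "code_rexp E < prod_encode (5, code_rexp E)" by (rule less_prod_encode) simp_all
  ultimately show ?case by simp
qed simp_all

lemma subcode_le:
  "code_shape \<phi> \<le> code_shape (Or \<phi> \<psi>)" "code_shape \<psi> \<le> code_shape (Or \<phi> \<psi>)"
  "code_shape \<phi> \<le> code_shape (And \<phi> \<psi>)" "code_shape \<psi> \<le> code_shape (And \<phi> \<psi>)"
  "code_shape \<phi> \<le> code_shape (ExRoles R \<phi>)" "code_roles R \<le> code_shape (ExRoles R \<phi>)"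
  "code_shape \<phi> \<le> code_shape (ExPath E \<phi>)" "code_rexp E \<le> code_shape (ExPath E \<phi>)"
  "code_concept B \<le> code_shape (Cpt B)" "s \<le> code_shape (NegName s)" "s \<le> code_shape (Name s)"
  "a \<le> code_shape (Nom a)"
  "code_rexp E \<le> code_shape (NomEQ a E E')" "code_rexp E' \<le> code_shape (NomEQ a E E')"
  "code_shape (Nom a) \<le> code_shape (NomEQ a E E')" "code_shape (Nom a) \<le> code_shape (NomDisj a E E')"
  "code_rexp E \<le> code_shape (NomDisj a E E')" "code_rexp E' \<le> code_shape (NomDisj a E E')"
  "a \<le> code_shape (NomEQ a E E')" "a \<le> code_shape (NomDisj a E E')"
  "code_rexp F \<le> code_rexp (RAlt F G)" "code_rexp G \<le> code_rexp (RAlt F G)"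
  "code_rexp F \<le> code_rexp (RSeq F G)" "code_rexp G \<le> code_rexp (RSeq F G)"
  "code_rexp F \<le> code_rexp (RStar F)" "code_role r \<le> code_rexp (RRole r)"
proof -
  have p: "x \<le> y \<Longrightarrow> x \<le> prod_encode (k, y)" "x \<le> k \<Longrightarrow> x \<le> prod_encode (k, y)" "x \<le> y \<Longrightarrow> x \<le> Suc y" for x y k :: nat
    using le_prod_encode_1[of k y] le_prod_encode_2[of y k] by linarith+
  show "code_shape \<phi> \<le> code_shape (Or \<phi> \<psi>)"
    "code_shape \<phi> \<le> code_shape (And \<phi> \<psi>)"
    "code_rexp E \<le> code_shape (ExPath E \<phi>)"
    "code_rexp F \<le> code_rexp (RAlt F G)"
    "code_rexp F \<le> code_rexp (RSeq F G)"
    unfolding code_shape.simps code_rexp.simps by (rule p(1), rule p(2), rule order_refl)+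
  show "code_roles R \<le> code_shape (ExRoles R \<phi>)"
    unfolding code_shape_ExRoles by (rule p(1), rule p(2), rule order_refl)
  show "code_shape \<psi> \<le> code_shape (Or \<phi> \<psi>)"
    "code_shape \<psi> \<le> code_shape (And \<phi> \<psi>)"
    "code_shape \<phi> \<le> code_shape (ExRoles R \<phi>)"
    "code_shape \<phi> \<le> code_shape (ExPath E \<phi>)"
    "code_rexp G \<le> code_rexp (RAlt F G)"
    "code_rexp G \<le> code_rexp (RSeq F G)"
    unfolding code_shape.simps code_rexp.simps by (rule p(1), rule p(1), rule order_refl)+
  show "code_concept B \<le> code_shape (Cpt B)" "s \<le> code_shape (NegName s)" "s \<le> code_shape (Name s)"
    "a \<le> code_shape (Nom a)" "code_rexp F \<le> code_rexp (RStar F)" "code_role r \<le> code_rexp (RRole r)"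
    unfolding code_shape.simps code_rexp.simps by (rule p(1), rule order_refl)+
  show "code_shape (Nom a) \<le> code_shape (NomEQ a E E')" "code_shape (Nom a) \<le> code_shape (NomDisj a E E')"
    unfolding code_shape.simps list_encode.simps
    by (intro prod_encode_mono p(3) p(2) order_refl; simp)+
  show "a \<le> code_shape (NomEQ a E E')" "a \<le> code_shape (NomDisj a E E')"
    unfolding code_shape.simps list_encode.simps by (rule p(1), rule p(3), rule p(2), rule order_refl)+
  show "code_rexp E \<le> code_shape (NomEQ a E E')" "code_rexp E \<le> code_shape (NomDisj a E E')"
    unfolding code_shape.simps list_encode.simps by (rule p(1), rule p(3), rule p(1), rule p(3), rule p(2), rule order_refl)+
  show "code_rexp E' \<le> code_shape (NomEQ a E E')" "code_rexp E' \<le> code_shape (NomDisj a E E')"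
    unfolding code_shape.simps list_encode.simps
    by (rule p(1), rule p(3), rule p(1), rule p(3), rule p(1), rule p(3), rule p(2), rule order_refl)+
qed

context rewriting
begin

text \<open>The formulas reachable from the constraints.  Unfolding a starred expression repeats it below
  one of smaller height only, so that the nesting depth stays bounded.\<close>

primrec good :: "fm \<Rightarrow> bool" where
  "good (Sh \<phi>) \<longleftrightarrow> code_shape \<phi> < c \<or> (\<exists>s<c. \<phi> = Name s)"
| "good (PT d E f) \<longleftrightarrow> code_rexp E < c \<and> height E + depth f \<le> c + 10 \<and> good f"
| "good (NT f) \<longleftrightarrow> depth f < c + 10 \<and> good f"

lemma good_depth: "good f \<Longrightarrow> depth f \<le> c + 10"
proof (cases f)
  case (PT d E g)
  thus "good f \<Longrightarrow> ?thesis" using height_pos[of E] by simp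
qed auto

text \<open>The leaves fit below the base of \<open>param_bound\<close>, and each layer of a formula
  adds at most three pairings. With depth at most \<open>c + 10\<close> this stays within the
  iterations provided there.\<close>

lemma good_less_W:
  assumes "good f"
  shows "code_fm f < W"
proof -
  let ?y = "2 ^ Suc (Suc (prod_encode (1, t + c) + t + c)) + 30"
  have "prod_encode (1, c) \<le> prod_encode (1, t + c)" by (rule prod_encode_mono) auto
  also have "\<dots> \<le> Suc (Suc (prod_encode (1, t + c) + t + c))" by simp
  also have "\<dots> \<le> 2 ^ Suc (Suc (prod_encode (1, t + c) + t + c))" by (rule less_imp_le, rule less_exp)
  finally have y: "prod_encode (1, c) \<le> ?y" by simp
  have c: "c \<le> ?y" using y le_prod_encode_2[of c 1] by linarith
  have leaf: "x \<le> grow i ?y" if "x \<le> ?y" for x i using that grow_ge[of ?y i] by linarith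
  have "code_fm f \<le> grow (3 * depth f + 1) ?y" using assms
  proof (induction f)
    case (Sh \<phi>)
    have "code_shape \<phi> \<le> ?y"
    proof (cases "code_shape \<phi> < c")
      \<comment> \<open>A name \<open>s < c\<close> need not have a shape code below
        \<open>c\<close>, which is why \<open>good\<close> lists names separately; the pair with tag
        1 still fits.\<close>
      case False
      then obtain s where "s < c" "\<phi> = Name s" using Sh by auto
      hence "code_shape \<phi> \<le> prod_encode (1, c)" by (simp add: prod_encode_mono)
      thus ?thesis using y by linarith
    qed (use c in simp)
    thus ?case unfolding code_fm.simps sh_code_def by (intro small_pair leaf) auto
  next
    case (PT d E f)
    have f: "code_fm f \<le> grow (3 * depth (PT d E f) + 1 - 1 - 1 - 1) ?y" using PT by simp
    have "code_rexp E \<le> ?y" using PT c by simp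
    thus ?case unfolding code_fm.simps path_code_def by (intro small_pair f leaf) auto
  next
    case (NT f)
    have "code_fm f \<le> grow (3 * depth f + 1) ?y" using NT by simp
    also have "\<dots> \<le> grow (3 * depth (NT f) + 1 - 1) ?y" by (rule grow_mono) simp
    finally have f: "code_fm f \<le> grow (3 * depth (NT f) + 1 - 1) ?y" .
    show ?case unfolding code_fm.simps not_code_def by (intro small_pair f leaf) auto
  qed
  also have "\<dots> \<le> grow (8 * c + 60) ?y" using good_depth[OF assms] by (intro grow_mono) simp
  finally show ?thesis unfolding W_def param_bound_def by simp
qed

lemma good_simps:
  "good (PT d (RAlt E F) f) \<Longrightarrow> good (PT d E f)" "good (PT d (RAlt E F) f) \<Longrightarrow> good (PT d F f)"
  "good (PT d (RSeq E F) f) \<Longrightarrow> good (PT b E (PT d' F f))" "good (PT d (RSeq E F) f) \<Longrightarrow> good (PT b F (PT d' E f))"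
  "good (PT d (RSeq E F) f) \<Longrightarrow> good (PT d' E f)" "good (PT d (RSeq E F) f) \<Longrightarrow> good (PT d' F f)"
  "good (PT d (RStar E) f) \<Longrightarrow> good (PT d E (PT d (RStar E) f))"
  "good (Sh (Or \<phi> \<psi>)) \<Longrightarrow> good (Sh \<phi>)" "good (Sh (Or \<phi> \<psi>)) \<Longrightarrow> good (Sh \<psi>)"
  "good (Sh (And \<phi> \<psi>)) \<Longrightarrow> good (Sh \<phi>)" "good (Sh (And \<phi> \<psi>)) \<Longrightarrow> good (Sh \<psi>)"
  "good (Sh (ExRoles R \<phi>)) \<Longrightarrow> good (Sh \<phi>)" "good (Sh (ExPath E \<phi>)) \<Longrightarrow> good (PT False E (Sh \<phi>))"
  "good (Sh (NegName s)) \<Longrightarrow> good (Sh (Name s))"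
  "good (Sh (NomEQ a E E')) \<Longrightarrow> good (Sh (Nom a))"
  "good (Sh (NomEQ a E E')) \<Longrightarrow> good (NT (PT False E (NT (PT True E' (Sh (Nom a))))))"
  "good (Sh (NomEQ a E E')) \<Longrightarrow> good (NT (PT False E' (NT (PT True E (Sh (Nom a))))))"
  "good (Sh (NomDisj a E E')) \<Longrightarrow> good (Sh (Nom a))"
  "good (Sh (NomDisj a E E')) \<Longrightarrow> good (NT (PT False E (PT True E' (Sh (Nom a)))))"
proof -
  note rexp_le = subcode_le(21,23)[where F = E and G = F] subcode_le(22,24)[where F = E and G = F] subcode_le(25)[where F = E]
  note shape_le = subcode_le(1,3)[where \<phi> = \<phi> and \<psi> = \<psi>] subcode_le(2,4)[where \<phi> = \<phi> and \<psi> = \<psi>]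
    subcode_le(5)[where \<phi> = \<phi> and R = R] subcode_le(7)[where \<phi> = \<phi> and E = E] subcode_le(8)[where \<phi> = \<phi> and E = E]
    subcode_le(10)[where s = s] subcode_le(13,15,16,17)[where a = a and E = E and E' = E'] subcode_le(14,18)[where a = a and E = E and E' = E']
  \<comment> \<open>The height never exceeds the code of an expression by more than one, so the
    surplus of 10 is left for the fixed nesting in the translated equality and disjointness
    shapes.\<close>
  have h: "height X \<le> c" if "code_rexp X < c" for X using height_le[of X] that by simp
  show "good (PT d (RAlt E F) f) \<Longrightarrow> good (PT d E f)" "good (PT d (RAlt E F) f) \<Longrightarrow> good (PT d F f)"
  "good (PT d (RSeq E F) f) \<Longrightarrow> good (PT b E (PT d' F f))" "good (PT d (RSeq E F) f) \<Longrightarrow> good (PT b F (PT d' E f))"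
  "good (PT d (RSeq E F) f) \<Longrightarrow> good (PT d' E f)" "good (PT d (RSeq E F) f) \<Longrightarrow> good (PT d' F f)"
  "good (PT d (RStar E) f) \<Longrightarrow> good (PT d E (PT d (RStar E) f))"
    using rexp_le by (auto simp del: code_rexp.simps)
  show "good (Sh (Or \<phi> \<psi>)) \<Longrightarrow> good (Sh \<phi>)" "good (Sh (Or \<phi> \<psi>)) \<Longrightarrow> good (Sh \<psi>)"
  "good (Sh (And \<phi> \<psi>)) \<Longrightarrow> good (Sh \<phi>)" "good (Sh (And \<phi> \<psi>)) \<Longrightarrow> good (Sh \<psi>)"
  "good (Sh (ExRoles R \<phi>)) \<Longrightarrow> good (Sh \<phi>)" "good (Sh (NegName s)) \<Longrightarrow> good (Sh (Name s))"
  "good (Sh (NomEQ a E E')) \<Longrightarrow> good (Sh (Nom a))" "good (Sh (NomDisj a E E')) \<Longrightarrow> good (Sh (Nom a))"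
    using shape_le by (auto simp del: code_shape.simps)
  show "good (Sh (ExPath E \<phi>)) \<Longrightarrow> good (PT False E (Sh \<phi>))"
    using shape_le h[of E] by (auto simp del: code_shape.simps)
  show "good (Sh (NomEQ a E E')) \<Longrightarrow> good (NT (PT False E (NT (PT True E' (Sh (Nom a))))))"
  "good (Sh (NomEQ a E E')) \<Longrightarrow> good (NT (PT False E' (NT (PT True E (Sh (Nom a))))))"
  "good (Sh (NomDisj a E E')) \<Longrightarrow> good (NT (PT False E (PT True E' (Sh (Nom a)))))"
    using shape_le h[of E] h[of E'] by (auto simp del: code_shape.simps)
qed

end

context rewriting
begin

lemma mem_c: "prod_encode (s, x) \<in> set_decode c \<longleftrightarrow> (\<exists>\<phi>. (s, \<phi>) \<in> C \<and> x = code_shape \<phi>)"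
  unfolding c_def by (rule mem_code_constraints[OF finite_C])

lemma C_less: "(s, \<phi>) \<in> C \<Longrightarrow> s < c \<and> code_shape \<phi> < c"
proof -
  assume "(s, \<phi>) \<in> C"
  hence "prod_encode (s, code_shape \<phi>) < c" using mem_c member_less by blast
  thus ?thesis using le_prod_encode_1[of s "code_shape \<phi>"] le_prod_encode_2[of "code_shape \<phi>" s] by linarith
qed

lemma names_less: "s \<in> names_of C \<Longrightarrow> s < c"
proof -
  have "s \<le> code_shape \<phi>" if "s \<in> shape_names \<phi>" for \<phi> s
    using that
  proof (induction \<phi>)
    case (Or \<phi> \<psi>)
    thus ?case using subcode_le(1)[of \<phi> \<psi>] subcode_le(2)[of \<psi> \<phi>] by (auto simp del: code_shape.simps)
  next
    case (And \<phi> \<psi>)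
    thus ?case using subcode_le(3)[of \<phi> \<psi>] subcode_le(4)[of \<psi> \<phi>] by (auto simp del: code_shape.simps)
  next
    case (ExRoles R \<phi>)
    thus ?case using subcode_le(5)[of \<phi> R] by (auto simp del: code_shape.simps)
  next
    case (ExPath E \<phi>)
    thus ?case using subcode_le(7)[of \<phi> E] by (auto simp del: code_shape.simps)
  qed (use subcode_le(10,11) in \<open>auto simp del: code_shape.simps\<close>)
  moreover assume "s \<in> names_of C"
  ultimately show ?thesis using C_less by (fastforce simp: names_of_def)
qed

end

text \<open>All that is kept of a stratification is a level for each name, high enough for the
  bodies of its constraints.\<close>

locale kb_strat = kb +
  fixes st :: "shape_name \<Rightarrow> nat"
  assumes strat: "stratified C" and st: "(s, \<phi>) \<in> C \<Longrightarrow> need_shape st \<phi> \<le> st s" and st_ge: "4 \<le> st s"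
begin

abbreviation S :: assignment where "S \<equiv> PA C U"

primrec fm_ext :: "fm \<Rightarrow> obj set" where
  "fm_ext (Sh \<phi>) = shape_ext U S \<phi>"
| "fm_ext (PT d E f) = {x. \<exists>y\<in>fm_ext f. (if d then (y, x) else (x, y)) \<in> rexp_ext U E}"
| "fm_ext (NT f) = dom U - fm_ext f"

lemma need_shape_ge: "4 \<le> need_shape st \<phi>"
  by (induction \<phi>) (use st_ge in \<open>auto simp: le_Suc_eq\<close>)

lemma need_ge: "4 \<le> need st f"
  by (induction f) (auto simp: need_shape_ge)

lemma reduct_ext_dom: "N \<subseteq> {(s, e). e \<in> dom U} \<Longrightarrow> reduct_ext U N' N \<phi> \<subseteq> dom U"
proof (induction \<phi>)
  case (Cpt B)
  thus ?case using concept_ext_dom[OF interpretation_wf_U] by simp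
qed (use el_dom[of _ "[]"] in \<open>auto split: if_splits\<close>)

lemma S_dom: "S \<subseteq> {(s, e). e \<in> dom U}"
proof (rule PA_least[OF strat])
  fix s :: shape_name and \<phi> e assume e: "e \<in> reduct_ext U S (S \<inter> {(s, e). e \<in> dom U}) \<phi>"
  have "reduct_ext U S (S \<inter> {(s, e). e \<in> dom U}) \<phi> \<subseteq> dom U" by (rule reduct_ext_dom) blast
  thus "(s, e) \<in> {(s, e). e \<in> dom U}" using e by blast
qed

lemma fm_ext_dom: "fm_ext f \<subseteq> dom U"
proof (induction f)
  case (Sh \<phi>)
  thus ?case using reduct_ext_dom[OF S_dom] by (simp add: shape_ext_eq_reduct)
next
  case (PT d E f)
  thus ?case using rexp_ext_dom[OF interpretation_wf_U] by (fastforce split: if_splits)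
qed auto

lemma formula_rule:
  "valid p \<Longrightarrow> (h, a, b, d) \<in> formula_rules t c W \<Longrightarrow> lits A (holds A) x p a \<Longrightarrow> lits A (holds A) x p b \<Longrightarrow>
   lits A (holds A) x p d \<Longrightarrow> h \<in> th A x p"
  using th_pos[of p h a b d A x] unfolding pos_rules_def by blast

lemma formula_neg_rule:
  "valid p \<Longrightarrow> (h, a, b) \<in> formula_neg_rules W \<Longrightarrow> lits A (holds A) x p a \<Longrightarrow> \<not> lits A (holds A) x p b \<Longrightarrow>
   h \<in> th A x p"
  using th_neg[of p h a b A x] unfolding neg_rules_def by blast

text \<open>The bound holds for the roles of the TBox and of the constraints together with their
  inverses, and it puts the code of any set of them below \<open>W\<close>.\<close>

definition small_roles :: "role fset \<Rightarrow> bool" where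
  "small_roles R \<longleftrightarrow> (\<forall>r. r |\<in>| R \<longrightarrow> code_role r \<le> prod_encode (1, t + c))"

lemma small_roles_less: "small_roles R \<Longrightarrow> code_roles R < W"
proof -
  assume "small_roles R"
  hence "code_role ` fset R \<subseteq> {..<Suc (prod_encode (1, t + c))}" by (auto simp: small_roles_def less_Suc_eq_le)
  from set_encode_mono_less[OF this] have "code_roles R \<le> 2 ^ Suc (prod_encode (1, t + c))"
    unfolding code_roles_def by simp
  also have "\<dots> \<le> 2 ^ Suc (Suc (prod_encode (1, t + c) + t + c))" by (rule power_increasing) auto
  finally show ?thesis by (intro W_bounds(5)) simp
qed

lemma code_le_1: "x \<le> t \<or> x \<le> c \<or> x \<le> prod_encode (1, t) \<or> x \<le> prod_encode (1, c) \<Longrightarrow> x \<le> prod_encode (1, t + c)"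
  using le_prod_encode_2[of "t + c" 1] prod_encode_mono[of 1 1 t "t + c"] prod_encode_mono[of 1 1 c "t + c"] by auto

context
  fixes n :: nat
  assumes n: "4 \<le> n" "n \<le> c + 10"
begin

lemma n_W: "n < W"
  using n W_bounds(3) by simp

abbreviation fmh :: "individual \<Rightarrow> nat list \<Rightarrow> fm \<Rightarrow> bool" where
  "fmh a p f \<equiv> (n, FM (code_fm f)) \<in> th A (Ind a) p"

subsection \<open>Completeness\<close>

text \<open>The empty conjunction of roles relates all nodes. The information climbs from the
  witness to its root by \<open>Bel\<close>, passes to every root through the empty role set, and
  descends by \<open>Glo\<close>.\<close>

lemma dia_all:
  assumes f: "code_fm f < W" and p: "node a p" and q: "node b q" and h: "fmh b q f"
  shows "(n, Dia 0 (code_fm f)) \<in> th A (Ind a) p"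
proof -
  have "(n, Bel (code_fm f)) \<in> th A (Ind b) q"
    by (rule formula_rule[OF node_valid[OF q] formula_rules.below[OF n_W f n(1)]]) (use h q in \<open>auto simp: node_def\<close>)
  hence "(n, Bel (code_fm f)) \<in> th A (Ind b) []" using q
  proof (induction q)
    case (Cons k q)
    have k: "k < W" "node b q" "valid q" using Cons.prems(2) node_kid[of b k q] axiom_less_W node_valid by (auto simp: node_def)
    have "(n, Bel (code_fm f)) \<in> th A (Ind b) q"
      by (rule formula_rule[OF k(3) formula_rules.below_kid[OF n_W k(1) f n(1)]]) (use Cons.prems(1) in auto)
    thus ?case using Cons.IH k(2) by blast
  qed
  hence "(n, Glo (code_fm f)) \<in> th A (Ind a) []"
  proof (intro formula_rule[OF _ formula_rules.global[OF n_W f n(1)]])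
    assume b: "(n, Bel (code_fm f)) \<in> th A (Ind b) []"
    have "0 = code_roles {||}" "0 < M" using W_bounds(4) W_le_M by (auto simp: code_roles_def)
    thus "lits A (holds A) (Ind a) [] (n, Nbr 0 (Bel (code_fm f)))"
      "lits A (holds A) (Ind a) [] (n, Nbr 0 (Bel (code_fm f)))"
      "lits A (holds A) (Ind a) [] (n, Nbr 0 (Bel (code_fm f)))" using b by auto
  qed auto
  hence "(n, Glo (code_fm f)) \<in> th A (Ind a) p" using node_valid[OF p]
  proof (induction p)
    case (Cons k p)
    show ?case
      by (rule formula_rule[OF Cons.prems(2) formula_rules.global_kid[OF n_W f n(1)]]) (use Cons in auto)
  qed
  thus ?thesis
    by (intro formula_rule[OF node_valid[OF p] formula_rules.dia_all[OF n_W f n(1)]]) auto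
qed

lemma dia_complete:
  assumes f: "code_fm f < W" and R: "small_roles R" and p: "node a p" and q: "node b q" and h: "fmh b q f"
    and rel: "\<And>r. r |\<in>| R \<Longrightarrow> rel a p b q r"
  shows "(n, Dia (code_roles R) (code_fm f)) \<in> th A (Ind a) p"
proof (cases "R = {||}")
  case True
  thus ?thesis using dia_all[OF f p q h] by (simp add: code_roles_def)
next
  case False
  then obtain r0 where r0: "r0 |\<in>| R" by blast
  have RW: "code_roles R < W" by (rule small_roles_less[OF R])
  have dR: "set_decode (code_roles R) = code_role ` fset R" by (simp add: code_roles_def set_encode_inverse)
  \<comment> \<open>One role of \<open>R\<close> already determines the relative position of the two
    nodes, and thereby the clause of \<open>rel\<close> that holds for all other roles of
    \<open>R\<close>.\<close>
  from rel[OF r0] consider "p = []" "q = []"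
    | e s g where "a = b" "ExIncl e s g \<in> T" "q = code_axiom (ExIncl e s g) # p"
    | e s g where "a = b" "ExIncl e s g \<in> T" "p = code_axiom (ExIncl e s g) # q"
    unfolding rel_def by blast
  thus ?thesis
  proof cases
    case 1
    \<comment> \<open>Different roles of \<open>R\<close> may be supported by different ABox roles
      between the same two individuals; these are collected in \<open>Q\<close>.\<close>
    have "\<forall>r. \<exists>u. r |\<in>| R \<longrightarrow> (Ind a, Ind b) \<in> role_ext (abox_interp A) u \<and> sub_role T u r"
      using rel 1 by (auto simp: rel_def)
    then obtain u where u: "\<And>r. r |\<in>| R \<Longrightarrow> (Ind a, Ind b) \<in> role_ext (abox_interp A) (u r) \<and> sub_role T (u r) r" by metis
    define Q where "Q = u |`| R"
    have "small_roles Q"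
      unfolding small_roles_def
    proof (intro allI impI)
      fix x assume "x |\<in>| Q"
      then obtain r where r: "r |\<in>| R" "x = u r" by (auto simp: Q_def)
      show "code_role x \<le> prod_encode (1, t + c)"
        using sub_role_source[of x r] u[OF r(1)] r R code_le_1[of "code_role x"] by (auto simp: small_roles_def)
    qed
    hence QW: "code_roles Q < W" by (rule small_roles_less)
    have dQ: "set_decode (code_roles Q) = code_role ` fset Q" by (simp add: code_roles_def set_encode_inverse)
    have cover: "\<forall>r<code_roles R. r \<in> set_decode (code_roles R) \<longrightarrow>
        (\<exists>v<code_roles Q. v \<in> set_decode (code_roles Q) \<and> role_le t v r)"
    proof (intro allI impI)
      fix x assume "x \<in> set_decode (code_roles R)"
      then obtain r where r: "r |\<in>| R" "x = code_role r" by (auto simp: dR)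
      have "code_role (u r) \<in> set_decode (code_roles Q)" unfolding dQ using r(1) by (auto simp: Q_def)
      thus "\<exists>v<code_roles Q. v \<in> set_decode (code_roles Q) \<and> role_le t v x"
        using u[OF r(1)] r(2) member_less by (intro exI[of _ "code_role (u r)"]) auto
    qed
    have "lits A (holds A) (Ind a) p (n, Nbr (code_roles Q) (FM (code_fm f)))"
      using 1 h u QW W_le_M by (auto simp: Q_def intro!: exI[of _ "Ind b"])
    thus ?thesis
      by (intro formula_rule[OF node_valid[OF p] formula_rules.dia_nbr[OF n_W RW QW f n(1) cover]])
  next
    case (2 e s g)
    have s: "sub_role T s r" if "r |\<in>| R" for r
      using rel[OF that] 2 by (auto simp: rel_def)
    note l = ExIncl_less[OF 2(2)] W_bounds(1)
    have all: "\<forall>r<code_roles R. r \<in> set_decode (code_roles R) \<longrightarrow> role_le t (code_role s) r"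
      using s by (auto simp: dR)
    have m: "ex_code (code_concept e) (code_role s) (code_concept g) \<in> set_decode t" using 2(2) by (auto simp: mem_t_codes)
    show ?thesis
      by (rule formula_rule[OF node_valid[OF p] formula_rules.dia_kid[OF n_W RW _ _ _ f n(1) m all]])
        (use l h q 2 in \<open>auto simp: node_def simp flip: code_axiom_codes\<close>)
  next
    case (3 e s g)
    have s: "sub_role T (inv_role s) r" if "r |\<in>| R" for r
      using rel[OF that] 3 by (auto simp: rel_def)
    note l = ExIncl_less[OF 3(2)] W_bounds(1)
    have all: "\<forall>r<code_roles R. r \<in> set_decode (code_roles R) \<longrightarrow> role_le t (inv_code (code_role s)) r"
      using s by (auto simp: dR)
    have m: "ex_code (code_concept e) (code_role s) (code_concept g) \<in> set_decode t" using 3(2) by (auto simp: mem_t_codes)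
    show ?thesis
      by (rule formula_rule[OF node_valid[OF p] formula_rules.dia_parent[OF n_W RW _ _ _ f n(1) m all]])
        (use l h q 3 in \<open>auto simp: node_def simp flip: code_axiom_codes\<close>)
  qed
qed

section \<open>Path formulas\<close>

definition el_sat :: "fm \<Rightarrow> obj \<Rightarrow> bool" where
  "el_sat f x \<longleftrightarrow> (\<exists>a p. node a p \<and> x = el a p \<and> fmh a p f)"

lemma el_sat_el [simp]: "el_sat f (el a p) \<longleftrightarrow> node a p \<and> fmh a p f"
  by (auto simp: el_sat_def)

lemma el_sat_rule: "el_sat f x \<Longrightarrow> (\<And>a p. node a p \<Longrightarrow> fmh a p f \<Longrightarrow> fmh a p g) \<Longrightarrow> el_sat g x"
  by (auto simp: el_sat_def)

lemma el_sat_dia: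
  assumes "el_sat f y" "x \<in> dom U" "code_fm f < W" "small_roles R" "\<And>r. r |\<in>| R \<Longrightarrow> (x, y) \<in> role_ext U r"
    "\<And>a p. node a p \<Longrightarrow> (n, Dia (code_roles R) (code_fm f)) \<in> th A (Ind a) p \<Longrightarrow> fmh a p g"
  shows "el_sat g x"
proof -
  obtain b q where y: "node b q" "y = el b q" "fmh b q f" using assms(1) by (auto simp: el_sat_def)
  obtain a p where x: "node a p" "x = el a p" using assms(2) by (auto simp: dom_U)
  have "rel a p b q r" if "r |\<in>| R" for r using assms(5)[OF that] x y by simp
  from assms(6)[OF x(1) dia_complete[OF assms(3,4) x(1) y(1,3) this]] show ?thesis using x by simp
qed

lemma d_W: "(if d then 1 else 0) < W"
  using W_bounds(4) by simp

lemma path_rules: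
  assumes p: "node a p" and f: "good f"
  shows "fmh a p f \<Longrightarrow> fmh a p (PT d ROne f)"
    "code_role r < W \<Longrightarrow> (n, Dia (code_roles {|r|}) (code_fm f)) \<in> th A (Ind a) p \<Longrightarrow> fmh a p (PT False (RRole r) f)"
    "code_role r < W \<Longrightarrow> (n, Dia (code_roles {|inv_role r|}) (code_fm f)) \<in> th A (Ind a) p \<Longrightarrow> fmh a p (PT True (RRole r) f)"
    "code_rexp E < W \<Longrightarrow> code_rexp F < W \<Longrightarrow> fmh a p (PT d E f) \<Longrightarrow> fmh a p (PT d (RAlt E F) f)"
    "code_rexp E < W \<Longrightarrow> code_rexp F < W \<Longrightarrow> fmh a p (PT d F f) \<Longrightarrow> fmh a p (PT d (RAlt E F) f)"
    "code_rexp E < W \<Longrightarrow> code_rexp F < W \<Longrightarrow> fmh a p (PT False E (PT False F f)) \<Longrightarrow> fmh a p (PT False (RSeq E F) f)"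
    "code_rexp E < W \<Longrightarrow> code_rexp F < W \<Longrightarrow> fmh a p (PT True F (PT True E f)) \<Longrightarrow> fmh a p (PT True (RSeq E F) f)"
    "code_rexp E < W \<Longrightarrow> fmh a p f \<Longrightarrow> fmh a p (PT d (RStar E) f)"
    "code_rexp E < W \<Longrightarrow> fmh a p (PT d E (PT d (RStar E) f)) \<Longrightarrow> fmh a p (PT d (RStar E) f)"
proof -
  note v = node_valid[OF p] and fW = good_less_W[OF f]
  note R = formula_rule[OF v]
  show "fmh a p f \<Longrightarrow> fmh a p (PT d ROne f)"
    using R[OF formula_rules.path_one[OF n_W d_W fW n(1)], of "Ind a"] by simp
  show "code_role r < W \<Longrightarrow> (n, Dia (code_roles {|r|}) (code_fm f)) \<in> th A (Ind a) p \<Longrightarrow> fmh a p (PT False (RRole r) f)"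
    using R[OF formula_rules.path_role[OF n_W _ fW n(1)], of "code_role r" "Ind a"] by (simp add: code_roles_single)
  show "code_role r < W \<Longrightarrow> (n, Dia (code_roles {|inv_role r|}) (code_fm f)) \<in> th A (Ind a) p \<Longrightarrow> fmh a p (PT True (RRole r) f)"
    using R[OF formula_rules.path_back[OF n_W _ fW n(1)], of "code_role r" "Ind a"] by (simp add: code_roles_single)
  show "code_rexp E < W \<Longrightarrow> code_rexp F < W \<Longrightarrow> fmh a p (PT d E f) \<Longrightarrow> fmh a p (PT d (RAlt E F) f)"
    using R[OF formula_rules.path_alt1[OF n_W d_W _ _ fW n(1)], of "code_rexp E" "code_rexp F" "Ind a"] by simp
  show "code_rexp E < W \<Longrightarrow> code_rexp F < W \<Longrightarrow> fmh a p (PT d F f) \<Longrightarrow> fmh a p (PT d (RAlt E F) f)"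
    using R[OF formula_rules.path_alt2[OF n_W d_W _ _ fW n(1)], of "code_rexp E" "code_rexp F" "Ind a"] by simp
  show "code_rexp E < W \<Longrightarrow> code_rexp F < W \<Longrightarrow> fmh a p (PT False E (PT False F f)) \<Longrightarrow> fmh a p (PT False (RSeq E F) f)"
    using R[OF formula_rules.path_seq[OF n_W _ _ fW n(1)], of "code_rexp E" "code_rexp F" "Ind a"] by simp
  show "code_rexp E < W \<Longrightarrow> code_rexp F < W \<Longrightarrow> fmh a p (PT True F (PT True E f)) \<Longrightarrow> fmh a p (PT True (RSeq E F) f)"
    using R[OF formula_rules.path_seq_back[OF n_W _ _ fW n(1)], of "code_rexp E" "code_rexp F" "Ind a"] by simp
  show "code_rexp E < W \<Longrightarrow> fmh a p f \<Longrightarrow> fmh a p (PT d (RStar E) f)"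
    using R[OF formula_rules.path_star0[OF n_W d_W _ fW n(1)], of "code_rexp E" "Ind a"] by simp
  show "code_rexp E < W \<Longrightarrow> fmh a p (PT d E (PT d (RStar E) f)) \<Longrightarrow> fmh a p (PT d (RStar E) f)"
    using R[OF formula_rules.path_star[OF n_W d_W _ fW n(1)], of "code_rexp E" "Ind a"] by simp
qed

lemma rexp_sub_W:
  "code_rexp (RAlt E F) < c \<Longrightarrow> code_rexp E < W \<and> code_rexp F < W"
  "code_rexp (RSeq E F) < c \<Longrightarrow> code_rexp E < W \<and> code_rexp F < W"
  "code_rexp (RStar E) < c \<Longrightarrow> code_rexp E < W"
  "code_rexp (RRole r) < c \<Longrightarrow> code_role r < W \<and> code_role r \<le> c"
  using subcode_le(21,23)[of E F] subcode_le(22,24)[of F E] subcode_le(25)[of E] subcode_le(26)[of r] W_bounds(2)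
  by linarith+

text \<open>The formula \<open>f\<close> acts as a continuation: the induction on the word consumes
  it factor by factor, and what remains to be done becomes the new \<open>f\<close>. This works for
  forward paths, whose formula holds at the starting point.\<close>

lemma path_complete:
  assumes "word_of E w" "labels_path U w x y" "el_sat f y" "good (PT False E f)"
  shows "el_sat (PT False E f) x"
  using assms
proof (induction arbitrary: f x y rule: word_of.induct)
  case 1
  hence "el_sat f x" by simp
  thus ?case by (rule el_sat_rule) (rule path_rules(1), use 1 in auto)
next
  case (2 r)
  have r: "(x, y) \<in> role_ext U r" using 2(1) by auto
  have g: "good f" "code_role r < W" "code_role r \<le> c" using 2 rexp_sub_W(4)[of r] by auto
  show ?case
  proof (rule el_sat_dia[OF 2(2), of x "{|r|}"])
    show "x \<in> dom U" using r by (auto simp: role_ext_U)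
  qed (use r g good_less_W path_rules(2) code_le_1 in \<open>auto simp: small_roles_def\<close>)
next
  case (3 E w F)
  have "el_sat (PT False E f) x" using 3 good_simps(1) by blast
  thus ?case by (rule el_sat_rule) (rule path_rules(4), use 3 rexp_sub_W(1)[of E F] in auto)
next
  case (4 F w E)
  have "el_sat (PT False F f) x" using 4 good_simps(2) by blast
  thus ?case by (rule el_sat_rule) (rule path_rules(5), use 4 rexp_sub_W(1)[of E F] in auto)
next
  case (5 E v F w)
  obtain m where m: "labels_path U v x m" "labels_path U w m y"
    using 5(5) labels_path_append[OF interpretation_wf_U] by blast
  have "el_sat (PT False F f) m" using 5(4)[OF m(2) 5(6)] good_simps(6)[OF 5(7)] by blast
  hence "el_sat (PT False E (PT False F f)) x" using 5(3)[OF m(1)] good_simps(3)[OF 5(7)] by blast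
  thus ?case by (rule el_sat_rule) (rule path_rules(6), use 5 rexp_sub_W(2)[of E F] in auto)
next
  case (6 E)
  hence "el_sat f x" by simp
  thus ?case by (rule el_sat_rule) (rule path_rules(8), use 6 rexp_sub_W(3)[of E] in auto)
next
  case (7 E v w)
  obtain m where m: "labels_path U v x m" "labels_path U w m y"
    using 7(5) labels_path_append[OF interpretation_wf_U] by blast
  have "el_sat (PT False (RStar E) f) m" using 7(4)[OF m(2) 7(6,7)] .
  hence "el_sat (PT False E (PT False (RStar E) f)) x" using 7(3)[OF m(1)] good_simps(7)[OF 7(7)] by blast
  thus ?case by (rule el_sat_rule) (rule path_rules(9), use 7 rexp_sub_W(3)[of E] in auto)
qed

text \<open>Here \<open>f\<close> holds at the start of the path and the path formula at its end.
  For a star the formula is carried along the word from the start, one factor at a time, so the main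
  induction is on the expression.\<close>

lemma path_back_complete:
  assumes "(x, y) \<in> rexp_ext U E" "el_sat f x" "good (PT True E f)"
  shows "el_sat (PT True E f) y"
  using assms
proof (induction E arbitrary: f x y)
  case RZero
  thus ?case by (auto simp: rexp_ext_def elim: word_of.cases)
next
  case ROne
  hence "el_sat f y" by (simp add: rexp_ext_eqs[OF interpretation_wf_U])
  thus ?case by (rule el_sat_rule) (rule path_rules(1), use ROne in auto)
next
  case (RRole r)
  have r: "(x, y) \<in> role_ext U r" using RRole(1) by (simp add: rexp_ext_eqs[OF interpretation_wf_U])
  have g: "good f" "code_role r < W" "code_role r \<le> c" using RRole rexp_sub_W(4)[of r] by auto
  have "code_role (inv_role r) \<le> prod_encode (1, c)" using inv_code_le[OF g(3)] by simp
  hence s: "small_roles {|inv_role r|}" using code_le_1 by (auto simp: small_roles_def)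
  show ?case
  proof (rule el_sat_dia[OF RRole(2) _ _ s])
    show "y \<in> dom U" using r by (auto simp: role_ext_U)
  qed (use r g good_less_W path_rules(3) in auto)
next
  case (RAlt E F)
  from RAlt(3) have "(x, y) \<in> rexp_ext U E \<or> (x, y) \<in> rexp_ext U F"
    by (fastforce simp: rexp_ext_def elim: word_of.cases)
  hence "el_sat (PT True E f) y \<or> el_sat (PT True F f) y" using RAlt good_simps(1,2) by blast
  thus ?case
  proof
    assume "el_sat (PT True E f) y"
    thus ?thesis by (rule el_sat_rule) (rule path_rules(4), use RAlt rexp_sub_W(1)[of E F] in auto)
  next
    assume "el_sat (PT True F f) y"
    thus ?thesis by (rule el_sat_rule) (rule path_rules(5), use RAlt rexp_sub_W(1)[of E F] in auto)
  qed
next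
  case (RSeq E F)
  obtain w where w: "word_of (RSeq E F) w" "labels_path U w x y" using RSeq(3) by (auto simp: rexp_ext_def)
  from w(1) obtain u v where uv: "w = u @ v" "word_of E u" "word_of F v" by (auto elim: word_of.cases)
  then obtain m where m: "(x, m) \<in> rexp_ext U E" "(m, y) \<in> rexp_ext U F"
    using w(2) labels_path_append[OF interpretation_wf_U] by (auto simp: rexp_ext_def)
  have "el_sat (PT True E f) m" using RSeq(1)[OF m(1) RSeq(4)] good_simps(5)[OF RSeq(5)] by blast
  hence "el_sat (PT True F (PT True E f)) y" using RSeq(2)[OF m(2)] good_simps(4)[OF RSeq(5)] by blast
  thus ?case by (rule el_sat_rule) (rule path_rules(7), use RSeq rexp_sub_W(2)[of E F] in auto)
next
  case (RStar E)
  note E = rexp_sub_W(3)[of E]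
  have step: "el_sat (PT True (RStar E) f) z" if "el_sat (PT True (RStar E) f) y" "(y, z) \<in> rexp_ext U E" for y z
  proof -
    have "el_sat (PT True E (PT True (RStar E) f)) z"
      using RStar(1)[OF that(2,1)] good_simps(7)[OF RStar(4)] by blast
    thus ?thesis by (rule el_sat_rule) (rule path_rules(9), use RStar E in auto)
  qed
  have "el_sat (PT True (RStar E) f) y"
    if "word_of F w" "F = RStar E" "labels_path U w x y" "el_sat (PT True (RStar E) f) x" for F w x y
    using that
  proof (induction arbitrary: x rule: word_of.induct)
    case (7 E' v w)
    then obtain m where "(x, m) \<in> rexp_ext U E" "labels_path U w m y"
      using labels_path_append[OF interpretation_wf_U] by (auto simp: rexp_ext_def)
    thus ?case using step 7 by blast
  qed auto
  moreover have "el_sat (PT True (RStar E) f) x"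
    using RStar(3) by (rule el_sat_rule) (rule path_rules(8), use RStar E in auto)
  ultimately show ?case using RStar(2) by (auto simp: rexp_ext_def)
qed

text \<open>Each inclusion between the successor sets becomes the absence of a successor along one
  expression that the converse of the other does not lead back to \<open>a\<close>.\<close>

lemma NomEQ_iff:
  "rexp_ext U E `` {Ind a} = rexp_ext U E' `` {Ind a} \<longleftrightarrow>
     Ind a \<notin> fm_ext (PT False E (NT (PT True E' (Sh (Nom a))))) \<and>
     Ind a \<notin> fm_ext (PT False E' (NT (PT True E (Sh (Nom a)))))"
proof -
  have "Ind a \<notin> fm_ext (PT False E (NT (PT True E' (Sh (Nom a))))) \<longleftrightarrow> rexp_ext U E `` {Ind a} \<subseteq> rexp_ext U E' `` {Ind a}" for E E'
  proof -
    have "y \<in> dom U" if "(Ind a, y) \<in> rexp_ext U E" for y using rexp_ext_dom[OF interpretation_wf_U that] ..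
    thus ?thesis by simp blast
  qed
  thus ?thesis by (simp only:) blast
qed

lemma NomDisj_iff:
  "rexp_ext U E `` {Ind a} \<inter> rexp_ext U E' `` {Ind a} = {} \<longleftrightarrow>
     Ind a \<notin> fm_ext (PT False E (PT True E' (Sh (Nom a))))"
  by auto

text \<open>A negation on level \<open>n\<close> reads level \<open>n - 1\<close>, so correctness is
  proved by induction on the level. Each direction on level \<open>n\<close> uses an equivalence
  below: completeness needs soundness there for negated formulas, and conversely.\<close>

context
  assumes IH: "\<And>m f a p. 4 \<le> m \<Longrightarrow> m < n \<Longrightarrow> good f \<Longrightarrow> need st f \<le> m \<Longrightarrow> node a p \<Longrightarrow>
    (m, FM (code_fm f)) \<in> th A (Ind a) p \<longleftrightarrow> el a p \<in> fm_ext f"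
begin

lemma not_complete:
  assumes "good (NT f)" "need st (NT f) \<le> n" "node a p" "el a p \<notin> fm_ext f"
  shows "fmh a p (NT f)"
proof -
  obtain m where m: "n = Suc m" "need st f \<le> m" "4 \<le> m" using assms(2) need_ge[of f] by (cases n) auto
  have f: "good f" using assms(1) by simp
  have "(m, FM (code_fm f)) \<notin> th A (Ind a) p" using IH[OF m(3) _ f m(2) assms(3)] m(1) assms(4) by simp
  thus ?thesis unfolding m(1) code_fm.simps
    by (intro formula_neg_rule[OF node_valid[OF assms(3)] formula_neg_rules.neg[OF _ good_less_W[OF f] m(3)]])
      (use n_W m(1) in auto)
qed

text \<open>The set to which leastness of the perfect assignment is applied.\<close>

definition name_complete :: "(shape_name \<times> obj) set" where
  "name_complete = {(s, e). \<forall>a p. e = el a p \<longrightarrow> node a p \<longrightarrow> s < c \<longrightarrow> st s \<le> n \<longrightarrow> fmh a p (Sh (Name s))}"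

text \<open>Positive names are read off \<open>S \<inter> name_complete\<close>, where completeness
  is already available; negated names are read off \<open>S\<close> and settled by correctness on
  the preceding level.\<close>

lemma shape_complete:
  assumes "el a p \<in> reduct_ext U S (S \<inter> name_complete) \<phi>" "node a p" "good (Sh \<phi>)" "need_shape st \<phi> \<le> n"
  shows "fmh a p (Sh \<phi>)"
  using assms
proof (induction \<phi> arbitrary: a p)
  case (Nom e)
  hence p: "p = []" "a = e" by auto
  have "e < W" using Nom(3) subcode_le(12)[of e] W_bounds(2) by auto
  thus ?case unfolding code_fm.simps code_shape.simps
    by (intro formula_rule[OF node_valid[OF Nom(2)] formula_rules.nom[OF n_W _ n(1)]]) (use p W_le_M in auto)
next
  case (Name s)
  have "s < c" using Name(3) subcode_le(11)[of s] by auto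
  thus ?case using Name by (auto simp: name_complete_def)
next
  case (NegName s)
  have g: "good (Sh (Name s))" using good_simps(14)[OF NegName(3)] .
  have s: "s < W" using NegName(3) subcode_le(10)[of s] W_bounds(2) by auto
  obtain m where m: "n = Suc m" "st s \<le> m" "4 \<le> m" using NegName(4) st_ge[of s] by (cases n) auto
  have "(m, FM (code_fm (Sh (Name s)))) \<notin> th A (Ind a) p"
    using IH[OF m(3) _ g _ NegName(2)] m(1,2) NegName(1) by simp
  thus ?case unfolding m(1) code_fm.simps code_shape.simps
    by (intro formula_neg_rule[OF node_valid[OF NegName(2)] formula_neg_rules.neg_name[OF _ s m(3)]])
      (use n_W m(1) in auto)
next
  case (Cpt B)
  have B: "code_concept B < W" using Cpt(3) subcode_le(9)[of B] W_bounds(2) by auto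
  hence "has A (Ind a) p B" using Cpt(1,2) by simp
  thus ?case unfolding code_fm.simps code_shape.simps
    by (intro formula_rule[OF node_valid[OF Cpt(2)] formula_rules.cpt[OF n_W B n(1)]]) auto
next
  case (Or \<phi> \<psi>)
  have W: "code_shape \<phi> < W" "code_shape \<psi> < W"
    using Or(5) subcode_le(1)[of \<phi> \<psi>] subcode_le(2)[of \<psi> \<phi>] W_bounds(2) by auto
  note g = good_simps(8,9)[OF Or(5)]
  from Or(3) consider "el a p \<in> reduct_ext U S (S \<inter> name_complete) \<phi>" | "el a p \<in> reduct_ext U S (S \<inter> name_complete) \<psi>" by auto
  thus ?case
  proof cases
    case 1
    hence "fmh a p (Sh \<phi>)" using Or g by simp
    thus ?thesis unfolding code_fm.simps code_shape.simps
      by (intro formula_rule[OF node_valid[OF Or(4)] formula_rules.or1[OF n_W W n(1)]]) auto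
  next
    case 2
    hence "fmh a p (Sh \<psi>)" using Or g by simp
    thus ?thesis unfolding code_fm.simps code_shape.simps
      by (intro formula_rule[OF node_valid[OF Or(4)] formula_rules.or2[OF n_W W n(1)]]) auto
  qed
next
  case (And \<phi> \<psi>)
  have W: "code_shape \<phi> < W" "code_shape \<psi> < W"
    using And(5) subcode_le(3)[of \<phi> \<psi>] subcode_le(4)[of \<psi> \<phi>] W_bounds(2) by auto
  note g = good_simps(10,11)[OF And(5)]
  have "fmh a p (Sh \<phi>)" "fmh a p (Sh \<psi>)" using And g by simp_all
  thus ?case unfolding code_fm.simps code_shape.simps
    by (intro formula_rule[OF node_valid[OF And(4)] formula_rules.conj_shape[OF n_W W n(1)]]) auto
next
  case (ExRoles R \<phi>)
  have W: "code_shape \<phi> < W" "code_roles R < c"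
    using ExRoles(4) subcode_le(5)[of \<phi> R] subcode_le(6)[of R \<phi>] W_bounds(2) by auto
  have "code_role r \<le> c" if "r |\<in>| R" for r
  proof -
    have "code_role r \<in> set_decode (code_roles R)" using that by (simp add: code_roles_def set_encode_inverse)
    thus ?thesis using member_less W(2) by fastforce
  qed
  hence R: "small_roles R" using code_le_1 by (auto simp: small_roles_def)
  obtain y where y: "y \<in> dom U" "\<forall>r. r |\<in>| R \<longrightarrow> (el a p, y) \<in> role_ext U r" "y \<in> reduct_ext U S (S \<inter> name_complete) \<phi>"
    using ExRoles(2) by auto
  obtain b q where b: "node b q" "y = el b q" using y(1) by (auto simp: dom_U)
  note g = good_simps(12)[OF ExRoles(4)]
  have h: "fmh b q (Sh \<phi>)" using ExRoles(1)[OF y(3)[unfolded b(2)] b(1) g] ExRoles(5) by simp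
  have "(n, Dia (code_roles R) (code_fm (Sh \<phi>))) \<in> th A (Ind a) p"
    by (rule dia_complete[OF good_less_W[OF g] R ExRoles(3) b(1) h]) (use y(2) b(2) in auto)
  thus ?case unfolding code_fm.simps code_shape_ExRoles
    by (intro formula_rule[OF node_valid[OF ExRoles(3)] formula_rules.ex_roles[OF n_W _ W(1) n(1)]]) (use W(2) W_bounds(2) in auto)
next
  case (ExPath E \<phi>)
  have W: "code_shape \<phi> < W" "code_rexp E < W"
    using ExPath(4) subcode_le(7)[of \<phi> E] subcode_le(8)[of E \<phi>] W_bounds(2) by auto
  obtain y where y: "y \<in> dom U" "(el a p, y) \<in> rexp_ext U E" "y \<in> reduct_ext U S (S \<inter> name_complete) \<phi>"
    using ExPath(2) by auto
  obtain b q where b: "node b q" "y = el b q" using y(1) by (auto simp: dom_U)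
  note g = good_simps(13)[OF ExPath(4)]
  have "fmh b q (Sh \<phi>)" using ExPath(1)[OF y(3)[unfolded b(2)] b(1)] g ExPath(5) by simp
  hence "el_sat (Sh \<phi>) y" using b by simp
  moreover obtain w where "word_of E w" "labels_path U w (el a p) y" using y(2) by (auto simp: rexp_ext_def)
  ultimately have "el_sat (PT False E (Sh \<phi>)) (el a p)" using path_complete g by blast
  hence "fmh a p (PT False E (Sh \<phi>))" by simp
  thus ?case unfolding code_fm.simps code_shape.simps
    by (intro formula_rule[OF node_valid[OF ExPath(3)] formula_rules.ex_path[OF n_W W(2,1) n(1)]]) auto
next
  case (NomEQ e E E')
  have p: "p = []" "a = e" and eq: "rexp_ext U E `` {Ind e} = rexp_ext U E' `` {Ind e}"
    using NomEQ(1) by (auto split: if_splits)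
  have W: "e < W" "code_rexp E < W" "code_rexp E' < W"
    using NomEQ(3) subcode_le(13)[of E e E'] subcode_le(14)[of E' e E] subcode_le(19)[of e E E'] W_bounds(2) by auto
  let ?V1 = "PT False E (NT (PT True E' (Sh (Nom e))))" and ?V2 = "PT False E' (NT (PT True E (Sh (Nom e))))"
  have "Ind e \<notin> fm_ext ?V1" "Ind e \<notin> fm_ext ?V2"
    using iffD1[OF NomEQ_iff eq] by (rule conjunct1, rule conjunct2)
  hence V: "fmh a p (NT ?V1)" "fmh a p (NT ?V2)"
    using not_complete[OF good_simps(16)[OF NomEQ(3)] _ NomEQ(2)] not_complete[OF good_simps(17)[OF NomEQ(3)] _ NomEQ(2)]
      p NomEQ(4) by (simp_all del: fm_ext.simps)
  have "fmh a p (Sh (Nom e))" unfolding code_fm.simps code_shape.simps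
    by (intro formula_rule[OF node_valid[OF NomEQ(2)] formula_rules.nom[OF n_W W(1) n(1)]]) (use p W(1) W_le_M in auto)
  thus ?case using V unfolding code_fm.simps code_shape.simps
    by (intro formula_rule[OF node_valid[OF NomEQ(2)] formula_rules.eq[OF n_W W n(1)]]) auto
next
  case (NomDisj e E E')
  have p: "p = []" "a = e" and eq: "rexp_ext U E `` {Ind e} \<inter> rexp_ext U E' `` {Ind e} = {}"
    using NomDisj(1) by (auto split: if_splits)
  have W: "e < W" "code_rexp E < W" "code_rexp E' < W"
    using NomDisj(3) subcode_le(17)[of E e E'] subcode_le(18)[of E' e E] subcode_le(20)[of e E E'] W_bounds(2) by auto
  let ?V = "PT False E (PT True E' (Sh (Nom e)))"
  have "Ind e \<notin> fm_ext ?V" using eq unfolding NomDisj_iff .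
  hence V: "fmh a p (NT ?V)"
    using not_complete[OF good_simps(19)[OF NomDisj(3)] _ NomDisj(2)] p NomDisj(4) by auto
  have "fmh a p (Sh (Nom e))" unfolding code_fm.simps code_shape.simps
    by (intro formula_rule[OF node_valid[OF NomDisj(2)] formula_rules.nom[OF n_W W(1) n(1)]]) (use p W(1) W_le_M in auto)
  thus ?case using V unfolding code_fm.simps code_shape.simps
    by (intro formula_rule[OF node_valid[OF NomDisj(2)] formula_rules.disj[OF n_W W n(1)]]) auto
qed

lemma S_complete: "S \<subseteq> name_complete"
proof (rule PA_least[OF strat])
  fix s \<phi> e assume C: "(s, \<phi>) \<in> C" and e: "e \<in> reduct_ext U S (S \<inter> name_complete) \<phi>"
  show "(s, e) \<in> name_complete"
    unfolding name_complete_def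
  proof (clarify)
    fix a p assume a: "e = el a p" "node a p" "s < c" "st s \<le> n"
    have "fmh a p (Sh \<phi>)"
      by (rule shape_complete[OF e[unfolded a(1)] a(2)]) (use C_less[OF C] st[OF C] a(4) in auto)
    moreover have m: "prod_encode (s, code_shape \<phi>) \<in> set_decode c" using C mem_c by blast
    ultimately show "fmh a p (Sh (Name s))" unfolding code_fm.simps code_shape.simps
      by (intro formula_rule[OF node_valid[OF a(2)] formula_rules.name[OF n_W _ _ n(1) m]])
        (use C_less[OF C] W_bounds(2) in auto)
  qed
qed

lemma complete:
  assumes "el a p \<in> fm_ext f" "node a p" "good f" "need st f \<le> n"
  shows "fmh a p f"
  using assms
proof (induction f arbitrary: a p)
  case (Sh \<phi>)
  have "S \<inter> name_complete = S" using S_complete by blast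
  thus ?case using shape_complete[of a p \<phi>] Sh by (simp add: shape_ext_eq_reduct)
next
  case (PT d E f)
  obtain y where y: "y \<in> fm_ext f" "(if d then (y, el a p) else (el a p, y)) \<in> rexp_ext U E" using PT(2) by auto
  then obtain b q where b: "node b q" "y = el b q" using fm_ext_dom dom_U by blast
  have f: "el_sat f y" using PT(1)[of b q] y(1) b PT(4,5) by simp
  show ?case
  proof (cases d)
    case True
    hence "(y, el a p) \<in> rexp_ext U E" using y(2) by simp
    from path_back_complete[OF this f] show ?thesis using PT(3,4) True by simp
  next
    case False
    hence "(el a p, y) \<in> rexp_ext U E" using y(2) by simp
    then obtain w where "word_of E w" "labels_path U w (el a p) y" by (auto simp: rexp_ext_def)
    from path_complete[OF this f] show ?thesis using PT(3,4) False by simp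
  qed
next
  case (NT f)
  thus ?case using not_complete[of f a p] by simp
qed

subsection \<open>Soundness\<close>

text \<open>A blank node of the canonical interpretation of the ABox behaves like an individual that the
  ABox does not mention.\<close>

lemma rep_exists: "\<exists>r. (\<forall>a. r (Ind a) = a) \<and> (\<forall>x p. th A x p = th A (Ind (r x)) p)"
proof -
  let ?used = "(\<Union>\<alpha>\<in>A. case \<alpha> of ConceptAssertion B a \<Rightarrow> {a} | RoleAssertion P a b \<Rightarrow> {a, b})"
  have "finite ({..<M} \<union> ?used)" using finite_A by (auto split: assertion.splits)
  then obtain e where e: "e \<notin> {..<M} \<union> ?used" using ex_new_if_finite[OF infinite_UNIV_nat] by blast
  have u: "ConceptAssertion B e \<notin> A" "RoleAssertion q e d \<notin> A" "RoleAssertion q d e \<notin> A" for B q d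
    using e by (auto split: assertion.splits)
  have "M \<le> e" using e by simp
  from th_Blank[OF this u] have "th A x p = th A (Ind (case x of Ind a \<Rightarrow> a | Blank b \<Rightarrow> e)) p" for x p
    by (cases x) simp_all
  thus ?thesis by (intro exI[of _ "\<lambda>x. case x of Ind a \<Rightarrow> a | Blank b \<Rightarrow> e"]) simp
qed

definition rep :: "obj \<Rightarrow> individual" where
  "rep = (SOME r. (\<forall>a. r (Ind a) = a) \<and> (\<forall>x p. th A x p = th A (Ind (r x)) p))"

lemma rep_Ind [simp]: "rep (Ind a) = a" and th_rep: "th A x p = th A (Ind (rep x)) p"
  using someI_ex[OF rep_exists] unfolding rep_def by blast+

lemma act_node: "act A x p \<Longrightarrow> valid p \<Longrightarrow> node (rep x) p"
  using act_good th_rep[of x p] by (simp add: node_def)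

definition ok :: "fm \<Rightarrow> bool" where "ok f \<longleftrightarrow> good f \<and> need st f \<le> n"

text \<open>Rules also derive formulas at nodes that are dropped, on levels that are too low, and
  for numbers that code no formula. The invariant is restricted to active nodes and to
  \<open>ok\<close> formulas; \<open>Bel\<close> and \<open>Glo\<close> only promise a witness
  somewhere, which makes sense at every node.\<close>

definition sem :: "obj \<Rightarrow> nat list \<Rightarrow> name_body \<Rightarrow> bool" where
  "sem x p m = (case m of
      FM k \<Rightarrow> \<forall>f. k = code_fm f \<longrightarrow> ok f \<longrightarrow> act A x p \<longrightarrow> el (rep x) p \<in> fm_ext f
    | Dia K k \<Rightarrow> \<forall>R f. K = code_roles R \<longrightarrow> k = code_fm f \<longrightarrow> ok f \<longrightarrow> act A x p \<longrightarrow>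
        (\<exists>y\<in>fm_ext f. \<forall>r. r |\<in>| R \<longrightarrow> (el (rep x) p, y) \<in> role_ext U r)
    | Bel k \<Rightarrow> \<forall>f. k = code_fm f \<longrightarrow> ok f \<longrightarrow> fm_ext f \<noteq> {}
    | Glo k \<Rightarrow> \<forall>f. k = code_fm f \<longrightarrow> ok f \<longrightarrow> fm_ext f \<noteq> {}
    | _ \<Rightarrow> True)"

abbreviation sems :: "obj \<Rightarrow> nat list \<Rightarrow> nm \<Rightarrow> bool" where
  "sems x p m \<equiv> m \<in> th A x p \<and> (basic m \<longrightarrow> fst m = n \<longrightarrow> sem x p (snd m))"

lemma sem_iffs [simp]:
  "sem x p (FM (code_fm f)) \<longleftrightarrow> (ok f \<longrightarrow> act A x p \<longrightarrow> el (rep x) p \<in> fm_ext f)"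
  "sem x p (Dia (code_roles R) (code_fm f)) \<longleftrightarrow> (ok f \<longrightarrow> act A x p \<longrightarrow>
     (\<exists>y\<in>fm_ext f. \<forall>r. r |\<in>| R \<longrightarrow> (el (rep x) p, y) \<in> role_ext U r))"
  "sem x p (Bel (code_fm f)) \<longleftrightarrow> (ok f \<longrightarrow> fm_ext f \<noteq> {})"
  "sem x p (Glo (code_fm f)) \<longleftrightarrow> (ok f \<longrightarrow> fm_ext f \<noteq> {})"
  by (simp_all add: sem_def)

lemma sem_FMI: "(\<And>f. k = code_fm f \<Longrightarrow> ok f \<Longrightarrow> act A x p \<Longrightarrow> el (rep x) p \<in> fm_ext f) \<Longrightarrow> sem x p (FM k)"
  and sem_DiaI: "(\<And>R f. K = code_roles R \<Longrightarrow> k = code_fm f \<Longrightarrow> ok f \<Longrightarrow> act A x p \<Longrightarrow>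
     \<exists>y\<in>fm_ext f. \<forall>r. r |\<in>| R \<longrightarrow> (el (rep x) p, y) \<in> role_ext U r) \<Longrightarrow> sem x p (Dia K k)"
  and sem_BelI: "(\<And>f. k = code_fm f \<Longrightarrow> ok f \<Longrightarrow> fm_ext f \<noteq> {}) \<Longrightarrow> sem x p (Bel k)"
  and sem_GloI: "(\<And>f. k = code_fm f \<Longrightarrow> ok f \<Longrightarrow> fm_ext f \<noteq> {}) \<Longrightarrow> sem x p (Glo k)"
  unfolding sem_def by (simp; blast)+

lemma sem_FMD: "sem x p (FM (code_fm f)) \<Longrightarrow> ok f \<Longrightarrow> act A x p \<Longrightarrow> el (rep x) p \<in> fm_ext f"
  by simp

lemma ok_simps:
  "ok (PT d (RAlt E F) f) \<Longrightarrow> ok (PT d E f) \<and> ok (PT d F f)"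
  "ok (PT d (RSeq E F) f) \<Longrightarrow> ok (PT b E (PT d' F f)) \<and> ok (PT b F (PT d' E f))"
  "ok (PT d (RStar E) f) \<Longrightarrow> ok (PT d E (PT d (RStar E) f))"
  "ok (PT d E f) \<Longrightarrow> ok f"
  "ok (Sh (Or \<phi> \<psi>)) \<Longrightarrow> ok (Sh \<phi>) \<and> ok (Sh \<psi>)"
  "ok (Sh (And \<phi> \<psi>)) \<Longrightarrow> ok (Sh \<phi>) \<and> ok (Sh \<psi>)"
  "ok (Sh (ExRoles R \<phi>)) \<Longrightarrow> ok (Sh \<phi>)" "ok (Sh (ExPath E \<phi>)) \<Longrightarrow> ok (PT False E (Sh \<phi>))"
  "ok (Sh (NomEQ a E E')) \<Longrightarrow> ok (Sh (Nom a)) \<and> ok (NT (PT False E (NT (PT True E' (Sh (Nom a)))))) \<and>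
     ok (NT (PT False E' (NT (PT True E (Sh (Nom a))))))"
  "ok (Sh (NomDisj a E E')) \<Longrightarrow> ok (Sh (Nom a)) \<and> ok (NT (PT False E (PT True E' (Sh (Nom a)))))"
proof -
  note [simp del] = good.simps
  show "ok (PT d (RAlt E F) f) \<Longrightarrow> ok (PT d E f) \<and> ok (PT d F f)"
    using good_simps(1,2)[of d E F f] by (simp add: ok_def)
  show "ok (PT d (RSeq E F) f) \<Longrightarrow> ok (PT b E (PT d' F f)) \<and> ok (PT b F (PT d' E f))"
    using good_simps(3,4)[of d E F f b d'] by (simp add: ok_def)
  show "ok (PT d (RStar E) f) \<Longrightarrow> ok (PT d E (PT d (RStar E) f))"
    using good_simps(7)[of d E f] by (simp add: ok_def)
  show "ok (PT d E f) \<Longrightarrow> ok f" by (simp add: ok_def good.simps(2))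
  show "ok (Sh (Or \<phi> \<psi>)) \<Longrightarrow> ok (Sh \<phi>) \<and> ok (Sh \<psi>)"
    using good_simps(8,9)[of \<phi> \<psi>] by (simp add: ok_def)
  show "ok (Sh (And \<phi> \<psi>)) \<Longrightarrow> ok (Sh \<phi>) \<and> ok (Sh \<psi>)"
    using good_simps(10,11)[of \<phi> \<psi>] by (simp add: ok_def)
  show "ok (Sh (ExRoles R \<phi>)) \<Longrightarrow> ok (Sh \<phi>)"
    using good_simps(12)[of R \<phi>] by (simp add: ok_def)
  show "ok (Sh (ExPath E \<phi>)) \<Longrightarrow> ok (PT False E (Sh \<phi>))"
    using good_simps(13)[of E \<phi>] by (simp add: ok_def)
  show "ok (Sh (NomEQ a E E')) \<Longrightarrow> ok (Sh (Nom a)) \<and> ok (NT (PT False E (NT (PT True E' (Sh (Nom a)))))) \<and>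
     ok (NT (PT False E' (NT (PT True E (Sh (Nom a))))))"
    using good_simps(15-17)[of a E E'] by (simp add: ok_def)
  show "ok (Sh (NomDisj a E E')) \<Longrightarrow> ok (Sh (Nom a)) \<and> ok (NT (PT False E (PT True E' (Sh (Nom a)))))"
    using good_simps(18,19)[of a E E'] by (simp add: ok_def)
qed

lemma formula_sound:
  assumes p: "valid p" and "((n, h), (a1, a2), (b1, b2), (d1, d2)) \<in> formula_rules t c W"
    and l: "lits A sems x p (a1, a2)" "lits A sems x p (b1, b2)" "lits A sems x p (d1, d2)"
  shows "sem x p h"
proof (rule formula_rules.cases[OF assms(2)], goal_cases)
  case (1 m e)
  show ?case unfolding 1(2)
  proof (rule sem_FMI)
    fix g assume "sh_code (prod_encode (0, e)) = code_fm g"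
    hence "g = Sh (Nom e)" by (auto simp: code_fm_inv code_shape_inv)
    thus "el (rep x) p \<in> fm_ext g" using l(1) 1(3,4) by simp
  qed
next
  case (2 m s f)
  have "sem x p (FM (sh_code f))" using l(1) 2(1-4) by simp
  thus ?case unfolding 2(2)
  proof (intro sem_FMI)
    fix g assume L: "sem x p (FM (sh_code f))" and g: "sh_code (prod_encode (1, s)) = code_fm g" "ok g" "act A x p"
    have g': "g = Sh (Name s)" using g(1) by (auto simp: code_fm_inv code_shape_inv)
    obtain \<phi> where C: "(s, \<phi>) \<in> C" "f = code_shape \<phi>" using 2(13) mem_c by blast
    have "ok (Sh \<phi>)" using g(2) C_less[OF C(1)] st[OF C(1)] by (auto simp: g' ok_def)
    hence "el (rep x) p \<in> shape_ext U S \<phi>" using L g(3) by (simp add: C(2) flip: code_fm.simps(1))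
    from PA_closed[OF strat C(1) this] show "el (rep x) p \<in> fm_ext g" by (simp add: g')
  qed
next
  case (3 m y)
  show ?case unfolding 3(2)
  proof (rule sem_FMI)
    fix g assume g: "sh_code (prod_encode (3, y)) = code_fm g" "ok g" "act A x p"
    then obtain B where B: "g = Sh (Cpt B)" "y = code_concept B" by (auto simp: code_fm_inv code_shape_inv)
    have "has A (Ind (rep x)) p B" using l(1) 3(3,4) B(2) th_rep[of x p] by simp
    thus "el (rep x) p \<in> fm_ext g" using act_node[OF g(3) p] 3(10) B by simp
  qed
next
  case (4 m u v)
  show ?case unfolding 4(2)
  proof (rule sem_FMI)
    fix g assume g: "sh_code (prod_encode (4, prod_encode (u, v))) = code_fm g" "ok g" "act A x p"
    then obtain \<phi> \<psi> where h: "g = Sh (Or \<phi> \<psi>)" "u = code_shape \<phi>" "v = code_shape \<psi>"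
      by (auto simp: code_fm_inv code_shape_inv)
    have "sem x p (FM (code_fm (Sh \<phi>)))" using l(1) 4(1,3,4) h by simp
    hence "el (rep x) p \<in> fm_ext (Sh \<phi>)"
      using ok_simps(5)[OF g(2)[unfolded h(1)]] g(3) unfolding sem_iffs by blast+
    thus "el (rep x) p \<in> fm_ext g" by (simp add: h(1))
  qed
next
  case (5 m u v)
  show ?case unfolding 5(2)
  proof (rule sem_FMI)
    fix g assume g: "sh_code (prod_encode (4, prod_encode (u, v))) = code_fm g" "ok g" "act A x p"
    then obtain \<phi> \<psi> where h: "g = Sh (Or \<phi> \<psi>)" "u = code_shape \<phi>" "v = code_shape \<psi>"
      by (auto simp: code_fm_inv code_shape_inv)
    have "sem x p (FM (code_fm (Sh \<psi>)))" using l(1) 5(1,3,4) h by simp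
    hence "el (rep x) p \<in> fm_ext (Sh \<psi>)"
      using ok_simps(5)[OF g(2)[unfolded h(1)]] g(3) unfolding sem_iffs by blast+
    thus "el (rep x) p \<in> fm_ext g" by (simp add: h(1))
  qed
next
  case (6 m u v)
  show ?case unfolding 6(2)
  proof (rule sem_FMI)
    fix g assume g: "sh_code (prod_encode (5, prod_encode (u, v))) = code_fm g" "ok g" "act A x p"
    then obtain \<phi> \<psi> where h: "g = Sh (And \<phi> \<psi>)" "u = code_shape \<phi>" "v = code_shape \<psi>"
      by (auto simp: code_fm_inv code_shape_inv)
    have "sem x p (FM (code_fm (Sh \<phi>)))" "sem x p (FM (code_fm (Sh \<psi>)))" using l(1,2) 6(1,3-6) h by simp_all
    hence "el (rep x) p \<in> fm_ext (Sh \<phi>)" "el (rep x) p \<in> fm_ext (Sh \<psi>)"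
      using ok_simps(6)[OF g(2)[unfolded h(1)]] g(3) unfolding sem_iffs by blast+
    thus "el (rep x) p \<in> fm_ext g" by (simp add: h(1))
  qed
next
  case (7 m K f)
  show ?case unfolding 7(2)
  proof (rule sem_FMI)
    fix g assume g: "sh_code (prod_encode (6, prod_encode (K, f))) = code_fm g" "ok g" "act A x p"
    then obtain R \<phi> where h: "g = Sh (ExRoles R \<phi>)" "K = code_roles R" "f = code_shape \<phi>"
      by (auto simp: code_fm_inv code_shape_inv)
    have "sem x p (Dia (code_roles R) (code_fm (Sh \<phi>)))" using l(1) 7(1,3,4) h by simp
    then obtain y where y: "y \<in> shape_ext U S \<phi>" "\<forall>r. r |\<in>| R \<longrightarrow> (el (rep x) p, y) \<in> role_ext U r"
      using g(2,3) ok_simps(7)[of R \<phi>] h(1) by (auto simp del: code_fm.simps)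
    moreover have "y \<in> dom U" using y(1) fm_ext_dom[of "Sh \<phi>"] by auto
    ultimately show "el (rep x) p \<in> fm_ext g" using act_node[OF g(3) p] by (auto simp: h(1))
  qed
next
  case (8 m e f)
  show ?case unfolding 8(2)
  proof (rule sem_FMI)
    fix g assume g: "sh_code (prod_encode (7, prod_encode (e, f))) = code_fm g" "ok g" "act A x p"
    then obtain E \<phi> where h: "g = Sh (ExPath E \<phi>)" "e = code_rexp E" "f = code_shape \<phi>"
      by (auto simp: code_fm_inv code_shape_inv)
    have "sem x p (FM (code_fm (PT False E (Sh \<phi>))))" using l(1) 8(1,3,4) h by simp
    hence "el (rep x) p \<in> fm_ext (PT False E (Sh \<phi>))" using g(2,3) ok_simps(8)[of E \<phi>] h(1) by (simp del: code_fm.simps)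
    thus "el (rep x) p \<in> fm_ext g" using act_node[OF g(3) p] fm_ext_dom[of "Sh \<phi>"] by (auto simp: h(1))
  qed
next
  case (9 m e u v)
  show ?case unfolding 9(2)
  proof (rule sem_FMI)
    fix g assume g: "sh_code (prod_encode (8, list_encode [e, u, v])) = code_fm g" "ok g" "act A x p"
    then obtain E E' where E: "g = Sh (NomEQ e E E')" "u = code_rexp E" "v = code_rexp E'"
      by (auto simp: code_fm_inv code_shape_inv simp del: list_encode.simps)
    let ?V1 = "PT False E (NT (PT True E' (Sh (Nom e))))" and ?V2 = "PT False E' (NT (PT True E (Sh (Nom e))))"
    have s: "sem x p (FM (code_fm (Sh (Nom e))))" "sem x p (FM (code_fm (NT ?V1)))" "sem x p (FM (code_fm (NT ?V2)))"
      using l 9(1,3-8) E(2,3) by simp_all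
    note o = ok_simps(9)[OF g(2)[unfolded E(1)]]
    have e: "el (rep x) p = Ind e" using sem_FMD[OF s(1) conjunct1[OF o] g(3)] by simp
    have V1: "Ind e \<notin> fm_ext ?V1"
      using sem_FMD[OF s(2) conjunct1[OF conjunct2[OF o]] g(3)] unfolding e fm_ext.simps(3) by (rule DiffE)
    have V2: "Ind e \<notin> fm_ext ?V2"
      using sem_FMD[OF s(3) conjunct2[OF conjunct2[OF o]] g(3)] unfolding e fm_ext.simps(3) by (rule DiffE)
    have "rexp_ext U E `` {Ind e} = rexp_ext U E' `` {Ind e}" by (rule iffD2[OF NomEQ_iff conjI[OF V1 V2]])
    thus "el (rep x) p \<in> fm_ext g" by (simp add: E(1) e)
  qed
next
  case (10 m e u v)
  show ?case unfolding 10(2)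
  proof (rule sem_FMI)
    fix g assume g: "sh_code (prod_encode (9, list_encode [e, u, v])) = code_fm g" "ok g" "act A x p"
    then obtain E E' where E: "g = Sh (NomDisj e E E')" "u = code_rexp E" "v = code_rexp E'"
      by (auto simp: code_fm_inv code_shape_inv simp del: list_encode.simps)
    let ?V = "PT False E (PT True E' (Sh (Nom e)))"
    have s: "sem x p (FM (code_fm (Sh (Nom e))))" "sem x p (FM (code_fm (NT ?V)))"
      using l 10(1,3-8) E(2,3) by simp_all
    note o = ok_simps(10)[OF g(2)[unfolded E(1)]]
    have e: "el (rep x) p = Ind e" using sem_FMD[OF s(1) conjunct1[OF o] g(3)] by simp
    have V: "Ind e \<notin> fm_ext ?V"
      using sem_FMD[OF s(2) conjunct2[OF o] g(3)] unfolding e fm_ext.simps(3) by (rule DiffE)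
    have "rexp_ext U E `` {Ind e} \<inter> rexp_ext U E' `` {Ind e} = {}" by (rule iffD2[OF NomDisj_iff V])
    thus "el (rep x) p \<in> fm_ext g" by (simp add: E(1) e)
  qed
next
  case (11 m d f)
  show ?case unfolding 11(2)
  proof (rule sem_FMI)
    fix g assume g: "path_code d (prod_encode (1, 0)) f = code_fm g" "ok g" "act A x p"
    then obtain b h where h: "g = PT b ROne h" "f = code_fm h" by (auto simp: code_fm_inv code_rexp_inv)
    have "sem x p (FM (code_fm h))" using l(1) 11(1,3,4) h(2) by simp
    hence "el (rep x) p \<in> fm_ext h" using g(2,3) ok_simps(4)[of b ROne h] h(1) by (simp del: code_fm.simps)
    thus "el (rep x) p \<in> fm_ext g" using fm_ext_dom by (fastforce simp: h(1) rexp_ext_eqs(1)[OF interpretation_wf_U])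
  qed
next
  case (12 m v f)
  show ?case unfolding 12(2)
  proof (rule sem_FMI)
    fix g assume g: "path_code 0 (prod_encode (2, v)) f = code_fm g" "ok g" "act A x p"
    then obtain r h where h: "g = PT False (RRole r) h" "v = code_role r" "f = code_fm h" by (auto simp: code_fm_inv code_rexp_inv split: if_splits)
    have "sem x p (Dia (code_roles {|r|}) (code_fm h))" using l(1) 12(1,3,4) h by (simp add: code_roles_single)
    then obtain y where "y \<in> fm_ext h" "(el (rep x) p, y) \<in> role_ext U (r)"
      using g(2,3) ok_simps(4)[of False "RRole r" h] h(1) by (auto simp del: code_fm.simps)
    thus "el (rep x) p \<in> fm_ext g" by (auto simp: h(1) rexp_ext_eqs(2)[OF interpretation_wf_U])
  qed
next
  case (13 m v f)
  show ?case unfolding 13(2)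
  proof (rule sem_FMI)
    fix g assume g: "path_code 1 (prod_encode (2, v)) f = code_fm g" "ok g" "act A x p"
    then obtain r h where h: "g = PT True (RRole r) h" "v = code_role r" "f = code_fm h" by (auto simp: code_fm_inv code_rexp_inv split: if_splits)
    have "sem x p (Dia (code_roles {|inv_role r|}) (code_fm h))" using l(1) 13(1,3,4) h by (simp add: code_roles_single)
    then obtain y where "y \<in> fm_ext h" "(el (rep x) p, y) \<in> role_ext U (inv_role r)"
      using g(2,3) ok_simps(4)[of True "RRole r" h] h(1) by (auto simp del: code_fm.simps)
    thus "el (rep x) p \<in> fm_ext g" by (auto simp: h(1) rexp_ext_eqs(2)[OF interpretation_wf_U])
  qed
next
  case (14 m d u v f)
  show ?case unfolding 14(2)
  proof (rule sem_FMI)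
    fix g assume g: "path_code d (prod_encode (3, prod_encode (u, v))) f = code_fm g" "ok g" "act A x p"
    then obtain b E F h where h: "g = PT b (RAlt E F) h" "d = (if b then 1 else 0)" "u = code_rexp E" "v = code_rexp F" "f = code_fm h" by (auto simp: code_fm_inv code_rexp_inv)
    have "sem x p (FM (code_fm (PT b E h)))" using l(1) 14(1,3,4) h by simp
    hence "el (rep x) p \<in> fm_ext (PT b E h)" using g(2,3) ok_simps(1)[of b E F h] h(1) by (simp del: code_fm.simps)
    thus "el (rep x) p \<in> fm_ext g" by (auto simp: h(1) split: if_splits intro: rexp_ext_eqs(3)[OF interpretation_wf_U])
  qed
next
  case (15 m d u v f)
  show ?case unfolding 15(2)
  proof (rule sem_FMI)
    fix g assume g: "path_code d (prod_encode (3, prod_encode (u, v))) f = code_fm g" "ok g" "act A x p"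
    then obtain b E F h where h: "g = PT b (RAlt E F) h" "d = (if b then 1 else 0)" "u = code_rexp E" "v = code_rexp F" "f = code_fm h" by (auto simp: code_fm_inv code_rexp_inv)
    have "sem x p (FM (code_fm (PT b F h)))" using l(1) 15(1,3,4) h by simp
    hence "el (rep x) p \<in> fm_ext (PT b F h)" using g(2,3) ok_simps(1)[of b E F h] h(1) by (simp del: code_fm.simps)
    thus "el (rep x) p \<in> fm_ext g" by (auto simp: h(1) split: if_splits intro: rexp_ext_eqs(4)[OF interpretation_wf_U])
  qed
next
  case (16 m u v f)
  show ?case unfolding 16(2)
  proof (rule sem_FMI)
    fix g assume g: "path_code 0 (prod_encode (4, prod_encode (u, v))) f = code_fm g" "ok g" "act A x p"
    then obtain E F h where h: "g = PT False (RSeq E F) h" "u = code_rexp E" "v = code_rexp F" "f = code_fm h" by (auto simp: code_fm_inv code_rexp_inv split: if_splits)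
    have "sem x p (FM (code_fm (PT False E (PT False F h))))" using l(1) 16(1,3,4) h by simp
    hence "el (rep x) p \<in> fm_ext (PT False E (PT False F h))" using g(2,3) ok_simps(2)[of False E F h False False] h(1) by (simp del: code_fm.simps)
    thus "el (rep x) p \<in> fm_ext g" by (auto simp: h(1) intro: rexp_ext_eqs(5)[OF interpretation_wf_U])
  qed
next
  case (17 m u v f)
  show ?case unfolding 17(2)
  proof (rule sem_FMI)
    fix g assume g: "path_code 1 (prod_encode (4, prod_encode (u, v))) f = code_fm g" "ok g" "act A x p"
    then obtain E F h where h: "g = PT True (RSeq E F) h" "u = code_rexp E" "v = code_rexp F" "f = code_fm h" by (auto simp: code_fm_inv code_rexp_inv split: if_splits)
    have "sem x p (FM (code_fm (PT True F (PT True E h))))" using l(1) 17(1,3,4) h by simp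
    hence "el (rep x) p \<in> fm_ext (PT True F (PT True E h))" using g(2,3) ok_simps(2)[of True E F h True True] h(1) by (simp del: code_fm.simps)
    thus "el (rep x) p \<in> fm_ext g" by (auto simp: h(1) intro: rexp_ext_eqs(5)[OF interpretation_wf_U])
  qed
next
  case (18 m d u f)
  show ?case unfolding 18(2)
  proof (rule sem_FMI)
    fix g assume g: "path_code d (prod_encode (5, u)) f = code_fm g" "ok g" "act A x p"
    then obtain b E h where h: "g = PT b (RStar E) h" "d = (if b then 1 else 0)" "u = code_rexp E" "f = code_fm h" by (auto simp: code_fm_inv code_rexp_inv)
    have "sem x p (FM (code_fm (h)))" using l(1) 18(1,3,4) h by simp
    hence "el (rep x) p \<in> fm_ext (h)" using g(2,3) ok_simps(4)[of b "RStar E" h] h(1) by (simp del: code_fm.simps)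
    thus "el (rep x) p \<in> fm_ext g" using fm_ext_dom rexp_ext_eqs(6)[OF interpretation_wf_U, of "el (rep x) p" E] by (fastforce simp: h(1))
  qed
next
  case (19 m d u f)
  show ?case unfolding 19(2)
  proof (rule sem_FMI)
    fix g assume g: "path_code d (prod_encode (5, u)) f = code_fm g" "ok g" "act A x p"
    then obtain b E h where h: "g = PT b (RStar E) h" "d = (if b then 1 else 0)" "u = code_rexp E" "f = code_fm h" by (auto simp: code_fm_inv code_rexp_inv)
    have "sem x p (FM (code_fm (PT b E (PT b (RStar E) h))))" using l(1) 19(1,3,4) h by simp
    hence "el (rep x) p \<in> fm_ext (PT b E (PT b (RStar E) h))" using g(2,3) ok_simps(3)[of b E h] h(1) by (simp del: code_fm.simps)
    thus "el (rep x) p \<in> fm_ext g" by (auto simp: h(1) split: if_splits intro: rexp_ext_eqs(7,8)[OF interpretation_wf_U])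
  qed
next
  case (20 m K Q f)
  show ?case unfolding 20(2)
  proof (rule sem_DiaI)
    fix R g assume g: "K = code_roles R" "f = code_fm g" "ok g" "act A x p"
    from l(1) 20(3,4) obtain Q' y where Q: "p = []" "Q = code_roles Q'" "\<And>r. r |\<in>| Q' \<Longrightarrow> (x, y) \<in> role_ext (abox_interp A) r"
      "sems y [] (m, FM f)" by auto
    have "sem y [] (FM (code_fm g))" using Q(4) 20(1) g(2) by simp
    hence y: "Ind (rep y) \<in> fm_ext g" using g(3) by simp
    have "(Ind (rep x), Ind (rep y)) \<in> role_ext U r" if r: "r |\<in>| R" for r
    proof -
      have "code_role r \<in> set_decode K" using r by (simp add: g(1) code_roles_def set_encode_inverse)
      then obtain u where "u \<in> set_decode Q" "role_le t u (code_role r)" using 20(14) member_less by blast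
      then obtain v where v: "v |\<in>| Q'" "sub_role T v r" by (auto simp: Q(2) code_roles_def set_encode_inverse)
      have "(x, y) \<in> role_ext (abox_interp A) v" by (rule Q(3)[OF v(1)])
      \<comment> \<open>An ABox role links individuals only, so \<open>rep\<close> does not move the
        two ends.\<close>
      moreover from this have "Ind (rep x) = x" "Ind (rep y) = y" by (cases v; auto simp: abox_interp_def)+
      ultimately have "rel (rep x) [] (rep y) [] r" using v(2) unfolding rel_def by auto
      thus ?thesis using role_ext_U_el[of "rep x" "[]" "rep y" "[]" r] by simp
    qed
    thus "\<exists>y\<in>fm_ext g. \<forall>r. r |\<in>| R \<longrightarrow> (el (rep x) p, y) \<in> role_ext U r" using y Q(1) by auto
  qed
next
  case (21 m K a r b f)
  show ?case unfolding 21(2)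
  proof (rule sem_DiaI)
    fix R g assume g: "K = code_roles R" "f = code_fm g" "ok g" "act A x p"
    let ?k = "ex_code a r b"
    obtain a' r' b' where ex: "r = code_role r'" "ExIncl a' r' b' \<in> T" "?k = code_axiom (ExIncl a' r' b')"
      using 21(16) unfolding mem_t_codes by (auto simp: code_axiom_codes)
    have kp: "valid (?k # p)" using p axiom_less_W[OF ex(2)] W_le_M by (simp add: ex(3))
    \<comment> \<open>Activity of a child is a premise of the rule, since \<open>U\<close> contains
      kept children only. For the parent it follows from the activity of the node.\<close>
    have act: "act A x (?k # p)" using l(2) 21(5,6) by simp
    have "sem x (?k # p) (FM (code_fm g))" using l(1) 21(1,3,4) g(2) by simp
    hence k: "el (rep x) (?k # p) \<in> fm_ext g" using g(3) act by simp
    have "(el (rep x) p, el (rep x) (?k # p)) \<in> role_ext U s" if s: "s |\<in>| R" for s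
    proof -
      have "code_role s \<in> set_decode K" using s by (simp add: g(1) code_roles_def set_encode_inverse)
      hence "role_le t r (code_role s)" using 21(17) member_less by blast
      hence "rel (rep x) p (rep x) (?k # p) s" using ex unfolding rel_def by auto
      thus ?thesis using act_node[OF g(4) p] act_node[OF act kp] by simp
    qed
    thus "\<exists>y\<in>fm_ext g. \<forall>r. r |\<in>| R \<longrightarrow> (el (rep x) p, y) \<in> role_ext U r" using k by blast
  qed
next
  case (22 m K a r b f)
  show ?case unfolding 22(2)
  proof (rule sem_DiaI)
    fix R g assume g: "K = code_roles R" "f = code_fm g" "ok g" "act A x p"
    let ?k = "ex_code a r b"
    obtain a' r' b' where ex: "r = code_role r'" "ExIncl a' r' b' \<in> T" "?k = code_axiom (ExIncl a' r' b')"
      using 22(16) unfolding mem_t_codes by (auto simp: code_axiom_codes)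
    obtain q where q: "p = ?k # q" using l(1) 22(3,4) by auto
    have act: "act A x q" using g(4) act_kid_iff[of ?k q x] p axiom_less_W[OF ex(2)] by (simp add: q ex(3))
    have "sem x q (FM (code_fm g))" using l(2) 22(1,5,6) g(2) q by simp
    hence k: "el (rep x) q \<in> fm_ext g" using g(3) act by simp
    have "(el (rep x) p, el (rep x) q) \<in> role_ext U s" if s: "s |\<in>| R" for s
    proof -
      have "code_role s \<in> set_decode K" using s by (simp add: g(1) code_roles_def set_encode_inverse)
      hence "role_le t (inv_code r) (code_role s)" using 22(17) member_less by blast
      hence "rel (rep x) p (rep x) q s" using ex q unfolding rel_def by auto
      moreover have "valid q" using p q by simp
      ultimately show ?thesis using act_node[OF g(4) p] act_node[OF act] by simp
    qed
    thus "\<exists>y\<in>fm_ext g. \<forall>r. r |\<in>| R \<longrightarrow> (el (rep x) p, y) \<in> role_ext U r" using k by blast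
  qed
next
  case (23 m f)
  show ?case unfolding 23(2)
  proof (rule sem_DiaI)
    fix R g assume g: "0 = code_roles R" "f = code_fm g" "ok g"
    \<comment> \<open>Only the empty set of roles has code 0, and for it any point that satisfies
      the formula is a witness.\<close>
    have "set_decode (code_roles R) = {}" unfolding g(1)[symmetric] by simp
    hence R: "R = {||}" by (auto simp: code_roles_def set_encode_inverse)
    have "sem x p (Glo (code_fm g))" using l(1) 23(1,3,4) g(2) by simp
    thus "\<exists>y\<in>fm_ext g. \<forall>r. r |\<in>| R \<longrightarrow> (el (rep x) p, y) \<in> role_ext U r" using g(3) R by auto
  qed
next
  case (24 m f)
  show ?case unfolding 24(2)
  proof (rule sem_BelI)
    fix g assume g: "f = code_fm g" "ok g"
    have "sem x p (FM (code_fm g))" "act A x p" using l(1,2) 24(1,3-6) g(1) by simp_all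
    thus "fm_ext g \<noteq> {}" using g(2) by auto
  qed
next
  case (25 m i f)
  show ?case unfolding 25(2)
  proof (rule sem_BelI)
    fix g assume g: "f = code_fm g" "ok g"
    have "sem x (i # p) (Bel (code_fm g))" using l(1) 25(1,3,4) g(1) by simp
    thus "fm_ext g \<noteq> {}" using g(2) by simp
  qed
next
  case (26 m f)
  show ?case unfolding 26(2)
  proof (rule sem_GloI)
    fix g assume g: "f = code_fm g" "ok g"
    have "\<exists>y. sem y [] (Bel (code_fm g))" using l(1) 26(1,3,4) g(1) by auto
    thus "fm_ext g \<noteq> {}" using g(2) by auto
  qed
next
  case (27 m f)
  show ?case unfolding 27(2)
  proof (rule sem_GloI)
    fix g assume g: "f = code_fm g" "ok g"
    have "\<exists>q. sem x q (Glo (code_fm g))" using l(1) 27(1,3,4) g(1) by auto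
    thus "fm_ext g \<noteq> {}" using g(2) by auto
  qed
qed

text \<open>The chase and the selection of children end at level 3, and \<open>n\<close> is at least
  4.\<close>

lemma high_rules:
  "((n, h), a, b, d) \<in> pos_rules t c W \<Longrightarrow> ((n, h), a, b, d) \<in> formula_rules t c W"
  "((n, h), a, b) \<in> neg_rules W \<Longrightarrow> ((n, h), a, b) \<in> formula_neg_rules W"
proof -
  obtain a1 a2 b1 b2 d1 d2 where abd: "a = (a1, a2)" "b = (b1, b2)" "d = (d1, d2)"
    by (cases a; cases b; cases d) blast
  show "((n, h), a, b, d) \<in> pos_rules t c W \<Longrightarrow> ((n, h), a, b, d) \<in> formula_rules t c W"
    unfolding abd pos_rules_def using n by (auto elim: concept_rules.cases select_rules.cases)
  show "((n, h), a, b) \<in> neg_rules W \<Longrightarrow> ((n, h), a, b) \<in> formula_neg_rules W"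
    unfolding abd neg_rules_def using n by (auto elim: select_neg_rules.cases)
qed

text \<open>The preceding level is exact at the nodes of \<open>U\<close>, so absence of a name
  there means failure of its formula. \<open>th_rep\<close> transfers absence from an arbitrary root
  to the individual that represents it.\<close>

lemma formula_neg_sound:
  assumes p: "valid p" and "((n, h), (a1, a2), (b1, b2)) \<in> formula_neg_rules W" and b: "(b1, b2) \<notin> th A x p"
  shows "sem x p h"
proof (rule formula_neg_rules.cases[OF assms(2)], goal_cases)
  case (1 m s)
  show ?case unfolding 1(2)
  proof (rule sem_FMI)
    fix g assume g: "sh_code (prod_encode (2, s)) = code_fm g" "ok g" "act A x p"
    hence g': "g = Sh (NegName s)" by (auto simp: code_fm_inv code_shape_inv)
    have g2: "good (Sh (NegName s))" "need st (Sh (NegName s)) \<le> n" using g(2) unfolding g' ok_def by blast+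
    have f: "good (Sh (Name s))" "need st (Sh (Name s)) \<le> m" using good_simps(14)[OF g2(1)] g2(2) 1(1) by simp_all
    have "(m, FM (code_fm (Sh (Name s)))) \<notin> th A (Ind (rep x)) p" using b 1(5,6) th_rep[of x p] by simp
    hence "el (rep x) p \<notin> fm_ext (Sh (Name s))" using IH[OF 1(9) _ f act_node[OF g(3) p]] 1(1) by blast
    thus "el (rep x) p \<in> fm_ext g" using act_node[OF g(3) p] by (simp add: g')
  qed
next
  case (2 m k)
  show ?case unfolding 2(2)
  proof (rule sem_FMI)
    fix g assume g: "not_code k = code_fm g" "ok g" "act A x p"
    then obtain f where g': "g = NT f" "k = code_fm f" by (auto simp: code_fm_inv)
    have g2: "good (NT f)" "need st (NT f) \<le> n" using g(2) unfolding g' ok_def by blast+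
    hence f: "good f" "need st f \<le> m" using 2(1) by simp_all
    have "(m, FM (code_fm f)) \<notin> th A (Ind (rep x)) p" using b 2(5,6) th_rep[of x p] g'(2) by simp
    hence "el (rep x) p \<notin> fm_ext f" using IH[OF 2(9) _ f act_node[OF g(3) p]] 2(1) by blast
    thus "el (rep x) p \<in> fm_ext g" using act_node[OF g(3) p] by (simp add: g')
  qed
qed

lemma sound: "m \<in> th A x p \<Longrightarrow> basic m \<Longrightarrow> valid p \<Longrightarrow> fst m = n \<longrightarrow> sem x p (snd m)"
proof (erule th_induct[where P = "\<lambda>x p m. fst m = n \<longrightarrow> sem x p (snd m)"], assumption, assumption, goal_cases)
  case (1 x p h a b d)
  obtain a1 a2 b1 b2 d1 d2 where abd: "a = (a1, a2)" "b = (b1, b2)" "d = (d1, d2)"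
    by (cases a; cases b; cases d) blast
  show ?case
  proof
    assume "fst h = n"
    then obtain k where h: "h = (n, k)" by (cases h) simp
    have "sem x p k"
      by (rule formula_sound[OF 1(3) high_rules(1)[OF 1(4)[unfolded abd h]] 1(5-7)[unfolded abd]])
    thus "sem x p (snd h)" by (simp add: h)
  qed
next
  case (2 x p h a b)
  obtain a1 a2 b1 b2 where abd: "a = (a1, a2)" "b = (b1, b2)" by (cases a; cases b) blast
  show ?case
  proof
    assume "fst h = n"
    then obtain k where h: "h = (n, k)" by (cases h) simp
    have "sem x p k"
      by (rule formula_neg_sound[OF 2(3) high_rules(2)[OF 2(4)[unfolded abd h]] 2(6)[unfolded abd]])
    thus "sem x p (snd h)" by (simp add: h)
  qed
qed

lemma correct_step:
  assumes "good f" "need st f \<le> n" "node a p"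
  shows "fmh a p f \<longleftrightarrow> el a p \<in> fm_ext f"
proof
  assume "fmh a p f"
  from sound[OF this _ node_valid[OF assms(3)]] have "sem (Ind a) p (FM (code_fm f))" by simp
  thus "el a p \<in> fm_ext f" using assms by (simp add: ok_def node_def)
qed (use complete assms in blast)

end

end

section \<open>Correctness on all levels\<close>

lemma correct:
  "4 \<le> n \<Longrightarrow> n \<le> c + 10 \<Longrightarrow> good f \<Longrightarrow> need st f \<le> n \<Longrightarrow> node a p \<Longrightarrow>
   (n, FM (code_fm f)) \<in> th A (Ind a) p \<longleftrightarrow> el a p \<in> fm_ext f"
proof (induction n arbitrary: f a p rule: less_induct)
  case (less n)
  show ?case
  proof (rule correct_step[OF less(2,3) _ less(4-6)])
    fix m f a p assume m: "4 \<le> m" "m < n" and f: "good f" "need st f \<le> m" "node a p"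
    show "(m, FM (code_fm f)) \<in> th A (Ind a) p \<longleftrightarrow> el a p \<in> fm_ext f"
      by (rule less(1)[OF m(2,1) _ f]) (use m(2) less(3) in simp)
  qed
qed

text \<open>The output reads copy \<open>c + 10\<close> of the name at the root, where the virtual
  tree describes \<open>U\<close>. The isomorphism with the canonical model fixes individuals, so
  targets are not affected by it.\<close>

theorem PA_rules_correct:
  assumes "s < c" "st s \<le> c + 10"
  shows "(s, Ind a) \<in> PA rules (abox_interp A) \<longleftrightarrow> (s, Ind a) \<in> PA C (can T A)"
proof -
  obtain g where g: "interp_iso U (can T A) g" "\<And>a. g (Ind a) = Ind a" using can_iso by blast
  have "(s, Ind a) \<in> PA rules (abox_interp A) \<longleftrightarrow> out_name c s \<in> th A (Ind a) []"
    by (rule PA_rules_iff[OF assms(1)])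
  also have "out_name c s = (c + 10, FM (code_fm (Sh (Name s))))" by (simp add: out_name_def)
  also have "\<dots> \<in> th A (Ind a) [] \<longleftrightarrow> el a [] \<in> fm_ext (Sh (Name s))"
    by (rule correct) (use assms in auto)
  also have "\<dots> \<longleftrightarrow> (s, Ind a) \<in> PA C U" by simp
  also have "\<dots> \<longleftrightarrow> (s, Ind a) \<in> PA C (can T A)"
    using interp_iso.PA_g[OF g(1) strat, of "Ind a" s] g(2) el_dom[of a "[]"] by simp
  finally show ?thesis .
qed

end

section \<open>Levels from a stratification, and the theorem\<close>

lemma need_shape_le:
  assumes "\<And>s. s \<in> shape_names \<phi> \<Longrightarrow> st s \<le> B" "\<And>s. s \<in> neg_names \<phi> \<Longrightarrow> st s < B" "6 \<le> B"
  shows "need_shape st \<phi> \<le> B"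
  using assms by (induction \<phi>) auto

text \<open>Counting the heads of lower strata instead of the strata themselves bounds the levels by \<open>c + 6\<close>.\<close>

lemma (in rewriting) levels_exist:
  assumes "stratified C"
  shows "\<exists>st. (\<forall>s \<phi>. (s, \<phi>) \<in> C \<longrightarrow> need_shape st \<phi> \<le> st s) \<and> (\<forall>s. 4 \<le> st s \<and> st s \<le> c + 10)"
proof -
  obtain Cs where Cs: "stratification Cs C" using assms unfolding stratified_def by blast
  have C: "\<Union>(set Cs) = C" using Cs by (simp add: stratification_def)
  have pos: "s \<notin> heads (Cs ! j)" if "i < j" "j < length Cs" "s \<in> names_of (Cs ! i)" for i j s
    using Cs that unfolding stratification_def by (metis IntI empty_iff order.strict_trans)
  have neg: "s \<notin> heads (Cs ! j)" if "i \<le> j" "j < length Cs" "s \<in> neg_names_of (Cs ! i)" for i j s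
    using Cs that unfolding stratification_def by (metis IntI empty_iff order.strict_trans1)
  have head: "s \<in> names_of D" if "s \<in> heads D" for s D
    using that by (auto simp: heads_def names_of_def)
  define lv where "lv s = (THE i. i < length Cs \<and> s \<in> heads (Cs ! i))" for s
  have lv: "lv s = i" if "i < length Cs" "s \<in> heads (Cs ! i)" for s i
    unfolding lv_def
  proof (rule the_equality)
    \<comment> \<open>A head is a name of its stratum and so cannot be defined in a later one; hence
      at most one stratum defines it.\<close>
    fix j assume "j < length Cs \<and> s \<in> heads (Cs ! j)"
    thus "j = i" using that pos[of i j s] pos[of j i s] head by (meson linorder_neqE_nat)
  qed (use that in simp)
  have lv_ex: "\<exists>i<length Cs. s \<in> heads (Cs ! i)" if "s \<in> heads C" for s
    using that unfolding C[symmetric] heads_def by (auto simp: in_set_conv_nth) force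
  define rank where "rank s = card {s' \<in> heads C. lv s' < lv s}" for s
  have fin: "finite (heads C)" using finite_C by (simp add: heads_def)
  have rank_mono: "rank s \<le> rank s'" if "lv s \<le> lv s'" for s s'
    unfolding rank_def by (rule card_mono) (use fin that in auto)
  have rank_less: "rank s < rank s'" if "lv s < lv s'" "s \<in> heads C" for s s'
    unfolding rank_def by (rule psubset_card_mono) (use fin that in auto)
  have rank_c: "rank s \<le> c" for s
  proof -
    have "heads C \<subseteq> {..<c}" using C_less by (auto simp: heads_def)
    hence "card {s' \<in> heads C. lv s' < lv s} \<le> card {..<c}" by (intro card_mono) auto
    thus ?thesis by (simp add: rank_def)
  qed
  \<comment> \<open>A name that is no head is empty on every level, so the lowest one suffices. For
    heads the 6 makes room for an equality shape, and it keeps them strictly above the names without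
    constraints, even under negation.\<close>
  define st where "st s = (if s \<in> heads C then 6 + rank s else 4)" for s
  have "need_shape st \<phi> \<le> st s" if s: "(s, \<phi>) \<in> C" for s \<phi>
  proof -
    have "s \<in> heads C" using s by (force simp: heads_def)
    hence B: "st s = 6 + rank s" by (simp add: st_def)
    obtain i where i: "i < length Cs" "(s, \<phi>) \<in> Cs ! i" using s C by (auto simp: in_set_conv_nth)
    have lvs: "lv s = i" by (rule lv[OF i(1)]) (use i(2) in \<open>force simp: heads_def\<close>)
    show ?thesis
    proof (rule need_shape_le)
      fix s' assume s': "s' \<in> shape_names \<phi>"
      have "lv s' \<le> lv s" if h: "s' \<in> heads C"
      proof -
        obtain j where j: "j < length Cs" "s' \<in> heads (Cs ! j)" using lv_ex[OF h] by blast
        have "s' \<in> names_of (Cs ! i)" using i(2) s' by (auto simp: names_of_def)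
        hence "\<not> i < j" using pos[of i j s'] j by blast
        thus ?thesis using lv[OF j] lvs by simp
      qed
      thus "st s' \<le> st s" unfolding B using rank_mono[of s' s] by (auto simp: st_def)
    next
      fix s' assume s': "s' \<in> neg_names \<phi>"
      have "rank s' < rank s" if h: "s' \<in> heads C"
      proof -
        obtain j where j: "j < length Cs" "s' \<in> heads (Cs ! j)" using lv_ex[OF h] by blast
        have "s' \<in> neg_names_of (Cs ! i)" using i(2) s' by (auto simp: neg_names_of_def)
        hence "\<not> i \<le> j" using neg[of i j s'] j by blast
        thus ?thesis using rank_less[OF _ h] lv[OF j] lvs by simp
      qed
      thus "st s' < st s" unfolding B by (auto simp: st_def)
    qed (simp add: B)
  qed
  moreover have "4 \<le> st s \<and> st s \<le> c + 10" for s using rank_c[of s] by (simp add: st_def)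
  ultimately show ?thesis by (intro exI[of _ st]) blast
qed

theorem mainTheorem8:
  "\<exists>f. recursive 2 f \<and>
     (\<forall>(T :: tbox) (C :: shape_constraint set).
        finite T \<longrightarrow> finite C \<longrightarrow> stratified C \<longrightarrow>
        (\<exists>C' :: shape_constraint set.
           finite C' \<and> stratified C' \<and>
           code_constraints C' = f [code_tbox T, code_constraints C] \<and>
           (\<forall>(G :: target set) (A :: abox).
              finite G \<longrightarrow> fst ` G \<subseteq> names_of C \<longrightarrow> finite A \<longrightarrow> consistent T A \<longrightarrow>
              (kb_validates T A C G \<longleftrightarrow> abox_validates A C' G))))"
proof -
  obtain f where f: "recursive 2 f" "\<And>xs. length xs = 2 \<Longrightarrow> f xs = rewriting_code (xs ! 0) (xs ! 1)"
    using computable_rewriting_code unfolding computable_def by metis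
  show ?thesis
  proof (intro exI[of _ f] conjI f(1) allI impI)
    fix T :: tbox and C :: "shape_constraint set"
    assume T: "finite T" and C: "finite C" "stratified C"
    interpret rewriting T C by unfold_locales (rule T C)+
    obtain st where levels: "\<And>s \<phi>. (s, \<phi>) \<in> C \<Longrightarrow> need_shape st \<phi> \<le> st s" "\<And>s. 4 \<le> st s" "\<And>s. st s \<le> c + 10"
      using levels_exist[OF C(2)] by blast
    show "\<exists>C'. finite C' \<and> stratified C' \<and> code_constraints C' = f [code_tbox T, code_constraints C] \<and>
      (\<forall>G A. finite G \<longrightarrow> fst ` G \<subseteq> names_of C \<longrightarrow> finite A \<longrightarrow> consistent T A \<longrightarrow>
        (kb_validates T A C G \<longleftrightarrow> abox_validates A C' G))"
    proof (intro exI[of _ rules] conjI allI impI finite_rules stratified_rules)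
      show "code_constraints rules = f [code_tbox T, code_constraints C]"
        unfolding code_constraints_rules unfolding t_def c_def by (simp add: f(2))
      fix G :: "target set" and A :: abox
      assume G: "fst ` G \<subseteq> names_of C" and A: "finite A" "consistent T A"
      \<comment> \<open>Only here does the ABox enter: the constraints and the levels were fixed
        before \<open>G\<close> and \<open>A\<close>.\<close>
      interpret kb_strat T C A st by unfold_locales (use A C(2) levels in auto)
      have "(s, Ind a) \<in> PA rules (abox_interp A) \<longleftrightarrow> (s, Ind a) \<in> PA C (can T A)" if "(s, a) \<in> G" for s a
        by (rule PA_rules_correct[OF names_less levels(3)]) (use G that in force)
      thus "kb_validates T A C G \<longleftrightarrow> abox_validates A rules G"
        by (auto simp: kb_validates_def abox_validates_def validates_def)
    qed
  qed
qed

end
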